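(* Consider the controlled dynamics on $(M,g)$ $$\frac{Dq'}{Dt}=-\mathrm{grad}(W)(q)+\sum_{j=1}^m u_j f_j(q),\qquad (q(0),q'(0))=(q_0,v_0)\in TM,$$ and suppose that $\Omega\subset\mathbb{R}^m$ is closed and convex. Let $R$ be a symmetric positive definite $m\times m$ real matrix and let $q_1\in M$. Then there exists an optimal control $u^*\in U_T$, i.e. $J(u^* )=\inf_{u\in U_T}J(u)$, for the cost $$J(u)=\int_0^T\Big(\|u\|_R^2+\tfrac12|v_u|^2+U(q_1,q_u)\Big)\,dt .$$
   Context: $(M,g)$ is the configuration manifold of a robot: a finite-dimensional Riemannian manifold, where $g=\langle\cdot,\cdot\rangle$ is the kinetic energy metric and $|\cdot|$ its norm. $W\in C^\infty(M)$ is a potential, $\mathrm{grad}(W)$ its $g$-gradient, $f_1,\dots,f_m$ are smooth vector fields on $M$, and $\frac{D}{Dt}$ is the Levi-Civita covariant derivative along the curve. Fix $T>0$, an initial state $(q_0,v_0)\in TM$ and a compact set $K\subset TM$. $U_T\subset L^2([0,T],\Omega)$ is the (nonempty) set of controls $u$ for which the trajectory $(q_u,v_u)$, $v_u=q_u'$, starting from $(q_0,v_0)$ is defined on $[0,T]$ and lies in $K$. $U(p,q)=\frac12 d_g^2(p,q)$, where $d_g$ is the Riemannian distance, and $\|u\|_R^2=u^{T}Ru$. *)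

theory Defs
  imports "HOL-Analysis.Analysis"
begin

section \<open>Smooth manifolds and tangent vectors\<close>

text \<open>For open \<open>S\<close>: continuous partial derivatives of all orders up to \<open>k\<close>.\<close>

primrec Ck_on ::
  "nat \<Rightarrow> ('x::euclidean_space \<Rightarrow> 'y::real_normed_vector) \<Rightarrow> 'x set \<Rightarrow> bool" where
  "Ck_on 0 F S \<longleftrightarrow> continuous_on S F"
| "Ck_on (Suc k) F S \<longleftrightarrow>
     (\<forall>x\<in>S. F differentiable (at x)) \<and> (\<forall>h. Ck_on k (\<lambda>x. frechet_derivative F (at x) h) S)"

definition smooth_on ::
  "('x::euclidean_space \<Rightarrow> 'y::real_normed_vector) \<Rightarrow> 'x set \<Rightarrow> bool" where
  "smooth_on F S \<longleftrightarrow> (\<forall>k. Ck_on k F S)"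

text \<open>A chart is a pair of a domain and a coordinate map; the value of the coordinate map outside
  the domain is irrelevant.\<close>

type_synonym ('a, 'n) chart = "'a set \<times> ('a \<Rightarrow> real ^ 'n)"

definition chart_dom :: "('a, 'n::finite) chart \<Rightarrow> 'a set" where
  "chart_dom c = fst c"

definition coords :: "('a, 'n::finite) chart \<Rightarrow> 'a \<Rightarrow> real ^ 'n" where
  "coords c = snd c"

definition chart_range :: "('a, 'n::finite) chart \<Rightarrow> (real ^ 'n) set" where
  "chart_range c = coords c ` chart_dom c"

definition param :: "('a, 'n::finite) chart \<Rightarrow> real ^ 'n \<Rightarrow> 'a" where
  "param c = inv_into (chart_dom c) (coords c)"

definition smooth_atlas ::
  "('a::{t2_space, second_countable_topology}, 'n::finite) chart set \<Rightarrow> bool" where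
  "smooth_atlas A \<longleftrightarrow>
     (\<Union>c\<in>A. chart_dom c) = UNIV \<and>
     (\<forall>c\<in>A. open (chart_dom c) \<and> open (chart_range c) \<and>
        homeomorphism (chart_dom c) (chart_range c) (coords c) (param c)) \<and>
     (\<forall>c\<in>A. \<forall>d\<in>A. smooth_on (coords d \<circ> param c) (coords c ` (chart_dom c \<inter> chart_dom d)))"

definition transition_deriv ::
  "('a, 'n::finite) chart \<Rightarrow> ('a, 'n) chart \<Rightarrow> 'a \<Rightarrow> real ^ 'n \<Rightarrow> real ^ 'n" where
  "transition_deriv c d p = frechet_derivative (coords d \<circ> param c) (at (coords c p))"

text \<open>A tangent vector at \<open>p\<close> is the family of its coordinate vectors in the charts around \<open>p\<close>,
  transforming by the derivatives of the chart changes. Entries for all other charts are zero, so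
  that equality of tangent vectors is equality of functions.\<close>

type_synonym ('a, 'n) tvec = "('a, 'n) chart \<Rightarrow> real ^ 'n"

definition tangent_space :: "('a, 'n::finite) chart set \<Rightarrow> 'a \<Rightarrow> ('a, 'n) tvec set" where
  "tangent_space A p =
     {\<xi>. (\<forall>c. c \<notin> A \<or> p \<notin> chart_dom c \<longrightarrow> \<xi> c = 0) \<and>
         (\<forall>c\<in>A. \<forall>d\<in>A. p \<in> chart_dom c \<inter> chart_dom d \<longrightarrow> \<xi> d = transition_deriv c d p (\<xi> c))}"

definition tangent_bundle :: "('a, 'n::finite) chart set \<Rightarrow> ('a \<times> ('a, 'n) tvec) set" where
  "tangent_bundle A = Sigma UNIV (tangent_space A)"

text \<open>The topology of the tangent bundle, whose basic open sets are the inverse images of open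
  sets under the bundle charts \<open>(p, \<xi>) \<mapsto> (coords c p, \<xi> c)\<close>.\<close>

definition tangent_bundle_topology ::
  "('a, 'n::finite) chart set \<Rightarrow> ('a \<times> ('a, 'n) tvec) topology" where
  "tangent_bundle_topology A = topology_generated_by
     {{(p, \<xi>) \<in> tangent_bundle A. p \<in> chart_dom c \<and> (coords c p, \<xi> c) \<in> B} | c B. c \<in> A \<and> open B}"

definition coord_vector ::
  "('a, 'n::finite) chart set \<Rightarrow> ('a, 'n) chart \<Rightarrow> 'n \<Rightarrow> 'a \<Rightarrow> ('a, 'n) tvec" where
  "coord_vector A c i p =
     (\<lambda>d. if d \<in> A \<and> p \<in> chart_dom d then transition_deriv c d p (axis i 1) else 0)"

definition smooth_fun :: "('a, 'n::finite) chart set \<Rightarrow> ('a \<Rightarrow> real) \<Rightarrow> bool" where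
  "smooth_fun A W \<longleftrightarrow> (\<forall>c\<in>A. smooth_on (W \<circ> param c) (chart_range c))"

definition smooth_vector_field ::
  "('a, 'n::finite) chart set \<Rightarrow> ('a \<Rightarrow> ('a, 'n) tvec) \<Rightarrow> bool" where
  "smooth_vector_field A X \<longleftrightarrow>
     (\<forall>p. X p \<in> tangent_space A p) \<and> (\<forall>c\<in>A. smooth_on (\<lambda>x. X (param c x) c) (chart_range c))"

section \<open>Riemannian geometry\<close>

definition metric_matrix ::
  "('a, 'n::finite) chart set \<Rightarrow> ('a \<Rightarrow> ('a, 'n) tvec \<Rightarrow> ('a, 'n) tvec \<Rightarrow> real) \<Rightarrow>
   ('a, 'n) chart \<Rightarrow> real ^ 'n \<Rightarrow> real ^ 'n ^ 'n" where
  "metric_matrix A g c x =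
     (\<chi> i j. g (param c x) (coord_vector A c i (param c x)) (coord_vector A c j (param c x)))"

definition riemannian_metric ::
  "('a, 'n::finite) chart set \<Rightarrow> ('a \<Rightarrow> ('a, 'n) tvec \<Rightarrow> ('a, 'n) tvec \<Rightarrow> real) \<Rightarrow> bool" where
  "riemannian_metric A g \<longleftrightarrow>
     (\<forall>p. \<forall>\<xi>\<in>tangent_space A p. \<forall>\<eta>\<in>tangent_space A p. g p \<xi> \<eta> = g p \<eta> \<xi>) \<and>
     (\<forall>p. \<forall>\<xi>\<in>tangent_space A p. \<forall>\<zeta>\<in>tangent_space A p. \<forall>\<eta>\<in>tangent_space A p. \<forall>a b.
        g p (\<lambda>c. a *\<^sub>R \<xi> c + b *\<^sub>R \<zeta> c) \<eta> = a * g p \<xi> \<eta> + b * g p \<zeta> \<eta>) \<and>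
     (\<forall>p. \<forall>\<xi>\<in>tangent_space A p. \<xi> \<noteq> (\<lambda>_. 0) \<longrightarrow> g p \<xi> \<xi> > 0) \<and>
     (\<forall>c\<in>A. \<forall>i j. smooth_on (\<lambda>x. metric_matrix A g c x $ i $ j) (chart_range c))"

definition grad ::
  "('a, 'n::finite) chart set \<Rightarrow> ('a \<Rightarrow> ('a, 'n) tvec \<Rightarrow> ('a, 'n) tvec \<Rightarrow> real) \<Rightarrow>
   ('a \<Rightarrow> real) \<Rightarrow> 'a \<Rightarrow> ('a, 'n) tvec" where
  "grad A g W p = (THE \<zeta>. \<zeta> \<in> tangent_space A p \<and>
     (\<forall>\<xi>\<in>tangent_space A p. \<forall>c\<in>A. p \<in> chart_dom c \<longrightarrow>
        g p \<zeta> \<xi> = frechet_derivative (W \<circ> param c) (at (coords c p)) (\<xi> c)))"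

definition partial :: "'n::finite \<Rightarrow> (real ^ 'n \<Rightarrow> real) \<Rightarrow> real ^ 'n \<Rightarrow> real" where
  "partial i F x = frechet_derivative F (at x) (axis i 1)"

text \<open>The Christoffel symbol \<open>\<Gamma>\<^sup>k\<^sub>i\<^sub>j\<close> of the Levi-Civita connection in the chart \<open>c\<close>.\<close>

definition christoffel ::
  "('a, 'n::finite) chart set \<Rightarrow> ('a \<Rightarrow> ('a, 'n) tvec \<Rightarrow> ('a, 'n) tvec \<Rightarrow> real) \<Rightarrow>
   ('a, 'n) chart \<Rightarrow> real ^ 'n \<Rightarrow> 'n \<Rightarrow> 'n \<Rightarrow> 'n \<Rightarrow> real" where
  "christoffel A g c x k i j =
     1 / 2 * (\<Sum>l\<in>UNIV. matrix_inv (metric_matrix A g c x) $ k $ l *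
        (partial i (\<lambda>y. metric_matrix A g c y $ j $ l) x
         + partial j (\<lambda>y. metric_matrix A g c y $ i $ l) x
         - partial l (\<lambda>y. metric_matrix A g c y $ i $ j) x))"

text \<open>The derivative at \<open>t\<close> of a curve parametrized on \<open>S\<close> (one-sided at end points of \<open>S\<close>).\<close>

definition velocity ::
  "('a, 'n::finite) chart set \<Rightarrow> real set \<Rightarrow> (real \<Rightarrow> 'a) \<Rightarrow> real \<Rightarrow> ('a, 'n) tvec" where
  "velocity A S q t =
     (\<lambda>c. if c \<in> A \<and> q t \<in> chart_dom c
          then vector_derivative (coords c \<circ> q) (at t within S) else 0)"

text \<open>\<open>DV/Dt = Z\<close> at time \<open>t\<close> for a vector field \<open>V\<close> along the curve \<open>q\<close>; in coordinates,
  \<open>dV\<^sup>k/dt + \<Gamma>\<^sup>k\<^sub>i\<^sub>j (dq\<^sup>i/dt) V\<^sup>j = Z\<^sup>k\<close>.\<close>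

definition has_covariant_derivative ::
  "('a, 'n::finite) chart set \<Rightarrow> ('a \<Rightarrow> ('a, 'n) tvec \<Rightarrow> ('a, 'n) tvec \<Rightarrow> real) \<Rightarrow>
   real set \<Rightarrow> (real \<Rightarrow> 'a) \<Rightarrow> (real \<Rightarrow> ('a, 'n) tvec) \<Rightarrow> ('a, 'n) tvec \<Rightarrow> real \<Rightarrow> bool" where
  "has_covariant_derivative A g S q V Z t \<longleftrightarrow>
     (\<forall>c\<in>A. q t \<in> chart_dom c \<longrightarrow>
        (\<exists>D. ((\<lambda>s. V s c) has_vector_derivative D) (at t within S) \<and>
             Z c = D + (\<chi> k. \<Sum>i\<in>UNIV. \<Sum>j\<in>UNIV.
                christoffel A g c (coords c (q t)) k i j * velocity A S q t c $ i * V t c $ j)))"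

definition piecewise_C1_curve ::
  "('a::topological_space, 'n::finite) chart set \<Rightarrow> (real \<Rightarrow> 'a) \<Rightarrow> bool" where
  "piecewise_C1_curve A \<gamma> \<longleftrightarrow> continuous_on {0..1} \<gamma> \<and>
     (\<forall>c\<in>A. \<forall>a b. 0 \<le> a \<and> a \<le> b \<and> b \<le> 1 \<and> \<gamma> ` {a..b} \<subseteq> chart_dom c \<longrightarrow>
        (coords c \<circ> \<gamma>) piecewise_C1_differentiable_on {a..b})"

definition curve_length ::
  "('a, 'n::finite) chart set \<Rightarrow> ('a \<Rightarrow> ('a, 'n) tvec \<Rightarrow> ('a, 'n) tvec \<Rightarrow> real) \<Rightarrow>
   (real \<Rightarrow> 'a) \<Rightarrow> ennreal" where
  "curve_length A g \<gamma> = (\<integral>\<^sup>+ t. ennreal (sqrt (g (\<gamma> t) (velocity A {0..1} \<gamma> t) (velocity A {0..1} \<gamma> t)))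
     \<partial>lebesgue_on {0..1})"

text \<open>Infinite for points in different connected components.\<close>

definition riemannian_dist ::
  "('a::topological_space, 'n::finite) chart set \<Rightarrow>
   ('a \<Rightarrow> ('a, 'n) tvec \<Rightarrow> ('a, 'n) tvec \<Rightarrow> real) \<Rightarrow> 'a \<Rightarrow> 'a \<Rightarrow> ennreal" where
  "riemannian_dist A g p q =
     (INF \<gamma>\<in>{\<gamma>. piecewise_C1_curve A \<gamma> \<and> \<gamma> 0 = p \<and> \<gamma> 1 = q}. curve_length A g \<gamma>)"

section \<open>Controlled trajectories and cost\<close>

definition absolutely_continuous_on :: "real set \<Rightarrow> (real \<Rightarrow> 'y::real_normed_vector) \<Rightarrow> bool" where
  "absolutely_continuous_on S F \<longleftrightarrow>
     (\<forall>\<epsilon>>0. \<exists>\<delta>>0. \<forall>(n::nat) a b.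
        (\<forall>i<n. a i \<le> b i \<and> {a i..b i} \<subseteq> S) \<and>
        (\<forall>i<n. \<forall>j<n. i \<noteq> j \<longrightarrow> {a i<..<b i} \<inter> {a j<..<b j} = {}) \<and>
        (\<Sum>i<n. b i - a i) < \<delta> \<longrightarrow>
        (\<Sum>i<n. norm (F (b i) - F (a i))) < \<epsilon>)"

text \<open>Members of the \<open>L\<^sup>2\<close> space are represented by measurable functions; their values off
  \<open>[0, T]\<close> are irrelevant.\<close>

definition L2_controls :: "real \<Rightarrow> (real ^ 'm) set \<Rightarrow> (real \<Rightarrow> real ^ 'm::finite) set" where
  "L2_controls T \<Omega> =
     {u \<in> borel_measurable (lebesgue_on {0..T}).
        integrable (lebesgue_on {0..T}) (\<lambda>t. (norm (u t))\<^sup>2) \<and>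
        (AE t in lebesgue_on {0..T}. u t \<in> \<Omega>)}"

text \<open>Solutions in the sense of Caratheodory: the velocity exists everywhere and is absolutely
  continuous in charts, and the equation of motion holds almost everywhere.\<close>

definition is_trajectory ::
  "('a::topological_space, 'n::finite) chart set \<Rightarrow>
   ('a \<Rightarrow> ('a, 'n) tvec \<Rightarrow> ('a, 'n) tvec \<Rightarrow> real) \<Rightarrow>
   ('a \<Rightarrow> real) \<Rightarrow> ('m::finite \<Rightarrow> 'a \<Rightarrow> ('a, 'n) tvec) \<Rightarrow> real \<Rightarrow> 'a \<Rightarrow> ('a, 'n) tvec \<Rightarrow>
   (real \<Rightarrow> real ^ 'm) \<Rightarrow> (real \<Rightarrow> 'a) \<Rightarrow> bool" where
  "is_trajectory A g W f T q0 v0 u q \<longleftrightarrow>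
     (let v = velocity A {0..T} q in
       continuous_on {0..T} q \<and> q 0 = q0 \<and> v 0 = v0 \<and>
       (\<forall>t\<in>{0..T}. \<forall>c\<in>A. q t \<in> chart_dom c \<longrightarrow>
          (coords c \<circ> q) differentiable (at t within {0..T})) \<and>
       (\<forall>c\<in>A. \<forall>a b. 0 \<le> a \<and> a \<le> b \<and> b \<le> T \<and> q ` {a..b} \<subseteq> chart_dom c \<longrightarrow>
          absolutely_continuous_on {a..b} (\<lambda>t. v t c)) \<and>
       (AE t in lebesgue_on {0..T}.
          has_covariant_derivative A g {0..T} q v
            (\<lambda>c. - grad A g W (q t) c + (\<Sum>j\<in>UNIV. (u t $ j) *\<^sub>R f j (q t) c)) t))"

text \<open>The trajectory of a control, uniquely determined on \<open>[0, T]\<close> whenever it exists there.\<close>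

definition trajectory_of ::
  "('a::topological_space, 'n::finite) chart set \<Rightarrow>
   ('a \<Rightarrow> ('a, 'n) tvec \<Rightarrow> ('a, 'n) tvec \<Rightarrow> real) \<Rightarrow>
   ('a \<Rightarrow> real) \<Rightarrow> ('m::finite \<Rightarrow> 'a \<Rightarrow> ('a, 'n) tvec) \<Rightarrow> real \<Rightarrow> 'a \<Rightarrow> ('a, 'n) tvec \<Rightarrow>
   (real \<Rightarrow> real ^ 'm) \<Rightarrow> real \<Rightarrow> 'a" where
  "trajectory_of A g W f T q0 v0 u = (SOME q. is_trajectory A g W f T q0 v0 u q)"

definition admissible_controls ::
  "('a::topological_space, 'n::finite) chart set \<Rightarrow>
   ('a \<Rightarrow> ('a, 'n) tvec \<Rightarrow> ('a, 'n) tvec \<Rightarrow> real) \<Rightarrow>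
   ('a \<Rightarrow> real) \<Rightarrow> ('m::finite \<Rightarrow> 'a \<Rightarrow> ('a, 'n) tvec) \<Rightarrow> real \<Rightarrow> 'a \<Rightarrow> ('a, 'n) tvec \<Rightarrow>
   (real ^ 'm) set \<Rightarrow> ('a \<times> ('a, 'n) tvec) set \<Rightarrow> (real \<Rightarrow> real ^ 'm) set" where
  "admissible_controls A g W f T q0 v0 \<Omega> K =
     {u \<in> L2_controls T \<Omega>. \<exists>q. is_trajectory A g W f T q0 v0 u q \<and>
        (\<forall>t\<in>{0..T}. (q t, velocity A {0..T} q t) \<in> K)}"

text \<open>The integrand is nonnegative as \<open>R\<close> and \<open>g\<close> are positive definite, so \<open>ennreal\<close> loses
  nothing; infinite values arise only from an infinite distance.\<close>

definition cost ::
  "('a::topological_space, 'n::finite) chart set \<Rightarrow>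
   ('a \<Rightarrow> ('a, 'n) tvec \<Rightarrow> ('a, 'n) tvec \<Rightarrow> real) \<Rightarrow>
   ('a \<Rightarrow> real) \<Rightarrow> ('m::finite \<Rightarrow> 'a \<Rightarrow> ('a, 'n) tvec) \<Rightarrow> real \<Rightarrow> 'a \<Rightarrow> ('a, 'n) tvec \<Rightarrow>
   real ^ 'm ^ 'm \<Rightarrow> 'a \<Rightarrow> (real \<Rightarrow> real ^ 'm) \<Rightarrow> ennreal" where
  "cost A g W f T q0 v0 R q1 u =
     (let q = trajectory_of A g W f T q0 v0 u; v = velocity A {0..T} q in
       \<integral>\<^sup>+ t. (ennreal (u t \<bullet> (R *v u t) + 1 / 2 * g (q t) (v t) (v t))
              + (riemannian_dist A g q1 (q t))\<^sup>2 / 2) \<partial>lebesgue_on {0..T})"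

end

theory Submission
  imports Defs "HOL-Library.Diagonal_Subsequence"
begin

text \<open>The direct method. Along a minimizing sequence the controls are bounded in \<open>L\<^sup>2\<close>, since \<open>R\<close> is
  positive definite. In a chart the state \<open>(q, v)\<close> solves \<open>z' = F z + \<Sum>\<^sub>j u\<^sub>j G\<^sub>j z\<close>, so that a bound on the
  control in \<open>L\<^sup>2\<close> makes the states equicontinuous; as they stay in the compact set \<open>K\<close>, a subsequence
  converges pointwise on \<open>[0, T]\<close>. The limit control is the almost everywhere limit of convex
  combinations of tails of the sequence; it takes values in \<open>\<Omega>\<close>, its quadratic cost is no larger, and
  integrals against bounded functions pass to the limit. Since the equation is affine in the control,
  the limit curve is the trajectory of the limit control. Fatou's lemma applies to the remaining part of
  the cost, because the kinetic energy is continuous and the distance is lower semicontinuous.\<close>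

section \<open>Absolutely continuous functions\<close>

text \<open>A trajectory is defined through derivatives, which do not survive pointwise limits, so
  the limit argument runs on the integrated equation in every chart. Getting there needs the
  fundamental theorem for absolutely continuous functions; coming back needs Lebesgue's
  differentiation theorem, with one null set that serves all charts because an atlas may be
  uncountable. A second obstacle is that no single chart need contain the whole motion. A finite
  cover of \<open>K\<close> by chart balls whose doubles still fit into the chart gives a time,
  depending only on the energy bound for the controls, during which a curve cannot leave the doubled
  ball; the work is done on such windows and glued. The limit control is not shown to be a weak
  limit: an integral against a bounded function passes to it only if it converges along the
  sequence, and for the functions that occur this convergence is read off from the convergent
  states. Finally, the cost refers to an arbitrarily chosen trajectory, so uniqueness of
  trajectories is needed before it can be computed.\<close>

lemma negligible_open_superset:
  fixes N :: "real set"
  assumes "negligible N" "0 < \<delta>"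
  obtains U where "open U" "N \<subseteq> U" "U \<in> lmeasurable" "measure lebesgue U < \<delta>"
proof -
  obtain U where U: "open U" "N \<subseteq> U" "U - N \<in> lmeasurable" "emeasure lebesgue (U - N) < ennreal \<delta>"
    using sets_lebesgue_outer_open[of N \<delta>] assms negligible_imp_sets by blast
  have eq: "U = (U - N) \<union> N" using U by auto
  have lm: "U \<in> lmeasurable"
    by (subst eq) (use U assms negligible_imp_measurable in \<open>blast intro: fmeasurable.Un\<close>)
  have "measure lebesgue U = measure lebesgue (U - N)"
    using measure_negligible_symdiff[of "U - N" U] U assms eq lm
    by (metis Diff_Diff_Int inf.absorb_iff2 measure_Diff_null_set negligible_iff_null_sets fmeasurableD)
  also have "\<dots> < \<delta>"
    using U assms by (metis emeasure_eq_measure2 ennreal_less_iff measure_nonneg)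
  finally show thesis using that U lm by blast
qed

text \<open>Reindexing by a bijection with \<open>{..<card D}\<close>. Tagged divisions come indexed
  by their pairs of tag and cell, not by an initial segment of the naturals.\<close>

lemma absolutely_continuous_on_finite_family:
  fixes F :: "real \<Rightarrow> 'b::real_normed_vector"
  assumes "absolutely_continuous_on S F" "0 < e"
  shows "\<exists>\<delta>>0. \<forall>(D::'i set) l r. finite D \<and> (\<forall>i\<in>D. l i \<le> r i \<and> {l i..r i} \<subseteq> S) \<and>
      (\<forall>i\<in>D. \<forall>j\<in>D. i \<noteq> j \<longrightarrow> {l i<..<r i} \<inter> {l j<..<r j} = {}) \<and>
      (\<Sum>i\<in>D. r i - l i) < \<delta> \<longrightarrow> (\<Sum>i\<in>D. norm (F (r i) - F (l i))) < e"
proof -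
  obtain \<delta> where \<delta>: "\<delta> > 0" "\<forall>(n::nat) a b.
        (\<forall>i<n. a i \<le> b i \<and> {a i..b i} \<subseteq> S) \<and>
        (\<forall>i<n. \<forall>j<n. i \<noteq> j \<longrightarrow> {a i<..<b i} \<inter> {a j<..<b j} = {}) \<and>
        (\<Sum>i<n. b i - a i) < \<delta> \<longrightarrow>
        (\<Sum>i<n. norm (F (b i) - F (a i))) < e"
    using assms(1)[unfolded absolutely_continuous_on_def, THEN spec, THEN mp, OF assms(2)]
    by (elim exE conjE) (rule that)
  show ?thesis
  proof (intro exI[of _ \<delta>] conjI allI impI \<delta>(1))
    fix D :: "'i set" and l r :: "'i \<Rightarrow> real"
    assume D0: "finite D \<and> (\<forall>i\<in>D. l i \<le> r i \<and> {l i..r i} \<subseteq> S) \<and>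
      (\<forall>i\<in>D. \<forall>j\<in>D. i \<noteq> j \<longrightarrow> {l i<..<r i} \<inter> {l j<..<r j} = {}) \<and> (\<Sum>i\<in>D. r i - l i) < \<delta>"
    note D = conjunct1[OF D0] conjunct1[OF conjunct2[OF D0], rule_format]
      conjunct1[OF conjunct2[OF conjunct2[OF D0]], rule_format] conjunct2[OF conjunct2[OF conjunct2[OF D0]]]
    obtain h where h: "bij_betw h {0..<card D} D" using ex_bij_betw_nat_finite[OF D(1)] by blast
    then have h': "bij_betw h {..<card D} D" by (simp add: atLeast0LessThan)
    have hD: "h i \<in> D" if "i < card D" for i using h' that by (auto simp: bij_betw_def)
    have inj: "h i \<noteq> h j" if "i < card D" "j < card D" "i \<noteq> j" for i j
      using h' that by (auto simp: bij_betw_def inj_on_def)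
    have s1: "(\<Sum>i<card D. r (h i) - l (h i)) = (\<Sum>i\<in>D. r i - l i)"
      by (rule sum.reindex_bij_betw[OF h'])
    have s2: "(\<Sum>i<card D. norm (F (r (h i)) - F (l (h i)))) = (\<Sum>i\<in>D. norm (F (r i) - F (l i)))"
      by (rule sum.reindex_bij_betw[OF h'])
    have "(\<Sum>i<card D. norm (F (r (h i)) - F (l (h i)))) < e"
      using \<delta>(2)[THEN spec[of _ "card D"], THEN spec[of _ "\<lambda>i. l (h i)"], THEN spec[of _ "\<lambda>i. r (h i)"]] D(2,3,4) hD inj s1 by auto
    then show "(\<Sum>i\<in>D. norm (F (r i) - F (l i))) < e" by (simp add: s2)
  qed
qed

text \<open>On the line, \<open>Inf K\<close> and \<open>Sup K\<close> serve as the end points of a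
  cell, so that no end points have to be chosen cell by cell.\<close>

lemma tagged_division_real_bounds:
  fixes a b :: real
  assumes "p tagged_partial_division_of {a..b}" "(x,K) \<in> p"
  shows "K = {Inf K..Sup K}" "Inf K \<le> x" "x \<le> Sup K" "K \<subseteq> {a..b}" "measure lborel K = Sup K - Inf K"
    "x \<in> {a..b}" "Inf K \<in> K" "Sup K \<in> K" "{Inf K..Sup K} \<subseteq> {a..b}" "interior K = {Inf K<..<Sup K}"
proof -
  have *: "x \<in> K" "K \<subseteq> {a..b}" "\<exists>u v. K = cbox u v"
    using tagged_partial_division_ofD[OF assms(1)] assms(2) by blast+
  then obtain u v where uv: "K = {u..v}" by auto
  with * have "u \<le> v" by auto
  with uv * show "K = {Inf K..Sup K}" "Inf K \<le> x" "x \<le> Sup K" "K \<subseteq> {a..b}" "measure lborel K = Sup K - Inf K"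
    "x \<in> {a..b}" "Inf K \<in> K" "Sup K \<in> K" "{Inf K..Sup K} \<subseteq> {a..b}" "interior K = {Inf K<..<Sup K}"
    by auto
qed

text \<open>The gauge integral allows a direct proof. Cells tagged off \<open>N\<close> obey the
  straddle estimate around their tag; cells tagged in \<open>N\<close> are forced by the gauge into
  an open set of small measure, where absolute continuity makes the sum of the increments of
  \<open>F\<close> small. Integrability of \<open>h\<close> is part of the conclusion.\<close>

lemma absolutely_continuous_has_integral:
  fixes F :: "real \<Rightarrow> 'b::banach"
  assumes ac: "absolutely_continuous_on {a..b} F" and ab: "a \<le> b" and N: "negligible N"
    and der: "\<And>t. t \<in> {a..b} - N \<Longrightarrow> (F has_vector_derivative h t) (at t within {a..b})"
  shows "(h has_integral F b - F a) {a..b}"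
proof -
  \<comment> \<open>On \<open>N\<close> nothing is known about \<open>h\<close>. With the value 0
    there, a cell tagged in \<open>N\<close> contributes only its increment of \<open>F\<close>; the
    spike theorem restores \<open>h\<close> at the end.\<close>
  define k where "k t = (if t \<in> N then 0 else h t)" for t
  have "(k has_integral F b - F a) {a..b}"
    unfolding has_integral_real
  proof (intro allI impI)
    fix e :: real assume e: "e > 0"
    \<comment> \<open>The added 1 keeps the quotient meaningful for \<open>a = b\<close> and the
      inequality of the next line strict.\<close>
    define e' where "e' = e / (2 * (b - a + 1))"
    have e': "e' > 0" "e' * (b - a) < e / 2" using e ab by (auto simp: e'_def field_simps)
    obtain \<delta> where \<delta>: "\<delta> > 0"
      "\<forall>(D::(real \<times> real set) set) l r. finite D \<and> (\<forall>i\<in>D. l i \<le> r i \<and> {l i..r i} \<subseteq> {a..b}) \<and>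
      (\<forall>i\<in>D. \<forall>j\<in>D. i \<noteq> j \<longrightarrow> {l i<..<r i} \<inter> {l j<..<r j} = {}) \<and>
      (\<Sum>i\<in>D. r i - l i) < \<delta> \<longrightarrow> (\<Sum>i\<in>D. norm (F (r i) - F (l i))) < e / 2"
      using absolutely_continuous_on_finite_family[OF ac half_gt_zero[OF e], where 'i = "real \<times> real set"]
      by (elim exE conjE) (rule that)
    obtain U where U: "open U" "N \<subseteq> U" "U \<in> lmeasurable" "measure lebesgue U < \<delta>"
      using negligible_open_superset[OF N \<delta>(1)] by blast
    have "\<exists>d>0. \<forall>y\<in>{a..b}. norm (y - t) < d \<longrightarrow> norm (F y - F t - (y - t) *\<^sub>R h t) \<le> e' * norm (y - t)"
      if "t \<in> {a..b} - N" for t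
      using der[OF that] e'(1) unfolding has_vector_derivative_def has_derivative_within_alt by blast
    then obtain d where d: "\<And>t. t \<in> {a..b} - N \<Longrightarrow> d t > 0"
      "\<And>t y. t \<in> {a..b} - N \<Longrightarrow> y \<in> {a..b} \<Longrightarrow> norm (y - t) < d t \<Longrightarrow>
         norm (F y - F t - (y - t) *\<^sub>R h t) \<le> e' * norm (y - t)"
      by metis
    define \<gamma> where "\<gamma> t = (if t \<in> N then U else if t \<in> {a..b} then ball t (d t) else ball t 1)" for t
    have g: "gauge \<gamma>" unfolding gauge_def \<gamma>_def using U d(1) by auto
    show "\<exists>\<gamma>. gauge \<gamma> \<and> (\<forall>\<D>. \<D> tagged_division_of {a..b} \<and> \<gamma> fine \<D> \<longrightarrow>
        norm ((\<Sum>(x,K)\<in>\<D>. measure lborel K *\<^sub>R k x) - (F b - F a)) < e)"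
    proof (intro exI[of _ \<gamma>] conjI allI impI g)
      fix p assume p: "p tagged_division_of {a..b} \<and> \<gamma> fine p"
      then have pp: "p tagged_partial_division_of {a..b}" and fp: "finite p"
        using tagged_division_of_finite by (auto simp: tagged_division_of_def)
      note bd = tagged_division_real_bounds[OF pp]
      have fine: "K \<subseteq> \<gamma> x" if "(x,K) \<in> p" for x K using p that by (auto simp: fine_def)
      define c where "c = (\<lambda>(x,K). measure lborel K *\<^sub>R k x - (F (Sup K) - F (Inf K)))"
      have Fsum: "(\<Sum>(x,K)\<in>p. F (Sup K) - F (Inf K)) = F b - F a"
        using additive_tagged_division_1[OF ab] p by blast
      have eq: "(\<Sum>(x,K)\<in>p. measure lborel K *\<^sub>R k x) - (F b - F a) = sum c p"
        unfolding Fsum[symmetric] c_def sum_subtractf[symmetric] by (simp add: case_prod_unfold)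
      define p1 where "p1 = {(x,K)\<in>p. x \<notin> N}"
      define p2 where "p2 = {(x,K)\<in>p. x \<in> N}"
      have p12: "p = p1 \<union> p2" "p1 \<inter> p2 = {}" "finite p1" "finite p2" "p1 \<subseteq> p" "p2 \<subseteq> p"
        using fp by (auto simp: p1_def p2_def intro: finite_subset[OF _ fp])
      have "norm (sum c p) \<le> norm (sum c p1) + norm (sum c p2)"
        using norm_triangle_ineq[of "sum c p1" "sum c p2"] p12 by (simp add: sum.union_disjoint)
      moreover have "norm (sum c p1) < e / 2"
      proof -
        have "norm (c xK) \<le> (case xK of (x,K) \<Rightarrow> e' * measure lborel K)" if i1: "xK \<in> p1" for xK
        proof -
          obtain x K where xK: "xK = (x,K)" "(x,K) \<in> p" "x \<notin> N" using i1 by (auto simp: p1_def)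
          note b = bd[OF xK(2)]
          have x: "x \<in> {a..b} - N" using b(6) xK by auto
          have K: "K \<subseteq> ball x (d x)" using fine[OF xK(2)] x by (auto simp: \<gamma>_def)
          have IS: "Inf K \<in> K" "Sup K \<in> K" "Inf K \<in> {a..b}" "Sup K \<in> {a..b}"
            using b(4,7,8) by auto
          have "\<bar>Sup K - x\<bar> < d x" "\<bar>Inf K - x\<bar> < d x"
            using subsetD[OF K IS(1)] subsetD[OF K IS(2)] by (simp_all add: dist_real_def abs_minus_commute)
          note dd = d(2)[OF x IS(4), unfolded real_norm_def, OF this(1)] d(2)[OF x IS(3), unfolded real_norm_def, OF this(2)]
          have d1: "norm (F (Sup K) - F x - (Sup K - x) *\<^sub>R h x) \<le> e' * (Sup K - x)"
            using dd(1) b(3) by simp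
          have d2: "norm (F (Inf K) - F x - (Inf K - x) *\<^sub>R h x) \<le> e' * (x - Inf K)"
            using dd(2) b(2) by simp
          \<comment> \<open>Splitting the increment at the tag lets the derivative estimate be used
            once on each side of it.\<close>
          have "c xK = (F (Inf K) - F x - (Inf K - x) *\<^sub>R h x) - (F (Sup K) - F x - (Sup K - x) *\<^sub>R h x)"
          proof -
            have "c xK = (Sup K - Inf K) *\<^sub>R h x - (F (Sup K) - F (Inf K))"
              using xK b(5) by (simp add: c_def k_def)
            then show ?thesis by (simp add: algebra_simps)
          qed
          then have "norm (c xK) \<le> e' * (x - Inf K) + e' * (Sup K - x)"
            using norm_triangle_ineq4 d1 d2 by (smt (verit))
          also have "\<dots> = e' * measure lborel K" by (simp only: b(5)) (simp add: algebra_simps)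
          finally show ?thesis using xK by simp
        qed
        then have "norm (sum c p1) \<le> (\<Sum>(x,K)\<in>p1. e' * measure lborel K)"
          by (rule sum_norm_le)
        also have "\<dots> \<le> (\<Sum>(x,K)\<in>p. e' * measure lborel K)"
          using p12 fp e' by (intro sum_mono2) auto
        also have "\<dots> = e' * (b - a)"
          using additive_content_tagged_division[of p a b] p ab
          by (simp add: sum_distrib_left[symmetric] case_prod_unfold)
        finally show ?thesis using e' by linarith
      qed
      moreover have "norm (sum c p2) < e / 2"
      proof -
        have int: "interior K = {Inf K<..<Sup K}" if "(x,K) \<in> p" for x K
          by (rule bd(10)[OF that])
        have disj: "interior (snd i) \<inter> interior (snd j) = {}" if "i \<in> p2" "j \<in> p2" "i \<noteq> j" for i j
          using tagged_partial_division_ofD(5)[OF pp, of "fst i" "snd i" "fst j" "snd j"] that p12 by auto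
        have "(\<Sum>i\<in>p2. Sup (snd i) - Inf (snd i)) = (\<Sum>i\<in>p2. measure lebesgue (interior (snd i)))"
        proof (rule sum.cong[OF refl])
          fix i assume "i \<in> p2"
          then have i: "(fst i, snd i) \<in> p" using p12 by auto
          show "Sup (snd i) - Inf (snd i) = measure lebesgue (interior (snd i))"
            using int[OF i] bd(2,3)[OF i] by simp
        qed
        also have "\<dots> = measure lebesgue (\<Union>i\<in>p2. interior (snd i))"
        proof (rule measure_finite_Union[symmetric])
          show "disjoint_family_on (\<lambda>i. interior (snd i)) p2"
            using disj by (auto simp: disjoint_family_on_def)
          show "emeasure lebesgue (interior (snd i)) \<noteq> \<infinity>" if "i \<in> p2" for i
          proof -
            have i: "(fst i, snd i) \<in> p" using that p12 by auto
            have "Inf (snd i) \<le> Sup (snd i)" using bd(2,3)[OF i] by simp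
            then show ?thesis using int[OF i] by simp
          qed
        qed (use p12 in auto)
        also have "\<dots> \<le> measure lebesgue U"
        proof (rule measure_mono_fmeasurable)
          show "(\<Union>i\<in>p2. interior (snd i)) \<subseteq> U"
          proof
            fix y assume "y \<in> (\<Union>i\<in>p2. interior (snd i))"
            then obtain x K where xK: "(x,K) \<in> p2" "y \<in> K" using interior_subset by fastforce
            then show "y \<in> U" using fine[of x K] by (auto simp: p2_def \<gamma>_def)
          qed
        qed (use U in \<open>auto intro!: sets.finite_UN p12\<close>)
        also have "\<dots> < \<delta>" by fact
        finally have "(\<Sum>i\<in>p2. Sup (snd i) - Inf (snd i)) < \<delta>" .
        then have "(\<Sum>i\<in>p2. norm (F (Sup (snd i)) - F (Inf (snd i)))) < e / 2"
        proof (intro \<delta>(2)[rule_format] conjI ballI impI)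
          fix i assume "i \<in> p2"
          then have i: "(fst i, snd i) \<in> p" using p12 by auto
          show "Inf (snd i) \<le> Sup (snd i)" "{Inf (snd i)..Sup (snd i)} \<subseteq> {a..b}"
            using bd(2,3,9)[OF i] by auto
        next
          fix i j assume ij: "i \<in> p2" "j \<in> p2" "i \<noteq> j"
          then have "(fst i, snd i) \<in> p" "(fst j, snd j) \<in> p" using p12 by auto
          from int[OF this(1)] int[OF this(2)]
          show "{Inf (snd i)<..<Sup (snd i)} \<inter> {Inf (snd j)<..<Sup (snd j)} = {}"
            using disj[OF ij] by simp
        qed (use p12 in auto)
        moreover have "norm (sum c p2) \<le> (\<Sum>i\<in>p2. norm (F (Sup (snd i)) - F (Inf (snd i))))"
        proof (rule sum_norm_le)
          fix i assume "i \<in> p2"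
          then show "norm (c i) \<le> norm (F (Sup (snd i)) - F (Inf (snd i)))"
            by (auto simp: c_def p2_def k_def norm_minus_commute)
        qed
        ultimately show ?thesis by linarith
      qed
      ultimately have "norm (sum c p) < e" by linarith
      then show "norm ((\<Sum>(x,K)\<in>p. measure lborel K *\<^sub>R k x) - (F b - F a)) < e" by (simp only: eq)
    qed
  qed
  then show ?thesis by (rule has_integral_spike[OF N, rotated]) (auto simp: k_def)
qed

text \<open>Vitali covering combined with Henstock's lemma. A point where the difference quotient
  misbehaves is the tag of arbitrarily short intervals on which Riemann term and integral differ by
  more than a fixed fraction of the length. Finitely many disjoint ones among them form a fine
  partial division, so Henstock's lemma bounds their total length.\<close>

lemma lebesgue_differentiation:
  fixes h :: "real \<Rightarrow> 'b::euclidean_space"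
  assumes h: "h integrable_on {a..b}"
  obtains N where "negligible N" "\<And>t. t \<in> {a..b} - N \<Longrightarrow>
     ((\<lambda>s. integral {a..s} h) has_vector_derivative h t) (at t within {a..b})"
proof -
  define H where "H s = integral {a..s} h" for s
  \<comment> \<open>Points at which the error of the difference quotient exceeds
    \<open>1 / Suc m\<close> at arbitrarily small distance; the exceptional set is the union over
    \<open>m\<close>.\<close>
  define E where "E m = {t\<in>{a..b}. \<forall>d>0. \<exists>s\<in>{a..b}. \<bar>s - t\<bar> < d \<and>
      norm (H s - H t - (s - t) *\<^sub>R h t) > \<bar>s - t\<bar> / real (Suc m)}" for m
  have Hdiff: "norm (H s - H t - (s - t) *\<^sub>R h t) =
      norm (measure lborel {min s t..max s t} *\<^sub>R h t - integral {min s t..max s t} h)"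
    if "s \<in> {a..b}" "t \<in> {a..b}" for s t
  proof -
    have *: "H y - H x = integral {x..y} h" if "a \<le> x" "x \<le> y" "y \<le> b" for x y
      using Henstock_Kurzweil_Integration.integral_combine[of a x y h] that
        integrable_subinterval_real[OF h, of a y] by (simp add: H_def algebra_simps)
    show ?thesis
    proof (cases "s \<le> t")
      case True
      then have "H t - H s = integral {s..t} h" using *[of s t] that by simp
      then have "H s - H t - (s - t) *\<^sub>R h t = (t - s) *\<^sub>R h t - integral {s..t} h"
        by (metis (no_types, opaque_lifting) diff_diff_eq2 minus_diff_eq scaleR_minus_left uminus_add_conv_diff diff_conv_add_uminus add.commute)
      then show ?thesis using True by simp
    next
      case False
      then have "H s - H t = integral {t..s} h" using *[of t s] that by simp
      then show ?thesis using False by (simp add: norm_minus_commute)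
    qed
  qed
  have "negligible (E m)" for m
    unfolding negligible_outer_le
  proof (intro allI impI)
    fix e :: real assume e: "e > 0"
    \<comment> \<open>Compensates the factor \<open>Suc m\<close> that is lost when the length of a
      bad interval is bounded by its Henstock error.\<close>
    define e' where "e' = e / real (Suc m)"
    have e': "e' > 0" using e by (simp add: e'_def)
    obtain \<gamma> where \<gamma>: "gauge \<gamma>" "\<And>p. p tagged_partial_division_of {a..b} \<Longrightarrow> \<gamma> fine p \<Longrightarrow>
        (\<Sum>(x,K)\<in>p. norm (measure lborel K *\<^sub>R h x - integral K h)) < e'"
      using Henstock_lemma[of h a b e'] h e' by (auto simp: box_real)
    define seg where "seg = (\<lambda>(t::real,s). {min s t..max s t})"
    define I where "I = {(t,s). t \<in> {a..b} \<and> s \<in> {a..b} \<and> s \<noteq> t \<and> seg (t,s) \<subseteq> \<gamma> t \<and>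
       norm (H s - H t - (s - t) *\<^sub>R h t) > \<bar>s - t\<bar> / real (Suc m)}"
    define cen where "cen = (\<lambda>(t::real,s::real). (t+s)/2)"
    define rad where "rad = (\<lambda>(t::real,s::real). \<bar>s-t\<bar>/2)"
    \<comment> \<open>The segments are rewritten as closed balls, the form in which the covering
      theorem selects disjoint members.\<close>
    have cb: "cball (cen i) (rad i) = seg i" for i
      by (cases i) (auto simp: cen_def rad_def seg_def cball_eq_atLeastAtMost field_simps min_def max_def abs_if)
    obtain C where C: "countable C" "C \<subseteq> I"
      "pairwise (\<lambda>i j. disjnt (cball (cen i) (rad i)) (cball (cen j) (rad j))) C"
      "negligible (E m - (\<Union>i\<in>C. cball (cen i) (rad i)))"
    proof (rule Vitali_covering_theorem_cballs[of I rad "E m" cen])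
      show "0 < rad i" if "i \<in> I" for i using that by (auto simp: I_def rad_def)
      fix t d :: real assume t: "t \<in> E m" and d: "0 < d"
      obtain r where r: "r > 0" "ball t r \<subseteq> \<gamma> t" using \<gamma>(1) unfolding gauge_def
        by (meson open_contains_ball)
      obtain s where s: "s \<in> {a..b}" "\<bar>s - t\<bar> < min d r"
          "norm (H s - H t - (s - t) *\<^sub>R h t) > \<bar>s - t\<bar> / real (Suc m)"
        using t[unfolded E_def mem_Collect_eq, THEN conjunct2, THEN spec[of _ "min d r"]] d r(1) by auto
      have "s \<noteq> t" using s(3) by auto
      moreover have "seg (t,s) \<subseteq> \<gamma> t" using r s(2) by (fastforce simp: seg_def dist_real_def)
      ultimately have "(t,s) \<in> I" using s t by (auto simp: I_def E_def)
      moreover have "t \<in> cball (cen (t,s)) (rad (t,s))" unfolding cb by (auto simp: seg_def)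
      moreover have "rad (t,s) < d" using s(2) \<open>s \<noteq> t\<close> by (auto simp: rad_def)
      ultimately show "\<exists>i. i \<in> I \<and> t \<in> cball (cen i) (rad i) \<and> rad i < d" by blast
    qed (rule that)
    \<comment> \<open>Henstock's lemma speaks about finite partial divisions; bounds for finite
      subfamilies carry over to the countable union.\<close>
    have bound: "measure lebesgue (\<Union>i\<in>J. seg i) \<le> e" if J: "J \<subseteq> C" "finite J" for J
    proof -
      define p where "p = (\<lambda>i. (fst i, seg i)) ` J"
      have JI: "i \<in> I" if "i \<in> J" for i using J C that by auto
      have dis: "seg i \<inter> seg j = {}" if "i \<in> J" "j \<in> J" "i \<noteq> j" for i j
        using C(3)[unfolded pairwise_def cb disjnt_def] J that by (meson subsetD)
      have ne: "fst i \<in> seg i" for i by (auto simp: seg_def split: prod.splits)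
      have inj: "inj_on (\<lambda>i. (fst i, seg i)) J" 
      proof (rule inj_onI)
        fix i j assume "i \<in> J" "j \<in> J" "(fst i, seg i) = (fst j, seg j)"
        then show "i = j" using dis[of i j] ne[of i] by auto
      qed
      have p: "p tagged_partial_division_of {a..b}"
        unfolding tagged_partial_division_of_def
      proof (intro conjI allI impI)
        show "finite p" using J by (simp add: p_def)
        fix x K assume "(x,K) \<in> p"
        then obtain i where i: "i \<in> J" "x = fst i" "K = seg i" by (auto simp: p_def)
        show "x \<in> K" using i ne by simp
        show "K \<subseteq> {a..b}" using JI[OF i(1)] i by (auto simp: I_def seg_def)
        show "\<exists>a b. K = cbox a b" using i by (auto simp: seg_def split: prod.splits)
      next
        fix x1 K1 x2 K2 assume "(x1, K1) \<in> p \<and> (x2, K2) \<in> p \<and> (x1, K1) \<noteq> (x2, K2)"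
        then obtain i j where ij: "i \<in> J" "j \<in> J" "(x1, K1) = (fst i, seg i)" "(x2, K2) = (fst j, seg j)"
          "(x1, K1) \<noteq> (x2, K2)" unfolding p_def by (elim conjE imageE) (rule that)
        then have "i \<noteq> j" by auto
        then have "K1 \<inter> K2 = {}" using dis[OF ij(1,2)] ij(3,4) by simp
        then show "interior K1 \<inter> interior K2 = {}" using interior_subset by blast
      qed
      have fp: "\<gamma> fine p" unfolding fine_def
      proof (intro ballI, clarify)
        fix x K y assume "(x, K) \<in> p" "y \<in> K"
        then obtain i where i: "i \<in> J" "x = fst i" "K = seg i" "y \<in> seg i" by (auto simp: p_def)
        from JI[OF i(1)] have "seg i \<subseteq> \<gamma> (fst i)" unfolding I_def by (cases i) simp
        then show "y \<in> \<gamma> x" using i by auto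
      qed
      have "measure lebesgue (\<Union>i\<in>J. seg i) \<le> (\<Sum>i\<in>J. measure lebesgue (seg i))"
        by (rule measure_UNION_le) (use J in \<open>auto simp: seg_def\<close>)
      also have "\<dots> \<le> (\<Sum>i\<in>J. real (Suc m) * norm (measure lborel (seg i) *\<^sub>R h (fst i) - integral (seg i) h))"
      proof (rule sum_mono)
        fix i assume "i \<in> J"
        then obtain t s where i: "i = (t,s)" "(t,s) \<in> I" using JI[of i] by (cases i) simp
        have "\<bar>s - t\<bar> \<le> real (Suc m) * norm (H s - H t - (s - t) *\<^sub>R h t)"
          using i(2) unfolding I_def by (simp add: field_simps del: of_nat_Suc)
        then show "measure lebesgue (seg i) \<le> real (Suc m) * norm (measure lborel (seg i) *\<^sub>R h (fst i) - integral (seg i) h)"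
        proof -
          have "measure lebesgue (seg i) = \<bar>s - t\<bar>" using i(1) by (simp add: seg_def min_def max_def)
          moreover have "norm (measure lborel (seg i) *\<^sub>R h (fst i) - integral (seg i) h) = norm (H s - H t - (s - t) *\<^sub>R h t)"
            using i Hdiff[of s t] by (simp add: I_def seg_def)
          ultimately show ?thesis using \<open>\<bar>s - t\<bar> \<le> _\<close> by simp
        qed
      qed
      also have "\<dots> = real (Suc m) * (\<Sum>(x,K)\<in>p. norm (measure lborel K *\<^sub>R h x - integral K h))"
        unfolding p_def by (simp add: sum.reindex[OF inj] sum_distrib_left[symmetric])
      also have "\<dots> \<le> real (Suc m) * e'" using \<gamma>(2)[OF p fp] by (intro mult_left_mono) auto
      also have "\<dots> = e" by (simp add: e'_def)
      finally show ?thesis .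
    qed
    have lm: "(\<Union>i\<in>C. seg i) \<in> lmeasurable" "measure lebesgue (\<Union>i\<in>C. seg i) \<le> e"
    proof -
      have sm: "seg i \<in> lmeasurable" for i by (cases i) (simp add: seg_def)
      show "(\<Union>i\<in>C. seg i) \<in> lmeasurable" "measure lebesgue (\<Union>i\<in>C. seg i) \<le> e"
        by (rule fmeasurable_UN_bound[OF C(1) sm bound]; assumption)
           (rule measure_UN_bound[OF C(1) sm bound]; assumption)
    qed
    show "\<exists>T. E m \<subseteq> T \<and> T \<in> lmeasurable \<and> measure lebesgue T \<le> e"
    proof (intro exI conjI)
      let ?Z = "E m - (\<Union>i\<in>C. seg i)"
      have nz: "negligible ?Z" using C(4) by (simp add: cb)
      show "E m \<subseteq> ?Z \<union> (\<Union>i\<in>C. seg i)" by blast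
      show "?Z \<union> (\<Union>i\<in>C. seg i) \<in> lmeasurable"
        using nz lm(1) by (blast intro: fmeasurable.Un negligible_imp_measurable)
      have "measure lebesgue (?Z \<union> (\<Union>i\<in>C. seg i)) \<le> measure lebesgue ?Z + measure lebesgue (\<Union>i\<in>C. seg i)"
        using nz lm(1) by (blast intro: measure_Un_le fmeasurableD negligible_imp_sets)
      then show "measure lebesgue (?Z \<union> (\<Union>i\<in>C. seg i)) \<le> e"
        using lm(2) nz negligible_imp_measure0 by fastforce
    qed
  qed
  then have "negligible (\<Union>m. E m)" by (intro negligible_Union_nat) auto
  moreover have "(H has_vector_derivative h t) (at t within {a..b})" if t: "t \<in> {a..b} - (\<Union>m. E m)" for t
    unfolding has_vector_derivative_def has_derivative_within_alt
  proof (intro conjI allI impI)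
    show "bounded_linear (\<lambda>x. x *\<^sub>R h t)" by (rule bounded_linear_scaleR_left)
    fix e :: real assume "0 < e"
    then obtain m where m: "1 / real (Suc m) < e" using nat_approx_posE by (metis)
    have "t \<notin> E m" using t by auto
    then have "\<exists>d>0. \<forall>s\<in>{a..b}. \<bar>s - t\<bar> < d \<longrightarrow>
        \<not> norm (H s - H t - (s - t) *\<^sub>R h t) > \<bar>s - t\<bar> / real (Suc m)"
    proof -
      have "t \<in> {a..b}" using t by simp
      with \<open>t \<notin> E m\<close> have "\<not> (\<forall>d>0. \<exists>s\<in>{a..b}. \<bar>s - t\<bar> < d \<and>
        norm (H s - H t - (s - t) *\<^sub>R h t) > \<bar>s - t\<bar> / real (Suc m))"
        unfolding E_def mem_Collect_eq by simp
      then show ?thesis by meson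
    qed
    then obtain d where d: "d > 0" "\<And>s. s\<in>{a..b} \<Longrightarrow> \<bar>s - t\<bar> < d \<Longrightarrow>
        norm (H s - H t - (s - t) *\<^sub>R h t) \<le> \<bar>s - t\<bar> / real (Suc m)"
      unfolding not_less by meson
    have "\<bar>s - t\<bar> / real (Suc m) \<le> e * \<bar>s - t\<bar>" for s
      using mult_right_mono[OF less_imp_le[OF m], of "\<bar>s - t\<bar>"] by simp
    then show "\<exists>d>0. \<forall>y\<in>{a..b}. norm (y - t) < d \<longrightarrow>
        norm (H y - H t - (y - t) *\<^sub>R h t) \<le> e * norm (y - t)"
      using d by (metis order_trans real_norm_def)
  qed
  ultimately show thesis using that unfolding H_def by blast
qed

section \<open>Convex combinations of square integrable functions\<close>

text \<open>Dyadic convex combinations of the tail from \<open>n\<close>. Midpoints alone are enough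
  for the parallelogram identity and for every convexity argument below, and rule induction replaces
  bookkeeping with weights.\<close>

inductive mid_hull :: "(nat \<Rightarrow> 'a \<Rightarrow> 'e::real_vector) \<Rightarrow> nat \<Rightarrow> ('a \<Rightarrow> 'e) \<Rightarrow> bool" for u n where
  base: "n \<le> k \<Longrightarrow> mid_hull u n (u k)"
| mid: "mid_hull u n v \<Longrightarrow> mid_hull u n w \<Longrightarrow> mid_hull u n (\<lambda>t. (1/2) *\<^sub>R (v t + w t))"

lemma mid_hull_mono: "mid_hull u m v \<Longrightarrow> n \<le> m \<Longrightarrow> mid_hull u n v"
  by (induction rule: mid_hull.induct) (auto intro: mid_hull.intros)

lemma norm_sq_midpoint_le:
  fixes x y :: "'e::real_inner"
  shows "(norm ((1/2) *\<^sub>R (x + y)))\<^sup>2 \<le> (norm x)\<^sup>2 / 2 + (norm y)\<^sup>2 / 2"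
proof -
  have "0 \<le> (norm (x - y))\<^sup>2" by simp
  then show ?thesis
    by (simp add: power2_norm_eq_inner inner_simps inner_commute power_divide algebra_simps)
qed

lemma parallelogram_midpoint:
  fixes x y :: "'e::real_inner"
  shows "(norm (x - y))\<^sup>2 = 2 * (norm x)\<^sup>2 + 2 * (norm y)\<^sup>2 - 4 * (norm ((1/2) *\<^sub>R (x + y)))\<^sup>2"
  by (simp add: power2_norm_eq_inner inner_simps inner_commute power_divide algebra_simps)

lemma (in finite_measure) integrable_norm_of_square:
  fixes w :: "'a \<Rightarrow> 'e::euclidean_space"
  assumes [measurable]: "w \<in> borel_measurable M" and "integrable M (\<lambda>t. (norm (w t))\<^sup>2)"
  shows "integrable M (\<lambda>t. norm (w t))"
proof (rule Bochner_Integration.integrable_bound[of M "\<lambda>t. 1 + (norm (w t))\<^sup>2"])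
  show "integrable M (\<lambda>t. 1 + (norm (w t))\<^sup>2)" using assms by simp
  have "x \<le> 1 + x\<^sup>2" for x :: real
    using zero_le_power2[of "x - 1/2"] by (simp add: power2_eq_square algebra_simps)
  then show "AE t in M. norm (norm (w t)) \<le> norm (1 + (norm (w t))\<^sup>2)" by auto
qed measurable

lemma (in finite_measure) mid_hull_measurable:
  fixes u :: "nat \<Rightarrow> 'a \<Rightarrow> 'e::euclidean_space"
  assumes "\<And>k. u k \<in> borel_measurable M" "mid_hull u n w"
  shows "w \<in> borel_measurable M"
  using assms(2) by induction (use assms(1) in measurable)

text \<open>Midpoint convexity of \<open>Q\<close> can be integrated, so a common bound on the tail
  survives averaging.\<close>

lemma (in finite_measure) mid_hull_nn_integral_le:
  fixes u :: "nat \<Rightarrow> 'a \<Rightarrow> 'e::euclidean_space"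
  assumes meas: "\<And>k. u k \<in> borel_measurable M" and w: "mid_hull u n w"
    and Q[measurable]: "Q \<in> borel_measurable borel" and Q0: "\<And>x. 0 \<le> Q x"
    and Qc: "\<And>x y. Q ((1/2) *\<^sub>R (x + y)) \<le> Q x / 2 + Q y / 2"
    and s: "\<And>k. n \<le> k \<Longrightarrow> (\<integral>\<^sup>+ t. ennreal (Q (u k t)) \<partial>M) \<le> s"
  shows "(\<integral>\<^sup>+ t. ennreal (Q (w t)) \<partial>M) \<le> s"
  using w
proof induction
  case (base k) then show ?case using s by auto
next
  case (mid v w)
  note [measurable] = mid_hull_measurable[OF meas mid(1)] mid_hull_measurable[OF meas mid(2)]
  have "(\<integral>\<^sup>+ t. ennreal (Q ((1/2) *\<^sub>R (v t + w t))) \<partial>M)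
      \<le> (\<integral>\<^sup>+ t. ennreal (1/2) * ennreal (Q (v t)) + ennreal (1/2) * ennreal (Q (w t)) \<partial>M)"
  proof (rule nn_integral_mono)
    fix t
    have "ennreal (Q ((1/2) *\<^sub>R (v t + w t))) \<le> ennreal (1/2 * Q (v t) + 1/2 * Q (w t))"
      using Qc[of "v t" "w t"] by (intro ennreal_leI) simp
    also have "\<dots> = ennreal (1/2) * ennreal (Q (v t)) + ennreal (1/2) * ennreal (Q (w t))"
      by (simp only: ennreal_plus ennreal_mult Q0 mult_nonneg_nonneg zero_le_divide_1_iff zero_le_numeral)
    finally show "ennreal (Q ((1/2) *\<^sub>R (v t + w t)))
      \<le> ennreal (1/2) * ennreal (Q (v t)) + ennreal (1/2) * ennreal (Q (w t))" .
  qed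
  also have "\<dots> = ennreal (1/2) * (\<integral>\<^sup>+ t. ennreal (Q (v t)) \<partial>M) + ennreal (1/2) * (\<integral>\<^sup>+ t. ennreal (Q (w t)) \<partial>M)"
    by (subst nn_integral_add) (auto simp: nn_integral_cmult)
  also have "\<dots> \<le> ennreal (1/2) * s + ennreal (1/2) * s"
    using mid.IH by (intro add_mono mult_left_mono) auto
  also have "\<dots> = (ennreal (1/2) + ennreal (1/2)) * s" by (simp add: distrib_right)
  also have "ennreal (1/2) + ennreal (1/2) = 1"
    by (subst ennreal_plus[symmetric]) auto
  finally show ?case by simp
qed

text \<open>Integrated form of \<open>2 * x \<le> e + x\<^sup>2 / e\<close>, standing in for
  Cauchy-Schwarz. With \<open>e = (1/2)^i\<close> and a square integral of order
  \<open>(1/4)^i\<close> both terms have order \<open>(1/2)^i\<close>.\<close>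

lemma (in finite_measure) integral_norm_le_sq:
  fixes h :: "'a \<Rightarrow> 'e::euclidean_space"
  assumes m[measurable]: "h \<in> borel_measurable M" and sq: "integrable M (\<lambda>t. (norm (h t))\<^sup>2)" and e: "0 < e"
  shows "(\<integral>t. norm (h t) \<partial>M) \<le> (e * measure M (space M) + (\<integral>t. (norm (h t))\<^sup>2 \<partial>M) / e) / 2"
proof -
  have "(\<integral>t. norm (h t) \<partial>M) \<le> (\<integral>t. (e + (norm (h t))\<^sup>2 / e) / 2 \<partial>M)"
  proof (rule integral_mono)
    show "integrable M (\<lambda>t. norm (h t))" by (rule integrable_norm_of_square[OF m sq])
    show "integrable M (\<lambda>t. (e + (norm (h t))\<^sup>2 / e) / 2)" using sq by auto
    fix t
    have "0 \<le> (e - norm (h t))\<^sup>2" by simp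
    then show "norm (h t) \<le> (e + (norm (h t))\<^sup>2 / e) / 2"
      using e by (simp add: field_simps power2_eq_square)
  qed
  also have "\<dots> = (e * measure M (space M) + (\<integral>t. (norm (h t))\<^sup>2 \<partial>M) / e) / 2"
    using sq by (simp add: mult.commute)
  finally show ?thesis .
qed

text \<open>The differences have \<open>L1\<close> norms of geometric order, so their sum is
  integrable and hence finite almost everywhere; the telescoping series then converges absolutely.
  The same sum plus the norm of the first term is the dominating function \<open>D\<close>.\<close>

lemma (in finite_measure) AE_convergent_of_L2_fast:
  fixes x :: "nat \<Rightarrow> 'a \<Rightarrow> 'e::euclidean_space"
  assumes m[measurable]: "\<And>i. x i \<in> borel_measurable M"
    and sq: "\<And>i. integrable M (\<lambda>t. (norm (x i t))\<^sup>2)"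
    and sqd: "\<And>i. integrable M (\<lambda>t. (norm (x (Suc i) t - x i t))\<^sup>2)"
    and fast: "\<And>i. (\<integral>t. (norm (x (Suc i) t - x i t))\<^sup>2 \<partial>M) \<le> (1/4)^i"
  obtains D where "integrable M D" "AE t in M. (\<forall>i. norm (x i t) \<le> D t) \<and> convergent (\<lambda>i. x i t)"
proof -
  define d where "d i t = norm (x (Suc i) t - x i t)" for i t
  have dm[measurable]: "d i \<in> borel_measurable M" for i unfolding d_def by measurable
  have di: "integrable M (d i)" for i unfolding d_def
    by (rule integrable_norm_of_square) (use sqd in auto)
  have dle: "(\<integral>t. d i t \<partial>M) \<le> (1/2)^i * ((measure M (space M) + 1) / 2)" for i
  proof -
    have "(\<integral>t. d i t \<partial>M) \<le> ((1/2)^i * measure M (space M) + (\<integral>t. (norm (x (Suc i) t - x i t))\<^sup>2 \<partial>M) / (1/2)^i) / 2"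
      unfolding d_def by (rule integral_norm_le_sq) (use sqd in auto)
    also have "\<dots> \<le> ((1/2)^i * measure M (space M) + (1/4)^i / (1/2)^i) / 2"
      using fast[of i] by (intro divide_right_mono add_left_mono) auto
    also have "(1/4::real)^i / (1/2)^i = (1/2)^i" by (simp add: power_divide[symmetric])
    finally show ?thesis by (simp add: algebra_simps)
  qed
  have sum1: "summable (\<lambda>i. (1/2)^i * ((measure M (space M) + 1) / 2))"
    by (intro summable_mult2 summable_geometric) auto
  have sumI: "summable (\<lambda>i. \<integral>t. norm (d i t) \<partial>M)"
    by (rule summable_comparison_test'[OF sum1, of 0])
      (use dle in \<open>auto simp: d_def intro!: order_trans[OF _ dle] integral_nonneg_AE\<close>)
  have "(\<integral>\<^sup>+ t. (\<Sum>i. ennreal (d i t)) \<partial>M) = (\<Sum>i. \<integral>\<^sup>+ t. ennreal (d i t) \<partial>M)"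
    by (rule nn_integral_suminf) auto
  also have "\<dots> = (\<Sum>i. ennreal (\<integral>t. d i t \<partial>M))"
    by (rule suminf_cong, rule nn_integral_eq_integral[OF di]) (auto simp: d_def)
  also have "\<dots> = ennreal (\<Sum>i. \<integral>t. d i t \<partial>M)"
  proof (rule suminf_ennreal2)
    show "0 \<le> (\<integral>t. d i t \<partial>M)" for i by (rule integral_nonneg_AE) (auto simp: d_def)
    have "norm (d i t) = d i t" for i t by (simp add: d_def)
    then show "summable (\<lambda>i. \<integral>t. d i t \<partial>M)" using sumI by simp
  qed
  finally have "(\<integral>\<^sup>+ t. (\<Sum>i. ennreal (d i t)) \<partial>M) \<noteq> \<infinity>" by simp
  then have "AE t in M. (\<Sum>i. ennreal (d i t)) \<noteq> \<infinity>"
    by (intro nn_integral_PInf_AE) auto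
  then have AEs: "AE t in M. summable (\<lambda>i. d i t)"
  proof eventually_elim
    case (elim t) then show ?case
      using summable_suminf_not_top[of "\<lambda>i. d i t"] by (simp add: d_def)
  qed
  define D where "D t = norm (x 0 t) + (\<Sum>i. d i t)" for t
  have "integrable M (\<lambda>t. \<Sum>i. d i t)"
    by (rule integrable_suminf[OF di _ sumI]) (use AEs in \<open>simp add: d_def\<close>)
  then have Di: "integrable M D"
    unfolding D_def by (intro Bochner_Integration.integrable_add integrable_norm_of_square m sq)
  have "AE t in M. (\<forall>i. norm (x i t) \<le> D t) \<and> convergent (\<lambda>i. x i t)"
    using AEs
  proof eventually_elim
    case (elim t)
    have tel: "x i t = x 0 t + (\<Sum>j<i. x (Suc j) t - x j t)" for i
      using sum_lessThan_telescope[of "\<lambda>j. x j t" i] by simp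
    have "norm (x i t) \<le> D t" for i
    proof -
      have "norm (x i t) \<le> norm (x 0 t) + (\<Sum>j<i. d j t)"
        by (subst tel) (auto simp: d_def intro!: norm_triangle_le norm_sum)
      also have "(\<Sum>j<i. d j t) \<le> (\<Sum>i. d i t)"
        by (rule sum_le_suminf[OF elim]) (auto simp: d_def)
      finally show ?thesis by (simp add: D_def)
    qed
    moreover have "summable (\<lambda>j. x (Suc j) t - x j t)"
      by (rule summable_norm_cancel) (use elim in \<open>simp add: d_def\<close>)
    then have "convergent (\<lambda>i. \<Sum>j<i. x (Suc j) t - x j t)" by (simp add: summable_iff_convergent)
    then have "convergent (\<lambda>i. x 0 t + (\<Sum>j<i. x (Suc j) t - x j t))"
      by (intro convergent_add convergent_const)
    then have "convergent (\<lambda>i. x i t)" by (simp only: tel[symmetric])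
    ultimately show ?case by blast
  qed
  with Di show thesis by (rule that)
qed

text \<open>Squared norms are nearly minimised over the combinations of each tail. The infima
  \<open>d n\<close> increase and are bounded by \<open>C\<close>, so far out the parallelogram
  identity leaves no room for two near-minimisers to differ: their midpoint is again a combination
  of the tail and has squared norm at least \<open>d n\<close>. The resulting Cauchy sequence is
  thinned out to geometric speed.\<close>

lemma (in finite_measure) mid_hull_fast_sequence:
  fixes u :: "nat \<Rightarrow> 'a \<Rightarrow> 'e::euclidean_space"
  assumes meas: "\<And>k. u k \<in> borel_measurable M"
    and sq: "\<And>k. integrable M (\<lambda>t. (norm (u k t))\<^sup>2)"
    and bd: "\<And>k. (\<integral>t. (norm (u k t))\<^sup>2 \<partial>M) \<le> C"
  obtains x where "\<And>i. mid_hull u i (x i)" "\<And>i. integrable M (\<lambda>t. (norm (x i t))\<^sup>2)"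
    "\<And>i. integrable M (\<lambda>t. (norm (x (Suc i) t - x i t))\<^sup>2)"
    "\<And>i. (\<integral>t. (norm (x (Suc i) t - x i t))\<^sup>2 \<partial>M) \<le> (1/4)^i"
proof -
  define Nq where "Nq w = (\<integral>t. (norm (w t))\<^sup>2 \<partial>M)" for w :: "'a \<Rightarrow> 'e"
  define d where "d n = Inf (Nq ` {w. mid_hull u n w})" for n
  have hm: "w \<in> borel_measurable M" if "mid_hull u n w" for n w
    by (rule mid_hull_measurable[of u n w, OF meas that])
  have hsq: "integrable M (\<lambda>t. (norm (w t))\<^sup>2)" if w: "mid_hull u n w" for n w
    using w
  proof induction
    case (mid v w)
    note [measurable] = hm[OF mid(1)] hm[OF mid(2)]
    show ?case
    proof (rule Bochner_Integration.integrable_bound)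
      show "integrable M (\<lambda>t. (norm (v t))\<^sup>2 / 2 + (norm (w t))\<^sup>2 / 2)" using mid.IH by auto
      show "AE t in M. norm ((norm ((1/2) *\<^sub>R (v t + w t)))\<^sup>2) \<le> norm ((norm (v t))\<^sup>2 / 2 + (norm (w t))\<^sup>2 / 2)"
        using norm_sq_midpoint_le by (auto intro!: AE_I2)
    qed measurable
  qed (use sq in auto)
  have bdd: "bdd_below (Nq ` {w. mid_hull u n w})" for n
    unfolding Nq_def by (rule bdd_belowI[of _ 0]) auto
  have ne: "Nq ` {w. mid_hull u n w} \<noteq> {}" for n using mid_hull.base[of n n u] by auto
  have dle: "d n \<le> Nq w" if "mid_hull u n w" for n w
    unfolding d_def using that bdd by (auto intro!: cInf_lower)
  have dC: "d n \<le> C" for n using dle[OF mid_hull.base[of n n u]] bd[of n] by (auto simp: Nq_def)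
  have dmono: "d n \<le> d m" if "n \<le> m" for n m
    unfolding d_def[of m] using that mid_hull_mono dle by (intro cInf_greatest ne) blast
  have diffsq: "integrable M (\<lambda>t. (norm (v t - w t))\<^sup>2)"
     "Nq (\<lambda>t. v t - w t) \<le> 2 * Nq v + 2 * Nq w - 4 * d n"
    if v: "mid_hull u n v" and w: "mid_hull u n w" for n v w
  proof -
    note m = mid_hull.mid[OF v w]
    show "integrable M (\<lambda>t. (norm (v t - w t))\<^sup>2)"
      unfolding parallelogram_midpoint using hsq[OF v] hsq[OF w] hsq[OF m] by auto
    have "Nq (\<lambda>t. v t - w t) = 2 * Nq v + 2 * Nq w - 4 * Nq (\<lambda>t. (1/2) *\<^sub>R (v t + w t))"
      unfolding Nq_def parallelogram_midpoint using hsq[OF v] hsq[OF w] hsq[OF m]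
      by (subst Bochner_Integration.integral_diff) (auto simp del: norm_scaleR)
    then show "Nq (\<lambda>t. v t - w t) \<le> 2 * Nq v + 2 * Nq w - 4 * d n" using dle[OF m] by simp
  qed
  have "\<exists>w. mid_hull u n w \<and> Nq w < d n + inverse (real (Suc n))" for n
    using cInf_lessD[OF ne, of n "d n + inverse (real (Suc n))"] unfolding d_def by auto
  then obtain w where w: "\<And>n. mid_hull u n (w n)" "\<And>n. Nq (w n) < d n + inverse (real (Suc n))" by metis
  have "incseq d" using dmono by (auto intro!: incseq_SucI)
  then obtain L where L: "d \<longlonglongrightarrow> L" "\<And>i. d i \<le> L"
    using incseq_convergent[of d C] dC by blast
  have "\<exists>N. \<forall>n\<ge>N. \<forall>m\<ge>n. integrable M (\<lambda>t. (norm (w m t - w n t))\<^sup>2) \<and> Nq (\<lambda>t. w m t - w n t) \<le> (1/4)^i" for i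
  proof -
    \<comment> \<open>For indices beyond \<open>N1\<close> and \<open>N2\<close> the parallelogram
      bound is at most \<open>2 * (L - d n) + 4 * e\<close>, hence below \<open>6 * e\<close>; the
      divisor 8 covers this.\<close>
    define e where "e = (1/4::real)^i / 8"
    have e: "e > 0" by (simp add: e_def)
    obtain N1 where N1: "\<And>n. n \<ge> N1 \<Longrightarrow> L - d n < e"
      using order_tendstoD(1)[OF L(1), of "L - e"] e by (auto simp: eventually_sequentially algebra_simps)
    obtain N2 where N2: "inverse (real (Suc N2)) < e" using reals_Archimedean[OF e] by blast
    show ?thesis
    proof (intro exI[of _ "max N1 N2"] allI impI)
      fix n m assume n: "max N1 N2 \<le> n" and m: "n \<le> m"
      have wm: "mid_hull u n (w m)" using mid_hull_mono[OF w(1) m] .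
      have i: "inverse (real (Suc k)) < e" if "k \<ge> N2" for k
      proof -
        have "inverse (real (Suc k)) \<le> inverse (real (Suc N2))" using that by (simp add: field_simps)
        then show ?thesis using N2 by linarith
      qed
      have "Nq (\<lambda>t. w m t - w n t) \<le> 2 * Nq (w m) + 2 * Nq (w n) - 4 * d n"
        by (rule diffsq(2)[OF wm w(1)])
      also have "\<dots> \<le> 8 * e"
        using w(2)[of m] w(2)[of n] i[of n] i[of m] n m N1[of n] L(2)[of m] e by simp
      finally show "integrable M (\<lambda>t. (norm (w m t - w n t))\<^sup>2) \<and> Nq (\<lambda>t. w m t - w n t) \<le> (1/4)^i"
        using diffsq(1)[OF wm w(1)] by (auto simp: e_def)
    qed
  qed
  then obtain N where N: "\<And>i n m. n \<ge> N i \<Longrightarrow> m \<ge> n \<Longrightarrow>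
      integrable M (\<lambda>t. (norm (w m t - w n t))\<^sup>2) \<and> Nq (\<lambda>t. w m t - w n t) \<le> (1/4)^i"
    by metis
  \<comment> \<open>Adding up the thresholds makes \<open>r\<close> nondecreasing and at least
    \<open>N i\<close>; the summand \<open>i\<close> keeps the combination inside the tail from
    \<open>i\<close>.\<close>
  define r where "r i = i + (\<Sum>j\<le>i. N j)" for i
  have r: "N i \<le> r i" "r i \<le> r (Suc i)" "i \<le> r i" for i
    using member_le_sum[of i "{..i}" N] by (auto simp: r_def)
  show thesis
  proof (rule that[of "\<lambda>i. w (r i)"])
    fix i
    show "mid_hull u i (w (r i))" by (rule mid_hull_mono[OF w(1) r(3)])
    then show "integrable M (\<lambda>t. (norm (w (r i) t))\<^sup>2)" by (rule hsq)
    show "integrable M (\<lambda>t. (norm (w (r (Suc i)) t - w (r i) t))\<^sup>2)"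
      "(\<integral>t. (norm (w (r (Suc i)) t - w (r i) t))\<^sup>2 \<partial>M) \<le> (1/4)^i"
      using N[OF r(1,2), of i] by (auto simp: Nq_def)
  qed
qed

text \<open>A substitute for weak sequential compactness of bounded sets of square integrable functions
  together with Mazur's lemma: minimising the norm over convex combinations of tails gives strong
  limits, which see every limit of a linear functional and every closed convex constraint.\<close>

lemma (in finite_measure) convex_combination_limit:
  fixes u :: "nat \<Rightarrow> 'a \<Rightarrow> 'e::euclidean_space"
  assumes meas: "\<And>k. u k \<in> borel_measurable M"
    and sq: "\<And>k. integrable M (\<lambda>t. (norm (u k t))\<^sup>2)"
    and bd: "\<And>k. (\<integral>t. (norm (u k t))\<^sup>2 \<partial>M) \<le> C"
  obtains v where "v \<in> borel_measurable M" "integrable M (\<lambda>t. (norm (v t))\<^sup>2)"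
    "\<And>\<phi> B l. \<phi> \<in> borel_measurable M \<Longrightarrow> (\<And>t. norm (\<phi> t) \<le> B) \<Longrightarrow>
       (\<lambda>k. \<integral>t. u k t \<bullet> \<phi> t \<partial>M) \<longlonglongrightarrow> l \<Longrightarrow> (\<integral>t. v t \<bullet> \<phi> t \<partial>M) = l"
    "\<And>\<Omega>. closed \<Omega> \<Longrightarrow> convex \<Omega> \<Longrightarrow> (\<And>k. AE t in M. u k t \<in> \<Omega>) \<Longrightarrow> AE t in M. v t \<in> \<Omega>"
    "\<And>Q j. continuous_on UNIV Q \<Longrightarrow> (\<And>x. 0 \<le> Q x) \<Longrightarrow>
       (\<And>x y. Q ((1/2) *\<^sub>R (x + y)) \<le> Q x / 2 + Q y / 2) \<Longrightarrow>
       (\<lambda>k. \<integral>\<^sup>+ t. ennreal (Q (u k t)) \<partial>M) \<longlonglongrightarrow> j \<Longrightarrow> (\<integral>\<^sup>+ t. ennreal (Q (v t)) \<partial>M) \<le> j"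
proof -
  obtain x where x: "\<And>i. mid_hull u i (x i)" "\<And>i. integrable M (\<lambda>t. (norm (x i t))\<^sup>2)"
    "\<And>i. integrable M (\<lambda>t. (norm (x (Suc i) t - x i t))\<^sup>2)"
    "\<And>i. (\<integral>t. (norm (x (Suc i) t - x i t))\<^sup>2 \<partial>M) \<le> (1/4)^i"
    by (rule mid_hull_fast_sequence[OF meas sq bd]) (rule that)
  have xm[measurable]: "x i \<in> borel_measurable M" for i by (rule mid_hull_measurable[OF meas x(1)])
  obtain D where D: "integrable M D" "AE t in M. (\<forall>i. norm (x i t) \<le> D t) \<and> convergent (\<lambda>i. x i t)"
    by (rule AE_convergent_of_L2_fast[OF xm x(2-4)]) (rule that)
  define v where "v t = lim (\<lambda>i. x i t)" for t
  have vm[measurable]: "v \<in> borel_measurable M" unfolding v_def by (rule borel_measurable_lim_metric) measurable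
  have lim: "AE t in M. (\<lambda>i. x i t) \<longlonglongrightarrow> v t"
    using D(2) by eventually_elim (auto simp: v_def convergent_LIMSEQ_iff)
  \<comment> \<open>Fatou along the almost everywhere convergent combinations, whose
    \<open>Q\<close>-integrals inherit the bound \<open>s\<close> of the tail by convexity. It
    yields the square integrability of \<open>v\<close> as well as the last claim.\<close>
  have Qle: "(\<integral>\<^sup>+ t. ennreal (Q (v t)) \<partial>M) \<le> s"
    if Q: "continuous_on UNIV Q" "\<And>x. 0 \<le> Q x" "\<And>x y. Q ((1/2) *\<^sub>R (x + y)) \<le> Q x / 2 + Q y / 2"
      and s: "\<And>k. k0 \<le> k \<Longrightarrow> (\<integral>\<^sup>+ t. ennreal (Q (u k t)) \<partial>M) \<le> s" for Q :: "'e \<Rightarrow> real" and s k0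
  proof -
    have Qm[measurable]: "Q \<in> borel_measurable borel" using Q(1) by (rule borel_measurable_continuous_onI)
    have "AE t in M. (\<lambda>i. Q (x i t)) \<longlonglongrightarrow> Q (v t)"
      using lim
    proof eventually_elim
      case (elim t)
      then show ?case
        using Q(1) by (intro isCont_tendsto_compose[of _ Q]) (auto simp: continuous_on_eq_continuous_at)
    qed
    then have "AE t in M. ennreal (Q (v t)) = liminf (\<lambda>i. ennreal (Q (x i t)))"
      by eventually_elim (metis lim_imp_Liminf sequentially_bot tendsto_ennrealI trivial_limit_sequentially)
    then have "(\<integral>\<^sup>+ t. ennreal (Q (v t)) \<partial>M) = (\<integral>\<^sup>+ t. liminf (\<lambda>i. ennreal (Q (x i t))) \<partial>M)"
      by (rule nn_integral_cong_AE)
    also have "\<dots> \<le> liminf (\<lambda>i. \<integral>\<^sup>+ t. ennreal (Q (x i t)) \<partial>M)"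
      by (rule nn_integral_liminf) measurable
    also have "\<dots> \<le> limsup (\<lambda>i. \<integral>\<^sup>+ t. ennreal (Q (x i t)) \<partial>M)"
      by (rule Liminf_le_Limsup) simp
    also have "\<dots> \<le> s"
    proof (rule Limsup_bounded)
      have "(\<integral>\<^sup>+ t. ennreal (Q (x i t)) \<partial>M) \<le> s" if "k0 \<le> i" for i
        by (rule mid_hull_nn_integral_le[OF meas x(1) Qm Q(2,3)]) (use s that in auto)
      then show "\<forall>\<^sub>F i in sequentially. (\<integral>\<^sup>+ t. ennreal (Q (x i t)) \<partial>M) \<le> s"
        unfolding eventually_sequentially by blast
    qed
    finally show ?thesis .
  qed
  show thesis
  proof (rule that[of v])
    show "v \<in> borel_measurable M" by measurable
    have "(\<integral>\<^sup>+ t. ennreal ((norm (v t))\<^sup>2) \<partial>M) \<le> ennreal C"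
    proof (rule Qle[of "\<lambda>x. (norm x)\<^sup>2" 0])
      show "(\<integral>\<^sup>+ t. ennreal ((norm (u k t))\<^sup>2) \<partial>M) \<le> ennreal C" for k
        using bd[of k] by (subst nn_integral_eq_integral[OF sq]) (auto intro!: ennreal_leI)
    qed (auto intro!: continuous_intros norm_sq_midpoint_le simp del: norm_scaleR)
    then show "integrable M (\<lambda>t. (norm (v t))\<^sup>2)"
      by (intro integrableI_bounded) (auto intro: le_less_trans[OF _ ennreal_less_top])
  next
    fix \<phi> B l assume [measurable]: "\<phi> \<in> borel_measurable M" and B: "\<And>t. norm (\<phi> t) \<le> B"
      and l: "(\<lambda>k. \<integral>t. u k t \<bullet> \<phi> t \<partial>M) \<longlonglongrightarrow> l"
    have int: "integrable M (\<lambda>t. w t \<bullet> \<phi> t)" if wm: "w \<in> borel_measurable M" and wi: "integrable M (\<lambda>t. norm (w t))" for w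
    proof (rule Bochner_Integration.integrable_bound)
      show "integrable M (\<lambda>t. norm (w t) * B)" using wi by auto
      show "AE t in M. norm (w t \<bullet> \<phi> t) \<le> norm (norm (w t) * B)"
      proof (rule AE_I2)
        fix t
        have "norm (w t \<bullet> \<phi> t) \<le> norm (w t) * norm (\<phi> t)" by (simp add: Cauchy_Schwarz_ineq2)
        also have "\<dots> \<le> norm (w t) * B" using B by (simp add: mult_left_mono)
        finally show "norm (w t \<bullet> \<phi> t) \<le> norm (norm (w t) * B)" by simp
      qed
    qed (use wm in measurable)
    have hi: "integrable M (\<lambda>t. norm (w t))" if "mid_hull u n w" for n w
      using that
    proof induction
      case (base k) then show ?case using integrable_norm_of_square[OF meas sq] by blast
    next
      case (mid v w)
      note [measurable] = mid_hull_measurable[OF meas mid(1)] mid_hull_measurable[OF meas mid(2)]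
      show ?case
      proof (rule Bochner_Integration.integrable_bound)
        show "integrable M (\<lambda>t. norm (v t) + norm (w t))" using mid.IH by auto
        have "norm ((1/2) *\<^sub>R (v t + w t)) \<le> norm (v t) + norm (w t)" for t
        proof -
          have "norm ((1/2) *\<^sub>R (v t + w t)) = norm (v t + w t) / 2" by simp
          then show ?thesis
            using norm_triangle_ineq[of "v t" "w t"] norm_ge_zero[of "v t"] norm_ge_zero[of "w t"] by linarith
        qed
        then show "AE t in M. norm (norm ((1/2) *\<^sub>R (v t + w t))) \<le> norm (norm (v t) + norm (w t))" by auto
      qed measurable
    qed
    \<comment> \<open>An interval around \<open>l\<close> is convex: if the functional takes its
      values there along the tail, it does so on all combinations of the tail.\<close>
    have hl: "\<bar>(\<integral>t. w t \<bullet> \<phi> t \<partial>M) - l\<bar> \<le> e"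
      if w: "mid_hull u n w" and e: "\<And>k. n \<le> k \<Longrightarrow> \<bar>(\<integral>t. u k t \<bullet> \<phi> t \<partial>M) - l\<bar> \<le> e" for w e n
      using w
    proof induction
      case (mid v w)
      have "(\<integral>t. ((1/2) *\<^sub>R (v t + w t)) \<bullet> \<phi> t \<partial>M) = 1/2 * (\<integral>t. v t \<bullet> \<phi> t \<partial>M) + 1/2 * (\<integral>t. w t \<bullet> \<phi> t \<partial>M)"
        using int[OF mid_hull_measurable[OF meas mid(1)] hi[OF mid(1)]]
          int[OF mid_hull_measurable[OF meas mid(2)] hi[OF mid(2)]]
        by (simp add: inner_add_left add_divide_distrib)
      then show ?case using mid.IH by (auto simp: abs_le_iff field_simps)
    qed (use e in auto)
    have "(\<lambda>i. \<integral>t. x i t \<bullet> \<phi> t \<partial>M) \<longlonglongrightarrow> l"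
    proof (rule LIMSEQ_I)
      fix r :: real assume r: "0 < r"
      then obtain n where n: "\<And>k. n \<le> k \<Longrightarrow> \<bar>(\<integral>t. u k t \<bullet> \<phi> t \<partial>M) - l\<bar> < r/2"
        using LIMSEQ_D[OF l, of "r/2"] by auto
      have "\<bar>(\<integral>t. x i t \<bullet> \<phi> t \<partial>M) - l\<bar> \<le> r/2" if "n \<le> i" for i
        by (rule hl[OF mid_hull_mono[OF x(1) that]]) (use n in \<open>auto intro: less_imp_le\<close>)
      then show "\<exists>no. \<forall>i\<ge>no. norm ((\<integral>t. x i t \<bullet> \<phi> t \<partial>M) - l) < r" using r by (intro exI[of _ n]) force
    qed
    moreover have "(\<lambda>i. \<integral>t. x i t \<bullet> \<phi> t \<partial>M) \<longlonglongrightarrow> (\<integral>t. v t \<bullet> \<phi> t \<partial>M)"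
    proof (rule integral_dominated_convergence[where w = "\<lambda>t. D t * B"])
      show "integrable M (\<lambda>t. D t * B)" using D(1) by auto
      show "AE t in M. (\<lambda>i. x i t \<bullet> \<phi> t) \<longlonglongrightarrow> v t \<bullet> \<phi> t"
        using lim by eventually_elim (auto intro!: tendsto_intros)
      show "AE t in M. norm (x i t \<bullet> \<phi> t) \<le> D t * B" for i
        using D(2)
      proof eventually_elim
        case (elim t)
        have "norm (x i t \<bullet> \<phi> t) \<le> norm (x i t) * norm (\<phi> t)" by (simp add: Cauchy_Schwarz_ineq2)
        also have "\<dots> \<le> D t * B" using elim B[of t] order_trans[OF norm_ge_zero] by (intro mult_mono) auto
        finally show ?case .
      qed
    qed measurable
    ultimately show "(\<integral>t. v t \<bullet> \<phi> t \<partial>M) = l" using LIMSEQ_unique by blast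
  next
    fix \<Omega> :: "'e set" assume cl: "closed \<Omega>" and cv: "convex \<Omega>" and u: "\<And>k. AE t in M. u k t \<in> \<Omega>"
    have AE_hull: "AE t in M. w t \<in> \<Omega>" if "mid_hull u n w" for n w
      using that
    proof induction
      case (mid v w)
      from mid.IH show ?case
      proof eventually_elim
        case (elim t) then show ?case
          using convexD[OF cv, of "v t" "w t" "1/2" "1/2"] by (simp add: scaleR_add_right)
      qed
    qed (use u in auto)
    have "AE t in M. \<forall>i. x i t \<in> \<Omega>" unfolding AE_all_countable by (intro allI AE_hull[OF x(1)])
    with lim show "AE t in M. v t \<in> \<Omega>"
    proof eventually_elim
      case (elim t)
      show ?case by (rule closed_sequentially[OF cl _ elim(1)]) (use elim(2) in blast)
    qed
  next
    fix Q :: "'e \<Rightarrow> real" and j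
    assume Q: "continuous_on UNIV Q" "\<And>x. 0 \<le> Q x" "\<And>x y. Q ((1/2) *\<^sub>R (x + y)) \<le> Q x / 2 + Q y / 2"
      and j: "(\<lambda>k. \<integral>\<^sup>+ t. ennreal (Q (u k t)) \<partial>M) \<longlonglongrightarrow> j"
    show "(\<integral>\<^sup>+ t. ennreal (Q (v t)) \<partial>M) \<le> j"
    \<comment> \<open>It is enough to bound by each \<open>s\<close> above \<open>j\<close>, since
      such an \<open>s\<close> eventually bounds the integrals along the sequence; an infinite
      \<open>j\<close> leaves nothing to check.\<close>
    proof (rule dense_ge)
      fix s assume "j < s"
      from order_tendstoD(2)[OF j this] obtain k0 where
        "\<And>k. k0 \<le> k \<Longrightarrow> (\<integral>\<^sup>+ t. ennreal (Q (u k t)) \<partial>M) < s" by (auto simp: eventually_sequentially)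
      then show "(\<integral>\<^sup>+ t. ennreal (Q (v t)) \<partial>M) \<le> s"
        by (intro Qle[OF Q, of k0]) (auto intro: less_imp_le)
    qed
  qed
qed

section \<open>Square integrable controls: integrability and uniform estimates\<close>

definition square_integrable_on :: "(real \<Rightarrow> 'e::euclidean_space) \<Rightarrow> real set \<Rightarrow> bool"  (infixr \<open>square'_integrable'_on\<close> 46) where
  "u square_integrable_on S \<longleftrightarrow> u \<in> borel_measurable (lebesgue_on S) \<and> integrable (lebesgue_on S) (\<lambda>t. (norm (u t))\<^sup>2)"

lemma square_integrable_absolutely:
  assumes "u square_integrable_on {a..b::real}"
  shows "u absolutely_integrable_on {a..b}" "(\<lambda>t. (norm (u t))\<^sup>2) integrable_on {a..b}"
    "(\<lambda>t. norm (u t)) integrable_on {a..b}" "(\<lambda>t. 1 + norm (u t)) integrable_on {a..b}"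
proof -
  interpret finite_measure "lebesgue_on {a..b}"
    by (rule finite_measure_lebesgue_on) auto
  have "integrable (lebesgue_on {a..b}) (\<lambda>t. norm (u t))"
  proof (rule Bochner_Integration.integrable_bound[of _ "\<lambda>t. 1 + (norm (u t))\<^sup>2"])
    show "integrable (lebesgue_on {a..b}) (\<lambda>t. 1 + (norm (u t))\<^sup>2)"
      using assms by (intro Bochner_Integration.integrable_add integrable_const) (auto simp: square_integrable_on_def)
    have "x \<le> 1 + x\<^sup>2" for x :: real
      using zero_le_power2[of "x - 1/2"] by (simp add: power2_eq_square algebra_simps)
    then show "AE t in lebesgue_on {a..b}. norm (norm (u t)) \<le> norm (1 + (norm (u t))\<^sup>2)" by auto
    show "(\<lambda>t. norm (u t)) \<in> borel_measurable (lebesgue_on {a..b})"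
      using assms by (auto simp: square_integrable_on_def)
  qed
  then show u: "u absolutely_integrable_on {a..b}"
    using assms by (auto simp: absolutely_integrable_measurable square_integrable_on_def o_def)
  then show "(\<lambda>t. norm (u t)) integrable_on {a..b}" by (auto simp: absolutely_integrable_on_def)
  then show "(\<lambda>t. 1 + norm (u t)) integrable_on {a..b}"
    by (intro Henstock_Kurzweil_Integration.integrable_add integrable_const_ivl)
  show "(\<lambda>t. (norm (u t))\<^sup>2) integrable_on {a..b}"
    using assms by (intro integrable_on_lebesgue_on) (auto simp: square_integrable_on_def)
qed

text \<open>Young's inequality; it makes the integral of the speed bound small on short intervals,
  uniformly over bounded sets of square integrable controls.\<close>

lemma sum_integral_le_young:
  fixes u :: "real \<Rightarrow> 'e::euclidean_space" and l r :: "'i \<Rightarrow> real"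
  assumes u: "u square_integrable_on {a..b}" and C: "(\<integral>t. (norm (u t))\<^sup>2 \<partial>lebesgue_on {a..b}) \<le> C"
    and D: "finite D" "\<And>i. i \<in> D \<Longrightarrow> l i \<le> r i \<and> {l i..r i} \<subseteq> {a..b}"
    and dis: "\<And>i j. i \<in> D \<Longrightarrow> j \<in> D \<Longrightarrow> i \<noteq> j \<Longrightarrow> {l i<..<r i} \<inter> {l j<..<r j} = {}"
    and \<kappa>: "0 < \<kappa>"
  shows "(\<Sum>i\<in>D. integral {l i..r i} (\<lambda>t. 1 + norm (u t))) \<le> (1 + 1 / \<kappa>) * (\<Sum>i\<in>D. r i - l i) + \<kappa> * C"
proof -
  note ui = square_integrable_absolutely[OF u]
  have sub: "h integrable_on {l i..r i}" if "h integrable_on {a..b}" "i \<in> D" for i and h :: "real \<Rightarrow> real"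
    using D(2) that by (meson integrable_on_subinterval)
  have "integral {l i..r i} (\<lambda>t. 1 + norm (u t)) \<le>
      (1 + 1 / \<kappa>) * (r i - l i) + \<kappa> * integral {l i..r i} (\<lambda>t. (norm (u t))\<^sup>2)" if i: "i \<in> D" for i
  proof -
    have "integral {l i..r i} (\<lambda>t. 1 + norm (u t)) \<le>
       integral {l i..r i} (\<lambda>t. (1 + 1 / \<kappa>) + \<kappa> * (norm (u t))\<^sup>2)"
    proof (rule integral_le)
      show "(\<lambda>t. (1 + 1 / \<kappa>) + \<kappa> * (norm (u t))\<^sup>2) integrable_on {l i..r i}"
        using integrable_cmul[OF sub[OF ui(2) i], of \<kappa>]
        by (intro Henstock_Kurzweil_Integration.integrable_add integrable_const_ivl) simp
      fix t
      have "x \<le> 1 / \<kappa> + \<kappa> * x\<^sup>2" if "0 \<le> x" for x :: real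
      proof -
        have "0 \<le> (2 * \<kappa> * x - 1)\<^sup>2" by simp
        then have "4 * (\<kappa> * x) \<le> 1 + 4 * (\<kappa> * x)\<^sup>2" by (simp add: power2_eq_square algebra_simps)
        then have "\<kappa> * x \<le> 1 + (\<kappa> * x)\<^sup>2" by simp
        then show ?thesis using \<kappa> by (simp add: field_simps power2_eq_square)
      qed
      then show "1 + norm (u t) \<le> (1 + 1 / \<kappa>) + \<kappa> * (norm (u t))\<^sup>2" by simp
    qed (rule sub[OF ui(4) i])
    also have "\<dots> = (1 + 1 / \<kappa>) * (r i - l i) + \<kappa> * integral {l i..r i} (\<lambda>t. (norm (u t))\<^sup>2)"
      using integrable_cmul[OF sub[OF ui(2) i], of \<kappa>] D(2)[OF i]
      by (subst Henstock_Kurzweil_Integration.integral_add) (auto simp: algebra_simps)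
    finally show ?thesis .
  qed
  then have "(\<Sum>i\<in>D. integral {l i..r i} (\<lambda>t. 1 + norm (u t))) \<le>
      (\<Sum>i\<in>D. (1 + 1 / \<kappa>) * (r i - l i) + \<kappa> * integral {l i..r i} (\<lambda>t. (norm (u t))\<^sup>2))"
    by (rule sum_mono)
  also have "\<dots> = (1 + 1 / \<kappa>) * (\<Sum>i\<in>D. r i - l i) + \<kappa> * (\<Sum>i\<in>D. integral {l i..r i} (\<lambda>t. (norm (u t))\<^sup>2))"
    by (simp add: sum.distrib sum_distrib_left)
  also have "(\<Sum>i\<in>D. integral {l i..r i} (\<lambda>t. (norm (u t))\<^sup>2)) \<le> C"
  proof -
    have "((\<lambda>t. (norm (u t))\<^sup>2) has_integral (\<Sum>i\<in>D. integral {l i..r i} (\<lambda>t. (norm (u t))\<^sup>2))) (\<Union>i\<in>D. {l i..r i})"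
    proof (rule has_integral_UN[OF D(1)])
      show "((\<lambda>t. (norm (u t))\<^sup>2) has_integral integral {l i..r i} (\<lambda>t. (norm (u t))\<^sup>2)) {l i..r i}" if "i \<in> D" for i
        using sub[OF ui(2) that] by (simp add: integrable_integral)
      show "pairwise (\<lambda>i i'. negligible ({l i..r i} \<inter> {l i'..r i'})) D"
      proof (rule pairwiseI)
        fix i j assume ij: "i \<in> D" "j \<in> D" "i \<noteq> j"
        \<comment> \<open>Intervals with disjoint interiors meet in end points at most, also when
          one of them is degenerate.\<close>
        have "{l i..r i} \<inter> {l j..r j} \<subseteq> {l i, r i, l j, r j}"
        proof
          fix x assume x: "x \<in> {l i..r i} \<inter> {l j..r j}"
          show "x \<in> {l i, r i, l j, r j}"
          proof (rule ccontr)
            assume "x \<notin> {l i, r i, l j, r j}"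
            with x have "x \<in> {l i<..<r i} \<inter> {l j<..<r j}" by auto
            then show False using dis[OF ij] by blast
          qed
        qed
        then show "negligible ({l i..r i} \<inter> {l j..r j})"
          by (rule negligible_subset[rotated]) (auto intro: negligible_finite)
      qed
    qed
    moreover have "((\<lambda>t. (norm (u t))\<^sup>2) has_integral integral {a..b} (\<lambda>t. (norm (u t))\<^sup>2)) {a..b}"
      using ui(2) by (simp add: integrable_integral)
    ultimately have "(\<Sum>i\<in>D. integral {l i..r i} (\<lambda>t. (norm (u t))\<^sup>2)) \<le> integral {a..b} (\<lambda>t. (norm (u t))\<^sup>2)"
    proof (rule has_integral_subset_le[rotated])
      show "(\<Union>i\<in>D. {l i..r i}) \<subseteq> {a..b}" using D(2) by blast
    qed auto
    also have "\<dots> = (\<integral>t. (norm (u t))\<^sup>2 \<partial>lebesgue_on {a..b})"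
      using u by (intro lebesgue_integral_eq_integral[symmetric]) (auto simp: square_integrable_on_def)
    finally show ?thesis using C by simp
  qed
  finally show ?thesis using \<kappa> by (simp add: mult_left_mono)
qed

text \<open>The order of quantifiers is the point: \<open>\<delta>\<close> is chosen before
  \<open>u\<close> and serves all controls of energy at most \<open>C\<close>. This is the source of
  equicontinuity of the states.\<close>

lemma square_integrable_modulus:
  fixes C :: real
  assumes "0 < e" "0 \<le> C"
  obtains \<delta> where "0 < \<delta>" "\<And>(u :: real \<Rightarrow> 'e::euclidean_space) s t. u square_integrable_on {a..b} \<Longrightarrow>
     (\<integral>t. (norm (u t))\<^sup>2 \<partial>lebesgue_on {a..b}) \<le> C \<Longrightarrow> a \<le> s \<Longrightarrow> s \<le> t \<Longrightarrow> t \<le> b \<Longrightarrow> t - s \<le> \<delta> \<Longrightarrow>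
     integral {s..t} (\<lambda>t. 1 + norm (u t)) \<le> e"
proof -
  \<comment> \<open>Half of \<open>e\<close> is spent on the energy term through
    \<open>\<kappa>\<close>, the other half on the length of the interval through
    \<open>\<delta>\<close>.\<close>
  define \<kappa> where "\<kappa> = e / (2 * (C + 1))"
  have \<kappa>: "\<kappa> > 0" "\<kappa> * C \<le> e / 2" using assms by (auto simp: \<kappa>_def field_simps)
  define \<delta> where "\<delta> = e / (2 * (1 + 1 / \<kappa>))"
  have k1: "0 < 1 + 1 / \<kappa>" using \<kappa> by (simp add: add_pos_pos)
  have \<delta>: "\<delta> > 0" "(1 + 1 / \<kappa>) * \<delta> = e / 2" using assms k1 by (auto simp: \<delta>_def field_simps)
  show thesis
  proof (rule that[OF \<delta>(1)])
    fix u :: "real \<Rightarrow> 'e" and s t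
    assume u: "u square_integrable_on {a..b}" "(\<integral>t. (norm (u t))\<^sup>2 \<partial>lebesgue_on {a..b}) \<le> C"
      and st: "a \<le> s" "s \<le> t" "t \<le> b" "t - s \<le> \<delta>"
    have "integral {s..t} (\<lambda>t. 1 + norm (u t)) \<le> (1 + 1 / \<kappa>) * (t - s) + \<kappa> * C"
      using sum_integral_le_young[OF u, of "{()}" "\<lambda>_. s" "\<lambda>_. t" \<kappa>] st \<kappa> by auto
    also have "(1 + 1 / \<kappa>) * (t - s) \<le> (1 + 1 / \<kappa>) * \<delta>" using st k1 by (intro mult_left_mono) auto
    finally show "integral {s..t} (\<lambda>t. 1 + norm (u t)) \<le> e" using \<delta> \<kappa> by linarith
  qed
qed

section \<open>Locally Lipschitz functions\<close>

text \<open>Strong enough for continuity of the vector fields and for uniqueness of solutions, and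
  stable under the operations that build gradients and Christoffel symbols, including matrix
  inversion.\<close>

definition loc_lipschitz :: "('x::metric_space \<Rightarrow> 'y::metric_space) \<Rightarrow> 'x set \<Rightarrow> bool" where
  "loc_lipschitz F S \<longleftrightarrow> (\<forall>x\<in>S. \<exists>r>0. \<exists>L. \<forall>y\<in>ball x r \<inter> S. \<forall>z\<in>ball x r \<inter> S. dist (F y) (F z) \<le> L * dist y z)"

lemma loc_lipschitzI:
  assumes "\<And>x. x \<in> S \<Longrightarrow> \<exists>r>0. \<exists>L. \<forall>y\<in>ball x r \<inter> S. \<forall>z\<in>ball x r \<inter> S. dist (F y) (F z) \<le> L * dist y z"
  shows "loc_lipschitz F S"
  using assms by (simp add: loc_lipschitz_def)

lemma loc_lipschitzE:
  assumes "loc_lipschitz F S" "x \<in> S"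
  obtains r L where "r > 0" "L \<ge> 0" "\<And>y z. y \<in> ball x r \<Longrightarrow> y \<in> S \<Longrightarrow> z \<in> ball x r \<Longrightarrow> z \<in> S \<Longrightarrow> dist (F y) (F z) \<le> L * dist y z"
proof -
  from assms obtain r L where rL: "r > 0" "\<forall>y\<in>ball x r \<inter> S. \<forall>z\<in>ball x r \<inter> S. dist (F y) (F z) \<le> L * dist y z"
    unfolding loc_lipschitz_def by meson
  show thesis
  proof (rule that[of r "\<bar>L\<bar>"])
    fix y z assume "y \<in> ball x r" "y \<in> S" "z \<in> ball x r" "z \<in> S"
    then have "dist (F y) (F z) \<le> L * dist y z" using rL(2) by blast
    also have "\<dots> \<le> \<bar>L\<bar> * dist y z" by (intro mult_right_mono) auto
    finally show "dist (F y) (F z) \<le> \<bar>L\<bar> * dist y z" .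
  qed (use rL in auto)
qed

lemma loc_lipschitz_continuous_on:
  assumes F: "loc_lipschitz F S"
  shows "continuous_on S F"
  unfolding continuous_on_iff
proof (intro ballI allI impI)
  fix x e assume x: "x \<in> S" and e: "(0::real) < e"
  obtain r L where rL: "r > 0" "L \<ge> 0" "\<And>y z. y \<in> ball x r \<Longrightarrow> y \<in> S \<Longrightarrow> z \<in> ball x r \<Longrightarrow> z \<in> S \<Longrightarrow> dist (F y) (F z) \<le> L * dist y z"
    by (rule loc_lipschitzE[OF F x]) (rule that)
  show "\<exists>d>0. \<forall>x'\<in>S. dist x' x < d \<longrightarrow> dist (F x') (F x) < e"
  proof (intro exI[of _ "min r (e / (L + 1))"] conjI ballI impI)
    show "0 < min r (e / (L + 1))" using rL e by auto
    fix y assume y: "y \<in> S" "dist y x < min r (e / (L + 1))"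
    have "dist (F y) (F x) \<le> L * dist y x" using rL(3)[of y x] y x rL(1) by (auto simp: dist_commute)
    also have "\<dots> \<le> (L + 1) * dist y x" by (simp add: distrib_right)
    also have "\<dots> < e" using y rL(2) by (simp add: field_simps)
    finally show "dist (F y) (F x) < e" .
  qed
qed

text \<open>Common core of the rules for sums, products, inverses and linear images: near each point
  the increments of \<open>H\<close> are bounded by those of \<open>F\<close> and \<open>G\<close>.
  For an operation with one argument take \<open>F = G\<close>.\<close>

lemma loc_lipschitz_lift2:
  assumes F: "loc_lipschitz F S" and G: "loc_lipschitz G S"
    and H: "\<And>x. x \<in> S \<Longrightarrow> \<exists>r>0. \<exists>K\<ge>0. \<forall>y\<in>ball x r \<inter> S. \<forall>z\<in>ball x r \<inter> S.
       dist (H y) (H z) \<le> K * (dist (F y) (F z) + dist (G y) (G z))"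
  shows "loc_lipschitz H S"
proof (rule loc_lipschitzI)
  fix x assume x: "x \<in> S"
  obtain r1 L1 where 1: "r1 > 0" "L1 \<ge> 0" "\<And>y z. y \<in> ball x r1 \<Longrightarrow> y \<in> S \<Longrightarrow> z \<in> ball x r1 \<Longrightarrow> z \<in> S \<Longrightarrow> dist (F y) (F z) \<le> L1 * dist y z"
    by (rule loc_lipschitzE[OF F x]) (rule that)
  obtain r2 L2 where 2: "r2 > 0" "L2 \<ge> 0" "\<And>y z. y \<in> ball x r2 \<Longrightarrow> y \<in> S \<Longrightarrow> z \<in> ball x r2 \<Longrightarrow> z \<in> S \<Longrightarrow> dist (G y) (G z) \<le> L2 * dist y z"
    by (rule loc_lipschitzE[OF G x]) (rule that)
  from H[OF x] obtain r K where 3: "r > 0" "K \<ge> 0" "\<forall>y\<in>ball x r \<inter> S. \<forall>z\<in>ball x r \<inter> S.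
       dist (H y) (H z) \<le> K * (dist (F y) (F z) + dist (G y) (G z))" by meson
  show "\<exists>r>0. \<exists>L. \<forall>y\<in>ball x r \<inter> S. \<forall>z\<in>ball x r \<inter> S. dist (H y) (H z) \<le> L * dist y z"
  proof (rule exI[of _ "min r (min r1 r2)"], rule conjI[rotated, OF exI[of _ "K * (L1 + L2)"]], intro conjI ballI)
    show "0 < min r (min r1 r2)" using 1 2 3 by auto
    fix y z assume y: "y \<in> ball x (min r (min r1 r2)) \<inter> S" and z: "z \<in> ball x (min r (min r1 r2)) \<inter> S"
    have "dist (H y) (H z) \<le> K * (dist (F y) (F z) + dist (G y) (G z))" using 3(3) y z by auto
    also have "\<dots> \<le> K * (L1 * dist y z + L2 * dist y z)"
      using 1(3)[of y z] 2(3)[of y z] y z 3(2) by (intro mult_left_mono add_mono) auto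
    finally show "dist (H y) (H z) \<le> K * (L1 + L2) * dist y z" by (simp add: algebra_simps)
  qed
qed

lemma loc_lipschitz_const [intro]: "loc_lipschitz (\<lambda>x. c) S"
proof (rule loc_lipschitzI)
  show "\<exists>r>0. \<exists>L. \<forall>y\<in>ball x r \<inter> S. \<forall>z\<in>ball x r \<inter> S. dist c c \<le> L * dist y z" for x
    by (intro exI[of _ "1::real"] conjI ballI) auto
qed

lemma loc_lipschitz_add [intro]:
  fixes F G :: "'x::metric_space \<Rightarrow> 'y::real_normed_vector"
  assumes "loc_lipschitz F S" "loc_lipschitz G S"
  shows "loc_lipschitz (\<lambda>x. F x + G x) S"
proof (rule loc_lipschitz_lift2[OF assms])
  show "\<exists>r>0. \<exists>K\<ge>0. \<forall>y\<in>ball x r \<inter> S. \<forall>z\<in>ball x r \<inter> S.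
       dist (F y + G y) (F z + G z) \<le> K * (dist (F y) (F z) + dist (G y) (G z))" for x
    by (intro exI[of _ "1::real"] conjI ballI) (auto simp: dist_norm add_diff_add norm_triangle_ineq)
qed

lemma loc_lipschitz_bounded_linear:
  assumes "bounded_linear h" "loc_lipschitz F S"
  shows "loc_lipschitz (\<lambda>x. h (F x)) S"
proof -
  interpret bounded_linear h by fact
  obtain B where B: "\<And>x. norm (h x) \<le> norm x * B" "B \<ge> 0" using nonneg_bounded by blast
  have "dist (h (F y)) (h (F z)) \<le> B * (dist (F y) (F z) + dist (F y) (F z))" for y z
  proof -
    have "dist (h (F y)) (h (F z)) \<le> B * dist (F y) (F z)"
      using B(1)[of "F y - F z"] by (simp add: dist_norm diff mult.commute)
    also have "\<dots> \<le> B * (dist (F y) (F z) + dist (F y) (F z))" using B by (intro mult_left_mono) auto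
    finally show ?thesis .
  qed
  note Bd = this
  show ?thesis
  proof (rule loc_lipschitz_lift2[OF assms(2) assms(2)])
    show "\<exists>r>0. \<exists>K\<ge>0. \<forall>y\<in>ball x r \<inter> S. \<forall>z\<in>ball x r \<inter> S.
       dist (h (F y)) (h (F z)) \<le> K * (dist (F y) (F z) + dist (F y) (F z))" for x
      by (rule exI[of _ 1], rule conjI[rotated, OF exI[of _ B]], intro conjI ballI Bd B(2)) auto
  qed
qed

lemma loc_lipschitz_minus [intro]:
  fixes F :: "'x::metric_space \<Rightarrow> 'y::real_normed_vector"
  shows "loc_lipschitz F S \<Longrightarrow> loc_lipschitz (\<lambda>x. - F x) S"
  by (rule loc_lipschitz_bounded_linear[OF bounded_linear_minus[OF bounded_linear_ident]])

lemma loc_lipschitz_diff [intro]: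
  fixes F G :: "'x::metric_space \<Rightarrow> 'y::real_normed_vector"
  assumes "loc_lipschitz F S" "loc_lipschitz G S"
  shows "loc_lipschitz (\<lambda>x. F x - G x) S"
  using loc_lipschitz_add[OF assms(1) loc_lipschitz_minus[OF assms(2)]] by simp

lemma loc_lipschitz_sum [intro]:
  fixes F :: "'i \<Rightarrow> 'x::metric_space \<Rightarrow> 'y::real_normed_vector"
  assumes "\<And>i. i \<in> I \<Longrightarrow> loc_lipschitz (F i) S"
  shows "loc_lipschitz (\<lambda>x. \<Sum>i\<in>I. F i x) S"
  using assms by (induction I rule: infinite_finite_induct) auto

lemma loc_lipschitz_scaleR [intro]:
  fixes F :: "'x::metric_space \<Rightarrow> real" and G :: "'x \<Rightarrow> 'y::real_normed_vector"
  assumes F: "loc_lipschitz F S" and G: "loc_lipschitz G S"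
  shows "loc_lipschitz (\<lambda>x. F x *\<^sub>R G x) S"
proof (rule loc_lipschitz_lift2[OF assms])
  fix x assume x: "x \<in> S"
  obtain d1 where d1: "d1 > 0" "\<And>y. y \<in> S \<Longrightarrow> dist y x < d1 \<Longrightarrow> dist (F y) (F x) < 1"
    using loc_lipschitz_continuous_on[OF F] x unfolding continuous_on_iff by (meson zero_less_one)
  obtain d2 where d2: "d2 > 0" "\<And>y. y \<in> S \<Longrightarrow> dist y x < d2 \<Longrightarrow> dist (G y) (G x) < 1"
    using loc_lipschitz_continuous_on[OF G] x unfolding continuous_on_iff by (meson zero_less_one)
  show "\<exists>r>0. \<exists>K\<ge>0. \<forall>y\<in>ball x r \<inter> S. \<forall>z\<in>ball x r \<inter> S.
       dist (F y *\<^sub>R G y) (F z *\<^sub>R G z) \<le> K * (dist (F y) (F z) + dist (G y) (G z))"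
  proof (rule exI[of _ "min d1 d2"], rule conjI[rotated, OF exI[of _ "\<bar>F x\<bar> + norm (G x) + 1"]], intro conjI ballI)
    show "0 < min d1 d2" "0 \<le> \<bar>F x\<bar> + norm (G x) + 1" using d1 d2 by auto
    fix y z assume y: "y \<in> ball x (min d1 d2) \<inter> S" and z: "z \<in> ball x (min d1 d2) \<inter> S"
    have Fb: "\<bar>F z\<bar> \<le> \<bar>F x\<bar> + 1" using d1(2)[of z] z by (auto simp: dist_commute dist_real_def)
    have Gb: "norm (G y) \<le> norm (G x) + 1"
      using d2(2)[of y] y norm_triangle_ineq2[of "G y" "G x"] norm_minus_commute[of "G y" "G x"] by (auto simp: dist_commute dist_norm)
    have "F y *\<^sub>R G y - F z *\<^sub>R G z = (F y - F z) *\<^sub>R G y + F z *\<^sub>R (G y - G z)" by (simp add: algebra_simps)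
    then have "dist (F y *\<^sub>R G y) (F z *\<^sub>R G z) \<le> \<bar>F y - F z\<bar> * norm (G y) + \<bar>F z\<bar> * norm (G y - G z)"
      unfolding dist_norm by (metis norm_scaleR norm_triangle_ineq)
    also have "\<dots> \<le> \<bar>F y - F z\<bar> * (\<bar>F x\<bar> + norm (G x) + 1) + (\<bar>F x\<bar> + norm (G x) + 1) * norm (G y - G z)"
    proof -
      have "\<bar>F z\<bar> \<le> \<bar>F x\<bar> + norm (G x) + 1" "norm (G y) \<le> \<bar>F x\<bar> + norm (G x) + 1"
        using Fb Gb norm_ge_zero[of "G x"] by linarith+
      then show ?thesis by (intro add_mono mult_mono) auto
    qed
    finally show "dist (F y *\<^sub>R G y) (F z *\<^sub>R G z) \<le> (\<bar>F x\<bar> + norm (G x) + 1) * (dist (F y) (F z) + dist (G y) (G z))"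
      by (simp add: dist_norm algebra_simps)
  qed
qed

lemma loc_lipschitz_mult [intro]:
  fixes F G :: "'x::metric_space \<Rightarrow> real"
  shows "loc_lipschitz F S \<Longrightarrow> loc_lipschitz G S \<Longrightarrow> loc_lipschitz (\<lambda>x. F x * G x) S"
  using loc_lipschitz_scaleR[of F S G] by simp

lemma loc_lipschitz_prod [intro]:
  fixes F :: "'i \<Rightarrow> 'x::metric_space \<Rightarrow> real"
  assumes "\<And>i. i \<in> I \<Longrightarrow> loc_lipschitz (F i) S"
  shows "loc_lipschitz (\<lambda>x. \<Prod>i\<in>I. F i x) S"
  using assms by (induction I rule: infinite_finite_induct) auto

lemma loc_lipschitz_inverse [intro]:
  fixes F :: "'x::metric_space \<Rightarrow> real"
  assumes F: "loc_lipschitz F S" and F0: "\<And>x. x \<in> S \<Longrightarrow> F x \<noteq> 0"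
  shows "loc_lipschitz (\<lambda>x. inverse (F x)) S"
proof (rule loc_lipschitz_lift2[OF F F])
  fix x assume x: "x \<in> S"
  define m where "m = \<bar>F x\<bar> / 2"
  have m: "m > 0" using F0[OF x] by (simp add: m_def)
  obtain d where d: "d > 0" "\<And>y. y \<in> S \<Longrightarrow> dist y x < d \<Longrightarrow> dist (F y) (F x) < m"
    using loc_lipschitz_continuous_on[OF F] x m unfolding continuous_on_iff by meson
  have lb: "m \<le> \<bar>F y\<bar>" if "y \<in> ball x d \<inter> S" for y
    using d(2)[of y] that by (auto simp: dist_commute dist_real_def m_def abs_if split: if_splits)
  show "\<exists>r>0. \<exists>K\<ge>0. \<forall>y\<in>ball x r \<inter> S. \<forall>z\<in>ball x r \<inter> S.
       dist (inverse (F y)) (inverse (F z)) \<le> K * (dist (F y) (F z) + dist (F y) (F z))"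
  proof (rule exI[of _ d], rule conjI[rotated, OF exI[of _ "1 / (m * m)"]], intro conjI ballI)
    fix y z assume y: "y \<in> ball x d \<inter> S" and z: "z \<in> ball x d \<inter> S"
    have eq: "inverse (F y) - inverse (F z) = (F z - F y) / (F y * F z)"
      using F0 y z by (simp add: field_simps)
    have "dist (inverse (F y)) (inverse (F z)) = dist (F y) (F z) / (\<bar>F y\<bar> * \<bar>F z\<bar>)"
      unfolding dist_real_def eq by (simp add: abs_divide abs_mult abs_minus_commute)
    also have "\<dots> \<le> dist (F y) (F z) / (m * m)"
      using lb[OF y] lb[OF z] m by (intro divide_left_mono mult_mono mult_pos_pos) auto
    also have "\<dots> \<le> 1 / (m * m) * (dist (F y) (F z) + dist (F y) (F z))"
      using m by (simp add: field_simps)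
    finally show "dist (inverse (F y)) (inverse (F z)) \<le> 1 / (m * m) * (dist (F y) (F z) + dist (F y) (F z))" .
  qed (use d m in auto)
qed

lemma loc_lipschitz_vec [intro]:
  fixes F :: "'x::metric_space \<Rightarrow> real ^ 'n::finite"
  assumes "\<And>i. loc_lipschitz (\<lambda>x. F x $ i) S"
  shows "loc_lipschitz F S"
proof -
  have eq: "F = (\<lambda>x. \<Sum>i\<in>UNIV. (F x $ i) *\<^sub>R axis i 1)"
    by (simp add: scalar_mult_eq_scaleR[symmetric] basis_expansion)
  show ?thesis by (subst eq) (intro loc_lipschitz_sum loc_lipschitz_scaleR assms loc_lipschitz_const)
qed

lemma loc_lipschitz_compose_linear:
  assumes "bounded_linear h" and F: "loc_lipschitz F S" and hS: "h ` T \<subseteq> S"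
  shows "loc_lipschitz (\<lambda>x. F (h x)) T"
proof (rule loc_lipschitzI)
  fix x assume x: "x \<in> T"
  interpret bounded_linear h by fact
  obtain B where B: "\<And>x. norm (h x) \<le> norm x * B" "B > 0" using pos_bounded by blast
  obtain r L where rL: "r > 0" "L \<ge> 0" "\<And>y z. y \<in> ball (h x) r \<Longrightarrow> y \<in> S \<Longrightarrow> z \<in> ball (h x) r \<Longrightarrow> z \<in> S \<Longrightarrow> dist (F y) (F z) \<le> L * dist y z"
    by (rule loc_lipschitzE[OF F, of "h x"]) (use x hS in blast, rule that)
  have hd: "dist (h y) (h z) \<le> B * dist y z" for y z
    using B(1)[of "y - z"] by (simp add: dist_norm diff mult.commute)
  show "\<exists>r>0. \<exists>L. \<forall>y\<in>ball x r \<inter> T. \<forall>z\<in>ball x r \<inter> T. dist (F (h y)) (F (h z)) \<le> L * dist y z"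
  proof (rule exI[of _ "r / B"], rule conjI[rotated, OF exI[of _ "L * B"]], intro conjI ballI)
    show "0 < r / B" using rL B by auto
    fix y z assume y: "y \<in> ball x (r / B) \<inter> T" and z: "z \<in> ball x (r / B) \<inter> T"
    have hb: "h y \<in> ball (h x) r" if "y \<in> ball x (r / B)" for y
      using that hd[of x y] B(2) by (simp add: field_simps)
    have "dist (F (h y)) (F (h z)) \<le> L * dist (h y) (h z)"
      using rL(3)[OF hb _ hb] y z hS by blast
    also have "\<dots> \<le> L * (B * dist y z)" using hd rL(2) by (intro mult_left_mono)
    finally show "dist (F (h y)) (F (h z)) \<le> L * B * dist y z" by (simp add: mult.assoc)
  qed
qed

section \<open>Smooth functions and inverse matrices are locally Lipschitz\<close>

lemma smooth_on_imp_differentiable: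
  "smooth_on F S \<Longrightarrow> x \<in> S \<Longrightarrow> (F has_derivative frechet_derivative F (at x)) (at x)"
  unfolding smooth_on_def by (metis Ck_on.simps(2) frechet_derivative_works)

lemma smooth_on_derivative:
  "smooth_on F S \<Longrightarrow> smooth_on (\<lambda>x. frechet_derivative F (at x) h) S"
  unfolding smooth_on_def by (metis Ck_on.simps(2))

lemma smooth_on_continuous_on: "smooth_on F S \<Longrightarrow> continuous_on S F"
  unfolding smooth_on_def by (metis Ck_on.simps(1))

text \<open>Smoothness provides continuity of each directional derivative separately. On a compact
  ball the derivatives along the basis vectors are bounded, their bounds add up to a bound on the
  operator norm, and the mean value inequality applies on the convex ball.\<close>

lemma smooth_on_loc_lipschitz:
  fixes F :: "'x::euclidean_space \<Rightarrow> 'y::real_normed_vector"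
  assumes F: "smooth_on F S" and S: "open S"
  shows "loc_lipschitz F S"
proof (rule loc_lipschitzI)
  fix x assume "x \<in> S"
  then obtain r where r: "r > 0" "cball x r \<subseteq> S" using S open_contains_cball by blast
  define D where "D y = frechet_derivative F (at y)" for y
  have cont: "continuous_on (cball x r) (\<lambda>y. D y b)" for b
    unfolding D_def using continuous_on_subset[OF smooth_on_continuous_on[OF smooth_on_derivative[OF F]] r(2)] .
  have "\<exists>B. \<forall>y\<in>cball x r. norm (D y b) \<le> B" for b
    using compact_imp_bounded[OF compact_continuous_image[OF cont compact_cball]]
    by (auto simp: bounded_iff)
  then obtain B where B: "\<And>b y. y \<in> cball x r \<Longrightarrow> norm (D y b) \<le> B b" by metis
  have B0: "B b \<ge> 0" for b using order_trans[OF norm_ge_zero B[of x b]] r(1) by simp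
  have der: "(F has_derivative D y) (at y)" if "y \<in> cball x r" for y
    unfolding D_def using smooth_on_imp_differentiable[OF F] r(2) that by blast
  have on: "onorm (D y) \<le> (\<Sum>b\<in>Basis. B b)" if y: "y \<in> cball x r" for y
  proof (rule onorm_le)
    fix h
    interpret bounded_linear "D y" using der[OF y] by (rule has_derivative_bounded_linear)
    have "norm (D y h) = norm (D y (\<Sum>b\<in>Basis. (h \<bullet> b) *\<^sub>R b))" by (simp add: euclidean_representation)
    also have "\<dots> = norm (\<Sum>b\<in>Basis. (h \<bullet> b) *\<^sub>R D y b)" by (simp add: sum scaleR)
    also have "\<dots> \<le> (\<Sum>b\<in>Basis. norm h * B b)"
      by (rule sum_norm_le) (auto intro!: mult_mono Basis_le_norm B y)
    finally show "norm (D y h) \<le> (\<Sum>b\<in>Basis. B b) * norm h" by (simp add: sum_distrib_left mult.commute)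
  qed
  show "\<exists>r>0. \<exists>L. \<forall>y\<in>ball x r \<inter> S. \<forall>z\<in>ball x r \<inter> S. dist (F y) (F z) \<le> L * dist y z"
  proof (rule exI[of _ r], rule conjI[rotated, OF exI[of _ "\<Sum>b\<in>Basis. B b"]], intro conjI ballI)
    fix y z assume "y \<in> ball x r \<inter> S" "z \<in> ball x r \<inter> S"
    then show "dist (F y) (F z) \<le> (\<Sum>b\<in>Basis. B b) * dist y z"
      unfolding dist_norm
      by (intro differentiable_bound[of "cball x r" F D]) (auto intro: on has_derivative_at_withinI[OF der])
  qed (rule r(1))
qed

text \<open>Cramer's rule turns the entries of the inverse into quotients of polynomials in the
  entries of \<open>M\<close>, to which the Lipschitz rules apply.\<close>

lemma matrix_inv_entry:
  fixes M :: "real ^ 'n ^ 'n"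
  assumes "det M \<noteq> 0"
  shows "matrix_inv M $ k $ l = det (\<chi> i j. if j = k then axis l 1 $ i else M $ i $ j) / det M"
proof -
  have "invertible M" using assms by (simp add: invertible_det_nz)
  then have "M ** matrix_inv M = mat 1" unfolding matrix_inv_def invertible_def
    by (rule someI2_ex) auto
  then have "M *v (matrix_inv M *v axis l 1) = axis l 1"
    by (simp add: matrix_vector_mul_assoc)
  then have "matrix_inv M *v axis l 1 = (\<chi> k. det (\<chi> i j. if j = k then axis l 1 $ i else M $ i $ j) / det M)"
    using cramer[OF assms] by blast
  then have "(matrix_inv M *v axis l 1) $ k = det (\<chi> i j. if j = k then axis l 1 $ i else M $ i $ j) / det M"
    by simp
  then show ?thesis by (simp add: matrix_vector_mult_basis column_def)
qed

lemma loc_lipschitz_matrix_inv: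
  fixes M :: "'x::metric_space \<Rightarrow> real ^ 'n ^ 'n"
  assumes M: "\<And>i j. loc_lipschitz (\<lambda>x. M x $ i $ j) S" and det: "\<And>x. x \<in> S \<Longrightarrow> det (M x) \<noteq> 0"
  shows "loc_lipschitz (\<lambda>x. matrix_inv (M x) $ k $ l) S"
proof -
  have D: "loc_lipschitz (\<lambda>x. det (N x)) S" if "\<And>i j. loc_lipschitz (\<lambda>x. N x $ i $ j) S"
    for N :: "'x \<Rightarrow> real ^ 'n ^ 'n"
    unfolding det_def using that by (intro loc_lipschitz_sum loc_lipschitz_mult loc_lipschitz_prod loc_lipschitz_const)
  have "loc_lipschitz (\<lambda>x. det (\<chi> i j. if j = k then axis l 1 $ i else M x $ i $ j) * inverse (det (M x))) S"
  proof (intro loc_lipschitz_mult loc_lipschitz_inverse D M det)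
    show "loc_lipschitz (\<lambda>x. (\<chi> i j. if j = k then axis l 1 $ i else M x $ i $ j) $ i $ j) S" for i j
      using M by (cases "j = k") auto
  qed
  then show ?thesis
    unfolding loc_lipschitz_def by (simp add: matrix_inv_entry[OF det] divide_inverse)
qed

section \<open>Tangent vectors and the metric in charts\<close>

text \<open>For a chart \<open>c\<close> around \<open>p\<close> this is the inverse of the
  coordinate isomorphism \<open>\<xi> \<mapsto> \<xi> c\<close> from the tangent space at
  \<open>p\<close>.\<close>

definition lift :: "('a, 'n::finite) chart set \<Rightarrow> ('a, 'n) chart \<Rightarrow> 'a \<Rightarrow> real ^ 'n \<Rightarrow> ('a, 'n) tvec" where
  "lift A c p w = (\<lambda>d. if d \<in> A \<and> p \<in> chart_dom d then transition_deriv c d p w else 0)"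

locale atlas =
  fixes A :: "('a::{t2_space, second_countable_topology}, 'n::finite) chart set"
  assumes smooth_atlas: "smooth_atlas A"
begin

lemma charts_cover: "\<exists>c\<in>A. p \<in> chart_dom c"
  using smooth_atlas unfolding smooth_atlas_def by blast

lemma
  assumes "c \<in> A"
  shows open_chart_dom: "open (chart_dom c)" and open_chart_range: "open (chart_range c)"
    and chart_homeomorphism: "homeomorphism (chart_dom c) (chart_range c) (coords c) (param c)"
  using assms smooth_atlas unfolding smooth_atlas_def by blast+

lemma smooth_transition:
  "c \<in> A \<Longrightarrow> d \<in> A \<Longrightarrow> smooth_on (coords d \<circ> param c) (coords c ` (chart_dom c \<inter> chart_dom d))"
  using smooth_atlas unfolding smooth_atlas_def by blast

lemma
  assumes c: "c \<in> A"
  shows param_coords: "p \<in> chart_dom c \<Longrightarrow> param c (coords c p) = p"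
    and coords_param: "x \<in> chart_range c \<Longrightarrow> coords c (param c x) = x"
    and param_in_dom: "x \<in> chart_range c \<Longrightarrow> param c x \<in> chart_dom c"
    and coords_in_range: "p \<in> chart_dom c \<Longrightarrow> coords c p \<in> chart_range c"
    and continuous_on_coords: "continuous_on (chart_dom c) (coords c)"
    and continuous_on_param: "continuous_on (chart_range c) (param c)"
  using chart_homeomorphism[OF c] unfolding homeomorphism_def by blast+

lemma open_overlap:
  assumes c: "c \<in> A" and U: "open U"
  shows "open (coords c ` (chart_dom c \<inter> U))"
proof -
  have "coords c ` (chart_dom c \<inter> U) = param c -` U \<inter> chart_range c"
  proof (rule set_eqI)
    fix x
    show "x \<in> coords c ` (chart_dom c \<inter> U) \<longleftrightarrow> x \<in> param c -` U \<inter> chart_range c"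
    proof
      assume "x \<in> param c -` U \<inter> chart_range c"
      then show "x \<in> coords c ` (chart_dom c \<inter> U)"
        using coords_param[OF c] param_in_dom[OF c] by (intro image_eqI[of _ _ "param c x"]) auto
    qed (auto simp: param_coords[OF c] coords_in_range[OF c])
  qed
  then show ?thesis
    using continuous_on_param[OF c] open_chart_range[OF c] U by (simp add: continuous_on_open_vimage)
qed

lemma transition_has_derivative:
  assumes "c \<in> A" "d \<in> A" "p \<in> chart_dom c" "p \<in> chart_dom d"
  shows "((coords d \<circ> param c) has_derivative transition_deriv c d p) (at (coords c p))"
  unfolding transition_deriv_def
  by (rule smooth_on_imp_differentiable[OF smooth_transition]) (use assms in auto)

lemma transition_deriv_linear:
  assumes "c \<in> A" "d \<in> A" "p \<in> chart_dom c" "p \<in> chart_dom d"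
  shows "bounded_linear (transition_deriv c d p)"
  using transition_has_derivative[OF assms] by (rule has_derivative_bounded_linear)

lemma transition_deriv_self:
  assumes c: "c \<in> A" and p: "p \<in> chart_dom c"
  shows "transition_deriv c c p w = w"
proof -
  have "((coords c \<circ> param c) has_derivative (\<lambda>w. w)) (at (coords c p))"
    by (rule has_derivative_transform_within_open[OF has_derivative_ident open_chart_range[OF c] coords_in_range[OF c p]])
      (simp add: coords_param[OF c])
  then show ?thesis using has_derivative_unique[OF transition_has_derivative[OF c c p p]] by metis
qed

text \<open>Chain rule for functions read in charts. With \<open>F\<close> a coordinate map it gives
  the cocycle rule for transition derivatives, with \<open>F = W\<close> the chart independence of
  the differential of \<open>W\<close>.\<close>

lemma chart_change_has_derivative:
  assumes c: "c \<in> A" and d: "d \<in> A" and p: "p \<in> chart_dom c" "p \<in> chart_dom d"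
    and F: "((F \<circ> param d) has_derivative F') (at (coords d p))"
  shows "((F \<circ> param c) has_derivative (\<lambda>w. F' (transition_deriv c d p w))) (at (coords c p))"
proof -
  have "((coords d \<circ> param c) has_derivative transition_deriv c d p) (at (coords c p))"
    by (rule transition_has_derivative[OF c d p])
  moreover have "((F \<circ> param d) has_derivative F') (at ((coords d \<circ> param c) (coords c p)))"
    using F by (simp add: param_coords[OF c p(1)])
  ultimately have "((F \<circ> param d) \<circ> (coords d \<circ> param c) has_derivative F' \<circ> transition_deriv c d p) (at (coords c p))"
    by (rule diff_chain_at)
  then have "((F \<circ> param c) has_derivative F' \<circ> transition_deriv c d p) (at (coords c p))"
  proof (rule has_derivative_transform_within_open[OF _ open_overlap[OF c open_chart_dom[OF d]]])
    show "coords c p \<in> coords c ` (chart_dom c \<inter> chart_dom d)" using p by blast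
    show "(F \<circ> param d \<circ> (coords d \<circ> param c)) x = (F \<circ> param c) x" if "x \<in> coords c ` (chart_dom c \<inter> chart_dom d)" for x
      using that by (auto simp: param_coords[OF c] param_coords[OF d])
  qed
  then show ?thesis by (simp add: o_def)
qed

lemma transition_deriv_comp:
  assumes "c \<in> A" "d \<in> A" "e \<in> A" "p \<in> chart_dom c" "p \<in> chart_dom d" "p \<in> chart_dom e"
  shows "transition_deriv d e p (transition_deriv c d p w) = transition_deriv c e p w"
  using has_derivative_unique[OF transition_has_derivative[OF assms(1,3,4,6)]
      chart_change_has_derivative[OF assms(1,2,4,5) transition_has_derivative[OF assms(2,3,5,6)]]]
  by metis

lemma lift_in_tangent_space:
  assumes c: "c \<in> A" "p \<in> chart_dom c"
  shows "lift A c p w \<in> tangent_space A p"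
  unfolding tangent_space_def lift_def using transition_deriv_comp[OF c(1) _ _ c(2)] by auto

lemma lift_at [simp]: "c \<in> A \<Longrightarrow> p \<in> chart_dom c \<Longrightarrow> lift A c p w c = w"
  by (simp add: lift_def transition_deriv_self)

lemma tangent_space_transition:
  "\<xi> \<in> tangent_space A p \<Longrightarrow> c \<in> A \<Longrightarrow> d \<in> A \<Longrightarrow> p \<in> chart_dom c \<Longrightarrow> p \<in> chart_dom d \<Longrightarrow>
    \<xi> d = transition_deriv c d p (\<xi> c)"
  unfolding tangent_space_def by blast

lemma tangent_space_outside:
  "\<xi> \<in> tangent_space A p \<Longrightarrow> c \<notin> A \<or> p \<notin> chart_dom c \<Longrightarrow> \<xi> c = 0"
  unfolding tangent_space_def by blast

lemma tangent_space_eq_lift: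
  assumes "\<xi> \<in> tangent_space A p" "c \<in> A" "p \<in> chart_dom c"
  shows "\<xi> = lift A c p (\<xi> c)"
  using tangent_space_transition[OF assms(1,2) _ assms(3)] tangent_space_outside[OF assms(1)]
  by (auto simp: lift_def)

lemma tangent_space_eqI:
  assumes "\<xi> \<in> tangent_space A p" "\<eta> \<in> tangent_space A p" "c \<in> A" "p \<in> chart_dom c" "\<xi> c = \<eta> c"
  shows "\<xi> = \<eta>"
  using tangent_space_eq_lift[OF assms(1,3,4)] tangent_space_eq_lift[OF assms(2,3,4)] assms(5) by simp

lemma coord_vector_eq_lift: "coord_vector A c i p = lift A c p (axis i 1)"
  by (simp add: coord_vector_def lift_def)

lemma lift_linear:
  assumes "c \<in> A" "p \<in> chart_dom c"
  shows "lift A c p (a *\<^sub>R v + b *\<^sub>R w) = (\<lambda>d. a *\<^sub>R lift A c p v d + b *\<^sub>R lift A c p w d)"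
proof
  fix d
  show "lift A c p (a *\<^sub>R v + b *\<^sub>R w) d = a *\<^sub>R lift A c p v d + b *\<^sub>R lift A c p w d"
    using bounded_linear.linear[OF transition_deriv_linear[OF assms(1) _ assms(2)], of d]
    by (auto simp: lift_def linear_add linear_scale)
qed

text \<open>Joint continuity in point and vector follows from continuity at each basis vector, by
  linearity in the second variable. It carries convergence of tangent vectors from one chart to
  another.\<close>

lemma continuous_on_transition_deriv:
  assumes c: "c \<in> A" and d: "d \<in> A"
  shows "continuous_on (coords c ` (chart_dom c \<inter> chart_dom d) \<times> UNIV)
    (\<lambda>z. frechet_derivative (coords d \<circ> param c) (at (fst z)) (snd z))"
proof -
  let ?S = "coords c ` (chart_dom c \<inter> chart_dom d)"
  let ?D = "\<lambda>x. frechet_derivative (coords d \<circ> param c) (at x)"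
  have "continuous_on (?S \<times> UNIV) (\<lambda>z. \<Sum>i\<in>UNIV. (snd z $ i) *\<^sub>R ?D (fst z) (axis i 1))"
  proof (intro continuous_intros)
    fix i
    show "continuous_on (?S \<times> UNIV) (\<lambda>z. ?D (fst z) (axis i 1))"
      by (rule continuous_on_compose2[OF smooth_on_continuous_on[OF smooth_on_derivative[OF smooth_transition[OF c d]]] continuous_on_fst[OF continuous_on_id]])
        auto
  qed
  moreover have "(\<Sum>i\<in>UNIV. (snd z $ i) *\<^sub>R ?D (fst z) (axis i 1)) = ?D (fst z) (snd z)" if "z \<in> ?S \<times> UNIV" for z
  proof -
    have "bounded_linear (?D (fst z))"
      using smooth_on_imp_differentiable[OF smooth_transition[OF c d], of "fst z"] that
      by (auto intro: has_derivative_bounded_linear)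
    then interpret bounded_linear "?D (fst z)" .
    have "?D (fst z) (snd z) = ?D (fst z) (\<Sum>i\<in>UNIV. (snd z $ i) *\<^sub>R axis i 1)"
      by (simp add: scalar_mult_eq_scaleR[symmetric] basis_expansion)
    then show ?thesis by (simp add: sum scaleR)
  qed
  ultimately show ?thesis by (subst continuous_on_cong[OF refl, symmetric]) auto
qed

end

locale riemannian = atlas A for A :: "('a::{t2_space, second_countable_topology}, 'n::finite) chart set" +
  fixes g :: "'a \<Rightarrow> ('a, 'n) tvec \<Rightarrow> ('a, 'n) tvec \<Rightarrow> real"
  assumes riemannian_metric: "riemannian_metric A g"
begin

lemma metric_sym: "\<xi> \<in> tangent_space A p \<Longrightarrow> \<eta> \<in> tangent_space A p \<Longrightarrow> g p \<xi> \<eta> = g p \<eta> \<xi>"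
  using riemannian_metric unfolding riemannian_metric_def by blast

lemma metric_linear:
  "\<xi> \<in> tangent_space A p \<Longrightarrow> \<zeta> \<in> tangent_space A p \<Longrightarrow> \<eta> \<in> tangent_space A p \<Longrightarrow>
     g p (\<lambda>c. a *\<^sub>R \<xi> c + b *\<^sub>R \<zeta> c) \<eta> = a * g p \<xi> \<eta> + b * g p \<zeta> \<eta>"
  using riemannian_metric unfolding riemannian_metric_def by blast

lemma metric_pos: "\<xi> \<in> tangent_space A p \<Longrightarrow> \<xi> \<noteq> (\<lambda>_. 0) \<Longrightarrow> g p \<xi> \<xi> > 0"
  using riemannian_metric unfolding riemannian_metric_def by blast

lemma metric_smooth: "c \<in> A \<Longrightarrow> smooth_on (\<lambda>x. metric_matrix A g c x $ i $ j) (chart_range c)"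
  using riemannian_metric unfolding riemannian_metric_def by blast

abbreviation gram where "gram \<equiv> metric_matrix A g"

lemma metric_lift_sum:
  assumes c: "c \<in> A" "p \<in> chart_dom c" and \<eta>: "\<eta> \<in> tangent_space A p" and I: "finite I"
  shows "g p (lift A c p (\<Sum>i\<in>I. a i *\<^sub>R w i)) \<eta> = (\<Sum>i\<in>I. a i * g p (lift A c p (w i)) \<eta>)"
  using I
proof induction
  case empty
  show ?case
    using lift_linear[OF c, of 0 0 0 0] metric_linear[OF lift_in_tangent_space[OF c] lift_in_tangent_space[OF c] \<eta>, of 0 0 0 0]
    by simp
next
  case (insert i I)
  then show ?case
    using lift_linear[OF c, of "a i" "w i" 1 "\<Sum>i\<in>I. a i *\<^sub>R w i"]
      metric_linear[OF lift_in_tangent_space[OF c] lift_in_tangent_space[OF c] \<eta>, of "a i" "w i" 1 "\<Sum>i\<in>I. a i *\<^sub>R w i"]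
    by simp
qed

text \<open>Linearity is postulated in the first slot only; symmetry moves the second argument there
  for its own expansion.\<close>

lemma metric_coords:
  assumes c: "c \<in> A" "p \<in> chart_dom c" and \<xi>: "\<xi> \<in> tangent_space A p" and \<eta>: "\<eta> \<in> tangent_space A p"
  shows "g p \<xi> \<eta> = \<xi> c \<bullet> (gram c (coords c p) *v \<eta> c)"
proof -
  have ex: "w = (\<Sum>i\<in>UNIV. (w $ i) *\<^sub>R axis i 1)" for w :: "real ^ 'n"
    by (simp add: scalar_mult_eq_scaleR[symmetric] basis_expansion)
  have E: "g p \<xi>' \<eta>' = (\<Sum>i\<in>UNIV. \<xi>' c $ i * g p (lift A c p (axis i 1)) \<eta>')"
    if "\<xi>' \<in> tangent_space A p" "\<eta>' \<in> tangent_space A p" for \<xi>' \<eta>'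
  proof -
    have "lift A c p (\<Sum>i\<in>UNIV. (\<xi>' c $ i) *\<^sub>R axis i 1) = \<xi>'"
      by (simp only: ex[symmetric]) (rule tangent_space_eq_lift[OF that(1) c, symmetric])
    with metric_lift_sum[OF c that(2) finite[of UNIV], of "\<lambda>i. \<xi>' c $ i" "\<lambda>i. axis i 1"]
    show ?thesis by simp
  qed
  have "g p (lift A c p (axis i 1)) \<eta> = (\<Sum>j\<in>UNIV. gram c (coords c p) $ i $ j * \<eta> c $ j)" for i
  proof -
    have "g p (lift A c p (axis i 1)) \<eta> = g p \<eta> (lift A c p (axis i 1))"
      by (rule metric_sym[OF lift_in_tangent_space[OF c] \<eta>])
    also have "\<dots> = (\<Sum>j\<in>UNIV. \<eta> c $ j * g p (lift A c p (axis j 1)) (lift A c p (axis i 1)))"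
      by (rule E[OF \<eta> lift_in_tangent_space[OF c]])
    also have "\<dots> = (\<Sum>j\<in>UNIV. gram c (coords c p) $ i $ j * \<eta> c $ j)"
      using metric_sym[OF lift_in_tangent_space[OF c] lift_in_tangent_space[OF c]]
      by (intro sum.cong refl) (simp add: metric_matrix_def coord_vector_eq_lift param_coords[OF c] mult.commute)
    finally show ?thesis .
  qed
  then show ?thesis
    by (subst E[OF \<xi> \<eta>]) (simp add: inner_vec_def matrix_vector_mult_def)
qed

text \<open>A kernel vector would lift to a nonzero tangent vector of length zero.\<close>

lemma det_gram:
  assumes c: "c \<in> A" and x: "x \<in> chart_range c"
  shows "det (gram c x) \<noteq> 0"
proof -
  define p where "p = param c x"
  have p: "p \<in> chart_dom c" "coords c p = x" using param_in_dom[OF c x] coords_param[OF c x] by (auto simp: p_def)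
  have "w = 0" if w: "gram c x *v w = 0" for w
  proof (rule ccontr)
    assume "w \<noteq> 0"
    let ?\<xi> = "lift A c p w"
    have t: "?\<xi> \<in> tangent_space A p" by (rule lift_in_tangent_space[OF c p(1)])
    have "?\<xi> c = w" using c p by simp
    then have "?\<xi> \<noteq> (\<lambda>_. 0)" using \<open>w \<noteq> 0\<close> by (metis)
    from metric_pos[OF t this] metric_coords[OF c p(1) t t] show False using w p c by simp
  qed
  then have "\<exists>B. B ** gram c x = mat 1" unfolding matrix_left_invertible_ker by blast
  then show ?thesis using invertible_left_inverse invertible_det_nz by metis
qed

lemma gram_matrix_inv:
  assumes "c \<in> A" "x \<in> chart_range c"
  shows "gram c x ** matrix_inv (gram c x) = mat 1"
proof -
  have "invertible (gram c x)" using det_gram[OF assms] by (simp add: invertible_det_nz)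
  then show ?thesis unfolding matrix_inv_def invertible_def by (rule someI2_ex) auto
qed

definition grad_coords :: "('a \<Rightarrow> real) \<Rightarrow> ('a, 'n) chart \<Rightarrow> real ^ 'n \<Rightarrow> real ^ 'n" where
  "grad_coords W c x = matrix_inv (gram c x) *v (\<chi> i. partial i (W \<circ> param c) x)"

text \<open>The description of \<open>grad\<close> prescribes the pairing in every chart, so besides
  solving the linear system in \<open>c\<close> the transformation of the differential of
  \<open>W\<close> enters. The solution is unique because the difference of two solutions is
  orthogonal to itself.\<close>

lemma grad_eq_lift:
  assumes W: "smooth_fun A W" and c: "c \<in> A" and p: "p \<in> chart_dom c"
  shows "grad A g W p = lift A c p (grad_coords W c (coords c p))"
proof -
  define \<zeta> where "\<zeta> = lift A c p (grad_coords W c (coords c p))"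
  let ?dW = "\<lambda>d. frechet_derivative (W \<circ> param d) (at (coords d p))"
  have Wd: "((W \<circ> param d) has_derivative ?dW d) (at (coords d p))" if "d \<in> A" "p \<in> chart_dom d" for d
    using W that coords_in_range[OF that] unfolding smooth_fun_def by (blast intro: smooth_on_imp_differentiable)
  have \<zeta>T: "\<zeta> \<in> tangent_space A p" unfolding \<zeta>_def by (rule lift_in_tangent_space[OF c p])
  have \<zeta>: "g p \<zeta> \<xi> = ?dW d (\<xi> d)" if \<xi>: "\<xi> \<in> tangent_space A p" and d: "d \<in> A" "p \<in> chart_dom d" for \<xi> d
  proof -
    have "g p \<zeta> \<xi> = \<xi> c \<bullet> (gram c (coords c p) *v \<zeta> c)"
      by (simp add: metric_sym[OF \<zeta>T \<xi>] metric_coords[OF c p \<xi> \<zeta>T])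
    also have "gram c (coords c p) *v \<zeta> c = (\<chi> i. partial i (W \<circ> param c) (coords c p))"
      using c p coords_in_range[OF c p]
      by (simp add: \<zeta>_def grad_coords_def matrix_vector_mul_assoc gram_matrix_inv)
    also have "\<xi> c \<bullet> \<dots> = (\<Sum>i\<in>UNIV. \<xi> c $ i * ?dW c (axis i 1))"
      by (simp add: inner_vec_def partial_def)
    also have "\<dots> = ?dW c (\<xi> c)"
    proof -
      interpret bounded_linear "?dW c" using Wd[OF c p] by (rule has_derivative_bounded_linear)
      have "?dW c (\<xi> c) = ?dW c (\<Sum>i\<in>UNIV. (\<xi> c $ i) *\<^sub>R axis i 1)"
        by (simp add: scalar_mult_eq_scaleR[symmetric] basis_expansion)
      then show ?thesis by (simp add: sum scaleR)
    qed
    also have "\<dots> = ?dW d (\<xi> d)"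
      using has_derivative_unique[OF Wd[OF c p] chart_change_has_derivative[OF c d(1) p d(2) Wd[OF d]]]
        tangent_space_transition[OF \<xi> c d(1) p d(2)] by metis
    finally show ?thesis .
  qed
  have "grad A g W p = \<zeta>" unfolding grad_def
  proof (rule the_equality)
    show "\<zeta> \<in> tangent_space A p \<and> (\<forall>\<xi>\<in>tangent_space A p. \<forall>d\<in>A. p \<in> chart_dom d \<longrightarrow> g p \<zeta> \<xi> = ?dW d (\<xi> d))"
      using \<zeta>T \<zeta> by blast
    fix \<zeta>' assume "\<zeta>' \<in> tangent_space A p \<and> (\<forall>\<xi>\<in>tangent_space A p. \<forall>d\<in>A. p \<in> chart_dom d \<longrightarrow> g p \<zeta>' \<xi> = ?dW d (\<xi> d))"
    then have \<zeta>'T: "\<zeta>' \<in> tangent_space A p" and \<zeta>': "\<And>\<xi>. \<xi> \<in> tangent_space A p \<Longrightarrow> g p \<zeta>' \<xi> = ?dW c (\<xi> c)"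
      using c p by blast+
    define \<delta> where "\<delta> = lift A c p (1 *\<^sub>R \<zeta>' c + (-1) *\<^sub>R \<zeta> c)"
    have \<delta>T: "\<delta> \<in> tangent_space A p" unfolding \<delta>_def by (rule lift_in_tangent_space[OF c p])
    have "\<delta> = (\<lambda>d. 1 *\<^sub>R \<zeta>' d + (-1) *\<^sub>R \<zeta> d)"
      unfolding \<delta>_def lift_linear[OF c p] tangent_space_eq_lift[OF \<zeta>'T c p, symmetric] tangent_space_eq_lift[OF \<zeta>T c p, symmetric] ..
    then have "g p \<delta> \<delta> = 1 * g p \<zeta>' \<delta> + (-1) * g p \<zeta> \<delta>"
      using metric_linear[OF \<zeta>'T \<zeta>T \<delta>T, of 1 "-1"] by simp
    also have "\<dots> = 0" using \<zeta>'[OF \<delta>T] \<zeta>[OF \<delta>T c p] by simp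
    finally have "\<delta> = (\<lambda>_. 0)" using metric_pos[OF \<delta>T] by force
    moreover have "\<delta> c = \<zeta>' c - \<zeta> c" using c p by (simp add: \<delta>_def)
    ultimately have "\<zeta>' c = \<zeta> c" by simp
    then show "\<zeta>' = \<zeta>" by (rule tangent_space_eqI[OF \<zeta>'T \<zeta>T c p])
  qed
  then show ?thesis by (simp add: \<zeta>_def)
qed

lemma loc_lipschitz_matrix_inv_gram:
  "c \<in> A \<Longrightarrow> loc_lipschitz (\<lambda>x. matrix_inv (gram c x) $ k $ l) (chart_range c)"
  by (intro loc_lipschitz_matrix_inv smooth_on_loc_lipschitz metric_smooth open_chart_range det_gram)

lemma loc_lipschitz_partial:
  "smooth_on F (chart_range c) \<Longrightarrow> c \<in> A \<Longrightarrow> loc_lipschitz (partial i F) (chart_range c)"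
  unfolding partial_def by (intro smooth_on_loc_lipschitz smooth_on_derivative open_chart_range)

lemma loc_lipschitz_christoffel:
  assumes c: "c \<in> A"
  shows "loc_lipschitz (\<lambda>x. christoffel A g c x k i j) (chart_range c)"
  unfolding christoffel_def
  by (intro loc_lipschitz_mult loc_lipschitz_const loc_lipschitz_sum loc_lipschitz_add loc_lipschitz_diff
      loc_lipschitz_matrix_inv_gram[OF c] loc_lipschitz_partial[OF metric_smooth[OF c] c])

lemma loc_lipschitz_grad_coords:
  assumes W: "smooth_fun A W" and c: "c \<in> A"
  shows "loc_lipschitz (grad_coords W c) (chart_range c)"
proof (rule loc_lipschitz_vec)
  fix i
  have "smooth_on (W \<circ> param c) (chart_range c)" using W c by (simp add: smooth_fun_def)
  then show "loc_lipschitz (\<lambda>x. grad_coords W c x $ i) (chart_range c)"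
    unfolding grad_coords_def matrix_vector_mult_def vec_lambda_beta
    by (intro loc_lipschitz_sum loc_lipschitz_mult loc_lipschitz_matrix_inv_gram[OF c] loc_lipschitz_partial[OF _ c])
qed

end

section \<open>Auxiliary facts on integrals of pairs and products\<close>

lemma has_integral_Pair:
  fixes f :: "'n::euclidean_space \<Rightarrow> 'a::euclidean_space" and h :: "'n \<Rightarrow> 'b::euclidean_space"
  shows "((\<lambda>x. (f x, h x)) has_integral (I, J)) S \<longleftrightarrow> (f has_integral I) S \<and> (h has_integral J) S"
proof
  assume L: "((\<lambda>x. (f x, h x)) has_integral (I, J)) S"
  show "(f has_integral I) S \<and> (h has_integral J) S"
    using has_integral_linear[OF L bounded_linear_fst] has_integral_linear[OF L bounded_linear_snd]
    by (simp add: o_def)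
next
  assume R: "(f has_integral I) S \<and> (h has_integral J) S"
  have "bounded_linear (\<lambda>x::'a. (x, 0::'b))" "bounded_linear (\<lambda>x::'b. (0::'a, x))"
    by (auto intro!: bounded_linear_Pair bounded_linear_ident bounded_linear_zero)
  note bl = this
  have "((\<lambda>x. (f x, 0::'b)) has_integral (I, 0)) S" "((\<lambda>x. (0::'a, h x)) has_integral (0, J)) S"
    using has_integral_linear[OF conjunct1[OF R] bl(1)] has_integral_linear[OF conjunct2[OF R] bl(2)]
    by (simp_all add: o_def)
  from has_integral_add[OF this] show "((\<lambda>x. (f x, h x)) has_integral (I, J)) S" by simp
qed

lemma AE_lebesgue_on_iff:
  fixes a b :: real
  shows "(AE t in lebesgue_on {a..b}. P t) \<longleftrightarrow> (\<exists>N. negligible N \<and> (\<forall>t\<in>{a..b} - N. P t))"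
proof -
  have "(AE t in lebesgue_on {a..b}. P t) \<longleftrightarrow> (AE t in lebesgue. t \<in> {a..b} \<longrightarrow> P t)"
    by (rule AE_restrict_space_iff) auto
  also have "\<dots> \<longleftrightarrow> (\<exists>N. negligible N \<and> (\<forall>t\<in>{a..b} - N. P t))"
    unfolding eventually_ae_filter negligible_iff_null_sets Bex_def space_completion space_lborel
    by (intro ex_cong1 conj_cong refl) auto
  finally show ?thesis .
qed

lemma absolutely_integrable_continuous_mult:
  fixes \<beta> :: "real \<Rightarrow> 'e::euclidean_space" and h :: "real \<Rightarrow> real"
  assumes "h absolutely_integrable_on {a..b}" "continuous_on {a..b} \<beta>"
  shows "(\<lambda>s. h s *\<^sub>R \<beta> s) absolutely_integrable_on {a..b}"
proof -
  have "(\<lambda>s. (\<lambda>x y. y *\<^sub>R x) (\<beta> s) (h s)) absolutely_integrable_on {a..b}"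
  proof (rule absolutely_integrable_bounded_measurable_product[where h = "\<lambda>(x::'e) (y::real). y *\<^sub>R x"])
    show "bilinear (\<lambda>(x::'e) (y::real). y *\<^sub>R x)"
      by (auto simp: bilinear_def linear_iff algebra_simps)
    show "\<beta> \<in> borel_measurable (lebesgue_on {a..b})"
      using assms(2) by (rule continuous_imp_measurable_on_sets_lebesgue) auto
    show "bounded (\<beta> ` {a..b})"
      using compact_continuous_image[OF assms(2)] compact_imp_bounded by auto
  qed (use assms in auto)
  then show ?thesis by simp
qed

lemma has_vector_derivative_zeroI:
  assumes "\<And>e. 0 < e \<Longrightarrow> \<exists>d>0. \<forall>y\<in>S. norm (y - t) < d \<longrightarrow> norm (F y - F t) \<le> e * norm (y - t)"
  shows "(F has_vector_derivative 0) (at t within S)"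
  unfolding has_vector_derivative_def has_derivative_within_alt using assms by auto

text \<open>At a point where the primitives of \<open>h\<close> and \<open>\<bar>h\<bar>\<close> have the expected derivatives, the
  fundamental theorem of calculus holds for \<open>h \<beta>\<close>, for every continuous \<open>\<beta>\<close> at once.\<close>

lemma integral_mult_continuous_has_vector_derivative:
  fixes \<beta> :: "real \<Rightarrow> 'e::euclidean_space" and h :: "real \<Rightarrow> real"
  assumes h: "h absolutely_integrable_on {a..b}" and \<beta>: "continuous_on {a..b} \<beta>" and t: "t \<in> {a..b}"
    and H: "((\<lambda>s. integral {a..s} h) has_vector_derivative h t) (at t within {a..b})"
    and P: "((\<lambda>s. integral {a..s} (\<lambda>s. \<bar>h s\<bar>)) has_vector_derivative \<bar>h t\<bar>) (at t within {a..b})"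
  shows "((\<lambda>s. integral {a..s} (\<lambda>s. h s *\<^sub>R \<beta> s)) has_vector_derivative h t *\<^sub>R \<beta> t) (at t within {a..b})"
proof -
  \<comment> \<open>Freezing \<open>\<beta>\<close> at \<open>t\<close> splits the integrand into a
    constant vector times \<open>h\<close> and the remainder \<open>r\<close>, whose primitive turns
    out to have derivative 0 at \<open>t\<close>.\<close>
  define r where "r s = h s *\<^sub>R (\<beta> s - \<beta> t)" for s
  have hi: "h integrable_on {a..b}" "(\<lambda>s. \<bar>h s\<bar>) integrable_on {a..b}"
    using h by (auto simp: absolutely_integrable_on_def)
  have ri: "r integrable_on {a..b}"
    unfolding r_def
    by (rule set_lebesgue_integral_eq_integral(1)[OF absolutely_integrable_continuous_mult[OF h]])
      (intro continuous_intros \<beta>)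
  have sub: "k integrable_on {x..y}" if "k integrable_on {a..b}" "a \<le> x" "y \<le> b" for k :: "real \<Rightarrow> 'x::banach" and x y
    by (rule integrable_on_subinterval[OF that(1)]) (use that in auto)
  have comb: "integral {a..y} k - integral {a..x} k = integral {x..y} k" if "k integrable_on {a..b}" "a \<le> x" "x \<le> y" "y \<le> b"
    for k :: "real \<Rightarrow> 'x::banach" and x y
    using Henstock_Kurzweil_Integration.integral_combine[OF that(2,3) sub[OF that(1) order_refl that(4)]] by (simp add: algebra_simps)
  have "((\<lambda>s. integral {a..s} r) has_vector_derivative 0) (at t within {a..b})"
  proof (rule has_vector_derivative_zeroI)
    fix e :: real assume e: "0 < e"
    \<comment> \<open>Near \<open>t\<close> the primitive of \<open>\<bar>h\<bar>\<close> changes at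
      a rate of at most \<open>\<bar>h t\<bar> + 1\<close>, which this choice absorbs.\<close>
    define e1 where "e1 = e / (\<bar>h t\<bar> + 1)"
    have e1: "e1 > 0" "e1 * (\<bar>h t\<bar> + 1) = e" using e by (auto simp: e1_def)
    obtain d1 where d1: "d1 > 0" "\<And>s. s \<in> {a..b} \<Longrightarrow> dist s t < d1 \<Longrightarrow> dist (\<beta> s) (\<beta> t) < e1"
      using \<beta> t e1(1) unfolding continuous_on_iff by meson
    obtain d2 where d2: "d2 > 0" "\<And>y. y \<in> {a..b} \<Longrightarrow> norm (y - t) < d2 \<Longrightarrow>
        norm (integral {a..y} (\<lambda>s. \<bar>h s\<bar>) - integral {a..t} (\<lambda>s. \<bar>h s\<bar>) - (y - t) *\<^sub>R \<bar>h t\<bar>) \<le> 1 * norm (y - t)"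
      using P[unfolded has_vector_derivative_def has_derivative_within_alt] zero_less_one by meson
    show "\<exists>d>0. \<forall>y\<in>{a..b}. norm (y - t) < d \<longrightarrow> norm (integral {a..y} r - integral {a..t} r) \<le> e * norm (y - t)"
    proof (intro exI[of _ "min d1 d2"] conjI ballI impI)
      fix y assume y: "y \<in> {a..b}" "norm (y - t) < min d1 d2"
      define l where "l = min y t"
      define m where "m = max y t"
      have lm: "a \<le> l" "l \<le> m" "m \<le> b" using y t by (auto simp: l_def m_def)
      have "norm (integral {l..m} r) \<le> integral {l..m} (\<lambda>s. e1 * \<bar>h s\<bar>)"
      proof (rule Henstock_Kurzweil_Integration.integral_norm_bound_integral)
        show "r integrable_on {l..m}" using sub[OF ri] lm by auto
        show "(\<lambda>s. e1 * \<bar>h s\<bar>) integrable_on {l..m}"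
          using integrable_cmul[OF sub[OF hi(2)], of l m e1] lm by simp
        fix s assume s: "s \<in> {l..m}"
        then have "dist s t < d1" "s \<in> {a..b}" using y t lm by (auto simp: l_def m_def dist_real_def min_def max_def split: if_splits)
        then have \<beta>e: "norm (\<beta> s - \<beta> t) \<le> e1" using d1(2)[of s] by (simp add: dist_norm)
        show "norm (r s) \<le> e1 * \<bar>h s\<bar>" unfolding r_def
          using mult_left_mono[OF \<beta>e, of "\<bar>h s\<bar>"] by (simp add: mult.commute)
      qed
      also have "\<dots> = e1 * integral {l..m} (\<lambda>s. \<bar>h s\<bar>)" by simp
      also have "integral {l..m} (\<lambda>s. \<bar>h s\<bar>) = \<bar>integral {a..y} (\<lambda>s. \<bar>h s\<bar>) - integral {a..t} (\<lambda>s. \<bar>h s\<bar>)\<bar>"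
      proof -
        have "0 \<le> integral {l..m} (\<lambda>s. \<bar>h s\<bar>)" by (rule Henstock_Kurzweil_Integration.integral_nonneg) (use sub[OF hi(2)] lm in auto)
        then show ?thesis using comb[OF hi(2) lm] by (auto simp: l_def m_def min_def max_def split: if_splits)
      qed
      also have "\<bar>integral {a..y} (\<lambda>s. \<bar>h s\<bar>) - integral {a..t} (\<lambda>s. \<bar>h s\<bar>)\<bar> \<le> (\<bar>h t\<bar> + 1) * norm (y - t)"
      proof -
        have "\<bar>x - z * k\<bar> \<le> 1 * \<bar>z\<bar> \<Longrightarrow> 0 \<le> k \<Longrightarrow> \<bar>x\<bar> \<le> (k + 1) * \<bar>z\<bar>" for x z k :: real
        proof -
          assume "\<bar>x - z * k\<bar> \<le> 1 * \<bar>z\<bar>" "0 \<le> k"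
          moreover have "\<bar>x\<bar> \<le> \<bar>x - z * k\<bar> + \<bar>z * k\<bar>" by simp
          ultimately show "\<bar>x\<bar> \<le> (k + 1) * \<bar>z\<bar>" by (simp add: abs_mult algebra_simps)
        qed
        from this[of _ "y - t" "\<bar>h t\<bar>"] show ?thesis using d2(2)[OF y(1)] y(2) by simp
      qed
      finally have "norm (integral {l..m} r) \<le> e1 * ((\<bar>h t\<bar> + 1) * norm (y - t))" using e1 by simp
      also have "\<dots> = e * norm (y - t)" by (simp only: mult.assoc[symmetric] e1)
      finally have "norm (integral {l..m} r) \<le> e * norm (y - t)" .
      moreover have "norm (integral {a..y} r - integral {a..t} r) = norm (integral {l..m} r)"
      proof (cases "y \<le> t")
        case True
        then show ?thesis using comb[OF ri, of y t] y t by (simp add: l_def m_def norm_minus_commute)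
      next
        case False
        then show ?thesis using comb[OF ri, of t y] y t by (simp add: l_def m_def)
      qed
      ultimately show "norm (integral {a..y} r - integral {a..t} r) \<le> e * norm (y - t)" by simp
    qed (use d1 d2 in auto)
  qed
  moreover have "((\<lambda>s. integral {a..s} h *\<^sub>R \<beta> t) has_vector_derivative h t *\<^sub>R \<beta> t) (at t within {a..b})"
    using bounded_linear.has_vector_derivative[OF bounded_linear_scaleR_left H] .
  ultimately have "((\<lambda>s. integral {a..s} r + integral {a..s} h *\<^sub>R \<beta> t) has_vector_derivative 0 + h t *\<^sub>R \<beta> t) (at t within {a..b})"
    by (rule has_vector_derivative_add)
  then have "((\<lambda>s. integral {a..s} r + integral {a..s} h *\<^sub>R \<beta> t) has_vector_derivative h t *\<^sub>R \<beta> t) (at t within {a..b})"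
    by simp
  then show ?thesis
  proof (rule has_vector_derivative_transform[OF t, rotated], goal_cases)
    case (1 s)
    have "((\<lambda>s. h s *\<^sub>R \<beta> t) has_integral integral {a..s} h *\<^sub>R \<beta> t) {a..s}"
      using has_integral_linear[OF integrable_integral[OF sub[OF hi(1) order_refl]] bounded_linear_scaleR_left, of s "\<beta> t"] 1
      by (simp add: o_def)
    moreover have "(r has_integral integral {a..s} r) {a..s}"
      using sub[OF ri order_refl] 1 by (intro integrable_integral) auto
    ultimately have "((\<lambda>s. r s + h s *\<^sub>R \<beta> t) has_integral integral {a..s} r + integral {a..s} h *\<^sub>R \<beta> t) {a..s}"
      by (intro has_integral_add)
    then show ?case by (intro integral_unique) (simp add: r_def algebra_simps)
  qed
qed

section \<open>The control system in charts\<close>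

locale control_system = riemannian A g
  for A :: "('a::{t2_space, second_countable_topology}, 'n::finite) chart set" and g +
  fixes W :: "'a \<Rightarrow> real" and f :: "'m::finite \<Rightarrow> 'a \<Rightarrow> ('a, 'n) tvec" and T :: real
  assumes W: "smooth_fun A W" and f: "\<And>j. smooth_vector_field A (f j)" and T: "T > 0"
begin

text \<open>Right-hand side at zero control of the coordinate equation solved for the derivative of
  the velocity: the Christoffel term has changed sides.\<close>

definition drift :: "('a, 'n) chart \<Rightarrow> (real ^ 'n) \<times> (real ^ 'n) \<Rightarrow> real ^ 'n" where
  "drift c z = - grad_coords W c (fst z) -
     (\<chi> k. \<Sum>i\<in>UNIV. \<Sum>j\<in>UNIV. christoffel A g c (fst z) k i j * snd z $ i * snd z $ j)"

definition ctrl :: "('a, 'n) chart \<Rightarrow> 'm \<Rightarrow> real ^ 'n \<Rightarrow> real ^ 'n" where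
  "ctrl c j x = f j (param c x) c"

definition sys :: "('a, 'n) chart \<Rightarrow> (real ^ 'n) \<times> (real ^ 'n) \<Rightarrow> real ^ 'm \<Rightarrow> (real ^ 'n) \<times> (real ^ 'n)" where
  "sys c z w = (snd z, drift c z + (\<Sum>j\<in>UNIV. (w $ j) *\<^sub>R ctrl c j (fst z)))"

definition phase :: "('a, 'n) chart \<Rightarrow> 'a \<Rightarrow> ('a, 'n) tvec \<Rightarrow> (real ^ 'n) \<times> (real ^ 'n)" where
  "phase c p \<xi> = (coords c p, \<xi> c)"

text \<open>The equation of motion in integrated form, on every time interval that a chart
  accommodates. \<open>V\<close> is an independent argument, not the velocity of \<open>q\<close>,
  because the limit produces positions and velocities separately; \<open>velocity_eq\<close>
  identifies the two afterwards.\<close>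

definition integral_curve :: "(real \<Rightarrow> real ^ 'm) \<Rightarrow> (real \<Rightarrow> 'a) \<Rightarrow> (real \<Rightarrow> ('a, 'n) tvec) \<Rightarrow> bool" where
  "integral_curve u q V \<longleftrightarrow> continuous_on {0..T} q \<and>
     (\<forall>c\<in>A. \<forall>a b. 0 \<le> a \<and> a \<le> b \<and> b \<le> T \<and> q ` {a..b} \<subseteq> chart_dom c \<longrightarrow>
        ((\<lambda>t. sys c (phase c (q t) (V t)) (u t)) has_integral
           (phase c (q b) (V b) - phase c (q a) (V a))) {a..b})"

lemma integral_curveD:
  assumes "integral_curve u q V"
  shows "continuous_on {0..T} q"
    "c \<in> A \<Longrightarrow> 0 \<le> a \<Longrightarrow> a \<le> b \<Longrightarrow> b \<le> T \<Longrightarrow> q ` {a..b} \<subseteq> chart_dom c \<Longrightarrow>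
        ((\<lambda>t. sys c (phase c (q t) (V t)) (u t)) has_integral
           (phase c (q b) (V b) - phase c (q a) (V a))) {a..b}"
  using assms unfolding integral_curve_def by blast+

lemma loc_lipschitz_drift: 
  assumes c: "c \<in> A"
  shows "loc_lipschitz (drift c) (chart_range c \<times> UNIV)"
proof -
  have fst: "loc_lipschitz (\<lambda>z::(real^'n)\<times>(real^'n). F (fst z)) (chart_range c \<times> UNIV)" if "loc_lipschitz F (chart_range c)"
    for F :: "real ^ 'n \<Rightarrow> 'y::real_normed_vector"
    by (rule loc_lipschitz_compose_linear[where h = fst and F = F, OF bounded_linear_fst that]) auto
  have id: "loc_lipschitz (\<lambda>x. x) S" for S :: "'y::real_normed_vector set"
    by (rule loc_lipschitzI) (auto intro!: exI[of _ "1::real"])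
  have snd: "loc_lipschitz (\<lambda>z::(real^'n)\<times>(real^'n). snd z $ i) S" for S i
    by (rule loc_lipschitz_bounded_linear[where F = "\<lambda>z. z" and h = "\<lambda>z. snd z $ i", OF _ id])
      (intro bounded_linear_compose[OF bounded_linear_vec_nth bounded_linear_snd])
  have "loc_lipschitz (\<lambda>z. (\<chi> k. \<Sum>i\<in>UNIV. \<Sum>j\<in>UNIV. christoffel A g c (fst z) k i j * snd z $ i * snd z $ j)) (chart_range c \<times> UNIV)"
    by (rule loc_lipschitz_vec) (simp, intro loc_lipschitz_sum loc_lipschitz_mult fst loc_lipschitz_christoffel c snd)
  then show ?thesis
    unfolding drift_def[abs_def]
    by (intro loc_lipschitz_diff loc_lipschitz_minus fst loc_lipschitz_grad_coords W c)
qed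

lemma smooth_ctrl: "c \<in> A \<Longrightarrow> smooth_on (ctrl c j) (chart_range c)"
  using f[of j] unfolding smooth_vector_field_def ctrl_def[abs_def] by blast

lemma continuous_on_drift: "c \<in> A \<Longrightarrow> continuous_on (chart_range c \<times> UNIV) (drift c)"
  by (rule loc_lipschitz_continuous_on[OF loc_lipschitz_drift])

lemma continuous_on_ctrl: "c \<in> A \<Longrightarrow> continuous_on (chart_range c) (ctrl c j)"
  by (rule smooth_on_continuous_on[OF smooth_ctrl])

text \<open>The coefficients are bounded on a compact set of states and the control enters linearly.
  The resulting speed bound is integrable in time for every square integrable control.\<close>

lemma sys_bound:
  assumes c: "c \<in> A" and C: "compact C" "C \<subseteq> chart_range c \<times> UNIV"
  obtains M where "M > 0" "\<And>z w. z \<in> C \<Longrightarrow> norm (sys c z w) \<le> M * (1 + norm w)"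
proof -
  have bd: "\<exists>B\<ge>0. \<forall>z\<in>C. norm (F z) \<le> B" if "continuous_on C F" for F :: "(real^'n)\<times>(real^'n) \<Rightarrow> 'y::real_normed_vector"
    using compact_imp_bounded[OF compact_continuous_image[OF that C(1)]] unfolding bounded_pos by (meson image_eqI less_imp_le)
  obtain B1 where B1: "B1 \<ge> 0" "\<And>z. z \<in> C \<Longrightarrow> norm (drift c z) \<le> B1"
    using bd[OF continuous_on_subset[OF continuous_on_drift[OF c] C(2)]] by metis
  obtain B2 where B2: "B2 \<ge> 0" "\<And>z. z \<in> C \<Longrightarrow> norm (snd z) \<le> B2"
    using bd[OF continuous_on_snd[OF continuous_on_id]] by (elim exE conjE) (rule that, auto)
  have "\<exists>B\<ge>0. \<forall>z\<in>C. norm (ctrl c j (fst z)) \<le> B" for j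
  proof (rule bd)
    show "continuous_on C (\<lambda>z. ctrl c j (fst z))"
    proof (rule continuous_on_compose2[where g = "ctrl c j" and f = fst, OF continuous_on_ctrl[OF c] continuous_on_fst[OF continuous_on_id]])
      show "fst ` C \<subseteq> chart_range c" using image_mono[OF C(2), of fst] by (simp add: fst_image_times)
    qed
  qed
  then have "\<forall>j. \<exists>B. B \<ge> 0 \<and> (\<forall>z\<in>C. norm (ctrl c j (fst z)) \<le> B)" by simp
  from choice[OF this] obtain B3 where "\<forall>j. B3 j \<ge> 0 \<and> (\<forall>z\<in>C. norm (ctrl c j (fst z)) \<le> B3 j)" ..
  then have B3: "\<And>j. B3 j \<ge> 0" "\<And>j z. z \<in> C \<Longrightarrow> norm (ctrl c j (fst z)) \<le> B3 j" by simp_all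
  define S where "S = (\<Sum>j\<in>UNIV. B3 j)"
  have S: "S \<ge> 0" unfolding S_def by (rule sum_nonneg) (use B3 in auto)
  show thesis
  proof (rule that[of "B1 + B2 + S + 1"])
    show "B1 + B2 + S + 1 > 0" using B1 B2 S by simp
    fix z w assume z: "z \<in> C"
    have "norm (\<Sum>j\<in>UNIV. (w $ j) *\<^sub>R ctrl c j (fst z)) \<le> (\<Sum>j\<in>UNIV. norm w * B3 j)"
      by (rule sum_norm_le) (auto intro!: mult_mono B3 z component_le_norm_cart)
    also have "\<dots> = S * norm w" by (simp add: S_def sum_distrib_left mult.commute)
    finally have "norm (sys c z w) \<le> B2 + (B1 + S * norm w)"
      unfolding sys_def
      by (intro order_trans[OF norm_Pair_le] add_mono order_trans[OF norm_triangle_ineq] B1 B2 z)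
    also have "\<dots> \<le> (B1 + B2 + S + 1) * (1 + norm w)"
      using B1(1) B2(1) S by (simp add: algebra_simps)
    finally show "norm (sys c z w) \<le> (B1 + B2 + S + 1) * (1 + norm w)" .
  qed
qed

text \<open>The Lipschitz constant in the state grows with the control. Along a control it is thus
  unbounded in general, but integrable in time, and uniqueness relies on that.\<close>

lemma sys_lipschitz:
  assumes c: "c \<in> A" and z0: "fst z0 \<in> chart_range c"
  obtains r L where "r > 0" "L > 0" "ball z0 r \<subseteq> chart_range c \<times> UNIV"
    "\<And>y z w. y \<in> ball z0 r \<Longrightarrow> z \<in> ball z0 r \<Longrightarrow> norm (sys c y w - sys c z w) \<le> L * (1 + norm w) * norm (y - z)"
proof -
  have z0': "z0 \<in> chart_range c \<times> UNIV" using z0 by (cases z0) auto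
  have op: "open (chart_range c \<times> (UNIV :: (real^'n) set))" by (intro open_Times open_chart_range c) auto
  obtain r0 where r0: "r0 > 0" "ball z0 r0 \<subseteq> chart_range c \<times> UNIV"
    using op z0' open_contains_ball by blast
  obtain r1 L1 where 1: "r1 > 0" "L1 \<ge> 0" "\<And>y z. y \<in> ball z0 r1 \<Longrightarrow> y \<in> chart_range c \<times> UNIV \<Longrightarrow> z \<in> ball z0 r1 \<Longrightarrow>
      z \<in> chart_range c \<times> UNIV \<Longrightarrow> dist (drift c y) (drift c z) \<le> L1 * dist y z"
    by (rule loc_lipschitzE[OF loc_lipschitz_drift[OF c] z0']) (rule that)
  \<comment> \<open>Radius and constant are packed into a pair so that a single choice over
    \<open>j\<close> provides both.\<close>
  have "\<forall>j. \<exists>rL. fst rL > 0 \<and> snd rL \<ge> 0 \<and> (\<forall>y\<in>ball z0 (fst rL). \<forall>z\<in>ball z0 (fst rL). y \<in> chart_range c \<times> UNIV \<longrightarrow> z \<in> chart_range c \<times> UNIV \<longrightarrow>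
       dist (ctrl c j (fst y)) (ctrl c j (fst z)) \<le> snd rL * dist y z)"
  proof
    fix j
    have l: "loc_lipschitz (\<lambda>z::(real^'n)\<times>(real^'n). ctrl c j (fst z)) (chart_range c \<times> UNIV)"
      by (rule loc_lipschitz_compose_linear[where h = fst and F = "ctrl c j", OF bounded_linear_fst smooth_on_loc_lipschitz[OF smooth_ctrl[OF c] open_chart_range[OF c]]]) auto
    obtain r L where rL: "r > 0" "L \<ge> 0" "\<And>y z. y \<in> ball z0 r \<Longrightarrow> y \<in> chart_range c \<times> UNIV \<Longrightarrow> z \<in> ball z0 r \<Longrightarrow>
      z \<in> chart_range c \<times> UNIV \<Longrightarrow> dist (ctrl c j (fst y)) (ctrl c j (fst z)) \<le> L * dist y z"
      by (rule loc_lipschitzE[OF l z0']) (rule that)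
    show "\<exists>rL. fst rL > 0 \<and> snd rL \<ge> 0 \<and> (\<forall>y\<in>ball z0 (fst rL). \<forall>z\<in>ball z0 (fst rL). y \<in> chart_range c \<times> UNIV \<longrightarrow> z \<in> chart_range c \<times> UNIV \<longrightarrow>
       dist (ctrl c j (fst y)) (ctrl c j (fst z)) \<le> snd rL * dist y z)"
      by (rule exI[of _ "(r, L)"], unfold fst_conv snd_conv, intro conjI ballI impI rL)
  qed
  from choice[OF this] obtain rL where rL: "\<forall>j. fst (rL j) > 0 \<and> snd (rL j) \<ge> 0 \<and> (\<forall>y\<in>ball z0 (fst (rL j)). \<forall>z\<in>ball z0 (fst (rL j)). y \<in> chart_range c \<times> UNIV \<longrightarrow> z \<in> chart_range c \<times> UNIV \<longrightarrow>
       dist (ctrl c j (fst y)) (ctrl c j (fst z)) \<le> snd (rL j) * dist y z)" ..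
  define r2 where "r2 j = fst (rL j)" for j
  define L2 where "L2 j = snd (rL j)" for j
  have 2: "r2 j > 0" "L2 j \<ge> 0" "y \<in> ball z0 (r2 j) \<Longrightarrow> z \<in> ball z0 (r2 j) \<Longrightarrow>
       y \<in> chart_range c \<times> UNIV \<Longrightarrow> z \<in> chart_range c \<times> UNIV \<Longrightarrow> dist (ctrl c j (fst y)) (ctrl c j (fst z)) \<le> L2 j * dist y z" for j y z
    using rL[rule_format, of j] by (simp_all only: r2_def L2_def)
  define S where "S = (\<Sum>j\<in>UNIV. L2 j)"
  have S: "S \<ge> 0" unfolding S_def by (rule sum_nonneg) (use 2 in auto)
  define r where "r = Min (insert r0 (insert r1 (range r2)))"
  have fin: "finite (insert r0 (insert r1 (range r2)))" by simp
  have rle: "r \<le> x" if "x \<in> insert r0 (insert r1 (range r2))" for x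
    unfolding r_def by (rule Min_le[OF fin that])
  have "r > 0" unfolding r_def using r0(1) 1(1) 2(1) by (subst Min_gr_iff[OF fin]) auto
  then have r: "r > 0" "r \<le> r0" "r \<le> r1" "\<And>j. r \<le> r2 j" by (auto intro: rle)
  show thesis
  proof (rule that[of r "1 + L1 + S"])
    show "r > 0" by fact
    show "1 + L1 + S > 0" using 1 S by simp
    show bs: "ball z0 r \<subseteq> chart_range c \<times> UNIV" by (rule subset_trans[OF subset_ball[OF r(2)] r0(2)])
    fix y z w assume y: "y \<in> ball z0 r" and z: "z \<in> ball z0 r"
    have yz: "y \<in> chart_range c \<times> UNIV" "z \<in> chart_range c \<times> UNIV" using bs y z by blast+
    have d: "norm (drift c y - drift c z) \<le> L1 * norm (y - z)"
      using 1(3)[of y z] y z yz r by (auto simp: dist_norm)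
    have k: "norm (ctrl c j (fst y) - ctrl c j (fst z)) \<le> L2 j * norm (y - z)" for j
      using 2(3)[of y j z] r(4)[of j] y z yz by (auto simp: dist_norm)
    have "norm (\<Sum>j\<in>UNIV. (w $ j) *\<^sub>R (ctrl c j (fst y) - ctrl c j (fst z))) \<le> (\<Sum>j\<in>UNIV. norm w * (L2 j * norm (y - z)))"
      by (rule sum_norm_le) (auto intro!: mult_mono k component_le_norm_cart)
    also have "\<dots> = S * norm w * norm (y - z)" by (simp add: S_def sum_distrib_left sum_distrib_right mult_ac)
    finally have s: "norm (\<Sum>j\<in>UNIV. (w $ j) *\<^sub>R (ctrl c j (fst y) - ctrl c j (fst z))) \<le> S * norm w * norm (y - z)" .
    have "sys c y w - sys c z w = (snd (y - z), (drift c y - drift c z) + (\<Sum>j\<in>UNIV. (w $ j) *\<^sub>R (ctrl c j (fst y) - ctrl c j (fst z))))"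
      by (simp add: sys_def scaleR_diff_right sum_subtractf)
    moreover have "norm (snd (y - z)) \<le> norm (y - z)" by (metis norm_snd_le prod.collapse)
    ultimately have "norm (sys c y w - sys c z w) \<le> norm (y - z) + (L1 * norm (y - z) + S * norm w * norm (y - z))"
      by (simp only:) (intro order_trans[OF norm_Pair_le] add_mono order_trans[OF norm_triangle_ineq] d s)
    also have "\<dots> = (1 + L1 + S * norm w) * norm (y - z)" by (simp add: algebra_simps)
    also have "\<dots> \<le> (1 + L1 + S) * (1 + norm w) * norm (y - z)"
      using 1(2) S by (intro mult_right_mono) (simp_all add: algebra_simps)
    finally show "norm (sys c y w - sys c z w) \<le> (1 + L1 + S) * (1 + norm w) * norm (y - z)" .
  qed
qed

section \<open>Equivalence of the differential and the integrated equation\<close>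

lemma trajectory_imp_integral_curve:
  assumes tr: "is_trajectory A g W f T q0 v0 u q"
  shows "integral_curve u q (velocity A {0..T} q)"
proof -
  let ?v = "velocity A {0..T} q"
  from tr have q: "continuous_on {0..T} q"
    and dq: "\<And>t c. t\<in>{0..T} \<Longrightarrow> c\<in>A \<Longrightarrow> q t \<in> chart_dom c \<Longrightarrow> (coords c \<circ> q) differentiable (at t within {0..T})"
    and ac: "\<And>c a b. c \<in> A \<Longrightarrow> 0 \<le> a \<Longrightarrow> a \<le> b \<Longrightarrow> b \<le> T \<Longrightarrow> q ` {a..b} \<subseteq> chart_dom c \<Longrightarrow> absolutely_continuous_on {a..b} (\<lambda>t. ?v t c)"
    and ae: "AE t in lebesgue_on {0..T}. has_covariant_derivative A g {0..T} q ?v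
            (\<lambda>c. - grad A g W (q t) c + (\<Sum>j\<in>UNIV. (u t $ j) *\<^sub>R f j (q t) c)) t"
    unfolding is_trajectory_def Let_def by blast+
  obtain N where N: "negligible N" "\<And>t. t \<in> {0..T} - N \<Longrightarrow> has_covariant_derivative A g {0..T} q ?v
            (\<lambda>c. - grad A g W (q t) c + (\<Sum>j\<in>UNIV. (u t $ j) *\<^sub>R f j (q t) c)) t"
    using ae unfolding AE_lebesgue_on_iff by blast
  show ?thesis unfolding integral_curve_def
  proof (intro conjI ballI allI impI q)
    fix c a b assume c: "c \<in> A" and "0 \<le> a \<and> a \<le> b \<and> b \<le> T \<and> q ` {a..b} \<subseteq> chart_dom c"
    then have ab: "0 \<le> a" "a \<le> b" "b \<le> T" and qc: "\<And>t. t \<in> {a..b} \<Longrightarrow> q t \<in> chart_dom c" "q ` {a..b} \<subseteq> chart_dom c" by auto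
    have sub: "{a..b} \<subseteq> {0..T}" using ab by auto
    \<comment> \<open>Positions are differentiable at every time, so the classical fundamental
      theorem applies.\<close>
    have "((\<lambda>t. ?v t c) has_integral (coords c \<circ> q) b - (coords c \<circ> q) a) {a..b}"
    proof (rule fundamental_theorem_of_calculus[OF ab(2)])
      fix t assume t: "t \<in> {a..b}"
      then have "((coords c \<circ> q) has_vector_derivative ?v t c) (at t within {0..T})"
        using dq[of t c] qc(1)[of t] c sub unfolding velocity_def by (auto simp: vector_derivative_works)
      then show "((coords c \<circ> q) has_vector_derivative ?v t c) (at t within {a..b})"
        by (rule has_vector_derivative_within_subset[OF _ sub])
    qed
    \<comment> \<open>The derivative of the velocity is available only off a null set; absolute
      continuity makes up for it.\<close>
    moreover have "((\<lambda>t. snd (sys c (phase c (q t) (?v t)) (u t))) has_integral (?v b c - ?v a c)) {a..b}"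
    proof (rule absolutely_continuous_has_integral[OF ac[OF c ab qc(2)] ab(2) N(1)])
      fix t assume t: "t \<in> {a..b} - N"
      then have qt: "q t \<in> chart_dom c" using qc by auto
      have "t \<in> {0..T} - N" using t sub by auto
      from N(2)[OF this] c qt obtain D where D: "((\<lambda>s. ?v s c) has_vector_derivative D) (at t within {0..T})"
        "- grad A g W (q t) c + (\<Sum>j\<in>UNIV. (u t $ j) *\<^sub>R f j (q t) c) = D + (\<chi> k. \<Sum>i\<in>UNIV. \<Sum>j\<in>UNIV.
                christoffel A g c (coords c (q t)) k i j * ?v t c $ i * ?v t c $ j)"
        unfolding has_covariant_derivative_def by blast
      have "D = snd (sys c (phase c (q t) (?v t)) (u t))"
        using D(2) c qt by (simp add: sys_def drift_def phase_def ctrl_def grad_eq_lift[OF W c qt] param_coords algebra_simps)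
      then show "((\<lambda>s. ?v s c) has_vector_derivative snd (sys c (phase c (q t) (?v t)) (u t))) (at t within {a..b})"
        using has_vector_derivative_within_subset[OF D(1) sub] by simp
    qed
    ultimately show "((\<lambda>t. sys c (phase c (q t) (?v t)) (u t)) has_integral (phase c (q b) (?v b) - phase c (q a) (?v a))) {a..b}"
      by (simp add: phase_def sys_def has_integral_Pair)
  qed
qed

text \<open>A neighbourhood relative to \<open>{0..T}\<close>, one-sided at the end points. The
  equality of filters lets derivatives computed on the small interval be read on the whole
  one.\<close>

lemma chart_neighbourhood:
  assumes q: "continuous_on {0..T} q" and t: "t \<in> {0..T}" and U: "open U" "q t \<in> U"
  obtains a b where "0 \<le> a" "a \<le> t" "t \<le> b" "b \<le> T" "a < b" "q ` {a..b} \<subseteq> U"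
    "at t within {a..b} = at t within {0..T}" "0 < t \<Longrightarrow> a < t" "t < T \<Longrightarrow> t < b"
proof -
  obtain B where B: "open B" "t \<in> B" "\<forall>y\<in>{0..T}. y \<in> B \<longrightarrow> q y \<in> U"
    using q[unfolded continuous_on_topological, rule_format, OF t U] by (elim exE conjE) (rule that)
  obtain e where e: "e > 0" "ball t e \<subseteq> B" using B(1,2) by (rule openE)
  define a where "a = max 0 (t - e/2)"
  define b where "b = min T (t + e/2)"
  show thesis
  proof (rule that[of a b])
    show "0 \<le> a" "a \<le> t" "t \<le> b" "b \<le> T" "a < b" "0 < t \<Longrightarrow> a < t" "t < T \<Longrightarrow> t < b"
      using t e T by (auto simp: a_def b_def)
    show "q ` {a..b} \<subseteq> U"
    proof
      fix p assume "p \<in> q ` {a..b}"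
      then obtain s where s: "s \<in> {a..b}" "p = q s" by auto
      then have "s \<in> ball t e" "s \<in> {0..T}" using e(1) t by (auto simp: a_def b_def dist_real_def)
      then show "p \<in> U" using B(3) e(2) s(2) by auto
    qed
    show "at t within {a..b} = at t within {0..T}"
    proof (rule at_within_nhd[of t "ball t (e/2)"])
      show "{a..b} \<inter> ball t (e/2) - {t} = {0..T} \<inter> ball t (e/2) - {t}"
        using t by (auto simp: a_def b_def dist_real_def abs_if split: if_splits)
    qed (use e in auto)
  qed
qed

lemma phase_diff:
  assumes ic: "integral_curve u q V" and c: "c \<in> A" and ab: "0 \<le> a" "a \<le> b" "b \<le> T" "q ` {a..b} \<subseteq> chart_dom c"
    and st: "a \<le> s" "s \<le> t" "t \<le> b"
  shows "((\<lambda>t. sys c (phase c (q t) (V t)) (u t)) has_integral (phase c (q t) (V t) - phase c (q s) (V s))) {s..t}"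
proof (rule integral_curveD(2)[OF ic c])
  show "q ` {s..t} \<subseteq> chart_dom c" using ab(4) st by (auto simp: image_subset_iff)
qed (use ab st in auto)

lemma phase_continuous:
  assumes ic: "integral_curve u q V" and c: "c \<in> A" and ab: "0 \<le> a" "a \<le> b" "b \<le> T" "q ` {a..b} \<subseteq> chart_dom c"
  shows "continuous_on {a..b} (\<lambda>t. phase c (q t) (V t))"
proof -
  let ?h = "\<lambda>t. sys c (phase c (q t) (V t)) (u t)"
  have "?h integrable_on {a..b}"
    using phase_diff[OF ic c ab order_refl ab(2) order_refl] by (rule has_integral_integrable)
  then have "continuous_on {a..b} (\<lambda>t. phase c (q a) (V a) + integral {a..t} ?h)"
    by (intro continuous_on_add continuous_on_const indefinite_integral_continuous_1)
  moreover have "phase c (q a) (V a) + integral {a..t} ?h = phase c (q t) (V t)" if "t \<in> {a..b}" for t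
  proof -
    have "(?h has_integral (phase c (q t) (V t) - phase c (q a) (V a))) {a..t}"
      by (rule phase_diff[OF ic c ab]) (use that in auto)
    from integral_unique[OF this] show ?thesis by simp
  qed
  ultimately show ?thesis by (rule continuous_on_eq)
qed

lemma phase_modulus:
  assumes ic: "integral_curve u q V" and u: "u square_integrable_on {0..T}" and c: "c \<in> A"
    and ab: "0 \<le> a" "a \<le> b" "b \<le> T" "q ` {a..b} \<subseteq> chart_dom c"
    and M: "\<And>t. t \<in> {a..b} \<Longrightarrow> norm (sys c (phase c (q t) (V t)) (u t)) \<le> M * (1 + norm (u t))"
  shows "norm (phase c (q b) (V b) - phase c (q a) (V a)) \<le> M * integral {a..b} (\<lambda>t. 1 + norm (u t))"
proof -
  note hi = phase_diff[OF ic c ab order_refl ab(2) order_refl]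
  have ui: "(\<lambda>t. 1 + norm (u t)) integrable_on {a..b}"
    by (rule integrable_on_subinterval[OF square_integrable_absolutely(4)[OF u]]) (use ab in auto)
  have "norm (integral {a..b} (\<lambda>t. sys c (phase c (q t) (V t)) (u t))) \<le> integral {a..b} (\<lambda>t. M * (1 + norm (u t)))"
  proof (rule Henstock_Kurzweil_Integration.integral_norm_bound_integral)
    show "(\<lambda>t. M * (1 + norm (u t))) integrable_on {a..b}" using integrable_cmul[OF ui, of M] by simp
  qed (use hi M in \<open>auto intro: has_integral_integrable\<close>)
  then show ?thesis using integral_unique[OF hi] by simp
qed

text \<open>Continuity of the state in the tangent bundle, phrased in one chart.\<close>

lemma phase_near:
  assumes ic: "integral_curve u q V" and c: "c \<in> A" and t: "t \<in> {0..T}" "q t \<in> chart_dom c"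
    and B: "open B" "phase c (q t) (V t) \<in> B"
  obtains e where "e > 0" "\<And>s. s \<in> {0..T} \<Longrightarrow> \<bar>s - t\<bar> < e \<Longrightarrow> q s \<in> chart_dom c \<and> phase c (q s) (V s) \<in> B"
proof -
  obtain a b where ab: "0 \<le> a" "a \<le> t" "t \<le> b" "b \<le> T" "a < b" "q ` {a..b} \<subseteq> chart_dom c"
    "at t within {a..b} = at t within {0..T}" "0 < t \<Longrightarrow> a < t" "t < T \<Longrightarrow> t < b"
    by (rule chart_neighbourhood[OF integral_curveD(1)[OF ic] t(1) open_chart_dom[OF c] t(2)]) (rule that)
  have tab: "t \<in> {a..b}" using ab by auto
  have pc: "continuous_on {a..b} (\<lambda>t. phase c (q t) (V t))"
    by (rule phase_continuous[OF ic c]) (use ab in auto)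
  obtain U where U: "open U" "t \<in> U" "\<forall>y\<in>{a..b}. y \<in> U \<longrightarrow> phase c (q y) (V y) \<in> B"
    using pc[unfolded continuous_on_topological, rule_format, OF tab B] by (elim exE conjE) (rule that)
  obtain e where e: "e > 0" "ball t e \<subseteq> U" using U(1,2) by (rule openE)
  define e' where "e' = min e (min (if 0 < t then t - a else 1) (if t < T then b - t else 1))"
  show thesis
  proof (rule that[of e'])
    show "e' > 0" using e ab(8,9) by (auto simp: e'_def)
    fix s assume s: "s \<in> {0..T}" "\<bar>s - t\<bar> < e'"
    have "s \<in> {a..b}" using s ab(1-4) t by (auto simp: e'_def abs_if split: if_splits)
    moreover have "s \<in> U" using s e by (auto simp: e'_def dist_real_def subset_iff)
    ultimately show "q s \<in> chart_dom c \<and> phase c (q s) (V s) \<in> B" using U(3) ab(6) by auto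
  qed
qed

text \<open>The first component of the integrated equation writes the coordinates of
  \<open>q\<close> as a primitive of a continuous function, so the derivative exists at every time
  and not just almost everywhere.\<close>

lemma integral_curve_velocity:
  assumes ic: "integral_curve u q V" and t: "t \<in> {0..T}" and c: "c \<in> A" "q t \<in> chart_dom c"
  shows "((coords c \<circ> q) has_vector_derivative V t c) (at t within {0..T})"
proof -
  obtain a b where ab: "0 \<le> a" "a \<le> t" "t \<le> b" "b \<le> T" "a < b" "q ` {a..b} \<subseteq> chart_dom c"
    "at t within {a..b} = at t within {0..T}" "0 < t \<Longrightarrow> a < t" "t < T \<Longrightarrow> t < b"
    by (rule chart_neighbourhood[OF integral_curveD(1)[OF ic] t open_chart_dom[OF c(1)] c(2)]) (rule that)
  have tab: "t \<in> {a..b}" using ab by auto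
  have "continuous_on {a..b} (\<lambda>s. snd (phase c (q s) (V s)))"
    by (intro continuous_on_snd phase_continuous[OF ic c(1)]) (use ab in auto)
  then have "continuous_on {a..b} (\<lambda>s. V s c)" by (simp add: phase_def)
  then have "((\<lambda>s. integral {a..s} (\<lambda>s. V s c)) has_vector_derivative V t c) (at t within {a..b})"
    by (rule integral_has_vector_derivative) (rule tab)
  then have "((\<lambda>s. coords c (q a) + integral {a..s} (\<lambda>s. V s c)) has_vector_derivative 0 + V t c) (at t within {a..b})"
    by (intro has_vector_derivative_add has_vector_derivative_const)
  then have "((\<lambda>s. coords c (q a) + integral {a..s} (\<lambda>s. V s c)) has_vector_derivative V t c) (at t within {a..b})"
    by simp
  then have "((coords c \<circ> q) has_vector_derivative V t c) (at t within {a..b})"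
  proof (rule has_vector_derivative_transform[OF tab, rotated])
    fix s assume s: "s \<in> {a..b}"
    have "((\<lambda>t. sys c (phase c (q t) (V t)) (u t)) has_integral (phase c (q s) (V s) - phase c (q a) (V a))) {a..s}"
      by (rule phase_diff[OF ic c(1) ab(1) less_imp_le[OF ab(5)] ab(4,6)]) (use s in auto)
    then have "((\<lambda>t. V t c) has_integral (coords c (q s) - coords c (q a))) {a..s}"
      by (simp add: phase_def sys_def has_integral_Pair)
    from integral_unique[OF this] show "(coords c \<circ> q) s = coords c (q a) + integral {a..s} (\<lambda>s. V s c)" by simp
  qed
  then show ?thesis by (simp only: ab(7))
qed

text \<open>Where a chart applies, the derivative within an interval is unique, also at its end
  points. Elsewhere \<open>velocity\<close> is 0 by convention, and \<open>out\<close> imposes the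
  same convention on \<open>V\<close>.\<close>

lemma velocity_eq:
  assumes ic: "integral_curve u q V" and t: "t \<in> {0..T}"
    and out: "\<And>c. c \<notin> A \<or> q t \<notin> chart_dom c \<Longrightarrow> V t c = 0"
  shows "velocity A {0..T} q t = V t"
proof
  fix c
  show "velocity A {0..T} q t c = V t c"
  proof (cases "c \<in> A \<and> q t \<in> chart_dom c")
    case True
    then have "vector_derivative (coords c \<circ> q) (at t within {0..T}) = V t c"
      using integral_curve_velocity[OF ic t] T t
      by (intro vector_derivative_within_closed_interval) auto
    then show ?thesis using True by (simp add: velocity_def)
  next
    case False
    then show ?thesis using out[of c] by (auto simp: velocity_def)
  qed
qed

text \<open>One null set that depends neither on a chart nor on a curve. The covariant derivative
  has to exist in all charts at the same time, and one null set per chart would not do for an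
  uncountable atlas.\<close>

lemma control_lebesgue_points:
  fixes u :: "real \<Rightarrow> real ^ 'm"
  assumes u: "u square_integrable_on {0..T}"
  obtains N where "negligible N" "\<And>t j. t \<in> {0..T} - N \<Longrightarrow>
      ((\<lambda>s. integral {0..s} (\<lambda>s. u s $ j)) has_vector_derivative u t $ j) (at t within {0..T}) \<and>
      ((\<lambda>s. integral {0..s} (\<lambda>s. \<bar>u s $ j\<bar>)) has_vector_derivative \<bar>u t $ j\<bar>) (at t within {0..T})"
proof -
  have "\<forall>j. \<exists>N. negligible N \<and> (\<forall>t\<in>{0..T} - N.
      ((\<lambda>s. integral {0..s} (\<lambda>s. u s $ j)) has_vector_derivative u t $ j) (at t within {0..T}) \<and>
      ((\<lambda>s. integral {0..s} (\<lambda>s. \<bar>u s $ j\<bar>)) has_vector_derivative \<bar>u t $ j\<bar>) (at t within {0..T}))"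
  proof
    fix j
    have ai: "(\<lambda>s. u s $ j) absolutely_integrable_on {0..T}"
      using absolutely_integrable_linear[OF square_integrable_absolutely(1)[OF u] bounded_linear_vec_nth] by (simp add: o_def)
    note i = set_lebesgue_integral_eq_integral(1)[OF ai] set_lebesgue_integral_eq_integral(1)[OF set_integrable_abs[OF ai]]
    obtain N1 where N1: "negligible N1" "\<And>t. t \<in> {0..T} - N1 \<Longrightarrow>
      ((\<lambda>s. integral {0..s} (\<lambda>s. u s $ j)) has_vector_derivative u t $ j) (at t within {0..T})"
      by (rule lebesgue_differentiation[OF i(1)]) (rule that)
    obtain N2 where N2: "negligible N2" "\<And>t. t \<in> {0..T} - N2 \<Longrightarrow>
      ((\<lambda>s. integral {0..s} (\<lambda>s. \<bar>u s $ j\<bar>)) has_vector_derivative \<bar>u t $ j\<bar>) (at t within {0..T})"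
      by (rule lebesgue_differentiation[OF i(2)]) (rule that)
    show "\<exists>N. negligible N \<and> (\<forall>t\<in>{0..T} - N.
      ((\<lambda>s. integral {0..s} (\<lambda>s. u s $ j)) has_vector_derivative u t $ j) (at t within {0..T}) \<and>
      ((\<lambda>s. integral {0..s} (\<lambda>s. \<bar>u s $ j\<bar>)) has_vector_derivative \<bar>u t $ j\<bar>) (at t within {0..T}))"
      by (rule exI[of _ "N1 \<union> N2"]) (use N1 N2 in auto)
  qed
  from choice[OF this] obtain N where N: "\<forall>j. negligible (N j) \<and> (\<forall>t\<in>{0..T} - N j.
      ((\<lambda>s. integral {0..s} (\<lambda>s. u s $ j)) has_vector_derivative u t $ j) (at t within {0..T}) \<and>
      ((\<lambda>s. integral {0..s} (\<lambda>s. \<bar>u s $ j\<bar>)) has_vector_derivative \<bar>u t $ j\<bar>) (at t within {0..T}))" ..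
  show thesis
  proof (rule that[of "\<Union>j. N j"])
    show "negligible (\<Union>j. N j)" by (rule negligible_Union) (use N in auto)
    fix t j assume "t \<in> {0..T} - (\<Union>j. N j)"
    then have "t \<in> {0..T} - N j" by auto
    then show "((\<lambda>s. integral {0..s} (\<lambda>s. u s $ j)) has_vector_derivative u t $ j) (at t within {0..T}) \<and>
      ((\<lambda>s. integral {0..s} (\<lambda>s. \<bar>u s $ j\<bar>)) has_vector_derivative \<bar>u t $ j\<bar>) (at t within {0..T})"
      using N[rule_format, of j] by simp
  qed
qed

text \<open>Along the curve the drift is continuous, and each control term is a component of
  \<open>u\<close>, at one of its Lebesgue points, times a continuous factor. Hence the primitive
  that represents \<open>V\<close> is differentiable at this very \<open>t\<close>.\<close>

lemma integral_curve_acceleration: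
  assumes ic: "integral_curve u q V" and u: "u square_integrable_on {0..T}"
    and t: "t \<in> {0..T}" and c: "c \<in> A" "q t \<in> chart_dom c"
    and L: "\<And>j. ((\<lambda>s. integral {0..s} (\<lambda>s. u s $ j)) has_vector_derivative u t $ j) (at t within {0..T}) \<and>
      ((\<lambda>s. integral {0..s} (\<lambda>s. \<bar>u s $ j\<bar>)) has_vector_derivative \<bar>u t $ j\<bar>) (at t within {0..T})"
  shows "((\<lambda>s. V s c) has_vector_derivative snd (sys c (phase c (q t) (V t)) (u t))) (at t within {0..T})"
proof -
  obtain a b where ab: "0 \<le> a" "a \<le> t" "t \<le> b" "b \<le> T" "a < b" "q ` {a..b} \<subseteq> chart_dom c"
    "at t within {a..b} = at t within {0..T}" "0 < t \<Longrightarrow> a < t" "t < T \<Longrightarrow> t < b"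
    by (rule chart_neighbourhood[OF integral_curveD(1)[OF ic] t open_chart_dom[OF c(1)] c(2)]) (rule that)
  have tab: "t \<in> {a..b}" and sub: "{a..b} \<subseteq> {0..T}" using ab by auto
  define z where "z s = phase c (q s) (V s)" for s
  have zc: "continuous_on {a..b} z" unfolding z_def
    by (rule phase_continuous[OF ic c(1)]) (use ab in auto)
  have zr: "z s \<in> chart_range c \<times> UNIV" if "s \<in> {a..b}" for s
  proof -
    have "q s \<in> chart_dom c" using ab(6) that by blast
    from coords_in_range[OF c(1) this] show ?thesis by (simp add: z_def phase_def)
  qed
  have dc: "continuous_on {a..b} (\<lambda>s. drift c (z s))"
    by (rule continuous_on_compose2[where g = "drift c" and f = z, OF continuous_on_drift[OF c(1)] zc]) (use zr in blast)
  have kc: "continuous_on {a..b} (\<lambda>s. ctrl c j (fst (z s)))" for j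
  proof (rule continuous_on_compose2[where g = "ctrl c j" and f = "\<lambda>s. fst (z s)", OF continuous_on_ctrl[OF c(1)] continuous_on_fst[OF zc]])
    show "(\<lambda>s. fst (z s)) ` {a..b} \<subseteq> chart_range c" using zr by (auto simp: mem_Times_iff)
  qed
  have ai: "(\<lambda>s. u s $ j) absolutely_integrable_on {0..T}" for j
    using absolutely_integrable_linear[OF square_integrable_absolutely(1)[OF u] bounded_linear_vec_nth] by (simp add: o_def)
  have ai': "(\<lambda>s. u s $ j) absolutely_integrable_on {a..b}" for j
    by (rule absolutely_integrable_on_subinterval[OF ai sub])
  \<comment> \<open>The hypotheses on \<open>u\<close> concern primitives starting at 0, while the
    chart interval starts at \<open>a\<close>; the two primitives differ by a constant.\<close>
  have shift: "((\<lambda>s. integral {a..s} h) has_vector_derivative D) (at t within {a..b})"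
    if D: "((\<lambda>s. integral {0..s} h) has_vector_derivative D) (at t within {0..T})" and h: "h integrable_on {0..T}"
    for h :: "real \<Rightarrow> real" and D
  proof -
    have "((\<lambda>s. integral {0..s} h - integral {0..a} h) has_vector_derivative D - 0) (at t within {a..b})"
      by (intro has_vector_derivative_diff has_vector_derivative_const has_vector_derivative_within_subset[OF D sub])
    then have "((\<lambda>s. integral {0..s} h - integral {0..a} h) has_vector_derivative D) (at t within {a..b})" by simp
    then show ?thesis
    proof (rule has_vector_derivative_transform[OF tab, rotated])
      fix s assume s: "s \<in> {a..b}"
      have "integral {0..a} h + integral {a..s} h = integral {0..s} h"
        by (rule Henstock_Kurzweil_Integration.integral_combine) (use s ab in \<open>auto intro: integrable_on_subinterval[OF h]\<close>)
      then show "integral {a..s} h = integral {0..s} h - integral {0..a} h" by simp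
    qed
  qed
  have kd: "((\<lambda>s. integral {a..s} (\<lambda>s. (u s $ j) *\<^sub>R ctrl c j (fst (z s)))) has_vector_derivative (u t $ j) *\<^sub>R ctrl c j (fst (z t))) (at t within {a..b})" for j
  proof (rule integral_mult_continuous_has_vector_derivative[OF ai' kc tab])
    show "((\<lambda>s. integral {a..s} (\<lambda>s. u s $ j)) has_vector_derivative u t $ j) (at t within {a..b})"
      by (rule shift[OF conjunct1[OF L]]) (use ai[of j] in \<open>simp add: absolutely_integrable_on_def\<close>)
    show "((\<lambda>s. integral {a..s} (\<lambda>s. \<bar>u s $ j\<bar>)) has_vector_derivative \<bar>u t $ j\<bar>) (at t within {a..b})"
      by (rule shift[OF conjunct2[OF L]]) (use ai[of j] in \<open>simp add: absolutely_integrable_on_def\<close>)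
  qed
  have dd: "((\<lambda>s. integral {a..s} (\<lambda>s. drift c (z s))) has_vector_derivative drift c (z t)) (at t within {a..b})"
    by (rule integral_has_vector_derivative[OF dc tab])
  have "((\<lambda>s. V a c + (integral {a..s} (\<lambda>s. drift c (z s)) + (\<Sum>j\<in>UNIV. integral {a..s} (\<lambda>s. (u s $ j) *\<^sub>R ctrl c j (fst (z s))))))
      has_vector_derivative 0 + (drift c (z t) + (\<Sum>j\<in>UNIV. (u t $ j) *\<^sub>R ctrl c j (fst (z t))))) (at t within {a..b})"
    by (intro has_vector_derivative_add has_vector_derivative_const dd has_vector_derivative_sum kd)
  then have "((\<lambda>s. V a c + (integral {a..s} (\<lambda>s. drift c (z s)) + (\<Sum>j\<in>UNIV. integral {a..s} (\<lambda>s. (u s $ j) *\<^sub>R ctrl c j (fst (z s))))))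
      has_vector_derivative snd (sys c (z t) (u t))) (at t within {a..b})"
    by (simp add: sys_def)
  then have "((\<lambda>s. V s c) has_vector_derivative snd (sys c (z t) (u t))) (at t within {a..b})"
  proof (rule has_vector_derivative_transform[OF tab, rotated])
    fix s assume s: "s \<in> {a..b}"
    have sb: "{a..s} \<subseteq> {a..b}" using s by auto
    have 1: "((\<lambda>s. drift c (z s)) has_integral integral {a..s} (\<lambda>s. drift c (z s))) {a..s}"
      by (intro integrable_integral integrable_continuous_interval continuous_on_subset[OF dc sb])
    have 2: "((\<lambda>s. (u s $ j) *\<^sub>R ctrl c j (fst (z s))) has_integral integral {a..s} (\<lambda>s. (u s $ j) *\<^sub>R ctrl c j (fst (z s)))) {a..s}" for j
      by (intro integrable_integral integrable_on_subinterval[OF set_lebesgue_integral_eq_integral(1)[OF absolutely_integrable_continuous_mult[OF ai' kc]] sb])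
    have "((\<lambda>s. drift c (z s) + (\<Sum>j\<in>UNIV. (u s $ j) *\<^sub>R ctrl c j (fst (z s)))) has_integral
      (integral {a..s} (\<lambda>s. drift c (z s)) + (\<Sum>j\<in>UNIV. integral {a..s} (\<lambda>s. (u s $ j) *\<^sub>R ctrl c j (fst (z s)))))) {a..s}"
      by (intro has_integral_add has_integral_sum 1 2) simp
    moreover have "((\<lambda>t. sys c (phase c (q t) (V t)) (u t)) has_integral (phase c (q s) (V s) - phase c (q a) (V a))) {a..s}"
      by (rule phase_diff[OF ic c(1) ab(1) less_imp_le[OF ab(5)] ab(4,6)]) (use s in auto)
    then have "((\<lambda>s. drift c (z s) + (\<Sum>j\<in>UNIV. (u s $ j) *\<^sub>R ctrl c j (fst (z s)))) has_integral (V s c - V a c)) {a..s}"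
      by (simp add: phase_def sys_def has_integral_Pair z_def)
    ultimately have "integral {a..s} (\<lambda>s. drift c (z s)) + (\<Sum>j\<in>UNIV. integral {a..s} (\<lambda>s. (u s $ j) *\<^sub>R ctrl c j (fst (z s)))) = V s c - V a c"
      by (rule has_integral_unique)
    then show "V s c = V a c + (integral {a..s} (\<lambda>s. drift c (z s)) + (\<Sum>j\<in>UNIV. integral {a..s} (\<lambda>s. (u s $ j) *\<^sub>R ctrl c j (fst (z s)))))"
      by simp
  qed
  then show ?thesis by (simp only: ab(7) z_def)
qed

text \<open>Increments of the state are bounded by \<open>M\<close> times integrals of
  \<open>1 + norm (u t)\<close>. Young's estimate sums these over disjoint intervals, with an energy
  part that is small whatever the intervals are.\<close>

lemma integral_curve_absolutely_continuous:
  assumes ic: "integral_curve u q V" and u: "u square_integrable_on {0..T}" and c: "c \<in> A"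
    and ab: "0 \<le> a" "a \<le> b" "b \<le> T" "q ` {a..b} \<subseteq> chart_dom c"
  shows "absolutely_continuous_on {a..b} (\<lambda>t. V t c)"
proof -
  define C where "C = (\<lambda>t. phase c (q t) (V t)) ` {a..b}"
  have Cc: "compact C" unfolding C_def
    by (intro compact_continuous_image phase_continuous[OF ic c ab] compact_Icc)
  have Cr: "C \<subseteq> chart_range c \<times> UNIV"
    using ab(4) coords_in_range[OF c] by (auto simp: C_def phase_def)
  obtain M where M: "M > 0" "\<And>z w. z \<in> C \<Longrightarrow> norm (sys c z w) \<le> M * (1 + norm w)"
    by (rule sys_bound[OF c Cc Cr]) (rule that)
  define E where "E = (\<integral>t. (norm (u t))\<^sup>2 \<partial>lebesgue_on {0..T})"
  have E: "E \<ge> 0" unfolding E_def by (rule Bochner_Integration.integral_nonneg) simp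
  show ?thesis unfolding absolutely_continuous_on_def
  proof (intro allI impI)
    fix e :: real assume e: "e > 0"
    \<comment> \<open>\<open>\<kappa>\<close> limits the energy part to \<open>e / 4\<close>;
      \<open>\<delta>\<close> below limits the length part to \<open>e / 2\<close>.\<close>
    define \<kappa> where "\<kappa> = e / (4 * M * (E + 1))"
    have \<kappa>: "\<kappa> > 0" using e M E by (simp add: \<kappa>_def)
    have "M * (\<kappa> * E) = e / 4 * (E / (E + 1))" using M(1) by (simp add: \<kappa>_def)
    also have "\<dots> \<le> e / 4 * 1" using e E by (intro mult_left_mono) auto
    finally have \<kappa>1: "M * (\<kappa> * E) \<le> e / 4" by simp
    have k1: "0 < 1 + 1 / \<kappa>" using \<kappa> by (simp add: add_pos_pos)
    define \<delta> where "\<delta> = e / (2 * M * (1 + 1 / \<kappa>))"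
    have "e / (2 * M * k) > 0" "M * (k * (e / (2 * M * k))) = e / 2" if "0 < k" for k
      using e M(1) that by (auto simp: field_simps)
    from this[OF k1] have \<delta>: "\<delta> > 0" "M * ((1 + 1 / \<kappa>) * \<delta>) = e / 2" by (simp_all only: \<delta>_def)
    show "\<exists>\<delta>>0. \<forall>(n::nat) l r. (\<forall>i<n. l i \<le> r i \<and> {l i..r i} \<subseteq> {a..b}) \<and>
        (\<forall>i<n. \<forall>j<n. i \<noteq> j \<longrightarrow> {l i<..<r i} \<inter> {l j<..<r j} = {}) \<and>
        (\<Sum>i<n. r i - l i) < \<delta> \<longrightarrow> (\<Sum>i<n. norm (V (r i) c - V (l i) c)) < e"
    proof (intro exI[of _ \<delta>] conjI allI impI \<delta>(1))
      fix n :: nat and l r :: "nat \<Rightarrow> real"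
      assume H: "(\<forall>i<n. l i \<le> r i \<and> {l i..r i} \<subseteq> {a..b}) \<and>
        (\<forall>i<n. \<forall>j<n. i \<noteq> j \<longrightarrow> {l i<..<r i} \<inter> {l j<..<r j} = {}) \<and> (\<Sum>i<n. r i - l i) < \<delta>"
      have "norm (V (r i) c - V (l i) c) \<le> M * integral {l i..r i} (\<lambda>t. 1 + norm (u t))" if "i < n" for i
      proof -
        have lr: "l i \<le> r i" "{l i..r i} \<subseteq> {a..b}" using H that by auto
        then have lr': "0 \<le> l i" "r i \<le> T" using ab by auto
        have "norm (phase c (q (r i)) (V (r i)) - phase c (q (l i)) (V (l i))) \<le> M * integral {l i..r i} (\<lambda>t. 1 + norm (u t))"
        proof (rule phase_modulus[OF ic u c lr'(1) lr(1) lr'(2)])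
          show "q ` {l i..r i} \<subseteq> chart_dom c" using ab(4) lr(2) by auto
          show "norm (sys c (phase c (q t) (V t)) (u t)) \<le> M * (1 + norm (u t))" if "t \<in> {l i..r i}" for t
            by (rule M(2)) (use that lr(2) in \<open>auto simp: C_def\<close>)
        qed
        moreover have "norm (V (r i) c - V (l i) c) \<le> norm (phase c (q (r i)) (V (r i)) - phase c (q (l i)) (V (l i)))"
          by (simp add: phase_def norm_snd_le)
        ultimately show ?thesis by linarith
      qed
      then have "(\<Sum>i<n. norm (V (r i) c - V (l i) c)) \<le> (\<Sum>i<n. M * integral {l i..r i} (\<lambda>t. 1 + norm (u t)))"
        by (intro sum_mono) auto
      also have "\<dots> = M * (\<Sum>i<n. integral {l i..r i} (\<lambda>t. 1 + norm (u t)))" by (simp add: sum_distrib_left)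
      also have "\<dots> \<le> M * ((1 + 1 / \<kappa>) * (\<Sum>i<n. r i - l i) + \<kappa> * E)"
      proof (intro mult_left_mono sum_integral_le_young[OF u _ _ _ _ \<kappa>])
        show "(\<integral>t. (norm (u t))\<^sup>2 \<partial>lebesgue_on {0..T}) \<le> E" by (simp add: E_def)
        show "l i \<le> r i \<and> {l i..r i} \<subseteq> {0..T}" if "i \<in> {..<n}" for i
        proof -
          have "l i \<le> r i" "{l i..r i} \<subseteq> {a..b}" using H that by auto
          moreover have "{a..b} \<subseteq> {0..T}" using ab by auto
          ultimately show ?thesis by (meson subset_trans)
        qed
        show "{l i<..<r i} \<inter> {l j<..<r j} = {}" if "i \<in> {..<n}" "j \<in> {..<n}" "i \<noteq> j" for i j
          using conjunct1[OF conjunct2[OF H]] that by (meson lessThan_iff)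
      qed (use M in auto)
      also have "\<dots> \<le> M * ((1 + 1 / \<kappa>) * \<delta> + \<kappa> * E)"
        using H M(1) k1 by (intro mult_left_mono add_right_mono) auto
      also have "\<dots> = M * ((1 + 1 / \<kappa>) * \<delta>) + M * (\<kappa> * E)" by (simp add: distrib_left)
      also have "\<dots> < e" using \<delta>(2) \<kappa>1 e by linarith
      finally show "(\<Sum>i<n. norm (V (r i) c - V (l i) c)) < e" .
    qed
  qed
qed

lemma integral_curve_imp_trajectory:
  assumes ic: "integral_curve u q V" and u: "u square_integrable_on {0..T}"
    and out: "\<And>t c. t \<in> {0..T} \<Longrightarrow> c \<notin> A \<or> q t \<notin> chart_dom c \<Longrightarrow> V t c = 0"
  shows "is_trajectory A g W f T (q 0) (V 0) u q"
proof -
  have v: "velocity A {0..T} q t = V t" if "t \<in> {0..T}" for t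
    by (rule velocity_eq[OF ic that out[OF that]])
  obtain N where N: "negligible N" "\<And>t j. t \<in> {0..T} - N \<Longrightarrow>
      ((\<lambda>s. integral {0..s} (\<lambda>s. u s $ j)) has_vector_derivative u t $ j) (at t within {0..T}) \<and>
      ((\<lambda>s. integral {0..s} (\<lambda>s. \<bar>u s $ j\<bar>)) has_vector_derivative \<bar>u t $ j\<bar>) (at t within {0..T})"
    by (rule control_lebesgue_points[OF u]) (rule that)
  \<comment> \<open>\<open>N\<close> is fixed before the chart, so off \<open>N\<close> the equation
    of motion holds in every chart.\<close>
  have hcd: "has_covariant_derivative A g {0..T} q (velocity A {0..T} q)
            (\<lambda>c. - grad A g W (q t) c + (\<Sum>j\<in>UNIV. (u t $ j) *\<^sub>R f j (q t) c)) t" if t: "t \<in> {0..T} - N" for t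
    unfolding has_covariant_derivative_def
  proof (intro ballI impI exI conjI)
    fix c assume c: "c \<in> A" and qt: "q t \<in> chart_dom c"
    have tT: "t \<in> {0..T}" using t by auto
    have "((\<lambda>s. V s c) has_vector_derivative snd (sys c (phase c (q t) (V t)) (u t))) (at t within {0..T})"
      by (rule integral_curve_acceleration[OF ic u tT c qt N(2)[OF t]])
    then show "((\<lambda>s. velocity A {0..T} q s c) has_vector_derivative snd (sys c (phase c (q t) (V t)) (u t))) (at t within {0..T})"
      by (rule has_vector_derivative_transform[OF tT, rotated]) (simp add: v)
    show "- grad A g W (q t) c + (\<Sum>j\<in>UNIV. (u t $ j) *\<^sub>R f j (q t) c) =
       snd (sys c (phase c (q t) (V t)) (u t)) + (\<chi> k. \<Sum>i\<in>UNIV. \<Sum>j\<in>UNIV.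
                christoffel A g c (coords c (q t)) k i j * velocity A {0..T} q t c $ i * velocity A {0..T} q t c $ j)"
      using c qt by (simp add: v[OF tT] sys_def drift_def phase_def ctrl_def grad_eq_lift[OF W c qt] param_coords)
  qed
  have vd: "(coords c \<circ> q) differentiable (at t within {0..T})" if "t \<in> {0..T}" "c \<in> A" "q t \<in> chart_dom c" for t c
    using integral_curve_velocity[OF ic that] unfolding has_vector_derivative_def differentiable_def by blast
  have va: "absolutely_continuous_on {a..b} (\<lambda>t. velocity A {0..T} q t c)"
    if c: "c \<in> A" and H: "0 \<le> a" "a \<le> b" "b \<le> T" "q ` {a..b} \<subseteq> chart_dom c" for c a b
  proof -
    have e: "velocity A {0..T} q s c = V s c" if "{s..t} \<subseteq> {a..b}" "s \<le> t" for s t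
      using v[of s] that H by auto
    have e': "velocity A {0..T} q t c = V t c" if "{s..t} \<subseteq> {a..b}" "s \<le> t" for s t
      using v[of t] that H by auto
    show ?thesis
      unfolding absolutely_continuous_on_def
    proof (intro allI impI)
      fix \<epsilon> :: real assume "\<epsilon> > 0"
      from integral_curve_absolutely_continuous[OF ic u c H, unfolded absolutely_continuous_on_def, THEN spec, THEN mp, OF this]
      obtain \<delta> where \<delta>: "\<delta> > 0" "\<forall>(n::nat) l r. (\<forall>i<n. l i \<le> r i \<and> {l i..r i} \<subseteq> {a..b}) \<and>
        (\<forall>i<n. \<forall>j<n. i \<noteq> j \<longrightarrow> {l i<..<r i} \<inter> {l j<..<r j} = {}) \<and>
        (\<Sum>i<n. r i - l i) < \<delta> \<longrightarrow> (\<Sum>i<n. norm (V (r i) c - V (l i) c)) < \<epsilon>"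
        by (elim exE conjE) (rule that)
      show "\<exists>\<delta>>0. \<forall>(n::nat) l r. (\<forall>i<n. l i \<le> r i \<and> {l i..r i} \<subseteq> {a..b}) \<and>
        (\<forall>i<n. \<forall>j<n. i \<noteq> j \<longrightarrow> {l i<..<r i} \<inter> {l j<..<r j} = {}) \<and>
        (\<Sum>i<n. r i - l i) < \<delta> \<longrightarrow> (\<Sum>i<n. norm (velocity A {0..T} q (r i) c - velocity A {0..T} q (l i) c)) < \<epsilon>"
      proof (intro exI[of _ \<delta>] conjI allI impI \<delta>(1))
        fix n :: nat and l r :: "nat \<Rightarrow> real"
        assume H': "(\<forall>i<n. l i \<le> r i \<and> {l i..r i} \<subseteq> {a..b}) \<and>
        (\<forall>i<n. \<forall>j<n. i \<noteq> j \<longrightarrow> {l i<..<r i} \<inter> {l j<..<r j} = {}) \<and> (\<Sum>i<n. r i - l i) < \<delta>"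
        have "(\<Sum>i<n. norm (velocity A {0..T} q (r i) c - velocity A {0..T} q (l i) c)) = (\<Sum>i<n. norm (V (r i) c - V (l i) c))"
        proof (rule sum.cong[OF refl])
          fix i assume "i \<in> {..<n}"
          then have "l i \<le> r i" "{l i..r i} \<subseteq> {a..b}" using H' by auto
          then show "norm (velocity A {0..T} q (r i) c - velocity A {0..T} q (l i) c) = norm (V (r i) c - V (l i) c)"
            using e[of "l i" "r i"] e'[of "l i" "r i"] by simp
        qed
        then show "(\<Sum>i<n. norm (velocity A {0..T} q (r i) c - velocity A {0..T} q (l i) c)) < \<epsilon>"
          using \<delta>(2)[THEN spec, THEN spec, THEN spec, THEN mp, OF H'] by simp
      qed
    qed
  qed
  have ae: "AE t in lebesgue_on {0..T}. has_covariant_derivative A g {0..T} q (velocity A {0..T} q)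
            (\<lambda>c. - grad A g W (q t) c + (\<Sum>j\<in>UNIV. (u t $ j) *\<^sub>R f j (q t) c)) t"
    unfolding AE_lebesgue_on_iff by (rule exI[of _ N], intro conjI ballI N(1) hcd)
  show ?thesis
    unfolding is_trajectory_def Let_def
  proof (intro conjI ballI allI impI ae)
    show "continuous_on {0..T} q" by (rule integral_curveD(1)[OF ic])
    show "velocity A {0..T} q 0 = V 0" using v[of 0] T by simp
    show "(coords c \<circ> q) differentiable (at t within {0..T})" if "t \<in> {0..T}" "c \<in> A" "q t \<in> chart_dom c" for t c
      by (rule vd[OF that])
    show "absolutely_continuous_on {a..b} (\<lambda>t. velocity A {0..T} q t c)"
      if "c \<in> A" "0 \<le> a \<and> a \<le> b \<and> b \<le> T \<and> q ` {a..b} \<subseteq> chart_dom c" for c a b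
      using va that by blast
  qed simp
qed

end

section \<open>Staying in a chart for a uniform time, and uniqueness of trajectories\<close>

lemma velocity_local_cong:
  fixes A :: "('a::topological_space, 'n::finite) chart set"
  assumes d: "0 < d" and eq: "\<And>s. s \<in> S \<Longrightarrow> dist s t < d \<Longrightarrow> q s = q' s" and t: "t \<in> S"
  shows "velocity A S q t = velocity A S q' t"
proof -
  have *: "((coords c \<circ> q) has_vector_derivative D) (at t within S) \<longleftrightarrow> ((coords c \<circ> q') has_vector_derivative D) (at t within S)"
    for c :: "('a, 'n) chart" and D
    by (intro iffI; erule has_vector_derivative_transform_within[OF _ d t]) (simp_all add: eq)
  have "q t = q' t" using eq[OF t] d by simp
  then have "velocity A S q t c = velocity A S q' t c" for c
    unfolding velocity_def vector_derivative_def *[of c] by (simp only:)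
  then show ?thesis by (rule ext)
qed

context control_system
begin

text \<open>Continuation argument. As long as the state is in the ball of radius
  \<open>2 * r\<close> the speed bound applies, so within time \<open>\<delta>\<close> it moves by
  less than \<open>r\<close> away from a point within \<open>r\<close> of the centre and cannot
  reach the boundary.\<close>

lemma phase_stays:
  assumes ic: "integral_curve u q V" and u: "u square_integrable_on {0..T}" and c: "c \<in> A" and r: "0 < r"
    and sub: "cball z0 (2 * r) \<subseteq> chart_range c \<times> UNIV"
    and M: "\<And>z w. z \<in> cball z0 (2 * r) \<Longrightarrow> norm (sys c z w) \<le> M * (1 + norm w)"
    and small: "\<And>a b. 0 \<le> a \<Longrightarrow> a \<le> b \<Longrightarrow> b \<le> T \<Longrightarrow> b - a \<le> \<delta> \<Longrightarrow> M * integral {a..b} (\<lambda>t. 1 + norm (u t)) < r"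
    and t0: "t0 \<in> {0..T}" "q t0 \<in> chart_dom c" "phase c (q t0) (V t0) \<in> ball z0 r"
    and s: "s \<in> {0..T}" "\<bar>s - t0\<bar> \<le> \<delta>"
  shows "q s \<in> chart_dom c \<and> phase c (q s) (V s) \<in> ball z0 (2 * r)"
proof (cases "s = t0")
  case True
  then show ?thesis using t0 r by auto
next
  case False
  \<comment> \<open>Parametrising the segment from \<open>t0\<close> to \<open>s\<close> by the unit
    interval treats times before and after \<open>t0\<close> alike; the infimum
    \<open>\<theta>'\<close> below is the exit parameter.\<close>
  define \<tau> where "\<tau> \<theta> = t0 + \<theta> * (s - t0)" for \<theta>
  define G where "G \<theta> \<longleftrightarrow> q (\<tau> \<theta>) \<in> chart_dom c \<and> phase c (q (\<tau> \<theta>)) (V (\<tau> \<theta>)) \<in> ball z0 (2 * r)" for \<theta>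
  have \<tau>T: "\<tau> \<theta> \<in> {0..T}" if "\<theta> \<in> {0..1}" for \<theta>
  proof -
    have eq: "\<tau> \<theta> = (1 - \<theta>) * t0 + \<theta> * s" by (simp add: \<tau>_def algebra_simps)
    have "0 \<le> (1 - \<theta>) * t0 + \<theta> * s" using that t0(1) s(1) by simp
    moreover have "(1 - \<theta>) * t0 + \<theta> * s \<le> (1 - \<theta>) * T + \<theta> * T"
      using that t0(1) s(1) by (intro add_mono mult_left_mono) auto
    ultimately show ?thesis unfolding eq by (simp add: algebra_simps)
  qed
  have "G 1"
  proof (rule ccontr)
    assume "\<not> G 1"
    define F where "F = {\<theta>\<in>{0..1}. \<not> G \<theta>}"
    have F: "1 \<in> F" "bdd_below F" "F \<noteq> {}" using \<open>\<not> G 1\<close> by (auto simp: F_def intro: bdd_belowI[of _ 0])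
    define \<theta>' where "\<theta>' = Inf F"
    have \<theta>'1: "\<theta>' \<le> 1" unfolding \<theta>'_def by (rule cInf_lower[OF F(1,2)])
    have \<theta>'0: "0 \<le> \<theta>'" unfolding \<theta>'_def by (rule cInf_greatest[OF F(3)]) (auto simp: F_def)
    have below: "G \<theta>" if "0 \<le> \<theta>" "\<theta> < \<theta>'" for \<theta>
    proof (rule ccontr)
      assume "\<not> G \<theta>"
      then have "\<theta> \<in> F" using that \<theta>'1 by (simp add: F_def)
      from cInf_lower[OF this F(2)] that show False by (simp add: \<theta>'_def)
    qed
    have \<tau>0: "\<tau> 0 = t0" by (simp add: \<tau>_def)
    have \<tau>c: "continuous_on S \<tau>" for S unfolding \<tau>_def by (intro continuous_intros)
    have clo: "closure {0..<\<theta>'} = {0..\<theta>'}" if "\<theta>' \<noteq> 0" using that \<theta>'0 by simp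
    have qd: "q (\<tau> \<theta>') \<in> chart_dom c"
    proof (cases "\<theta>' = 0")
      case True then show ?thesis using \<tau>0 t0 by simp
    next
      case nz: False
      \<comment> \<open>At the exit parameter the curve might have left the chart domain, where
        coordinates say nothing. It has not: the positions before lie in the image \<open>P\<close>
        of a compact ball, which is closed in a Hausdorff space and hence contains the limit
        position too.\<close>
      define P where "P = param c ` (fst ` cball z0 (2 * r))"
      have fr: "fst ` cball z0 (2 * r) \<subseteq> chart_range c" using image_mono[OF sub, of fst] by (simp add: fst_image_times)
      have "compact P" unfolding P_def
        by (intro compact_continuous_image continuous_on_subset[OF continuous_on_param[OF c] fr] continuous_on_fst continuous_on_id compact_cball)
      then have Pc: "closed P" by (rule compact_imp_closed)
      have "(\<lambda>\<theta>. q (\<tau> \<theta>)) ` closure {0..<\<theta>'} \<subseteq> P"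
      proof (rule image_closure_subset[OF _ Pc])
        show "continuous_on (closure {0..<\<theta>'}) (\<lambda>\<theta>. q (\<tau> \<theta>))" unfolding clo[OF nz]
          by (rule continuous_on_compose2[where g = q and f = \<tau>, OF integral_curveD(1)[OF ic] \<tau>c]) (use \<tau>T \<theta>'1 in auto)
        show "(\<lambda>\<theta>. q (\<tau> \<theta>)) ` {0..<\<theta>'} \<subseteq> P"
        proof
          fix p assume "p \<in> (\<lambda>\<theta>. q (\<tau> \<theta>)) ` {0..<\<theta>'}"
          then obtain \<theta> where \<theta>: "0 \<le> \<theta>" "\<theta> < \<theta>'" "p = q (\<tau> \<theta>)" by auto
          from below[OF \<theta>(1,2)] have G: "p \<in> chart_dom c" "phase c p (V (\<tau> \<theta>)) \<in> cball z0 (2 * r)"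
            unfolding G_def \<theta>(3)[symmetric] using ball_subset_cball by blast+
          have "p = param c (fst (phase c p (V (\<tau> \<theta>))))" by (simp add: phase_def param_coords[OF c G(1)])
          then show "p \<in> P" unfolding P_def using G(2) by blast
        qed
      qed
      moreover have "q (\<tau> \<theta>') \<in> (\<lambda>\<theta>. q (\<tau> \<theta>)) ` closure {0..<\<theta>'}" unfolding clo[OF nz] using \<theta>'0 by auto
      ultimately have "q (\<tau> \<theta>') \<in> P" by blast
      then obtain x where x: "x \<in> fst ` cball z0 (2 * r)" "q (\<tau> \<theta>') = param c x" unfolding P_def by (rule imageE)
      show ?thesis unfolding x(2) by (rule param_in_dom[OF c subsetD[OF fr x(1)]])
    qed
    define l where "l = min t0 (\<tau> \<theta>')"
    define m where "m = max t0 (\<tau> \<theta>')"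
    have lm: "0 \<le> l" "l \<le> m" "m \<le> T" using \<tau>T[of \<theta>'] t0(1) \<theta>'0 \<theta>'1 by (auto simp: l_def m_def)
    have \<tau>diff: "\<tau> \<theta> - t0 = \<theta> * (s - t0)" for \<theta> by (simp add: \<tau>_def)
    have ml: "m - l \<le> \<delta>"
    proof -
      have "m - l = \<bar>\<tau> \<theta>' - t0\<bar>" by (auto simp: l_def m_def)
      also have "\<dots> = \<theta>' * \<bar>s - t0\<bar>" unfolding \<tau>diff using \<theta>'0 by (simp add: abs_mult)
      also have "\<dots> \<le> 1 * \<bar>s - t0\<bar>" using \<theta>'1 by (intro mult_right_mono) auto
      finally show ?thesis using s(2) by simp
    qed
    have par: "\<exists>\<theta>\<in>{0..\<theta>'}. t = \<tau> \<theta>" if t: "t \<in> {l..m}" for t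
    proof (rule bexI[of _ "(t - t0) / (s - t0)"])
      show "t = \<tau> ((t - t0) / (s - t0))" using False by (simp add: \<tau>_def)
      have t\<theta>': "\<tau> \<theta>' = t0 + \<theta>' * (s - t0)" by (simp add: \<tau>_def)
      show "(t - t0) / (s - t0) \<in> {0..\<theta>'}"
      proof (cases "t0 < s")
        case True
        then have "0 \<le> \<theta>' * (s - t0)" using \<theta>'0 by simp
        then have "t0 \<le> t" "t \<le> t0 + \<theta>' * (s - t0)" using t by (auto simp: l_def m_def t\<theta>')
        then show ?thesis using True by (simp add: divide_simps)
      next
        case neg: False
        then have lt: "s < t0" using False by simp
        then have "\<theta>' * (s - t0) \<le> 0" using \<theta>'0 by (simp add: mult_nonneg_nonpos)
        then have "t \<le> t0" "t0 + \<theta>' * (s - t0) \<le> t" using t by (auto simp: l_def m_def t\<theta>')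
        then show ?thesis using lt by (simp add: divide_simps)
      qed
    qed
    have qlm: "q ` {l..m} \<subseteq> chart_dom c"
    proof
      fix p assume "p \<in> q ` {l..m}"
      then obtain t where "t \<in> {l..m}" "p = q t" by auto
      with par obtain \<theta> where \<theta>: "\<theta> \<in> {0..\<theta>'}" "p = q (\<tau> \<theta>)" by blast
      show "p \<in> chart_dom c"
      proof (cases "\<theta> = \<theta>'")
        case False
        then show ?thesis using below[of \<theta>] \<theta> by (simp add: G_def)
      qed (use qd \<theta> in simp)
    qed
    have pc: "continuous_on {l..m} (\<lambda>t. phase c (q t) (V t))" by (rule phase_continuous[OF ic c lm qlm])
    have \<tau>lm: "\<tau> \<theta> \<in> {l..m}" if "\<theta> \<in> {0..\<theta>'}" for \<theta>
    proof (cases "t0 < s")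
      case True
      then have "0 \<le> \<theta> * (s - t0)" "\<theta> * (s - t0) \<le> \<theta>' * (s - t0)" using that by (auto intro: mult_right_mono)
      then show ?thesis by (auto simp: l_def m_def \<tau>_def)
    next
      case neg: False
      then have "\<theta> * (s - t0) \<le> 0" "\<theta>' * (s - t0) \<le> \<theta> * (s - t0)" using that by (auto intro: mult_right_mono_neg mult_nonneg_nonpos)
      then show ?thesis by (auto simp: l_def m_def \<tau>_def)
    qed
    have ph: "phase c (q (\<tau> \<theta>)) (V (\<tau> \<theta>)) \<in> cball z0 (2 * r)" if "\<theta> \<in> {0..\<theta>'}" for \<theta>
    proof (cases "\<theta>' = 0")
      case True then show ?thesis using that \<tau>0 t0(3) r by auto
    next
      case nz: False
      have "(\<lambda>\<theta>. phase c (q (\<tau> \<theta>)) (V (\<tau> \<theta>))) ` closure {0..<\<theta>'} \<subseteq> cball z0 (2 * r)"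
      proof (rule image_closure_subset[OF _ closed_cball])
        show "continuous_on (closure {0..<\<theta>'}) (\<lambda>\<theta>. phase c (q (\<tau> \<theta>)) (V (\<tau> \<theta>)))" unfolding clo[OF nz]
          by (rule continuous_on_compose2[where g = "\<lambda>t. phase c (q t) (V t)" and f = \<tau>, OF pc \<tau>c]) (use \<tau>lm in blast)
        show "(\<lambda>\<theta>. phase c (q (\<tau> \<theta>)) (V (\<tau> \<theta>))) ` {0..<\<theta>'} \<subseteq> cball z0 (2 * r)"
        proof (rule image_subsetI)
          fix \<theta> assume "\<theta> \<in> {0..<\<theta>'}"
          then have "G \<theta>" using below by simp
          then show "phase c (q (\<tau> \<theta>)) (V (\<tau> \<theta>)) \<in> cball z0 (2 * r)" using ball_subset_cball unfolding G_def by blast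
        qed
      qed
      then show ?thesis using that unfolding clo[OF nz] by blast
    qed
    have "norm (phase c (q m) (V m) - phase c (q l) (V l)) \<le> M * integral {l..m} (\<lambda>t. 1 + norm (u t))"
    proof (rule phase_modulus[OF ic u c lm qlm])
      fix t assume "t \<in> {l..m}"
      from par[OF this] ph show "norm (sys c (phase c (q t) (V t)) (u t)) \<le> M * (1 + norm (u t))" by (auto intro: M)
    qed
    also have "\<dots> < r" by (rule small[OF lm ml])
    finally have "dist (phase c (q t0) (V t0)) (phase c (q (\<tau> \<theta>')) (V (\<tau> \<theta>'))) < r"
      by (auto simp: l_def m_def dist_norm norm_minus_commute max_def min_def split: if_splits)
    moreover have "dist z0 (phase c (q t0) (V t0)) < r" using t0(3) by simp
    ultimately have "dist z0 (phase c (q (\<tau> \<theta>')) (V (\<tau> \<theta>'))) < 2 * r"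
      using dist_triangle[of z0 "phase c (q (\<tau> \<theta>')) (V (\<tau> \<theta>'))" "phase c (q t0) (V t0)"] by linarith
    then have pb: "phase c (q (\<tau> \<theta>')) (V (\<tau> \<theta>')) \<in> ball z0 (2 * r)" by simp
    have \<tau>'T: "\<tau> \<theta>' \<in> {0..T}" by (rule \<tau>T) (use \<theta>'0 \<theta>'1 in simp)
    obtain e where e: "e > 0" "\<And>s. s \<in> {0..T} \<Longrightarrow> \<bar>s - \<tau> \<theta>'\<bar> < e \<Longrightarrow> q s \<in> chart_dom c \<and> phase c (q s) (V s) \<in> ball z0 (2 * r)"
      by (rule phase_near[OF ic c \<tau>'T qd open_ball pb]) (rule that)
    have st: "\<bar>s - t0\<bar> > 0" using False by simp
    \<comment> \<open>All times close to \<open>\<tau> \<theta>'\<close> are still good, whereas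
      \<open>F\<close> has members arbitrarily close to its infimum.\<close>
    have "\<exists>\<theta>\<in>F. \<theta> < \<theta>' + e / \<bar>s - t0\<bar>"
      by (rule cInf_lessD[OF F(3)]) (use e(1) st in \<open>simp add: \<theta>'_def\<close>)
    then obtain \<theta> where \<theta>: "\<theta> \<in> F" "\<theta> < \<theta>' + e / \<bar>s - t0\<bar>" by blast
    have "\<theta>' \<le> \<theta>" unfolding \<theta>'_def by (rule cInf_lower[OF \<theta>(1) F(2)])
    then have "\<bar>\<tau> \<theta> - \<tau> \<theta>'\<bar> = (\<theta> - \<theta>') * \<bar>s - t0\<bar>"
      by (simp add: \<tau>_def abs_mult flip: left_diff_distrib)
    also have "\<dots> < e / \<bar>s - t0\<bar> * \<bar>s - t0\<bar>" using \<theta>(2) st by (intro mult_strict_right_mono) auto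
    also have "\<dots> = e" using st by simp
    finally have "\<bar>\<tau> \<theta> - \<tau> \<theta>'\<bar> < e" .
    moreover have "\<tau> \<theta> \<in> {0..T}" by (rule \<tau>T) (use \<theta>(1) in \<open>simp add: F_def\<close>)
    ultimately have "G \<theta>" using e(2) by (simp add: G_def)
    then show False using \<theta>(1) by (simp add: F_def)
  qed
  then show ?thesis by (simp add: G_def \<tau>_def)
qed

text \<open>At the infimum \<open>\<tau>\<close> of the times of disagreement the states still
  coincide in a chart. On a short interval after it, chosen so that the integral of
  \<open>1 + norm (u t)\<close> is small, the Lipschitz estimate bounds the maximal distance of the
  states by half of itself.\<close>

lemma integral_curve_unique:
  assumes ic: "integral_curve u q V" and ic': "integral_curve u q' V'" and u: "u square_integrable_on {0..T}"
    and q0: "q 0 = q' 0" and V0: "V 0 = V' 0" and t: "t \<in> {0..T}"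
  shows "q t = q' t"
proof (rule ccontr)
  assume ne: "q t \<noteq> q' t"
  define F where "F = {t\<in>{0..T}. q t \<noteq> q' t}"
  have F: "t \<in> F" "bdd_below F" "F \<noteq> {}" using ne t by (auto simp: F_def intro: bdd_belowI[of _ 0])
  define \<tau> where "\<tau> = Inf F"
  have \<tau>t: "\<tau> \<le> t" unfolding \<tau>_def by (rule cInf_lower[OF F(1,2)])
  have \<tau>0: "0 \<le> \<tau>" unfolding \<tau>_def by (rule cInf_greatest[OF F(3)]) (auto simp: F_def)
  have \<tau>T: "\<tau> \<in> {0..T}" using \<tau>t \<tau>0 t by auto
  have below: "q s = q' s" if "0 \<le> s" "s < \<tau>" for s
  proof (rule ccontr)
    assume "q s \<noteq> q' s"
    then have "s \<in> F" using that \<tau>T by (simp add: F_def)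
    from cInf_lower[OF this F(2)] that show False by (simp add: \<tau>_def)
  qed
  have q\<tau>: "q \<tau> = q' \<tau>"
  proof (cases "\<tau> = 0")
    case False
    then have clo: "closure {0..<\<tau>} = {0..\<tau>}" using \<tau>0 by simp
    \<comment> \<open>Agreement passes to the limit time because the diagonal of a Hausdorff space
      is closed.\<close>
    have "(\<lambda>s. (q s, q' s)) ` closure {0..<\<tau>} \<subseteq> {y. \<exists>x. y = (x, x)}"
    proof (rule image_closure_subset[OF _ closed_diagonal])
      show "continuous_on (closure {0..<\<tau>}) (\<lambda>s. (q s, q' s))" unfolding clo
        by (intro continuous_on_Pair continuous_on_subset[OF integral_curveD(1)[OF ic]] continuous_on_subset[OF integral_curveD(1)[OF ic']])
          (use \<tau>T in auto)
      show "(\<lambda>s. (q s, q' s)) ` {0..<\<tau>} \<subseteq> {y. \<exists>x. y = (x, x)}" using below by auto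
    qed
    moreover have "(q \<tau>, q' \<tau>) \<in> (\<lambda>s. (q s, q' s)) ` closure {0..<\<tau>}" unfolding clo using \<tau>0 by auto
    ultimately show ?thesis by auto
  qed (use q0 in simp)
  obtain c where c: "c \<in> A" "q \<tau> \<in> chart_dom c" using charts_cover by blast
  have c': "q' \<tau> \<in> chart_dom c" using c q\<tau> by simp
  \<comment> \<open>For positive \<open>\<tau>\<close> both velocities are left derivatives of the
    same function; at 0 they are the common initial value.\<close>
  have V\<tau>: "V \<tau> c = V' \<tau> c"
  proof (cases "\<tau> = 0")
    case False
    then have \<tau>p: "0 < \<tau>" using \<tau>0 by simp
    have sub: "{0..\<tau>} \<subseteq> {0..T}" using \<tau>T by auto
    have mem: "\<tau> \<in> {0..\<tau>}" using \<tau>0 by simp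
    have 1: "((coords c \<circ> q) has_vector_derivative V \<tau> c) (at \<tau> within {0..\<tau>})"
      by (rule has_vector_derivative_within_subset[OF integral_curve_velocity[OF ic \<tau>T c] sub])
    have "((coords c \<circ> q') has_vector_derivative V' \<tau> c) (at \<tau> within {0..\<tau>})"
      by (rule has_vector_derivative_within_subset[OF integral_curve_velocity[OF ic' \<tau>T c(1) c'] sub])
    then have 2: "((coords c \<circ> q) has_vector_derivative V' \<tau> c) (at \<tau> within {0..\<tau>})"
    proof (rule has_vector_derivative_transform[OF mem, rotated])
      fix s assume "s \<in> {0..\<tau>}"
      then have "q s = q' s" using below[of s] q\<tau> by (cases "s = \<tau>") auto
      then show "(coords c \<circ> q) s = (coords c \<circ> q') s" by simp
    qed
    show ?thesis
      using vector_derivative_within_closed_interval[OF \<tau>p mem 1] vector_derivative_within_closed_interval[OF \<tau>p mem 2] by simp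
  qed (use V0 in simp)
  define \<phi> where "\<phi> s = phase c (q s) (V s)" for s
  define \<phi>' where "\<phi>' s = phase c (q' s) (V' s)" for s
  have \<phi>\<tau>: "\<phi> \<tau> = \<phi>' \<tau>" by (simp add: \<phi>_def \<phi>'_def phase_def q\<tau> V\<tau>)
  have rng: "fst (\<phi> \<tau>) \<in> chart_range c" using coords_in_range[OF c] by (simp add: \<phi>_def phase_def)
  obtain r L where rL: "r > 0" "L > 0" "ball (\<phi> \<tau>) r \<subseteq> chart_range c \<times> UNIV"
    "\<And>y z w. y \<in> ball (\<phi> \<tau>) r \<Longrightarrow> z \<in> ball (\<phi> \<tau>) r \<Longrightarrow> norm (sys c y w - sys c z w) \<le> L * (1 + norm w) * norm (y - z)"
    by (rule sys_lipschitz[OF c(1) rng]) (rule that)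
  have in1: "phase c (q \<tau>) (V \<tau>) \<in> ball (\<phi> \<tau>) r" using rL(1) by (simp add: \<phi>_def)
  have in2: "phase c (q' \<tau>) (V' \<tau>) \<in> ball (\<phi> \<tau>) r" using rL(1) \<phi>\<tau> by (simp add: \<phi>'_def)
  obtain e1 where e1: "e1 > 0" "\<And>s. s \<in> {0..T} \<Longrightarrow> \<bar>s - \<tau>\<bar> < e1 \<Longrightarrow> q s \<in> chart_dom c \<and> phase c (q s) (V s) \<in> ball (\<phi> \<tau>) r"
    by (rule phase_near[OF ic c(1) \<tau>T c(2) open_ball in1]) (rule that)
  obtain e2 where e2: "e2 > 0" "\<And>s. s \<in> {0..T} \<Longrightarrow> \<bar>s - \<tau>\<bar> < e2 \<Longrightarrow> q' s \<in> chart_dom c \<and> phase c (q' s) (V' s) \<in> ball (\<phi> \<tau>) r"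
    by (rule phase_near[OF ic' c(1) \<tau>T c' open_ball in2]) (rule that)
  define E where "E = (\<integral>t. (norm (u t))\<^sup>2 \<partial>lebesgue_on {0..T})"
  have E: "E \<ge> 0" unfolding E_def by (rule Bochner_Integration.integral_nonneg) simp
  \<comment> \<open>With this bound on the integral of \<open>1 + norm (u t)\<close> the Lipschitz
    constant \<open>L\<close> turns into the contraction factor 1/2.\<close>
  have L2: "0 < 1 / (2 * L)" using rL(2) by simp
  obtain \<delta> where \<delta>: "0 < \<delta>" "\<And>(u :: real \<Rightarrow> real^'m) s t. u square_integrable_on {0..T} \<Longrightarrow>
     (\<integral>t. (norm (u t))\<^sup>2 \<partial>lebesgue_on {0..T}) \<le> E \<Longrightarrow> 0 \<le> s \<Longrightarrow> s \<le> t \<Longrightarrow> t \<le> T \<Longrightarrow> t - s \<le> \<delta> \<Longrightarrow>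
     integral {s..t} (\<lambda>t. 1 + norm (u t)) \<le> 1 / (2 * L)"
    by (rule square_integrable_modulus[OF L2 E, where 'e = "real^'m" and a = 0 and b = T]) (rule that)
  define \<eta> where "\<eta> = min (e1/2) (min (e2/2) \<delta>)"
  have \<eta>: "\<eta> > 0" "\<eta> < e1" "\<eta> < e2" "\<eta> \<le> \<delta>" using e1(1) e2(1) \<delta>(1) by (auto simp: \<eta>_def)
  define b where "b = min T (\<tau> + \<eta>)"
  have b: "\<tau> \<le> b" "b \<le> T" "b \<le> \<tau> + \<eta>" using \<tau>T \<eta> by (auto simp: b_def)
  have near: "q s \<in> chart_dom c" "q' s \<in> chart_dom c" "\<phi> s \<in> ball (\<phi> \<tau>) r" "\<phi>' s \<in> ball (\<phi> \<tau>) r"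
    if "s \<in> {\<tau>..b}" for s
  proof -
    have "s \<in> {0..T}" "\<bar>s - \<tau>\<bar> < e1" "\<bar>s - \<tau>\<bar> < e2" using that b \<tau>0 \<eta> by auto
    then show "q s \<in> chart_dom c" "q' s \<in> chart_dom c" "\<phi> s \<in> ball (\<phi> \<tau>) r" "\<phi>' s \<in> ball (\<phi> \<tau>) r"
      using e1(2)[of s] e2(2)[of s] unfolding \<phi>_def[of s] \<phi>'_def[of s] by blast+
  qed
  have qb: "q ` {\<tau>..b} \<subseteq> chart_dom c" "q' ` {\<tau>..b} \<subseteq> chart_dom c" using near(1,2) by auto
  have "continuous_on {\<tau>..b} (\<lambda>s. norm (\<phi> s - \<phi>' s))" unfolding \<phi>_def \<phi>'_def
    by (intro continuous_on_norm continuous_on_diff phase_continuous[OF ic c(1) \<tau>0 b(1,2) qb(1)] phase_continuous[OF ic' c(1) \<tau>0 b(1,2) qb(2)])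
  from continuous_attains_sup[OF compact_Icc _ this] b(1) obtain t1 where t1: "t1 \<in> {\<tau>..b}"
    "\<forall>s\<in>{\<tau>..b}. norm (\<phi> s - \<phi>' s) \<le> norm (\<phi> t1 - \<phi>' t1)" by auto
  define D where "D = norm (\<phi> t1 - \<phi>' t1)"
  have t1': "\<tau> \<le> \<tau>" "\<tau> \<le> t1" "t1 \<le> b" using t1(1) by auto
  have "((\<lambda>s. sys c (\<phi> s) (u s) - sys c (\<phi>' s) (u s)) has_integral ((\<phi> t1 - \<phi> \<tau>) - (\<phi>' t1 - \<phi>' \<tau>))) {\<tau>..t1}"
    unfolding \<phi>_def \<phi>'_def
    by (intro has_integral_diff phase_diff[OF ic c(1) \<tau>0 b(1,2) qb(1) t1'] phase_diff[OF ic' c(1) \<tau>0 b(1,2) qb(2) t1'])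
  then have hi: "((\<lambda>s. sys c (\<phi> s) (u s) - sys c (\<phi>' s) (u s)) has_integral (\<phi> t1 - \<phi>' t1)) {\<tau>..t1}"
    by (simp add: \<phi>\<tau>)
  have ui: "(\<lambda>t. 1 + norm (u t)) integrable_on {\<tau>..t1}"
    by (rule integrable_on_subinterval[OF square_integrable_absolutely(4)[OF u]]) (use t1' b \<tau>0 in auto)
  have "norm (integral {\<tau>..t1} (\<lambda>s. sys c (\<phi> s) (u s) - sys c (\<phi>' s) (u s))) \<le> integral {\<tau>..t1} (\<lambda>s. (L * D) * (1 + norm (u s)))"
  proof (rule Henstock_Kurzweil_Integration.integral_norm_bound_integral)
    show "(\<lambda>s. sys c (\<phi> s) (u s) - sys c (\<phi>' s) (u s)) integrable_on {\<tau>..t1}" using hi by (rule has_integral_integrable)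
    show "(\<lambda>s. (L * D) * (1 + norm (u s))) integrable_on {\<tau>..t1}" using integrable_cmul[OF ui, of "L * D"] by simp
    fix s assume "s \<in> {\<tau>..t1}"
    then have s: "s \<in> {\<tau>..b}" using t1' by auto
    have "norm (sys c (\<phi> s) (u s) - sys c (\<phi>' s) (u s)) \<le> L * (1 + norm (u s)) * norm (\<phi> s - \<phi>' s)"
      by (rule rL(4)[OF near(3,4)[OF s]])
    also have "\<dots> \<le> L * (1 + norm (u s)) * D"
      using t1(2) s rL(2) unfolding D_def by (intro mult_left_mono) auto
    finally show "norm (sys c (\<phi> s) (u s) - sys c (\<phi>' s) (u s)) \<le> (L * D) * (1 + norm (u s))" by (simp add: mult_ac)
  qed
  also have "\<dots> = L * D * integral {\<tau>..t1} (\<lambda>s. 1 + norm (u s))" by simp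
  also have "\<dots> \<le> L * D * (1 / (2 * L))"
  proof (rule mult_left_mono)
    show "integral {\<tau>..t1} (\<lambda>s. 1 + norm (u s)) \<le> 1 / (2 * L)"
      by (rule \<delta>(2)[OF u]) (use t1' b \<tau>0 \<eta> in \<open>auto simp: E_def\<close>)
  qed (use rL(2) in \<open>simp add: D_def\<close>)
  also have "\<dots> = D / 2" using rL(2) by simp
  finally have "D \<le> D / 2" using integral_unique[OF hi] by (simp add: D_def)
  then have D0: "D = 0" by (simp add: D_def)
  have agree: "q s = q' s" if s: "s \<in> {\<tau>..b}" for s
  proof -
    have "norm (\<phi> s - \<phi>' s) \<le> 0" using t1(2) s D0 by (auto simp: D_def)
    then have "\<phi> s = \<phi>' s" by simp
    then have e: "coords c (q s) = coords c (q' s)" by (simp add: \<phi>_def \<phi>'_def phase_def)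
    have "q s = param c (coords c (q s))" by (rule param_coords[OF c(1) near(1)[OF s], symmetric])
    also have "\<dots> = q' s" unfolding e by (rule param_coords[OF c(1) near(2)[OF s]])
    finally show ?thesis .
  qed
  have "\<exists>s\<in>F. s < \<tau> + \<eta>" by (rule cInf_lessD[OF F(3)]) (use \<eta> in \<open>simp add: \<tau>_def\<close>)
  then obtain s where s: "s \<in> F" "s < \<tau> + \<eta>" by blast
  have "\<tau> \<le> s" unfolding \<tau>_def by (rule cInf_lower[OF s(1) F(2)])
  then have "s \<in> {\<tau>..b}" using s by (auto simp: F_def b_def)
  from agree[OF this] s(1) show False by (simp add: F_def)
qed

text \<open>Uniqueness removes the arbitrary choice in \<open>trajectory_of\<close>, so that the
  cost can be computed along any known trajectory.\<close>

lemma trajectory_of_eq: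
  assumes tr: "is_trajectory A g W f T q0 v0 u q" and u: "u square_integrable_on {0..T}" and t: "t \<in> {0..T}"
  shows "trajectory_of A g W f T q0 v0 u t = q t"
    "velocity A {0..T} (trajectory_of A g W f T q0 v0 u) t = velocity A {0..T} q t"
proof -
  let ?q = "trajectory_of A g W f T q0 v0 u"
  have tr': "is_trajectory A g W f T q0 v0 u ?q" unfolding trajectory_of_def
    by (rule someI[of "is_trajectory A g W f T q0 v0 u", OF tr])
  have i: "q 0 = q0" "velocity A {0..T} q 0 = v0" "?q 0 = q0" "velocity A {0..T} ?q 0 = v0"
    using tr tr' unfolding is_trajectory_def Let_def by blast+
  have eq: "?q s = q s" if "s \<in> {0..T}" for s
    by (rule integral_curve_unique[OF trajectory_imp_integral_curve[OF tr'] trajectory_imp_integral_curve[OF tr] u _ _ that]) (simp_all add: i)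
  then show "?q t = q t" using t by blast
  show "velocity A {0..T} ?q t = velocity A {0..T} q t" by (rule velocity_local_cong[OF zero_less_one _ t]) (rule eq)
qed

end

section \<open>Compactness of trajectories\<close>

lemma finite_uniform_radius:
  fixes P :: "'i \<Rightarrow> real \<Rightarrow> bool"
  assumes "finite I" "\<And>i. i \<in> I \<Longrightarrow> \<exists>\<delta>>0. P i \<delta>" "\<And>i \<delta> \<delta>'. P i \<delta> \<Longrightarrow> 0 < \<delta>' \<Longrightarrow> \<delta>' \<le> \<delta> \<Longrightarrow> P i \<delta>'"
  shows "\<exists>\<delta>>0. \<forall>i\<in>I. P i \<delta>"
  using assms(1,2)
proof (induction rule: finite_induct)
  case empty
  show ?case by (intro exI[of _ 1]) auto
next
  case (insert i I)
  obtain \<delta>1 where 1: "\<delta>1 > 0" "P i \<delta>1" using insert.prems[of i] by auto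
  obtain \<delta>2 where 2: "\<delta>2 > 0" "\<forall>i\<in>I. P i \<delta>2" using insert.IH insert.prems by auto
  show ?case
    by (rule exI[of _ "min \<delta>1 \<delta>2"]) (use 1 2 in \<open>auto intro: assms(3)[of _ \<delta>1] assms(3)[of _ \<delta>2]\<close>)
qed

lemma dense_sequence_Icc:
  fixes T :: real
  assumes "0 \<le> T"
  obtains t :: "nat \<Rightarrow> real" where "range t \<subseteq> {0..T}" "\<And>s e. s \<in> {0..T} \<Longrightarrow> 0 < e \<Longrightarrow> \<exists>n. \<bar>t n - s\<bar> < e"
proof -
  \<comment> \<open>Clamping a rational to \<open>{0..T}\<close> does not increase its distance to
    points of the interval.\<close>
  define t where "t n = max 0 (min T (of_rat (nat_to_rat_surj n)))" for n
  show thesis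
  proof (rule that[of t])
    show "range t \<subseteq> {0..T}" using assms by (auto simp: t_def)
    fix s e :: real assume s: "s \<in> {0..T}" and e: "0 < e"
    obtain x where x: "s - e < of_rat x" "of_rat x < s + e" using of_rat_dense[of "s - e" "s + e"] e by auto
    obtain n where "x = nat_to_rat_surj n" using surj_nat_to_rat_surj by (metis surjE)
    moreover have "\<bar>max 0 (min T y) - s\<bar> \<le> \<bar>y - s\<bar>" for y using s by (auto simp: max_def min_def)
    ultimately have "\<bar>t n - s\<bar> \<le> \<bar>of_rat x - s\<bar>" by (simp add: t_def)
    then have "\<bar>t n - s\<bar> < e" using x by linarith
    then show "\<exists>n. \<bar>t n - s\<bar> < e" by blast
  qed
qed

context control_system
begin

text \<open>Sequential convergence in the tangent bundle, spelled out in coordinates. Vectors are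
  tested only in charts around the limit point, where the base points eventually lie.\<close>

definition tconv :: "(nat \<Rightarrow> 'a) \<Rightarrow> (nat \<Rightarrow> ('a, 'n) tvec) \<Rightarrow> 'a \<Rightarrow> ('a, 'n) tvec \<Rightarrow> bool" where
  "tconv q V p \<xi> \<longleftrightarrow> q \<longlonglongrightarrow> p \<and> (\<forall>c\<in>A. p \<in> chart_dom c \<longrightarrow> (\<lambda>k. V k c) \<longlonglongrightarrow> \<xi> c)"

lemma tconv_subseq:
  fixes r :: "nat \<Rightarrow> nat"
  assumes "tconv q V p \<xi>" "strict_mono r"
  shows "tconv (\<lambda>k. q (r k)) (\<lambda>k. V (r k)) p \<xi>"
  unfolding tconv_def
proof (intro conjI ballI impI)
  show "(\<lambda>k. q (r k)) \<longlonglongrightarrow> p"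
    using LIMSEQ_subseq_LIMSEQ[OF _ assms(2), of q p] assms(1) by (simp add: tconv_def o_def)
  fix c assume "c \<in> A" "p \<in> chart_dom c"
  then have "(\<lambda>k. V k c) \<longlonglongrightarrow> \<xi> c" using assms(1) unfolding tconv_def by blast
  from LIMSEQ_subseq_LIMSEQ[OF this assms(2)] show "(\<lambda>k. V (r k) c) \<longlonglongrightarrow> \<xi> c" by (simp add: o_def)
qed

lemma tconv_offset:
  assumes "tconv (\<lambda>k. q (k + n)) (\<lambda>k. V (k + n)) p \<xi>"
  shows "tconv q V p \<xi>"
  unfolding tconv_def
proof (intro conjI ballI impI)
  show "q \<longlonglongrightarrow> p" using assms LIMSEQ_offset unfolding tconv_def by blast
  fix c assume "c \<in> A" "p \<in> chart_dom c"
  then have "(\<lambda>k. V (k + n) c) \<longlonglongrightarrow> \<xi> c" using assms unfolding tconv_def by blast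
  then show "(\<lambda>k. V k c) \<longlonglongrightarrow> \<xi> c" by (rule LIMSEQ_offset[of "\<lambda>k. V k c"])
qed

lemma tconv_eventually_dom:
  assumes "tconv q V p \<xi>" "open U" "p \<in> U"
  shows "\<forall>\<^sub>F k in sequentially. q k \<in> U"
  by (rule topological_tendstoD[OF conjunct1[OF assms(1)[unfolded tconv_def]] assms(2,3)])

lemma tconv_phase:
  assumes tc: "tconv q V p \<xi>" and c: "c \<in> A" "p \<in> chart_dom c"
  shows "(\<lambda>k. phase c (q k) (V k)) \<longlonglongrightarrow> phase c p \<xi>"
proof -
  have "isCont (coords c) p"
    using continuous_on_coords[OF c(1)] c(2) open_chart_dom[OF c(1)] continuous_on_eq_continuous_at by blast
  then have "(\<lambda>k. coords c (q k)) \<longlonglongrightarrow> coords c p"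
    by (rule isCont_tendsto_compose) (use tc in \<open>simp add: tconv_def\<close>)
  moreover have "(\<lambda>k. V k c) \<longlonglongrightarrow> \<xi> c" using tc c unfolding tconv_def by blast
  ultimately show ?thesis unfolding phase_def by (rule tendsto_Pair)
qed

text \<open>Convergence in a single chart suffices, because derivatives of chart changes are jointly
  continuous in point and vector. The limit is found in coordinates and lifted back.\<close>

lemma tconv_from_chart:
  assumes c: "c \<in> A" and dom: "\<forall>\<^sub>F k in sequentially. q k \<in> chart_dom c"
    and tan: "\<And>k. V k \<in> tangent_space A (q k)"
    and lim: "(\<lambda>k. phase c (q k) (V k)) \<longlonglongrightarrow> z" and z: "fst z \<in> chart_range c"
  shows "tconv q V (param c (fst z)) (lift A c (param c (fst z)) (snd z))"
proof -
  define p where "p = param c (fst z)"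
  have p: "p \<in> chart_dom c" "coords c p = fst z"
    using param_in_dom[OF c z] coords_param[OF c z] by (auto simp: p_def)
  have lx: "(\<lambda>k. coords c (q k)) \<longlonglongrightarrow> fst z" using tendsto_fst[OF lim] by (simp add: phase_def)
  have ip: "isCont (param c) (fst z)"
    using continuous_on_param[OF c] z open_chart_range[OF c] continuous_on_eq_continuous_at by blast
  have lq: "q \<longlonglongrightarrow> p"
  proof (rule Lim_transform_eventually[of "\<lambda>k. param c (coords c (q k))"])
    show "(\<lambda>k. param c (coords c (q k))) \<longlonglongrightarrow> p" unfolding p_def by (rule isCont_tendsto_compose[OF ip lx])
    show "\<forall>\<^sub>F k in sequentially. param c (coords c (q k)) = q k"
      using dom by eventually_elim (rule param_coords[OF c])
  qed
  have "(\<lambda>k. V k d) \<longlonglongrightarrow> lift A c p (snd z) d" if d: "d \<in> A" "p \<in> chart_dom d" for d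
  proof -
    let ?S = "coords c ` (chart_dom c \<inter> chart_dom d)"
    let ?D = "\<lambda>y. frechet_derivative (coords d \<circ> param c) (at (fst y)) (snd y)"
    have "open (?S \<times> (UNIV :: (real^'n) set))" by (intro open_Times open_overlap[OF c open_chart_dom[OF d(1)]] open_UNIV)
    moreover have "z \<in> ?S \<times> UNIV" unfolding mem_Times_iff using p d by (auto intro!: image_eqI[of _ _ p])
    ultimately have "isCont ?D z"
      using continuous_on_transition_deriv[OF c d(1)] continuous_on_eq_continuous_at by blast
    then have "(\<lambda>k. ?D (phase c (q k) (V k))) \<longlonglongrightarrow> ?D z" by (rule isCont_tendsto_compose[OF _ lim])
    moreover have "?D z = lift A c p (snd z) d" using d p by (simp add: lift_def transition_deriv_def)
    moreover have "\<forall>\<^sub>F k in sequentially. ?D (phase c (q k) (V k)) = V k d"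
      using dom topological_tendstoD[OF lq open_chart_dom[OF d(1)] d(2)]
    proof eventually_elim
      case (elim k)
      show ?case
        using tangent_space_transition[OF tan c d(1) elim] by (simp add: phase_def transition_deriv_def)
    qed
    ultimately show ?thesis by (auto intro: Lim_transform_eventually)
  qed
  with lq show ?thesis unfolding tconv_def p_def by blast
qed

lemma openin_chart_set:
  assumes "c \<in> A" "open B"
  shows "openin (tangent_bundle_topology A) {(p, \<xi>) \<in> tangent_bundle A. p \<in> chart_dom c \<and> (coords c p, \<xi> c) \<in> B}"
  unfolding tangent_bundle_topology_def 
  by (rule topology_generated_by_Basis, rule CollectI, rule exI[of _ c], rule exI[of _ B], intro conjI refl assms)

text \<open>Each ball comes with its double inside the image of the same chart. This is the margin
  that curves starting in the ball may use up.\<close>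

lemma compact_finite_charts:
  assumes K: "compactin (tangent_bundle_topology A) K" "K \<subseteq> tangent_bundle A"
  obtains I where "finite I"
    "\<And>c z r. (c, z, r) \<in> I \<Longrightarrow> c \<in> A \<and> r > 0 \<and> cball z (2 * r) \<subseteq> chart_range c \<times> UNIV"
    "\<And>p \<xi>. (p, \<xi>) \<in> K \<Longrightarrow> \<exists>c z r. (c, z, r) \<in> I \<and> p \<in> chart_dom c \<and> phase c p \<xi> \<in> ball z r"
proof -
  define I0 where "I0 = {(c, z, r). c \<in> A \<and> r > 0 \<and> cball z (2 * r) \<subseteq> chart_range c \<times> (UNIV :: (real^'n) set)}"
  define B where "B = (\<lambda>(c, z, r). {(p, \<xi>) \<in> tangent_bundle A. p \<in> chart_dom c \<and> (coords c p, \<xi> c) \<in> ball z r})"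
  have op: "openin (tangent_bundle_topology A) u" if "u \<in> B ` I0" for u
  proof -
    obtain i where i: "i \<in> I0" "u = B i" using \<open>u \<in> B ` I0\<close> by (rule imageE)
    obtain c z r where czr: "i = (c, z, r)" by (rule prod_cases3)
    have "c \<in> A" using i(1) by (simp add: czr I0_def)
    from openin_chart_set[OF this open_ball[of z r]] show ?thesis by (simp add: i(2) czr B_def)
  qed
  have cov: "K \<subseteq> \<Union>(B ` I0)"
  proof
    fix x assume x: "x \<in> K"
    obtain p \<xi> where px: "x = (p, \<xi>)" by (cases x)
    obtain c where c: "c \<in> A" "p \<in> chart_dom c" using charts_cover by blast
    have op1: "open (chart_range c \<times> (UNIV :: (real^'n) set))" by (intro open_Times open_chart_range c open_UNIV)
    have "phase c p \<xi> \<in> chart_range c \<times> UNIV" using coords_in_range[OF c] by (simp add: phase_def)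
    from open_contains_cball[THEN iffD1, OF op1, THEN bspec, OF this]
    obtain e where e: "e > 0" "cball (phase c p \<xi>) e \<subseteq> chart_range c \<times> UNIV" by (elim exE conjE) (rule that)
    have "(c, phase c p \<xi>, e / 2) \<in> I0" using c e by (simp add: I0_def)
    moreover have "x \<in> B (c, phase c p \<xi>, e / 2)" using subsetD[OF K(2) x] px c e(1) by (simp add: B_def phase_def)
    ultimately show "x \<in> \<Union>(B ` I0)" by blast
  qed
  have "\<exists>F. finite F \<and> F \<subseteq> B ` I0 \<and> K \<subseteq> \<Union>F"
    by (rule K(1)[unfolded compactin_def, THEN conjunct2, THEN spec, THEN mp], intro conjI ballI op cov)
  then obtain F where F: "finite F" "F \<subseteq> B ` I0" "K \<subseteq> \<Union>F" by blast
  from finite_subset_image[OF F(1,2)] obtain I where I: "I \<subseteq> I0" "finite I" "F = B ` I" by blast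
  show thesis
  proof (rule that[OF I(2)])
    show "c \<in> A \<and> r > 0 \<and> cball z (2 * r) \<subseteq> chart_range c \<times> UNIV" if "(c, z, r) \<in> I" for c z r
      using subsetD[OF I(1) that] by (simp add: I0_def)
    show "\<exists>c z r. (c, z, r) \<in> I \<and> p \<in> chart_dom c \<and> phase c p \<xi> \<in> ball z r" if "(p, \<xi>) \<in> K" for p \<xi>
    proof -
      from that F(3) I(3) obtain i where i: "i \<in> I" "(p, \<xi>) \<in> B i" by blast
      obtain c z r where "i = (c, z, r)" by (rule prod_cases3)
      with i show ?thesis unfolding B_def phase_def by (intro exI[of _ c] exI[of _ z] exI[of _ r]) simp
    qed
  qed
qed

text \<open>The topology of the bundle is given only by generating sets, so sequential compactness
  is derived by hand: one of finitely many chart balls receives infinitely many terms, and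
  Bolzano-Weierstrass applies in a closed ball of coordinates.\<close>

lemma compact_seq_tconv:
  fixes q :: "nat \<Rightarrow> 'a"
  assumes K: "compactin (tangent_bundle_topology A) K" "K \<subseteq> tangent_bundle A"
    and z: "\<And>k. (q k, V k) \<in> K"
  obtains r :: "nat \<Rightarrow> nat" and p \<xi> where "strict_mono r" "\<xi> \<in> tangent_space A p" "tconv (\<lambda>k. q (r k)) (\<lambda>k. V (r k)) p \<xi>"
proof -
  have tan: "V k \<in> tangent_space A (q k)" for k using z K(2) by (auto simp: tangent_bundle_def)
  obtain I where I: "finite I"
    "\<And>c z r. (c, z, r) \<in> I \<Longrightarrow> c \<in> A \<and> r > 0 \<and> cball z (2 * r) \<subseteq> chart_range c \<times> UNIV"
    "\<And>p \<xi>. (p, \<xi>) \<in> K \<Longrightarrow> \<exists>c z r. (c, z, r) \<in> I \<and> p \<in> chart_dom c \<and> phase c p \<xi> \<in> ball z r"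
    by (rule compact_finite_charts[OF K]) (rule that)
  define S where "S = (\<lambda>(c, z, r). {k. q k \<in> chart_dom c \<and> phase c (q k) (V k) \<in> ball z r})"
  have "(\<Union>i\<in>I. S i) = UNIV"
  proof -
    have "k \<in> (\<Union>i\<in>I. S i)" for k
    proof -
      obtain c z0 e where "(c, z0, e) \<in> I" "q k \<in> chart_dom c \<and> phase c (q k) (V k) \<in> ball z0 e"
        using I(3)[OF z[of k]] by (elim exE conjE) (rule that, auto)
      then show ?thesis by (intro UN_I[of "(c, z0, e)"]) (simp_all add: S_def)
    qed
    then show ?thesis by blast
  qed
  note cov = this
  have "\<not> (\<forall>i\<in>I. finite (S i))"
  proof
    assume "\<forall>i\<in>I. finite (S i)"
    then have "finite (\<Union>i\<in>I. S i)" by (intro finite_UN_I[OF I(1)]) (rule bspec)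
    then show False unfolding cov by simp
  qed
  then obtain i0 where i0: "i0 \<in> I" "infinite (S i0)" by blast
  obtain c z0 e where "i0 = (c, z0, e)" by (rule prod_cases3)
  with i0 have i: "(c, z0, e) \<in> I" "infinite (S (c, z0, e))" by simp_all
  obtain r1 :: "nat \<Rightarrow> nat" where r1: "strict_mono r1" "\<And>n. r1 n \<in> S (c, z0, e)" using infinite_enumerate[OF i(2)] by blast
  have c: "c \<in> A" "e > 0" "cball z0 (2 * e) \<subseteq> chart_range c \<times> UNIV" using I(2)[OF i(1)] by auto
  have "phase c (q (r1 n)) (V (r1 n)) \<in> cball z0 (2 * e)" for n using r1(2)[of n] c(2) by (simp add: S_def)
  then have "\<forall>n. (\<lambda>n. phase c (q (r1 n)) (V (r1 n))) n \<in> cball z0 (2 * e)" by blast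
  note inb = this
  obtain l and r2 :: "nat \<Rightarrow> nat" where l: "l \<in> cball z0 (2 * e)" "strict_mono r2" "((\<lambda>n. phase c (q (r1 n)) (V (r1 n))) \<circ> r2) \<longlonglongrightarrow> l"
    by (rule seq_compactE[OF compact_imp_seq_compact[OF compact_cball] inb]) (rule that)
  show thesis
  proof (rule that)
    show "strict_mono (r1 \<circ> r2)" using r1(1) l(2) by (rule strict_mono_o)
    have fz: "fst l \<in> chart_range c" using subsetD[OF c(3) l(1)] by (simp add: mem_Times_iff)
    show "lift A c (param c (fst l)) (snd l) \<in> tangent_space A (param c (fst l))"
      by (rule lift_in_tangent_space[OF c(1) param_in_dom[OF c(1) fz]])
    show "tconv (\<lambda>k. q ((r1 \<circ> r2) k)) (\<lambda>k. V ((r1 \<circ> r2) k)) (param c (fst l)) (lift A c (param c (fst l)) (snd l))"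
    proof (rule tconv_from_chart[OF c(1) _ _ _ fz])
      show "\<forall>\<^sub>F k in sequentially. q ((r1 \<circ> r2) k) \<in> chart_dom c" using r1(2) by (simp add: S_def)
      show "V ((r1 \<circ> r2) k) \<in> tangent_space A (q ((r1 \<circ> r2) k))" for k by (rule tan)
      show "(\<lambda>k. phase c (q ((r1 \<circ> r2) k)) (V ((r1 \<circ> r2) k))) \<longlonglongrightarrow> l" using l(3) by (simp add: o_def)
    qed
  qed
qed

text \<open>If the limit were outside \<open>K\<close>, the open sets that the sequence eventually
  avoids would cover \<open>K\<close>; a finite subcover would then be avoided by terms that lie in
  \<open>K\<close>. A point of \<open>K\<close> is separated from the limit in the base or, over the
  same base point, by the vector entries in one chart.\<close>

lemma tconv_in_compact:
  assumes K: "compactin (tangent_bundle_topology A) K" "K \<subseteq> tangent_bundle A"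
    and z: "\<And>k. (q k, V k) \<in> K" and tc: "tconv q V p \<xi>" and \<xi>: "\<xi> \<in> tangent_space A p"
  shows "(p, \<xi>) \<in> K"
proof (rule ccontr)
  assume nK: "(p, \<xi>) \<notin> K"
  define \<U> where "\<U> = {u. openin (tangent_bundle_topology A) u \<and> (\<forall>\<^sub>F k in sequentially. (q k, V k) \<notin> u)}"
  have "K \<subseteq> \<Union>\<U>"
  proof
    fix x assume x: "x \<in> K"
    obtain p' \<xi>' where px: "x = (p', \<xi>')" by (cases x)
    have xT: "(p', \<xi>') \<in> tangent_bundle A" using x px K(2) by auto
    then have \<xi>': "\<xi>' \<in> tangent_space A p'" by (simp add: tangent_bundle_def)
    show "x \<in> \<Union>\<U>"
    proof (cases "p' = p")
      case False
      obtain U U' where U: "open U" "open U'" "p \<in> U" "p' \<in> U'" "U \<inter> U' = {}"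
        using hausdorff[OF False[symmetric]] by blast
      obtain c where c: "c \<in> A" "p' \<in> chart_dom c" using charts_cover by blast
      define u where "u = {(p, \<xi>) \<in> tangent_bundle A. p \<in> chart_dom c \<and> (coords c p, \<xi> c) \<in> coords c ` (chart_dom c \<inter> U') \<times> UNIV}"
      have "openin (tangent_bundle_topology A) u" unfolding u_def
        by (intro openin_chart_set c open_Times open_overlap U open_UNIV)
      moreover have "x \<in> u" using xT c U px by (simp add: u_def)
      moreover have "\<forall>\<^sub>F k in sequentially. (q k, V k) \<notin> u"
        using tconv_eventually_dom[OF tc U(1,3)]
      proof eventually_elim
        case (elim k)
        show ?case
        proof
          assume "(q k, V k) \<in> u"
          then have 1: "q k \<in> chart_dom c" and "coords c (q k) \<in> coords c ` (chart_dom c \<inter> U')" by (auto simp: u_def)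
          then obtain y where y: "y \<in> chart_dom c" "y \<in> U'" "coords c (q k) = coords c y" by auto
          have "q k = param c (coords c (q k))" by (rule param_coords[OF c(1) 1, symmetric])
          also have "\<dots> = y" unfolding y(3) by (rule param_coords[OF c(1) y(1)])
          finally show False using y(2) elim U(5) by auto
        qed
      qed
      ultimately show ?thesis unfolding \<U>_def by blast
    next
      case True
      then have "\<xi>' \<noteq> \<xi>" using nK x px by auto
      then obtain c where c: "\<xi>' c \<noteq> \<xi> c" unfolding fun_eq_iff by blast
      \<comment> \<open>Entries for other charts vanish for both vectors, so the index where they
        differ is a chart around \<open>p\<close>.\<close>
      have "\<not> (c \<notin> A \<or> p \<notin> chart_dom c)"
      proof
        assume "c \<notin> A \<or> p \<notin> chart_dom c"
        then have "\<xi> c = 0" "\<xi>' c = 0"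
          using tangent_space_outside[OF \<xi>, of c] tangent_space_outside[OF \<xi>', of c] True by simp_all
        then show False using c by simp
      qed
      then have cA: "c \<in> A" "p \<in> chart_dom c" by simp_all
      define e where "e = dist (\<xi>' c) (\<xi> c) / 2"
      have e: "e > 0" using c by (simp add: e_def)
      define u where "u = {(p, \<xi>) \<in> tangent_bundle A. p \<in> chart_dom c \<and> (coords c p, \<xi> c) \<in> UNIV \<times> ball (\<xi>' c) e}"
      have "openin (tangent_bundle_topology A) u" unfolding u_def
        by (intro openin_chart_set cA open_Times open_UNIV open_ball)
      moreover have "x \<in> u" using xT cA True px e by (simp add: u_def)
      moreover have "(\<lambda>k. V k c) \<longlonglongrightarrow> \<xi> c" using tc cA unfolding tconv_def by blast
      from tendstoD[OF this e] have "\<forall>\<^sub>F k in sequentially. (q k, V k) \<notin> u"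
      proof eventually_elim
        case (elim k)
        have "dist (\<xi>' c) (\<xi> c) \<le> dist (\<xi>' c) (V k c) + dist (V k c) (\<xi> c)" by (rule dist_triangle)
        then have "\<not> dist (\<xi>' c) (V k c) < e" using elim by (simp add: e_def)
        then show ?case by (simp add: u_def)
      qed
      ultimately show ?thesis unfolding \<U>_def by blast
    qed
  qed
  moreover have "\<forall>u\<in>\<U>. openin (tangent_bundle_topology A) u" by (simp add: \<U>_def)
  ultimately have "\<exists>F. finite F \<and> F \<subseteq> \<U> \<and> K \<subseteq> \<Union>F"
    by (intro K(1)[unfolded compactin_def, THEN conjunct2, THEN spec, THEN mp] conjI)
  then obtain F where F: "finite F" "F \<subseteq> \<U>" "K \<subseteq> \<Union>F" by blast
  have "\<forall>\<^sub>F k in sequentially. \<forall>u\<in>F. (q k, V k) \<notin> u"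
    by (rule eventually_ball_finite[OF F(1)]) (use subsetD[OF F(2)] in \<open>simp add: \<U>_def\<close>)
  then obtain k where "\<forall>u\<in>F. (q k, V k) \<notin> u" 
    unfolding eventually_sequentially by blast
  then show False using z[of k] F(3) by blast
qed

text \<open>\<open>M\<close> and \<open>\<delta>\<close> depend on the chart ball and the energy
  bound only; the same window serves every control and every curve passing through the inner
  ball.\<close>

lemma stays_uniformly:
  assumes c: "c \<in> A" and r: "r > 0" and sub: "cball z0 (2 * r) \<subseteq> chart_range c \<times> UNIV" and E: "0 \<le> E"
  obtains M \<delta> where "M > 0" "\<delta> > 0" "\<And>z w. z \<in> cball z0 (2 * r) \<Longrightarrow> norm (sys c z w) \<le> M * (1 + norm w)"
    "\<And>u q V t0 s. integral_curve u q V \<Longrightarrow> u square_integrable_on {0..T} \<Longrightarrow>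
      (\<integral>t. (norm (u t))\<^sup>2 \<partial>lebesgue_on {0..T}) \<le> E \<Longrightarrow> t0 \<in> {0..T} \<Longrightarrow> q t0 \<in> chart_dom c \<Longrightarrow>
      phase c (q t0) (V t0) \<in> ball z0 r \<Longrightarrow> s \<in> {0..T} \<Longrightarrow> \<bar>s - t0\<bar> \<le> \<delta> \<Longrightarrow>
      q s \<in> chart_dom c \<and> phase c (q s) (V s) \<in> ball z0 (2 * r)"
proof -
  obtain M where M: "M > 0" "\<And>z w. z \<in> cball z0 (2 * r) \<Longrightarrow> norm (sys c z w) \<le> M * (1 + norm w)"
    by (rule sys_bound[OF c compact_cball sub]) (rule that)
  have e: "0 < r / (2 * M)" using r M(1) by simp
  obtain \<delta> where \<delta>: "0 < \<delta>" "\<And>(u :: real \<Rightarrow> real^'m) s t. u square_integrable_on {0..T} \<Longrightarrow>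
     (\<integral>t. (norm (u t))\<^sup>2 \<partial>lebesgue_on {0..T}) \<le> E \<Longrightarrow> 0 \<le> s \<Longrightarrow> s \<le> t \<Longrightarrow> t \<le> T \<Longrightarrow> t - s \<le> \<delta> \<Longrightarrow>
     integral {s..t} (\<lambda>t. 1 + norm (u t)) \<le> r / (2 * M)"
    by (rule square_integrable_modulus[OF e E, where 'e = "real^'m" and a = 0 and b = T]) (rule that)
  show thesis
  proof (rule that[OF M(1) \<delta>(1) M(2)])
    fix u q V t0 s
    assume ic: "integral_curve u q V" and u: "u square_integrable_on {0..T}"
      and uE: "(\<integral>t. (norm (u t))\<^sup>2 \<partial>lebesgue_on {0..T}) \<le> E"
      and t0: "t0 \<in> {0..T}" "q t0 \<in> chart_dom c" "phase c (q t0) (V t0) \<in> ball z0 r"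
      and s: "s \<in> {0..T}" "\<bar>s - t0\<bar> \<le> \<delta>"
    show "q s \<in> chart_dom c \<and> phase c (q s) (V s) \<in> ball z0 (2 * r)"
    proof (rule phase_stays[OF ic u c r sub M(2) _ t0 s])
      fix a b :: real assume "0 \<le> a" "a \<le> b" "b \<le> T" "b - a \<le> \<delta>"
      from \<delta>(2)[OF u uE this] have "M * integral {a..b} (\<lambda>t. 1 + norm (u t)) \<le> M * (r / (2 * M))"
        using M(1) by (intro mult_left_mono) auto
      also have "\<dots> < r" using M(1) r by simp
      finally show "M * integral {a..b} (\<lambda>t. 1 + norm (u t)) < r" .
    qed
  qed
qed

lemma phase_set_closed:
  assumes c: "c \<in> A" and C: "compact C" "C \<subseteq> chart_range c \<times> (UNIV :: (real^'n) set)"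
  shows "closed (param c ` fst ` C)" "param c ` fst ` C \<subseteq> chart_dom c"
proof -
  have fr: "fst ` C \<subseteq> chart_range c" using image_mono[OF C(2), of fst] by (simp add: fst_image_times)
  have "compact (param c ` fst ` C)"
    by (intro compact_continuous_image continuous_on_subset[OF continuous_on_param[OF c] fr] continuous_on_fst continuous_on_id C(1))
  then show "closed (param c ` fst ` C)" by (rule compact_imp_closed)
  show "param c ` fst ` C \<subseteq> chart_dom c" using fr param_in_dom[OF c] by (meson image_subsetI subsetD)
qed

text \<open>States confined to a compact coordinate set cannot converge to a point outside the chart
  domain, since the corresponding set of positions is closed in the whole manifold.\<close>

lemma tconv_in_phase_set:
  assumes c: "c \<in> A" and C: "compact C" "C \<subseteq> chart_range c \<times> (UNIV :: (real^'n) set)"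
    and tc: "tconv q V p \<xi>"
    and ev: "\<forall>\<^sub>F k in sequentially. q k \<in> chart_dom c \<and> phase c (q k) (V k) \<in> C"
  shows "p \<in> chart_dom c" "phase c p \<xi> \<in> C"
proof -
  have ev': "\<forall>\<^sub>F k in sequentially. q k \<in> param c ` fst ` C"
    using ev
  proof eventually_elim
    case (elim k)
    have "q k = param c (fst (phase c (q k) (V k)))" using param_coords[OF c conjunct1[OF elim]] by (simp add: phase_def)
    then show ?case using conjunct2[OF elim] by blast
  qed
  have "p \<in> param c ` fst ` C"
    by (rule Lim_in_closed_set[OF phase_set_closed(1)[OF c C] ev' sequentially_bot]) (use tc in \<open>simp add: tconv_def\<close>)
  then show p: "p \<in> chart_dom c" using phase_set_closed(2)[OF c C] by (rule subsetD[rotated])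
  have ev'': "\<forall>\<^sub>F k in sequentially. phase c (q k) (V k) \<in> C" using ev by eventually_elim simp
  show "phase c p \<xi> \<in> C"
    by (rule Lim_in_closed_set[OF compact_imp_closed[OF C(1)] ev'' sequentially_bot tconv_phase[OF tc c p]])
qed

text \<open>Arzela-Ascoli on a manifold. A diagonal subsequence converges at a dense sequence of
  times; at any other time the states are compared, inside one chart, with those at nearby dense
  times, and equicontinuity makes them Cauchy.\<close>

lemma curves_compact:
  fixes u :: "nat \<Rightarrow> real \<Rightarrow> real ^ 'm"
  assumes K: "compactin (tangent_bundle_topology A) K" "K \<subseteq> tangent_bundle A"
    and ic: "\<And>k. integral_curve (u k) (q k) (V k)" and u: "\<And>k. u k square_integrable_on {0..T}"
    and uE: "\<And>k. (\<integral>t. (norm (u k t))\<^sup>2 \<partial>lebesgue_on {0..T}) \<le> E"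
    and qK: "\<And>k t. t \<in> {0..T} \<Longrightarrow> (q k t, V k t) \<in> K"
  obtains \<rho> Q X where "strict_mono \<rho>" "\<And>t. t \<in> {0..T} \<Longrightarrow> X t \<in> tangent_space A (Q t)"
    "\<And>t. t \<in> {0..T} \<Longrightarrow> tconv (\<lambda>k. q (\<rho> k) t) (\<lambda>k. V (\<rho> k) t) (Q t) (X t)"
proof -
  have T0: "0 \<le> T" using T by simp
  have E: "0 \<le> E" by (rule order_trans[OF Bochner_Integration.integral_nonneg uE[of 0]]) simp
  have tan: "V k t \<in> tangent_space A (q k t)" if "t \<in> {0..T}" for k t
    using subsetD[OF K(2) qK[OF that]] by (simp add: tangent_bundle_def)
  obtain t :: "nat \<Rightarrow> real" where t: "range t \<subseteq> {0..T}" "\<And>s e. s \<in> {0..T} \<Longrightarrow> 0 < e \<Longrightarrow> \<exists>n. \<bar>t n - s\<bar> < e"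
    by (rule dense_sequence_Icc[OF T0]) (rule that)
  have tT: "t n \<in> {0..T}" for n using t(1) by blast
  define P where "P n s \<longleftrightarrow> (\<exists>p \<xi>. \<xi> \<in> tangent_space A p \<and> tconv (\<lambda>k. q (s k) (t n)) (\<lambda>k. V (s k) (t n)) p \<xi>)"
    for n and s :: "nat \<Rightarrow> nat"
  interpret subseqs P
  proof
    fix n and s :: "nat \<Rightarrow> nat"
    obtain r p \<xi> where r: "strict_mono r" "\<xi> \<in> tangent_space A p" "tconv (\<lambda>k. q (s (r k)) (t n)) (\<lambda>k. V (s (r k)) (t n)) p \<xi>"
      by (rule compact_seq_tconv[OF K, of "\<lambda>k. q (s k) (t n)" "\<lambda>k. V (s k) (t n)", OF qK[OF tT]]) (rule that)
    show "\<exists>r'. strict_mono r' \<and> P n (s \<circ> r')"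
      unfolding P_def o_def using r by (intro exI[of _ r] conjI) (auto intro!: exI)
  qed
  define \<rho> where "\<rho> = diagseq"
  have \<rho>: "strict_mono \<rho>" unfolding \<rho>_def by (rule subseq_diagseq)
  have ct: "\<exists>p \<xi>. \<xi> \<in> tangent_space A p \<and> tconv (\<lambda>k. q (\<rho> k) (t n)) (\<lambda>k. V (\<rho> k) (t n)) p \<xi>" for n
  proof -
    \<comment> \<open>Only from index \<open>Suc n\<close> on is the diagonal sequence a subsequence
      of the one selected to satisfy \<open>P n\<close>; \<open>tconv_offset\<close> ignores the
      terms before.\<close>
    have "P n (diagseq \<circ> ((+) (Suc n)))"
    proof (rule diagseq_holds)
      fix r s :: "nat \<Rightarrow> nat" and n assume "strict_mono r" "P n s"
      then show "P n (s \<circ> r)"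
        unfolding P_def o_def using tconv_subseq[of "\<lambda>k. q (s k) (t n)" "\<lambda>k. V (s k) (t n)" _ _ r] by blast
    qed
    then have "P n (\<rho> \<circ> ((+) (Suc n)))" by (simp only: \<rho>_def)
    moreover have "\<rho> \<circ> ((+) (Suc n)) = (\<lambda>k. \<rho> (k + Suc n))" by (simp add: fun_eq_iff add.commute)
    ultimately have "P n (\<lambda>k. \<rho> (k + Suc n))" by simp
    then obtain p \<xi> where p: "\<xi> \<in> tangent_space A p"
      "tconv (\<lambda>k. q (\<rho> (k + Suc n)) (t n)) (\<lambda>k. V (\<rho> (k + Suc n)) (t n)) p \<xi>"
      unfolding P_def by (elim exE conjE) (rule that)
    show ?thesis using p(1) tconv_offset[OF p(2)] by blast
  qed
  obtain I where I: "finite I"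
    "\<And>c z r. (c, z, r) \<in> I \<Longrightarrow> c \<in> A \<and> r > 0 \<and> cball z (2 * r) \<subseteq> chart_range c \<times> UNIV"
    "\<And>p \<xi>. (p, \<xi>) \<in> K \<Longrightarrow> \<exists>c z r. (c, z, r) \<in> I \<and> p \<in> chart_dom c \<and> phase c p \<xi> \<in> ball z r"
    by (rule compact_finite_charts[OF K]) (rule that)
  define S where "S = (\<lambda>(c, z, r) \<delta>. \<forall>k. \<forall>t0\<in>{0..T}. \<forall>s\<in>{0..T}. q k t0 \<in> chart_dom c \<longrightarrow> phase c (q k t0) (V k t0) \<in> ball z r \<longrightarrow>
     \<bar>s - t0\<bar> \<le> \<delta> \<longrightarrow> q k s \<in> chart_dom c \<and> phase c (q k s) (V k s) \<in> ball z (2 * r))"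
  \<comment> \<open>One time step for all balls of the finite cover and all curves of the
    sequence.\<close>
  have "\<exists>\<delta>>0. \<forall>i\<in>I. S i \<delta>"
  proof (rule finite_uniform_radius[OF I(1)])
    fix i assume "i \<in> I"
    obtain c z r where i: "i = (c, z, r)" by (rule prod_cases3)
    have c: "c \<in> A" "r > 0" "cball z (2 * r) \<subseteq> chart_range c \<times> UNIV" using I(2) \<open>i \<in> I\<close> i by blast+
    obtain M \<delta> where \<delta>: "M > 0" "\<delta> > 0" "\<And>z' w. z' \<in> cball z (2 * r) \<Longrightarrow> norm (sys c z' w) \<le> M * (1 + norm w)"
    "\<And>u q V t0 s. integral_curve u q V \<Longrightarrow> u square_integrable_on {0..T} \<Longrightarrow>
      (\<integral>t. (norm (u t))\<^sup>2 \<partial>lebesgue_on {0..T}) \<le> E \<Longrightarrow> t0 \<in> {0..T} \<Longrightarrow> q t0 \<in> chart_dom c \<Longrightarrow>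
      phase c (q t0) (V t0) \<in> ball z r \<Longrightarrow> s \<in> {0..T} \<Longrightarrow> \<bar>s - t0\<bar> \<le> \<delta> \<Longrightarrow>
      q s \<in> chart_dom c \<and> phase c (q s) (V s) \<in> ball z (2 * r)"
      by (rule stays_uniformly[OF c E]) (rule that)
    show "\<exists>\<delta>>0. S i \<delta>"
      unfolding i S_def prod.case by (rule exI[of _ \<delta>], intro conjI \<delta>(2) allI ballI impI \<delta>(4)[OF ic u uE])
  next
    fix i \<delta> \<delta>' assume "S i \<delta>" "0 < \<delta>'" "\<delta>' \<le> \<delta>"
    moreover obtain c z r where i: "i = (c, z, r)" by (rule prod_cases3)
    ultimately show "S i \<delta>'" unfolding S_def i prod.case by (meson order_trans)
  qed
  then obtain \<delta> where \<delta>0: "\<delta> > 0" "\<forall>i\<in>I. S i \<delta>" by (elim exE conjE) (rule that)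
  have "q k s \<in> chart_dom c \<and> phase c (q k s) (V k s) \<in> ball z (2 * r)"
    if "(c, z, r) \<in> I" "t0 \<in> {0..T}" "s \<in> {0..T}" "q k t0 \<in> chart_dom c" "phase c (q k t0) (V k t0) \<in> ball z r" "\<bar>s - t0\<bar> \<le> \<delta>"
    for c z r k t0 s
    by (rule bspec[OF \<delta>0(2) that(1), unfolded S_def prod.case, rule_format, OF that(2-6)])
  note \<delta> = \<delta>0(1) this
  have conv: "\<exists>p \<xi>. \<xi> \<in> tangent_space A p \<and> tconv (\<lambda>k. q (\<rho> k) s) (\<lambda>k. V (\<rho> k) s) p \<xi>" if s: "s \<in> {0..T}" for s
  proof -
    obtain n where n: "\<bar>t n - s\<bar> < \<delta>" using t(2)[OF s \<delta>(1)] by blast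
    obtain p \<xi> where p: "\<xi> \<in> tangent_space A p" "tconv (\<lambda>k. q (\<rho> k) (t n)) (\<lambda>k. V (\<rho> k) (t n)) p \<xi>"
      using ct[of n] by (elim exE conjE) (rule that)
    \<comment> \<open>The limit at the dense time \<open>t n\<close> is again in \<open>K\<close>,
      hence in a ball of the cover. The curves are eventually in that ball at time
      \<open>t n\<close> and still in its double at time \<open>s\<close>.\<close>
    have "(p, \<xi>) \<in> K" by (rule tconv_in_compact[OF K qK[OF tT] p(2,1)])
    from I(3)[OF this] obtain c z r where czr: "(c, z, r) \<in> I" "p \<in> chart_dom c" "phase c p \<xi> \<in> ball z r"
      by (elim exE conjE) (rule that)
    have c: "c \<in> A" "r > 0" "cball z (2 * r) \<subseteq> chart_range c \<times> UNIV" using I(2)[OF czr(1)] by blast+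
    have ev: "\<forall>\<^sub>F k in sequentially. q (\<rho> k) (t n) \<in> chart_dom c \<and> phase c (q (\<rho> k) (t n)) (V (\<rho> k) (t n)) \<in> ball z r"
      by (intro eventually_conj tconv_eventually_dom[OF p(2) open_chart_dom[OF c(1)] czr(2)]
          topological_tendstoD[OF tconv_phase[OF p(2) c(1) czr(2)] open_ball czr(3)])
    have win: "\<forall>\<^sub>F k in sequentially. \<forall>s'\<in>{0..T}. \<bar>s' - t n\<bar> \<le> \<delta> \<longrightarrow>
        q (\<rho> k) s' \<in> chart_dom c \<and> phase c (q (\<rho> k) s') (V (\<rho> k) s') \<in> cball z (2 * r)"
      using ev
    proof eventually_elim
      case (elim k)
      show ?case
      proof (intro ballI impI)
        fix s' assume s': "s' \<in> {0..T}" "\<bar>s' - t n\<bar> \<le> \<delta>"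
        from \<delta>(2)[OF czr(1) tT s'(1) conjunct1[OF elim] conjunct2[OF elim] s'(2)]
        show "q (\<rho> k) s' \<in> chart_dom c \<and> phase c (q (\<rho> k) s') (V (\<rho> k) s') \<in> cball z (2 * r)"
          using ball_subset_cball by blast
      qed
    qed
    define \<phi> where "\<phi> k s' = phase c (q (\<rho> k) s') (V (\<rho> k) s')" for k s'
    obtain M where M: "M > 0" "\<And>z' w. z' \<in> cball z (2 * r) \<Longrightarrow> norm (sys c z' w) \<le> M * (1 + norm w)"
      by (rule sys_bound[OF c(1) compact_cball c(3)]) (rule that)
    have "Cauchy (\<lambda>k. \<phi> k s)"
    proof (rule metric_CauchyI)
      fix e :: real assume e: "0 < e"
      have e3: "0 < e / (4 * M)" using e M(1) by simp
      obtain \<eta> where \<eta>: "0 < \<eta>" "\<And>(u :: real \<Rightarrow> real^'m) s t. u square_integrable_on {0..T} \<Longrightarrow>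
         (\<integral>t. (norm (u t))\<^sup>2 \<partial>lebesgue_on {0..T}) \<le> E \<Longrightarrow> 0 \<le> s \<Longrightarrow> s \<le> t \<Longrightarrow> t \<le> T \<Longrightarrow> t - s \<le> \<eta> \<Longrightarrow>
         integral {s..t} (\<lambda>t. 1 + norm (u t)) \<le> e / (4 * M)"
        by (rule square_integrable_modulus[OF e3 E, where 'e = "real^'m" and a = 0 and b = T]) (rule that)
      \<comment> \<open>The second dense time \<open>t m\<close> must be near \<open>s\<close> for
        the modulus of continuity and also inside the window around \<open>t n\<close>.\<close>
      have "0 < min \<eta> (\<delta> - \<bar>t n - s\<bar>)" using \<eta>(1) n by simp
      from t(2)[OF s this] obtain m where m: "\<bar>t m - s\<bar> < \<eta>" "\<bar>t m - s\<bar> < \<delta> - \<bar>t n - s\<bar>" by auto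
      define l where "l = min s (t m)"
      define h where "h = max s (t m)"
      have lh: "0 \<le> l" "l \<le> h" "h \<le> T" "h - l \<le> \<eta>" using s tT[of m] m by (auto simp: l_def h_def)
      have lhw: "s' \<in> {0..T} \<and> \<bar>s' - t n\<bar> \<le> \<delta>" if "s' \<in> {l..h}" for s'
        using that lh m(2) by (auto simp: l_def h_def abs_if min_def max_def split: if_splits)
      have near: "\<forall>\<^sub>F k in sequentially. dist (\<phi> k s) (\<phi> k (t m)) \<le> e / 4"
        using win
      proof eventually_elim
        case (elim k)
        have qd: "q (\<rho> k) ` {l..h} \<subseteq> chart_dom c" using elim lhw by blast
        have "norm (phase c (q (\<rho> k) h) (V (\<rho> k) h) - phase c (q (\<rho> k) l) (V (\<rho> k) l)) \<le> M * integral {l..h} (\<lambda>t. 1 + norm (u (\<rho> k) t))"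
          by (rule phase_modulus[OF ic u c(1) lh(1-3) qd]) (use elim lhw M(2) in blast)
        also have "\<dots> \<le> M * (e / (4 * M))"
          using M(1) \<eta>(2)[OF u uE lh] by (intro mult_left_mono) auto
        also have "\<dots> = e / 4" using M(1) by simp
        finally have "dist (\<phi> k h) (\<phi> k l) \<le> e / 4" by (simp add: dist_norm \<phi>_def)
        then show ?case by (auto simp: l_def h_def dist_commute max_def min_def split: if_splits)
      qed
      obtain p' \<xi>' where p': "\<xi>' \<in> tangent_space A p'" "tconv (\<lambda>k. q (\<rho> k) (t m)) (\<lambda>k. V (\<rho> k) (t m)) p' \<xi>'"
        using ct[of m] by (elim exE conjE) (rule that)
      have evm: "\<forall>\<^sub>F k in sequentially. q (\<rho> k) (t m) \<in> chart_dom c \<and> phase c (q (\<rho> k) (t m)) (V (\<rho> k) (t m)) \<in> cball z (2 * r)"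
        using win by eventually_elim (use lhw[of "t m"] in \<open>simp add: l_def h_def\<close>)
      have "p' \<in> chart_dom c" by (rule tconv_in_phase_set(1)[OF c(1) compact_cball c(3) p'(2) evm])
      from tconv_phase[OF p'(2) c(1) this] have "(\<lambda>k. \<phi> k (t m)) \<longlonglongrightarrow> phase c p' \<xi>'" by (simp add: \<phi>_def)
      then have "\<forall>\<^sub>F k in sequentially. dist (\<phi> k (t m)) (phase c p' \<xi>') < e / 4" by (rule tendstoD) (use e in simp)
      with near have "\<forall>\<^sub>F k in sequentially. dist (\<phi> k s) (phase c p' \<xi>') < e / 2"
      proof eventually_elim
        case (elim k)
        then show ?case using dist_triangle[of "\<phi> k s" "phase c p' \<xi>'" "\<phi> k (t m)"] by simp
      qed
      then obtain N where N: "\<And>k. k \<ge> N \<Longrightarrow> dist (\<phi> k s) (phase c p' \<xi>') < e / 2"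
        unfolding eventually_sequentially by blast
      show "\<exists>N. \<forall>k\<ge>N. \<forall>l\<ge>N. dist (\<phi> k s) (\<phi> l s) < e"
      proof (intro exI[of _ N] allI impI)
        fix k l assume "k \<ge> N" "l \<ge> N"
        from N[OF this(1)] N[OF this(2)] show "dist (\<phi> k s) (\<phi> l s) < e"
          using dist_triangle2[of "\<phi> k s" "\<phi> l s" "phase c p' \<xi>'"] by linarith
      qed
    qed
    then obtain y where y: "(\<lambda>k. \<phi> k s) \<longlonglongrightarrow> y" using Cauchy_convergent_iff convergent_def by blast
    have sw: "\<bar>s - t n\<bar> \<le> \<delta>" using n by simp
    have evs: "\<forall>\<^sub>F k in sequentially. q (\<rho> k) s \<in> chart_dom c" "\<forall>\<^sub>F k in sequentially. \<phi> k s \<in> cball z (2 * r)"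
      using win by (eventually_elim; use s sw in \<open>simp add: \<phi>_def\<close>)+
    have "y \<in> cball z (2 * r)" by (rule Lim_in_closed_set[OF closed_cball evs(2) sequentially_bot y])
    then have fy: "fst y \<in> chart_range c" using subsetD[OF c(3)] by (simp add: mem_Times_iff)
    show ?thesis
      using tconv_from_chart[OF c(1) evs(1) tan[OF s] y[unfolded \<phi>_def] fy]
        lift_in_tangent_space[OF c(1) param_in_dom[OF c(1) fy]] by blast
  qed
  have "\<forall>s. \<exists>x. s \<in> {0..T} \<longrightarrow> snd x \<in> tangent_space A (fst x) \<and> tconv (\<lambda>k. q (\<rho> k) s) (\<lambda>k. V (\<rho> k) s) (fst x) (snd x)"
  proof
    fix s
    show "\<exists>x. s \<in> {0..T} \<longrightarrow> snd x \<in> tangent_space A (fst x) \<and> tconv (\<lambda>k. q (\<rho> k) s) (\<lambda>k. V (\<rho> k) s) (fst x) (snd x)"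
    proof (cases "s \<in> {0..T}")
      case True
      from conv[OF this] obtain p \<xi> where "\<xi> \<in> tangent_space A p \<and> tconv (\<lambda>k. q (\<rho> k) s) (\<lambda>k. V (\<rho> k) s) p \<xi>" by blast
      then show ?thesis by (intro exI[of _ "(p, \<xi>)"]) simp
    qed blast
  qed
  from choice[OF this] obtain x where x: "\<forall>s. s \<in> {0..T} \<longrightarrow> snd (x s) \<in> tangent_space A (fst (x s)) \<and>
     tconv (\<lambda>k. q (\<rho> k) s) (\<lambda>k. V (\<rho> k) s) (fst (x s)) (snd (x s))" ..
  show thesis
    by (rule that[OF \<rho>, of "\<lambda>s. snd (x s)" "\<lambda>s. fst (x s)"]) (use x in simp_all)
qed

end

section \<open>Limits of trajectories\<close>

context control_system
begin

text \<open>The chart is prescribed and is not taken from the finite cover of \<open>K\<close>,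
  because the integrated equation has to be verified in every chart. The ball is therefore built
  around the limit state itself.\<close>

lemma limit_window:
  fixes u :: "nat \<Rightarrow> real \<Rightarrow> real ^ 'm"
  assumes ic: "\<And>k. integral_curve (u k) (q k) (V k)" and u: "\<And>k. u k square_integrable_on {0..T}"
    and uE: "\<And>k. (\<integral>t. (norm (u k t))\<^sup>2 \<partial>lebesgue_on {0..T}) \<le> E" and E: "0 \<le> E"
    and tc: "\<And>t. t \<in> {0..T} \<Longrightarrow> tconv (\<lambda>k. q k t) (\<lambda>k. V k t) (Q t) (X t)"
    and t0: "t0 \<in> {0..T}" and c: "c \<in> A" "Q t0 \<in> chart_dom c"
  obtains \<delta> C M where "\<delta> > 0" "M > 0" "compact C" "C \<subseteq> chart_range c \<times> UNIV"
    "\<And>z w. z \<in> C \<Longrightarrow> norm (sys c z w) \<le> M * (1 + norm w)"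
    "\<And>s. s \<in> {0..T} \<Longrightarrow> \<bar>s - t0\<bar> \<le> \<delta> \<Longrightarrow> Q s \<in> chart_dom c \<and> phase c (Q s) (X s) \<in> C"
    "\<forall>\<^sub>F k in sequentially. \<forall>s\<in>{0..T}. \<bar>s - t0\<bar> \<le> \<delta> \<longrightarrow> q k s \<in> chart_dom c \<and> phase c (q k s) (V k s) \<in> C"
proof -
  define z where "z = phase c (Q t0) (X t0)"
  have op: "open (chart_range c \<times> (UNIV :: (real^'n) set))" by (intro open_Times open_chart_range c open_UNIV)
  have "z \<in> chart_range c \<times> UNIV" using coords_in_range[OF c] by (simp add: z_def phase_def)
  from open_contains_cball[THEN iffD1, OF op, THEN bspec, OF this]
  obtain e where e: "e > 0" "cball z e \<subseteq> chart_range c \<times> UNIV" by (elim exE conjE) (rule that)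
  define r where "r = e / 2"
  have r: "r > 0" "cball z (2 * r) \<subseteq> chart_range c \<times> UNIV" using e by (simp_all add: r_def)
  obtain M \<delta> where M: "M > 0" "\<delta> > 0" "\<And>z' w. z' \<in> cball z (2 * r) \<Longrightarrow> norm (sys c z' w) \<le> M * (1 + norm w)"
    "\<And>u q V t0 s. integral_curve u q V \<Longrightarrow> u square_integrable_on {0..T} \<Longrightarrow>
      (\<integral>t. (norm (u t))\<^sup>2 \<partial>lebesgue_on {0..T}) \<le> E \<Longrightarrow> t0 \<in> {0..T} \<Longrightarrow> q t0 \<in> chart_dom c \<Longrightarrow>
      phase c (q t0) (V t0) \<in> ball z r \<Longrightarrow> s \<in> {0..T} \<Longrightarrow> \<bar>s - t0\<bar> \<le> \<delta> \<Longrightarrow>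
      q s \<in> chart_dom c \<and> phase c (q s) (V s) \<in> ball z (2 * r)"
    by (rule stays_uniformly[OF c(1) r E]) (rule that)
  have zb: "phase c (Q t0) (X t0) \<in> ball z r" using r(1) by (simp add: z_def)
  have "\<forall>\<^sub>F k in sequentially. q k t0 \<in> chart_dom c \<and> phase c (q k t0) (V k t0) \<in> ball z r"
    by (intro eventually_conj tconv_eventually_dom[OF tc[OF t0] open_chart_dom[OF c(1)] c(2)]
          topological_tendstoD[OF tconv_phase[OF tc[OF t0] c] open_ball zb])
  then have ev: "\<forall>\<^sub>F k in sequentially. \<forall>s\<in>{0..T}. \<bar>s - t0\<bar> \<le> \<delta> \<longrightarrow> q k s \<in> chart_dom c \<and> phase c (q k s) (V k s) \<in> cball z (2 * r)"
  proof eventually_elim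
    case (elim k)
    show ?case
    proof (intro ballI impI)
      fix s assume "s \<in> {0..T}" "\<bar>s - t0\<bar> \<le> \<delta>"
      from M(4)[OF ic u uE t0 conjunct1[OF elim] conjunct2[OF elim] this]
      show "q k s \<in> chart_dom c \<and> phase c (q k s) (V k s) \<in> cball z (2 * r)" using ball_subset_cball by blast
    qed
  qed
  show thesis
  proof (rule that[OF M(2,1) compact_cball r(2) M(3) _ ev])
    fix s assume s: "s \<in> {0..T}" "\<bar>s - t0\<bar> \<le> \<delta>"
    have ev': "\<forall>\<^sub>F k in sequentially. q k s \<in> chart_dom c \<and> phase c (q k s) (V k s) \<in> cball z (2 * r)"
      using ev by eventually_elim (use s in simp)
    show "Q s \<in> chart_dom c \<and> phase c (Q s) (X s) \<in> cball z (2 * r)"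
      using tconv_in_phase_set[OF c(1) compact_cball r(2) tc[OF s(1)] ev'] by blast
  qed
qed

text \<open>\<open>b k\<close> tends to 0 in \<open>L2\<close> by dominated convergence, while
  \<open>u k\<close> is merely bounded there. Young's inequality with weight \<open>\<kappa>\<close>
  leaves half of \<open>e\<close> for each factor.\<close>

lemma integral_product_tendsto_0:
  fixes u b :: "nat \<Rightarrow> real \<Rightarrow> 'e::euclidean_space"
  assumes int: "\<And>k. (\<lambda>t. u k t \<bullet> b k t) integrable_on {s..s'}"
    and usq: "\<And>k. (\<lambda>t. (norm (u k t))\<^sup>2) integrable_on {s..s'}" "\<And>k. integral {s..s'} (\<lambda>t. (norm (u k t))\<^sup>2) \<le> E"
    and bc: "\<And>k. continuous_on {s..s'} (b k)" and bB: "\<And>k t. t \<in> {s..s'} \<Longrightarrow> norm (b k t) \<le> B"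
    and b0: "\<And>t. t \<in> {s..s'} \<Longrightarrow> (\<lambda>k. b k t) \<longlonglongrightarrow> 0"
  shows "(\<lambda>k. integral {s..s'} (\<lambda>t. u k t \<bullet> b k t)) \<longlonglongrightarrow> 0"
proof (rule LIMSEQ_I)
  fix e :: real assume e: "0 < e"
  have E: "0 \<le> E" by (rule order_trans[OF Henstock_Kurzweil_Integration.integral_nonneg[OF usq(1)] usq(2)[of 0]]) simp
  define \<kappa> where "\<kappa> = e / (2 * (E + 1))"
  have \<kappa>: "\<kappa> > 0" using e E by (simp add: \<kappa>_def)
  have "\<kappa> * E = e / 2 * (E / (E + 1))" by (simp add: \<kappa>_def)
  also have "\<dots> \<le> e / 2 * 1" using e E by (intro mult_left_mono) auto
  finally have \<kappa>E: "\<kappa> * E \<le> e / 2" by simp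
  have b2: "(\<lambda>t. (norm (b k t))\<^sup>2) integrable_on {s..s'}" for k
    by (intro integrable_continuous_interval continuous_intros bc)
  have "(\<lambda>k. integral {s..s'} (\<lambda>t. (norm (b k t))\<^sup>2)) \<longlonglongrightarrow> integral {s..s'} (\<lambda>t. 0)"
  proof (rule dominated_convergence(2)[where h = "\<lambda>_. B\<^sup>2"])
    show "norm ((norm (b k t))\<^sup>2) \<le> B\<^sup>2" if "t \<in> {s..s'}" for k t
      using bB[OF that, of k] by (simp add: power_mono)
    show "(\<lambda>k. (norm (b k t))\<^sup>2) \<longlonglongrightarrow> 0" if "t \<in> {s..s'}" for t
      using tendsto_power[OF tendsto_norm[OF b0[OF that]], of 2] by simp
  qed (use b2 in auto)
  then have "(\<lambda>k. integral {s..s'} (\<lambda>t. (norm (b k t))\<^sup>2)) \<longlonglongrightarrow> 0" by simp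
  from LIMSEQ_D[OF this, of "e / 2 * \<kappa>"] e \<kappa> obtain N where N: "\<And>k. k \<ge> N \<Longrightarrow> norm (integral {s..s'} (\<lambda>t. (norm (b k t))\<^sup>2) - 0) < e / 2 * \<kappa>"
    by auto
  show "\<exists>N. \<forall>k\<ge>N. norm (integral {s..s'} (\<lambda>t. u k t \<bullet> b k t) - 0) < e"
  proof (intro exI[of _ N] allI impI)
    fix k assume k: "N \<le> k"
    have k1: "(\<lambda>t. \<kappa> * (norm (u k t))\<^sup>2) integrable_on {s..s'}" using integrable_cmul[OF usq(1), of \<kappa>] by simp
    have k2: "(\<lambda>t. (1 / \<kappa>) * (norm (b k t))\<^sup>2) integrable_on {s..s'}" using integrable_cmul[OF b2, of "1 / \<kappa>"] by simp
    have "norm (integral {s..s'} (\<lambda>t. u k t \<bullet> b k t)) \<le> integral {s..s'} (\<lambda>t. \<kappa> * (norm (u k t))\<^sup>2 + (1 / \<kappa>) * (norm (b k t))\<^sup>2)"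
    proof (rule Henstock_Kurzweil_Integration.integral_norm_bound_integral[OF int Henstock_Kurzweil_Integration.integrable_add[OF k1 k2]])
      fix t assume "t \<in> {s..s'}"
      have "norm (u k t \<bullet> b k t) \<le> norm (u k t) * norm (b k t)" by (simp add: Cauchy_Schwarz_ineq2)
      also have "\<dots> \<le> \<kappa> * (norm (u k t))\<^sup>2 + (1 / \<kappa>) * (norm (b k t))\<^sup>2"
      proof -
        have "x * y \<le> \<kappa> * x\<^sup>2 + (1 / \<kappa>) * y\<^sup>2" if "0 \<le> x" "0 \<le> y" for x y :: real
        proof -
          have "0 \<le> (\<kappa> * x - y)\<^sup>2" by simp
          then have "2 * (\<kappa> * x * y) \<le> (\<kappa> * x)\<^sup>2 + y\<^sup>2" by (simp add: power2_eq_square algebra_simps)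
          moreover have "0 \<le> \<kappa> * x * y" using \<kappa> that by simp
          ultimately have "\<kappa> * (x * y) \<le> \<kappa> * (\<kappa> * x\<^sup>2 + (1 / \<kappa>) * y\<^sup>2)"
            using \<kappa> by (simp add: power2_eq_square algebra_simps)
          then show ?thesis using \<kappa> by simp
        qed
        then show ?thesis by simp
      qed
      finally show "norm (u k t \<bullet> b k t) \<le> \<kappa> * (norm (u k t))\<^sup>2 + (1 / \<kappa>) * (norm (b k t))\<^sup>2" .
    qed
    also have "\<dots> = \<kappa> * integral {s..s'} (\<lambda>t. (norm (u k t))\<^sup>2) + (1 / \<kappa>) * integral {s..s'} (\<lambda>t. (norm (b k t))\<^sup>2)"
      by (subst Henstock_Kurzweil_Integration.integral_add[OF k1 k2]) simp
    also have "\<dots> \<le> \<kappa> * E + (1 / \<kappa>) * integral {s..s'} (\<lambda>t. (norm (b k t))\<^sup>2)"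
      using usq(2)[of k] \<kappa> by simp
    also have "\<dots> < e / 2 + (1 / \<kappa>) * (e / 2 * \<kappa>)"
      using N[OF k] \<kappa> by (intro add_le_less_mono \<kappa>E mult_strict_left_mono) auto
    also have "\<dots> = e" using \<kappa> by simp
    finally show "norm (integral {s..s'} (\<lambda>t. u k t \<bullet> b k t) - 0) < e" by simp
  qed
qed

text \<open>Row \<open>i\<close> of the matrix of control fields. A component of the control term
  thus becomes an inner product with \<open>w\<close>, the form in which the limit control can be
  tested.\<close>

definition ctrl_row :: "('a, 'n) chart \<Rightarrow> 'n \<Rightarrow> real ^ 'n \<Rightarrow> real ^ 'm" where
  "ctrl_row c i x = (\<chi> j. ctrl c j x $ i)"

lemma sys_component: "snd (sys c z w) $ i = drift c z $ i + w \<bullet> ctrl_row c i (fst z)"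
  by (simp add: sys_def ctrl_row_def inner_vec_def)

lemma continuous_on_ctrl_row: "c \<in> A \<Longrightarrow> continuous_on (chart_range c) (ctrl_row c i)"
  unfolding ctrl_row_def by (intro continuous_on_vec_lambda continuous_on_component continuous_on_ctrl)

text \<open>The state converges pointwise and boundedly in the chart, so only the terms linear in the
  control need an argument beyond dominated convergence.\<close>

lemma limit_integral_eq_window:
  fixes u :: "nat \<Rightarrow> real \<Rightarrow> real ^ 'm"
  assumes ic: "\<And>k. integral_curve (u k) (q k) (V k)" and u: "\<And>k. u k square_integrable_on {0..T}"
    and uE: "\<And>k. (\<integral>t. (norm (u k t))\<^sup>2 \<partial>lebesgue_on {0..T}) \<le> E"
    and v: "v square_integrable_on {0..T}"
    and weak: "\<And>\<phi> B l. \<phi> \<in> borel_measurable (lebesgue_on {0..T}) \<Longrightarrow> (\<And>t. norm (\<phi> t) \<le> B) \<Longrightarrow>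
       (\<lambda>k. \<integral>t. u k t \<bullet> \<phi> t \<partial>lebesgue_on {0..T}) \<longlonglongrightarrow> l \<Longrightarrow> (\<integral>t. v t \<bullet> \<phi> t \<partial>lebesgue_on {0..T}) = l"
    and c: "c \<in> A" and C: "compact C" "C \<subseteq> chart_range c \<times> UNIV"
    and s: "0 \<le> s" "s \<le> s'" "s' \<le> T"
    and win: "\<And>k t. t \<in> {s..s'} \<Longrightarrow> q k t \<in> chart_dom c \<and> phase c (q k t) (V k t) \<in> C"
    and Z: "continuous_on {s..s'} Z" "\<And>t. t \<in> {s..s'} \<Longrightarrow> Z t \<in> C"
    and lim: "\<And>t. t \<in> {s..s'} \<Longrightarrow> (\<lambda>k. phase c (q k t) (V k t)) \<longlonglongrightarrow> Z t"
  shows "((\<lambda>t. sys c (Z t) (v t)) has_integral (Z s' - Z s)) {s..s'}"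
proof -
  define \<phi> where "\<phi> k t = phase c (q k t) (V k t)" for k t
  have sub: "{s..s'} \<subseteq> {0..T}" using s by auto
  have qd: "q k ` {s..s'} \<subseteq> chart_dom c" for k using win by auto
  have \<phi>c: "continuous_on {s..s'} (\<phi> k)" for k
    unfolding \<phi>_def by (rule phase_continuous[OF ic c s qd])
  have \<phi>C: "\<phi> k t \<in> C" if "t \<in> {s..s'}" for k t using win[OF that] by (simp add: \<phi>_def)
  have \<phi>Z: "(\<lambda>k. \<phi> k t) \<longlonglongrightarrow> Z t" if "t \<in> {s..s'}" for t using lim[OF that] by (simp add: \<phi>_def)
  have op: "open (chart_range c \<times> (UNIV :: (real^'n) set))" by (intro open_Times open_chart_range c open_UNIV)
  have comp: "continuous_on {s..s'} (\<lambda>t. F (\<phi> k t))" "continuous_on {s..s'} (\<lambda>t. F (Z t))"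
    "\<exists>B. \<forall>z\<in>C. norm (F z) \<le> B" "\<And>t. t \<in> {s..s'} \<Longrightarrow> (\<lambda>k. F (\<phi> k t)) \<longlonglongrightarrow> F (Z t)"
    if F: "continuous_on (chart_range c \<times> UNIV) F" for F :: "(real^'n) \<times> (real^'n) \<Rightarrow> 'e::real_normed_vector" and k
  proof -
    have FC: "continuous_on C F" by (rule continuous_on_subset[OF F C(2)])
    show "continuous_on {s..s'} (\<lambda>t. F (\<phi> k t))"
      by (rule continuous_on_compose2[where g = F and f = "\<phi> k", OF FC \<phi>c]) (use \<phi>C in blast)
    show "continuous_on {s..s'} (\<lambda>t. F (Z t))"
      by (rule continuous_on_compose2[where g = F and f = Z, OF FC Z(1)]) (use Z(2) in blast)
    show "\<exists>B. \<forall>z\<in>C. norm (F z) \<le> B"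
      using compact_imp_bounded[OF compact_continuous_image[OF FC C(1)]] unfolding bounded_iff ball_simps(9) .
    fix t assume t: "t \<in> {s..s'}"
    have "isCont F (Z t)"
      by (rule continuous_on_eq_continuous_at[OF op, THEN iffD1, OF F, THEN bspec, OF subsetD[OF C(2) Z(2)[OF t]]])
    then show "(\<lambda>k. F (\<phi> k t)) \<longlonglongrightarrow> F (Z t)" by (rule isCont_tendsto_compose[OF _ \<phi>Z[OF t]])
  qed
  have dom: "(\<lambda>k. integral {s..s'} (\<lambda>t. F (\<phi> k t))) \<longlonglongrightarrow> integral {s..s'} (\<lambda>t. F (Z t))"
    if F: "continuous_on (chart_range c \<times> UNIV) F" for F :: "(real^'n) \<times> (real^'n) \<Rightarrow> 'e::euclidean_space"
  proof -
    obtain B where B: "\<forall>z\<in>C. norm (F z) \<le> B" using comp(3)[OF F] by blast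
    show ?thesis
    proof (rule dominated_convergence(2)[where h = "\<lambda>_. B"])
      show "(\<lambda>t. F (\<phi> k t)) integrable_on {s..s'}" for k by (rule integrable_continuous_interval[OF comp(1)[OF F]])
      show "norm (F (\<phi> k t)) \<le> B" if "t \<in> {s..s'}" for k t using B \<phi>C[OF that] by blast
      show "(\<lambda>k. F (\<phi> k t)) \<longlonglongrightarrow> F (Z t)" if "t \<in> {s..s'}" for t by (rule comp(4)[OF F that])
    qed (rule integrable_const_ivl)
  qed
  have hi: "((\<lambda>t. sys c (\<phi> k t) (u k t)) has_integral (\<phi> k s' - \<phi> k s)) {s..s'}" for k
    unfolding \<phi>_def by (rule phase_diff[OF ic c s qd order_refl s(2) order_refl])
  have \<phi>d: "(\<lambda>k. \<phi> k s' - \<phi> k s) \<longlonglongrightarrow> Z s' - Z s" using s by (intro tendsto_diff \<phi>Z) auto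
  have cf: "continuous_on (chart_range c \<times> UNIV) (\<lambda>z::(real^'n)\<times>(real^'n). snd z)" by (intro continuous_on_snd continuous_on_id)
  have "integral {s..s'} (\<lambda>t. snd (Z t)) = fst (Z s' - Z s)"
  proof (rule LIMSEQ_unique[OF dom[OF cf]])
    have "integral {s..s'} (\<lambda>t. snd (\<phi> k t)) = fst (\<phi> k s' - \<phi> k s)" for k
      using has_integral_linear[OF hi bounded_linear_fst] by (simp add: o_def sys_def integral_unique)
    then show "(\<lambda>k. integral {s..s'} (\<lambda>t. snd (\<phi> k t))) \<longlonglongrightarrow> fst (Z s' - Z s)" using tendsto_fst[OF \<phi>d] by simp
  qed
  moreover have "(\<lambda>t. snd (Z t)) integrable_on {s..s'}" by (rule integrable_continuous_interval[OF comp(2)[OF cf]])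
  ultimately have H1: "((\<lambda>t. snd (Z t)) has_integral fst (Z s' - Z s)) {s..s'}" by (metis integrable_integral)
  have ctrl_int: "(\<lambda>t. w t \<bullet> b t) absolutely_integrable_on {s..s'}"
    if w: "w square_integrable_on {0..T}" and b: "continuous_on {s..s'} b" for w b :: "real \<Rightarrow> real ^ 'm"
  proof -
    have "(\<lambda>t. b t \<bullet> w t) absolutely_integrable_on {s..s'}"
    proof (rule absolutely_integrable_bounded_measurable_product[where h = "(\<bullet>)"])
      show "bilinear ((\<bullet>) :: real^'m \<Rightarrow> _)" by (simp add: bilinear_conv_bounded_bilinear bounded_bilinear_inner)
      show "b \<in> borel_measurable (lebesgue_on {s..s'})" using b by (rule continuous_imp_measurable_on_sets_lebesgue) auto
      show "bounded (b ` {s..s'})" using compact_continuous_image[OF b] compact_imp_bounded by auto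
      show "w absolutely_integrable_on {s..s'}"
        by (rule absolutely_integrable_on_subinterval[OF square_integrable_absolutely(1)[OF w] sub])
    qed auto
    then show ?thesis by (simp add: inner_commute)
  qed
  have H2: "((\<lambda>t. snd (sys c (Z t) (v t)) $ i) has_integral snd (Z s' - Z s) $ i) {s..s'}" for i
  proof -
    define b where "b t = ctrl_row c i (fst (Z t))" for t
    define bk where "bk k t = ctrl_row c i (fst (\<phi> k t))" for k t
    have rc: "continuous_on (chart_range c \<times> UNIV) (\<lambda>z::(real^'n)\<times>(real^'n). ctrl_row c i (fst z))"
      by (rule continuous_on_compose2[where g = "ctrl_row c i" and f = fst, OF continuous_on_ctrl_row[OF c] continuous_on_fst[OF continuous_on_id]])
        (simp add: fst_image_times)
    have bc: "continuous_on {s..s'} b" "continuous_on {s..s'} (bk k)" for k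
      unfolding b_def bk_def by (rule comp(2)[OF rc], rule comp(1)[OF rc])
    obtain B where B: "\<forall>z\<in>C. norm (ctrl_row c i (fst z)) \<le> B" using comp(3)[OF rc] by blast
    have dc: "continuous_on (chart_range c \<times> UNIV) (\<lambda>z. drift c z $ i)"
      by (intro continuous_on_component continuous_on_drift c)
    have di: "(\<lambda>t. drift c (\<phi> k t) $ i) integrable_on {s..s'}" "(\<lambda>t. drift c (Z t) $ i) integrable_on {s..s'}" for k
      by (rule integrable_continuous_interval[OF comp(1)[OF dc]], rule integrable_continuous_interval[OF comp(2)[OF dc]])
    have ik: "(\<lambda>t. u k t \<bullet> bk k t) integrable_on {s..s'}" "(\<lambda>t. u k t \<bullet> b t) integrable_on {s..s'}" "(\<lambda>t. v t \<bullet> b t) integrable_on {s..s'}" for k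
      using ctrl_int[OF u bc(2)] ctrl_int[OF u bc(1)] ctrl_int[OF v bc(1)] by (blast intro: set_lebesgue_integral_eq_integral(1))+
    \<comment> \<open>The integrated equation expresses the control term by increments and drift of
      the state. Both converge, so the integrals of the control term do as well, to the
      \<open>l\<close> defined below.\<close>
    have e1: "integral {s..s'} (\<lambda>t. u k t \<bullet> bk k t) = snd (\<phi> k s' - \<phi> k s) $ i - integral {s..s'} (\<lambda>t. drift c (\<phi> k t) $ i)" for k
    proof -
      have "((\<lambda>t. snd (sys c (\<phi> k t) (u k t)) $ i) has_integral snd (\<phi> k s' - \<phi> k s) $ i) {s..s'}"
        using has_integral_linear[OF hi bounded_linear_compose[OF bounded_linear_vec_nth bounded_linear_snd]] by (simp add: o_def)
      then have "((\<lambda>t. drift c (\<phi> k t) $ i + u k t \<bullet> bk k t) has_integral snd (\<phi> k s' - \<phi> k s) $ i) {s..s'}"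
        by (simp add: sys_component bk_def)
      from integral_unique[OF this] show ?thesis
        by (simp add: Henstock_Kurzweil_Integration.integral_add[OF di(1) ik(1)])
    qed
    define l where "l = snd (Z s' - Z s) $ i - integral {s..s'} (\<lambda>t. drift c (Z t) $ i)"
    have e1l: "(\<lambda>k. integral {s..s'} (\<lambda>t. u k t \<bullet> bk k t)) \<longlonglongrightarrow> l"
      unfolding e1 l_def by (intro tendsto_diff tendsto_vec_nth tendsto_snd \<phi>d dom[OF dc])
    \<comment> \<open>The test function still depends on \<open>k\<close>; replacing it by its limit
      \<open>b\<close> costs an error that tends to 0.\<close>
    have "(\<lambda>k. integral {s..s'} (\<lambda>t. u k t \<bullet> (bk k t - b t))) \<longlonglongrightarrow> 0"
    proof (rule integral_product_tendsto_0)
      show "(\<lambda>t. u k t \<bullet> (bk k t - b t)) integrable_on {s..s'}" for k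
        using Henstock_Kurzweil_Integration.integrable_diff[OF ik(1,2)] by (simp add: inner_diff_right)
      show "(\<lambda>t. (norm (u k t))\<^sup>2) integrable_on {s..s'}" for k
        by (rule integrable_on_subinterval[OF square_integrable_absolutely(2)[OF u] sub])
      show "integral {s..s'} (\<lambda>t. (norm (u k t))\<^sup>2) \<le> E" for k
      proof -
        have "integral {s..s'} (\<lambda>t. (norm (u k t))\<^sup>2) \<le> integral {0..T} (\<lambda>t. (norm (u k t))\<^sup>2)"
          by (rule integral_subset_le[OF sub]) (use square_integrable_absolutely(2)[OF u] integrable_on_subinterval[OF square_integrable_absolutely(2)[OF u] sub] in auto)
        also have "\<dots> = (\<integral>t. (norm (u k t))\<^sup>2 \<partial>lebesgue_on {0..T})"
          using u by (intro lebesgue_integral_eq_integral[symmetric]) (auto simp: square_integrable_on_def)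
        finally show ?thesis using uE[of k] by simp
      qed
      show "continuous_on {s..s'} (\<lambda>t. bk k t - b t)" for k by (intro continuous_on_diff bc)
      show "norm (bk k t - b t) \<le> B + B" if "t \<in> {s..s'}" for k t
        unfolding bk_def b_def using B \<phi>C[OF that] Z(2)[OF that] by (intro norm_triangle_le_diff add_mono) auto
      show "(\<lambda>k. bk k t - b t) \<longlonglongrightarrow> 0" if "t \<in> {s..s'}" for t
        using tendsto_diff[OF comp(4)[OF rc that] tendsto_const[of "b t"]] by (simp add: bk_def b_def)
    qed
    from tendsto_diff[OF e1l this]
    have "(\<lambda>k. integral {s..s'} (\<lambda>t. u k t \<bullet> bk k t) - integral {s..s'} (\<lambda>t. u k t \<bullet> (bk k t - b t))) \<longlonglongrightarrow> l" by simp
    moreover have "integral {s..s'} (\<lambda>t. u k t \<bullet> bk k t) - integral {s..s'} (\<lambda>t. u k t \<bullet> (bk k t - b t)) = integral {s..s'} (\<lambda>t. u k t \<bullet> b t)" for k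
      using Henstock_Kurzweil_Integration.integral_diff[OF ik(1,2)] by (simp add: inner_diff_right)
    ultimately have e2: "(\<lambda>k. integral {s..s'} (\<lambda>t. u k t \<bullet> b t)) \<longlonglongrightarrow> l" by simp
    \<comment> \<open>Extension by zero, since the limit control is tested on all of
      \<open>{0..T}\<close>.\<close>
    define \<psi> where "\<psi> t = indicator {s..s'} t *\<^sub>R b t" for t :: real
    have trans: "(\<integral>t. w t \<bullet> \<psi> t \<partial>lebesgue_on {0..T}) = integral {s..s'} (\<lambda>t. w t \<bullet> b t)" if w: "w square_integrable_on {0..T}" for w :: "real \<Rightarrow> real ^ 'm"
    proof -
      have "(\<integral>t. w t \<bullet> \<psi> t \<partial>lebesgue_on {0..T}) = (\<integral>t. indicator {0..T} t *\<^sub>R (w t \<bullet> \<psi> t) \<partial>lebesgue)"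
        by (rule integral_restrict_space) auto
      also have "\<dots> = (\<integral>t. indicator {s..s'} t *\<^sub>R (w t \<bullet> b t) \<partial>lebesgue)"
        by (rule Bochner_Integration.integral_cong) (use sub in \<open>auto simp: \<psi>_def indicator_def\<close>)
      also have "\<dots> = (\<integral>t. w t \<bullet> b t \<partial>lebesgue_on {s..s'})"
        by (rule integral_restrict_space[symmetric]) auto
      also have "\<dots> = integral {s..s'} (\<lambda>t. w t \<bullet> b t)"
      proof (rule lebesgue_integral_eq_integral)
        show "integrable (lebesgue_on {s..s'}) (\<lambda>t. w t \<bullet> b t)"
          using ctrl_int[OF w bc(1)] by (subst integrable_restrict_space) (auto simp: set_integrable_def)
      qed auto
      finally show ?thesis .
    qed
    \<comment> \<open>\<open>weak\<close> demands convergence along the sequence as a premise;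
      \<open>e2\<close> supplies it.\<close>
    have "(\<integral>t. v t \<bullet> \<psi> t \<partial>lebesgue_on {0..T}) = l"
    proof (rule weak)
      have "b \<in> borel_measurable (lebesgue_on {s..s'})" using bc(1) by (rule continuous_imp_measurable_on_sets_lebesgue) auto
      then have "\<psi> \<in> borel_measurable lebesgue" unfolding \<psi>_def
        by (subst (asm) borel_measurable_restrict_space_iff) auto
      then show "\<psi> \<in> borel_measurable (lebesgue_on {0..T})" by (rule measurable_restrict_space1)
      show "norm (\<psi> t) \<le> max B 0" for t
        using B Z(2)[of t] by (auto simp: \<psi>_def indicator_def b_def le_max_iff_disj)
      show "(\<lambda>k. \<integral>t. u k t \<bullet> \<psi> t \<partial>lebesgue_on {0..T}) \<longlonglongrightarrow> l" unfolding trans[OF u] by (rule e2)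
    qed
    then have "integral {s..s'} (\<lambda>t. v t \<bullet> b t) = l" unfolding trans[OF v] .
    then have "((\<lambda>t. v t \<bullet> b t) has_integral l) {s..s'}" using ik(3) by (metis integrable_integral)
    from has_integral_add[OF integrable_integral[OF di(2)] this] show ?thesis
      by (simp add: sys_component b_def l_def)
  qed
  have "((\<lambda>t. snd (sys c (Z t) (v t))) has_integral snd (Z s' - Z s)) {s..s'}"
    unfolding has_integral_componentwise_iff[of "\<lambda>t. snd (sys c (Z t) (v t))"]
  proof
    fix a :: "real ^ 'n" assume "a \<in> Basis"
    then obtain i where "a = axis i 1" by (auto simp: Basis_vec_def)
    then show "((\<lambda>t. snd (sys c (Z t) (v t)) \<bullet> a) has_integral snd (Z s' - Z s) \<bullet> a) {s..s'}"
      using H2[of i] by (simp add: inner_axis)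
  qed
  with H1 have "((\<lambda>t. (snd (Z t), snd (sys c (Z t) (v t)))) has_integral (fst (Z s' - Z s), snd (Z s' - Z s))) {s..s'}"
    by (simp only: has_integral_Pair)
  moreover have "(snd (Z t), snd (sys c (Z t) (v t))) = sys c (Z t) (v t)" for t by (simp add: sys_def)
  ultimately show ?thesis by (simp only: prod.collapse)
qed

text \<open>After finitely many terms the curves stay in the window, and dropping those terms
  changes no limit. The limit state is continuous there because the remaining states share a modulus
  of continuity.\<close>

lemma limit_chart_window:
  fixes u :: "nat \<Rightarrow> real \<Rightarrow> real ^ 'm"
  assumes ic: "\<And>k. integral_curve (u k) (q k) (V k)" and u: "\<And>k. u k square_integrable_on {0..T}"
    and uE: "\<And>k. (\<integral>t. (norm (u k t))\<^sup>2 \<partial>lebesgue_on {0..T}) \<le> E"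
    and v: "v square_integrable_on {0..T}"
    and weak: "\<forall>\<phi> B l. \<phi> \<in> borel_measurable (lebesgue_on {0..T}) \<longrightarrow> (\<forall>t. norm (\<phi> t) \<le> B) \<longrightarrow>
       (\<lambda>k. \<integral>t. u k t \<bullet> \<phi> t \<partial>lebesgue_on {0..T}) \<longlonglongrightarrow> l \<longrightarrow> (\<integral>t. v t \<bullet> \<phi> t \<partial>lebesgue_on {0..T}) = l"
    and tc: "\<forall>t\<in>{0..T}. tconv (\<lambda>k. q k t) (\<lambda>k. V k t) (Q t) (X t)"
    and t0: "t0 \<in> {0..T}" and c: "c \<in> A" "Q t0 \<in> chart_dom c"
  obtains \<delta> where "\<delta> > 0" "\<And>s. s \<in> {max 0 (t0 - \<delta>)..min T (t0 + \<delta>)} \<Longrightarrow> Q s \<in> chart_dom c"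
    "continuous_on {max 0 (t0 - \<delta>)..min T (t0 + \<delta>)} (\<lambda>t. phase c (Q t) (X t))"
    "\<And>s s'. max 0 (t0 - \<delta>) \<le> s \<Longrightarrow> s \<le> s' \<Longrightarrow> s' \<le> min T (t0 + \<delta>) \<Longrightarrow>
      ((\<lambda>t. sys c (phase c (Q t) (X t)) (v t)) has_integral (phase c (Q s') (X s') - phase c (Q s) (X s))) {s..s'}"
proof -
  have E: "0 \<le> E" by (rule order_trans[OF Bochner_Integration.integral_nonneg uE[of 0]]) simp
  obtain \<delta> C M where w: "\<delta> > 0" "M > 0" "compact C" "C \<subseteq> chart_range c \<times> UNIV"
    "\<And>z w. z \<in> C \<Longrightarrow> norm (sys c z w) \<le> M * (1 + norm w)"
    "\<And>s. s \<in> {0..T} \<Longrightarrow> \<bar>s - t0\<bar> \<le> \<delta> \<Longrightarrow> Q s \<in> chart_dom c \<and> phase c (Q s) (X s) \<in> C"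
    "\<forall>\<^sub>F k in sequentially. \<forall>s\<in>{0..T}. \<bar>s - t0\<bar> \<le> \<delta> \<longrightarrow> q k s \<in> chart_dom c \<and> phase c (q k s) (V k s) \<in> C"
    by (rule limit_window[where u = u and q = q and V = V and Q = Q and X = X, OF ic u uE E _ t0 c]) (rule bspec[OF tc], assumption, rule that)
  define a where "a = max 0 (t0 - \<delta>)"
  define b where "b = min T (t0 + \<delta>)"
  have inw: "s \<in> {0..T}" "\<bar>s - t0\<bar> \<le> \<delta>" if "s \<in> {a..b}" for s using that by (auto simp: a_def b_def)
  define \<phi> where "\<phi> k t = phase c (q k t) (V k t)" for k t
  define Z where "Z t = phase c (Q t) (X t)" for t
  have QC: "Q s \<in> chart_dom c" "Z s \<in> C" if "s \<in> {a..b}" for s using w(6)[OF inw[OF that]] by (simp_all add: Z_def)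
  have lim: "(\<lambda>k. \<phi> k s) \<longlonglongrightarrow> Z s" if "s \<in> {a..b}" for s
    unfolding \<phi>_def Z_def by (rule tconv_phase[OF bspec[OF tc inw(1)[OF that]] c(1) QC(1)[OF that]])
  obtain N where N: "\<And>k s. k \<ge> N \<Longrightarrow> s \<in> {a..b} \<Longrightarrow> q k s \<in> chart_dom c \<and> \<phi> k s \<in> C"
    using w(7) inw unfolding eventually_sequentially \<phi>_def by meson
  have Zc: "continuous_on {a..b} Z"
    unfolding continuous_on_iff
  proof (intro ballI allI impI)
    fix x and e :: real assume x: "x \<in> {a..b}" and e: "0 < e"
    have e2: "0 < e / (2 * M)" using e w(2) by simp
    obtain \<eta> where \<eta>: "0 < \<eta>" "\<And>(u :: real \<Rightarrow> real^'m) s t. u square_integrable_on {0..T} \<Longrightarrow>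
       (\<integral>t. (norm (u t))\<^sup>2 \<partial>lebesgue_on {0..T}) \<le> E \<Longrightarrow> 0 \<le> s \<Longrightarrow> s \<le> t \<Longrightarrow> t \<le> T \<Longrightarrow> t - s \<le> \<eta> \<Longrightarrow>
       integral {s..t} (\<lambda>t. 1 + norm (u t)) \<le> e / (2 * M)"
      by (rule square_integrable_modulus[OF e2 E, where 'e = "real^'m" and a = 0 and b = T]) (rule that)
    have bound: "dist (\<phi> k h) (\<phi> k l) \<le> e / 2" if lh: "l \<in> {a..b}" "h \<in> {a..b}" "l \<le> h" "h - l \<le> \<eta>" and k: "k \<ge> N" for k l h
    proof -
      have r: "0 \<le> l" "h \<le> T" using inw(1)[OF lh(1)] inw(1)[OF lh(2)] by auto
      have sub: "{l..h} \<subseteq> {a..b}" using lh by auto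
      have "norm (phase c (q k h) (V k h) - phase c (q k l) (V k l)) \<le> M * integral {l..h} (\<lambda>t. 1 + norm (u k t))"
      proof (rule phase_modulus[OF ic u c(1) r(1) lh(3) r(2)])
        show "q k ` {l..h} \<subseteq> chart_dom c" using N[OF k] sub by blast
        show "norm (sys c (phase c (q k t) (V k t)) (u k t)) \<le> M * (1 + norm (u k t))" if "t \<in> {l..h}" for t
          using w(5) conjunct2[OF N[OF k subsetD[OF sub that]]] by (simp add: \<phi>_def)
      qed
      also have "\<dots> \<le> M * (e / (2 * M))" using \<eta>(2)[OF u uE r(1) lh(3) r(2) lh(4)] w(2) by (intro mult_left_mono) auto
      also have "\<dots> = e / 2" using w(2) by simp
      finally show ?thesis by (simp add: dist_norm \<phi>_def)
    qed
    show "\<exists>d>0. \<forall>x'\<in>{a..b}. dist x' x < d \<longrightarrow> dist (Z x') (Z x) < e"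
    proof (intro exI[of _ \<eta>] conjI ballI impI \<eta>(1))
      fix y assume y: "y \<in> {a..b}" "dist y x < \<eta>"
      have "\<forall>\<^sub>F k in sequentially. dist (\<phi> k y) (\<phi> k x) \<le> e / 2"
        unfolding eventually_sequentially
      proof (intro exI[of _ N] allI impI)
        fix k assume k: "N \<le> k"
        show "dist (\<phi> k y) (\<phi> k x) \<le> e / 2"
        proof (cases "x \<le> y")
          case True
          then show ?thesis using bound[OF x y(1) True _ k] y(2) by (simp add: dist_real_def)
        next
          case False
          then show ?thesis using bound[OF y(1) x _ _ k] y(2) by (simp add: dist_real_def dist_commute)
        qed
      qed
      then have "dist (Z y) (Z x) \<le> e / 2"
        by (intro tendsto_upperbound[OF tendsto_dist[OF lim[OF y(1)] lim[OF x]]]) simp_all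
      then show "dist (Z y) (Z x) < e" using e by simp
    qed
  qed
  have eq: "((\<lambda>t. sys c (Z t) (v t)) has_integral (Z s' - Z s)) {s..s'}" if s: "a \<le> s" "s \<le> s'" "s' \<le> b" for s s'
  proof (rule limit_integral_eq_window[of "\<lambda>k. u (k + N)" "\<lambda>k. q (k + N)" "\<lambda>k. V (k + N)", OF ic u uE v _ c(1) w(3,4)])
    have sub: "{s..s'} \<subseteq> {a..b}" using s by auto
    show "0 \<le> s" "s \<le> s'" "s' \<le> T" using s by (auto simp: a_def b_def)
    fix t assume "t \<in> {s..s'}"
    then have t: "t \<in> {a..b}" using sub by auto
    show "q (k + N) t \<in> chart_dom c \<and> phase c (q (k + N) t) (V (k + N) t) \<in> C" for k
      using N[OF _ t, of "k + N"] by (simp add: \<phi>_def)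
    show "Z t \<in> C" by (rule QC(2)[OF t])
    show "(\<lambda>k. phase c (q (k + N) t) (V (k + N) t)) \<longlonglongrightarrow> Z t"
      using LIMSEQ_ignore_initial_segment[OF lim[OF t], of N] by (simp add: \<phi>_def)
  next
    show "continuous_on {s..s'} Z" by (rule continuous_on_subset[OF Zc]) (use s in auto)
    fix \<phi> :: "real \<Rightarrow> real ^ 'm" and B l
    assume p: "\<phi> \<in> borel_measurable (lebesgue_on {0..T})" "\<And>t. norm (\<phi> t) \<le> B"
      "(\<lambda>k. \<integral>t. u (k + N) t \<bullet> \<phi> t \<partial>lebesgue_on {0..T}) \<longlonglongrightarrow> l"
    show "(\<integral>t. v t \<bullet> \<phi> t \<partial>lebesgue_on {0..T}) = l"
      using weak p(1,2) LIMSEQ_offset[of "\<lambda>k. \<integral>t. u k t \<bullet> \<phi> t \<partial>lebesgue_on {0..T}", OF p(3)] by blast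
  qed
  show thesis
    by (rule that[of \<delta>]) (use w(1) QC(1) Zc eq in \<open>simp_all add: a_def b_def Z_def\<close>)
qed

lemma limit_integral_curve:
  fixes u :: "nat \<Rightarrow> real \<Rightarrow> real ^ 'm"
  assumes ic: "\<And>k. integral_curve (u k) (q k) (V k)" and u: "\<And>k. u k square_integrable_on {0..T}"
    and uE: "\<And>k. (\<integral>t. (norm (u k t))\<^sup>2 \<partial>lebesgue_on {0..T}) \<le> E"
    and v: "v square_integrable_on {0..T}"
    and weak: "\<forall>\<phi> B l. \<phi> \<in> borel_measurable (lebesgue_on {0..T}) \<longrightarrow> (\<forall>t. norm (\<phi> t) \<le> B) \<longrightarrow>
       (\<lambda>k. \<integral>t. u k t \<bullet> \<phi> t \<partial>lebesgue_on {0..T}) \<longlonglongrightarrow> l \<longrightarrow> (\<integral>t. v t \<bullet> \<phi> t \<partial>lebesgue_on {0..T}) = l"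
    and tc: "\<forall>t\<in>{0..T}. tconv (\<lambda>k. q k t) (\<lambda>k. V k t) (Q t) (X t)"
  shows "integral_curve v Q X"
  unfolding integral_curve_def
proof (intro conjI ballI allI impI)
  show "continuous_on {0..T} Q"
    unfolding continuous_on_eq_continuous_within
  proof
    fix t0 assume t0: "t0 \<in> {0..T}"
    obtain c where c: "c \<in> A" "Q t0 \<in> chart_dom c" using charts_cover by blast
    obtain \<delta> where \<delta>: "\<delta> > 0" "\<And>s. s \<in> {max 0 (t0 - \<delta>)..min T (t0 + \<delta>)} \<Longrightarrow> Q s \<in> chart_dom c"
      "continuous_on {max 0 (t0 - \<delta>)..min T (t0 + \<delta>)} (\<lambda>t. phase c (Q t) (X t))"
      by (rule limit_chart_window[where u = u and q = q and V = V and Q = Q and X = X, OF ic u uE v weak tc t0 c]) (rule that)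
    let ?J = "{max 0 (t0 - \<delta>)..min T (t0 + \<delta>)}"
    have "continuous_on ?J (\<lambda>t. param c (fst (phase c (Q t) (X t))))"
    proof (rule continuous_on_compose2[where g = "param c" and f = "\<lambda>t. fst (phase c (Q t) (X t))", OF continuous_on_param[OF c(1)] continuous_on_fst[OF \<delta>(3)]])
      show "(\<lambda>t. fst (phase c (Q t) (X t))) ` ?J \<subseteq> chart_range c"
        using coords_in_range[OF c(1) \<delta>(2)] by (auto simp: phase_def)
    qed
    then have "continuous_on ?J Q"
      by (rule continuous_on_eq) (simp add: phase_def param_coords[OF c(1)] \<delta>(2))
    then have "continuous (at t0 within ?J) Q"
      using t0 \<delta>(1) by (simp add: continuous_on_eq_continuous_within)
    moreover have "at t0 within ?J = at t0 within {0..T}"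
    proof (rule at_within_nhd[of t0 "ball t0 \<delta>"])
      show "?J \<inter> ball t0 \<delta> - {t0} = {0..T} \<inter> ball t0 \<delta> - {t0}"
        by (auto simp: dist_real_def)
    qed (use \<delta>(1) in auto)
    ultimately show "continuous (at t0 within {0..T}) Q" by simp
  qed
next
  fix c a b assume c: "c \<in> A" and H: "0 \<le> a \<and> a \<le> b \<and> b \<le> T \<and> Q ` {a..b} \<subseteq> chart_dom c"
  let ?h = "\<lambda>t. sys c (phase c (Q t) (X t)) (v t)"
  let ?Z = "\<lambda>t. phase c (Q t) (X t)"
  have ab: "a \<le> b" using H by simp
  \<comment> \<open>Gluing of windows: the integrated equation is additive under concatenation of
    intervals and holds on all short intervals around each time, so bisection yields it on
    \<open>{a..b}\<close>. The trivial premises adapt the claim to the bisection rule.\<close>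
  have "a \<le> a \<longrightarrow> b \<le> b \<longrightarrow> a \<le> b \<longrightarrow> (?h has_integral (?Z b - ?Z a)) {a..b}"
    using ab
  proof (induction rule: Bolzano[where P = "\<lambda>x y. a \<le> x \<longrightarrow> y \<le> b \<longrightarrow> x \<le> y \<longrightarrow> (?h has_integral (?Z y - ?Z x)) {x..y}"])
    case (trans x y z)
    show ?case
    proof (intro impI)
      assume "a \<le> x" "z \<le> b" "x \<le> z"
      with trans have "(?h has_integral (?Z y - ?Z x)) {x..y}" "(?h has_integral (?Z z - ?Z y)) {y..z}" by auto
      from has_integral_combine[OF trans(3,4) this] show "(?h has_integral (?Z z - ?Z x)) {x..z}" by simp
    qed
  next
    case (local t0)
    then have t0: "t0 \<in> {0..T}" "Q t0 \<in> chart_dom c" using H by auto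
    obtain \<delta> where \<delta>: "\<delta> > 0" 
      "\<And>s s'. max 0 (t0 - \<delta>) \<le> s \<Longrightarrow> s \<le> s' \<Longrightarrow> s' \<le> min T (t0 + \<delta>) \<Longrightarrow>
      (?h has_integral (?Z s' - ?Z s)) {s..s'}"
      by (rule limit_chart_window[where u = u and q = q and V = V and Q = Q and X = X, OF ic u uE v weak tc t0(1) c t0(2)]) (rule that)
    show ?case
    proof (intro exI[of _ \<delta>] conjI allI impI \<delta>(1))
      fix x y assume xy: "x \<le> t0 \<and> t0 \<le> y \<and> y - x < \<delta>" "a \<le> x" "y \<le> b" "x \<le> y"
      show "(?h has_integral (?Z y - ?Z x)) {x..y}"
        by (rule \<delta>(2)) (use xy H in auto)
    qed
  qed
  then show "(?h has_integral (?Z b - ?Z a)) {a..b}" using ab by blast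
qed

end

section \<open>Lower semicontinuity of the Riemannian distance\<close>

text \<open>Measurability of the integrand of \<open>curve_length\<close> is not established.
  Unfolding the integral as a supremum puts a simple, hence measurable, function below
  \<open>h\<close>, and the splitting is carried out for that function.\<close>

lemma nn_integral_le_split:
  assumes S: "S \<in> sets M" and le: "AE t in M. h t \<le> (if t \<in> S then f t else k)"
  shows "(\<integral>\<^sup>+ t. h t \<partial>M) \<le> (\<integral>\<^sup>+ t. f t \<partial>M) + k * emeasure M (space M - S)"
  unfolding nn_integral_def[of M h]
proof (rule SUP_least)
  fix s assume "s \<in> {s. simple_function M s \<and> s \<le> h}"
  then have s: "simple_function M s" and sh: "\<And>t. s t \<le> h t" by (auto simp: le_fun_def)
  have [measurable]: "s \<in> borel_measurable M" "S \<in> sets M" using s S by (auto intro: borel_measurable_simple_function)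
  have "integral\<^sup>S M s = (\<integral>\<^sup>+ t. s t \<partial>M)" by (rule nn_integral_eq_simple_integral[OF s, symmetric])
  also have "\<dots> = (\<integral>\<^sup>+ t. s t * indicator S t + s t * indicator (space M - S) t \<partial>M)"
    by (rule nn_integral_cong) (auto simp: indicator_def)
  also have "\<dots> = (\<integral>\<^sup>+ t. s t * indicator S t \<partial>M) + (\<integral>\<^sup>+ t. s t * indicator (space M - S) t \<partial>M)"
    by (rule nn_integral_add) measurable
  also have "\<dots> \<le> (\<integral>\<^sup>+ t. f t \<partial>M) + (\<integral>\<^sup>+ t. k * indicator (space M - S) t \<partial>M)"
  proof (intro add_mono nn_integral_mono_AE)
    show "AE t in M. s t * indicator S t \<le> f t"
      using le by eventually_elim (use sh order_trans in \<open>fastforce simp: indicator_def\<close>)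
    show "AE t in M. s t * indicator (space M - S) t \<le> k * indicator (space M - S) t"
      using le by eventually_elim (use sh order_trans in \<open>fastforce simp: indicator_def\<close>)
  qed
  also have "(\<integral>\<^sup>+ t. k * indicator (space M - S) t \<partial>M) = k * emeasure M (space M - S)"
    by (rule nn_integral_cmult_indicator) measurable
  finally show "integral\<^sup>S M s \<le> (\<integral>\<^sup>+ t. f t \<partial>M) + k * emeasure M (space M - S)" .
qed

text \<open>The derivatives in this notion are two-sided, so the functions are compared on an open
  set around the interval.\<close>

lemma piecewise_C1_differentiable_on_cong:
  fixes h :: "real \<Rightarrow> 'e::real_normed_vector"
  assumes h: "h piecewise_C1_differentiable_on I" and U: "open U" "I \<subseteq> U" and eq: "\<And>t. t \<in> U \<Longrightarrow> h t = k t"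
  shows "k piecewise_C1_differentiable_on I"
proof -
  obtain S D where S: "continuous_on I h" "finite S" "\<forall>x\<in>I - S. (h has_vector_derivative D x) (at x)" "continuous_on (I - S) D"
    using h unfolding piecewise_C1_differentiable_on_def C1_differentiable_on_def by (elim exE conjE) (rule that)
  show ?thesis
    unfolding piecewise_C1_differentiable_on_def C1_differentiable_on_def
  proof (intro conjI exI[of _ S] exI[of _ D] ballI S(2,4))
    show "continuous_on I k" by (rule continuous_on_eq[OF S(1)]) (use U eq in auto)
    fix x assume x: "x \<in> I - S"
    show "(k has_vector_derivative D x) (at x)"
      by (rule has_vector_derivative_transform_within_open[OF bspec[OF S(3) x] U(1)]) (use x U eq in auto)
  qed
qed

section \<open>Coordinate segments and their length\<close>

context atlas
begin

lemma chart_curve_has_vector_derivative: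
  assumes c: "c \<in> A" and d: "d \<in> A" and t: "\<sigma> t \<in> chart_range c" "param c (\<sigma> t) \<in> chart_dom d"
    and \<sigma>: "(\<sigma> has_vector_derivative w) (at t)"
  shows "((\<lambda>s. coords d (param c (\<sigma> s))) has_vector_derivative transition_deriv c d (param c (\<sigma> t)) w) (at t)"
proof -
  let ?p = "param c (\<sigma> t)"
  have p: "?p \<in> chart_dom c" "coords c ?p = \<sigma> t" using param_in_dom[OF c t(1)] coords_param[OF c t(1)] by auto
  have 1: "((coords d \<circ> param c) has_derivative transition_deriv c d ?p) (at (\<sigma> t))"
    using transition_has_derivative[OF c d p(1) t(2)] by (simp add: p(2))
  have "((coords d \<circ> param c) \<circ> \<sigma> has_derivative transition_deriv c d ?p \<circ> (\<lambda>x. x *\<^sub>R w)) (at t)"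
    by (rule diff_chain_at[OF \<sigma>[unfolded has_vector_derivative_def] 1])
  moreover have "transition_deriv c d ?p (x *\<^sub>R w) = x *\<^sub>R transition_deriv c d ?p w" for x
    using transition_deriv_linear[OF c d p(1) t(2)] by (simp add: linear_simps)
  ultimately show ?thesis by (simp add: has_vector_derivative_def o_def)
qed

lemma chart_segment_C1:
  assumes c: "c \<in> A" and d: "d \<in> A" and rng: "\<And>t. t \<in> I \<Longrightarrow> \<sigma> t \<in> chart_range c" "\<And>t. t \<in> I \<Longrightarrow> param c (\<sigma> t) \<in> chart_dom d"
    and \<sigma>: "\<And>t. (\<sigma> has_vector_derivative w) (at t)"
  shows "(\<lambda>s. coords d (param c (\<sigma> s))) piecewise_C1_differentiable_on I"
proof (rule C1_differentiable_imp_piecewise)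
  let ?S = "coords c ` (chart_dom c \<inter> chart_dom d)"
  have \<sigma>c: "continuous_on I \<sigma>"
    using \<sigma> by (intro continuous_at_imp_continuous_on ballI has_vector_derivative_continuous)
  have in_S: "\<sigma> t \<in> ?S" if "t \<in> I" for t
    using rng[OF that] param_in_dom[OF c rng(1)[OF that]] coords_param[OF c rng(1)[OF that]] by (intro image_eqI[of _ _ "param c (\<sigma> t)"]) auto
  have "continuous_on I (\<lambda>t. frechet_derivative (coords d \<circ> param c) (at (\<sigma> t)) w)"
    by (rule continuous_on_compose2[where g = "\<lambda>x. frechet_derivative (coords d \<circ> param c) (at x) w" and f = \<sigma>,
          OF smooth_on_continuous_on[OF smooth_on_derivative[OF smooth_transition[OF c d]]] \<sigma>c]) (use in_S in blast)
  then have cont: "continuous_on I (\<lambda>t. transition_deriv c d (param c (\<sigma> t)) w)"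
    by (rule continuous_on_eq) (simp add: transition_deriv_def coords_param[OF c rng(1)])
  show "(\<lambda>s. coords d (param c (\<sigma> s))) C1_differentiable_on I"
    unfolding C1_differentiable_on_def
    by (intro exI[of _ "\<lambda>t. transition_deriv c d (param c (\<sigma> t)) w"] conjI ballI cont
        chart_curve_has_vector_derivative c d rng \<sigma>)
qed

end

context riemannian
begin

text \<open>Squared Riemannian length in coordinates: \<open>fst z\<close> is the point and
  \<open>snd z\<close> the vector.\<close>

definition energy :: "('a, 'n) chart \<Rightarrow> (real ^ 'n) \<times> (real ^ 'n) \<Rightarrow> real" where
  "energy c z = snd z \<bullet> (gram c (fst z) *v snd z)"

lemma continuous_on_energy:
  assumes c: "c \<in> A"
  shows "continuous_on (chart_range c \<times> UNIV) (energy c)"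
proof -
  have "continuous_on (chart_range c \<times> UNIV) (\<lambda>z::(real^'n)\<times>(real^'n). gram c (fst z) $ i $ j)" for i j
    by (rule continuous_on_compose2[where g = "\<lambda>x. gram c x $ i $ j" and f = fst, OF smooth_on_continuous_on[OF metric_smooth[OF c]] continuous_on_fst[OF continuous_on_id]])
      (simp add: fst_image_times)
  note gc = this
  have "continuous_on (chart_range c \<times> UNIV) (\<lambda>z::(real^'n)\<times>(real^'n). \<Sum>i\<in>UNIV. snd z $ i * (\<Sum>j\<in>UNIV. gram c (fst z) $ i $ j * snd z $ j))"
    by (intro continuous_on_sum continuous_on_mult gc continuous_on_component continuous_on_snd continuous_on_id)
  moreover have "energy c = (\<lambda>z. \<Sum>i\<in>UNIV. snd z $ i * (\<Sum>j\<in>UNIV. gram c (fst z) $ i $ j * snd z $ j))"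
    by (simp add: energy_def inner_vec_def matrix_vector_mult_def fun_eq_iff)
  ultimately show ?thesis by simp
qed

lemma metric_nonneg: "\<xi> \<in> tangent_space A p \<Longrightarrow> 0 \<le> g p \<xi> \<xi>"
proof (cases "\<xi> = (\<lambda>_. 0)")
  case True
  assume x: "\<xi> \<in> tangent_space A p"
  have "g p (\<lambda>c. 0 *\<^sub>R \<xi> c + 0 *\<^sub>R \<xi> c) \<xi> = 0 * g p \<xi> \<xi> + 0 * g p \<xi> \<xi>"
    by (rule metric_linear[OF x x x])
  then show ?thesis using True by simp
next
  case False
  assume "\<xi> \<in> tangent_space A p"
  from metric_pos[OF this False] show ?thesis by (rule less_imp_le)
qed

text \<open>Homogeneity of degree two reduces the bound to the compact product of \<open>C\<close>
  with the unit sphere.\<close>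

lemma energy_bound:
  assumes c: "c \<in> A" and C: "compact C" "C \<subseteq> chart_range c"
  obtains B where "B > 0" "\<And>x w. x \<in> C \<Longrightarrow> energy c (x, w) \<le> (B * norm w)\<^sup>2"
proof -
  have sub: "C \<times> sphere 0 1 \<subseteq> chart_range c \<times> (UNIV :: (real^'n) set)" using C by auto
  have "bounded (energy c ` (C \<times> sphere 0 1))"
    by (intro compact_imp_bounded compact_continuous_image continuous_on_subset[OF continuous_on_energy[OF c] sub] compact_Times C compact_sphere)
  then obtain K where K: "K > 0" "\<And>y. y \<in> energy c ` (C \<times> sphere 0 1) \<Longrightarrow> norm y \<le> K" unfolding bounded_pos by blast
  show thesis
  proof (rule that[of "sqrt K"])
    show "sqrt K > 0" using K by simp
    fix x and w :: "real ^ 'n" assume x: "x \<in> C"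
    show "energy c (x, w) \<le> (sqrt K * norm w)\<^sup>2"
    proof (cases "w = 0")
      case False
      define e where "e = (1 / norm w) *\<^sub>R w"
      have we: "w = norm w *\<^sub>R e" using False by (simp add: e_def)
      have "(x, e) \<in> C \<times> sphere 0 1" using x False by (simp add: e_def)
      then have "energy c (x, e) \<le> K" using K(2)[of "energy c (x, e)"] by (metis abs_le_D1 image_eqI real_norm_def)
      then have "(norm w)\<^sup>2 * energy c (x, e) \<le> (norm w)\<^sup>2 * K" by (intro mult_left_mono) auto
      moreover have "energy c (x, w) = (norm w)\<^sup>2 * energy c (x, e)"
        by (subst we) (simp add: energy_def matrix_vector_mult_scaleR power2_eq_square)
      ultimately show ?thesis using K(1) by (simp add: power_mult_distrib mult.commute)
    qed (simp add: energy_def)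
  qed
qed

text \<open>The last bit of a curve that ends near \<open>p\<close> is replaced by a short coordinate segment to \<open>p\<close>,
  which avoids any reparametrisation of the remaining part.\<close>

lemma riemannian_dist_near:
  assumes e: "0 < e"
  obtains U where "open U" "p \<in> U" "\<And>p'. p' \<in> U \<Longrightarrow> riemannian_dist A g q1 p \<le> riemannian_dist A g q1 p' + ennreal e"
proof -
  obtain c where c: "c \<in> A" "p \<in> chart_dom c" using charts_cover by blast
  define x0 where "x0 = coords c p"
  have x0: "x0 \<in> chart_range c" "param c x0 = p" using coords_in_range[OF c] param_coords[OF c] by (auto simp: x0_def)
  obtain r where r: "r > 0" "cball x0 r \<subseteq> chart_range c"
    using open_contains_cball[THEN iffD1, OF open_chart_range[OF c(1)], THEN bspec, OF x0(1)] by (elim exE conjE) (rule that)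
  obtain B where B: "B > 0" "\<And>x w. x \<in> cball x0 r \<Longrightarrow> energy c (x, w) \<le> (B * norm w)\<^sup>2"
    by (rule energy_bound[OF c(1) compact_cball r(2)]) (rule that)
  \<comment> \<open>The bound \<open>e / B\<close> makes coordinate segments of length below
    \<open>\<rho>\<close> have Riemannian length at most \<open>e\<close>; the bound
    \<open>r\<close> keeps them where \<open>B\<close> is valid.\<close>
  define \<rho> where "\<rho> = min r (e / B)"
  have \<rho>: "\<rho> > 0" "\<rho> \<le> r" "B * \<rho> \<le> e"
  proof -
    show "\<rho> > 0" "\<rho> \<le> r" using r e B(1) by (auto simp: \<rho>_def)
    have "B * \<rho> \<le> B * (e / B)" using B(1) by (intro mult_left_mono) (auto simp: \<rho>_def)
    then show "B * \<rho> \<le> e" using B(1) by simp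
  qed
  have bc: "ball x0 \<rho> \<subseteq> cball x0 r" using \<rho>(2) by auto
  have br: "ball x0 \<rho> \<subseteq> chart_range c" using bc r(2) by (rule subset_trans)
  define U where "U = chart_dom c \<inter> coords c -` ball x0 \<rho>"
  have U: "open U" unfolding U_def
    by (intro continuous_open_preimage continuous_on_coords open_chart_dom c open_ball)
  have pU: "p \<in> U" using c \<rho>(1) by (simp add: U_def x0_def)
  show thesis
  proof (rule that[OF U pU])
    fix p' assume p': "p' \<in> U"
    have key: "riemannian_dist A g q1 p \<le> curve_length A g \<gamma> + ennreal e"
      if \<gamma>: "piecewise_C1_curve A \<gamma>" "\<gamma> 0 = q1" "\<gamma> 1 = p'" for \<gamma>
    proof -
      have \<gamma>c: "continuous_on {0..1} \<gamma>" using \<gamma>(1) by (simp add: piecewise_C1_curve_def)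
      have one: "(1::real) \<in> {0..1}" by simp
      have gU: "\<gamma> 1 \<in> U" using \<gamma>(3) p' by simp
      obtain N where N: "open N" "1 \<in> N" "\<forall>y\<in>{0..1}. y \<in> N \<longrightarrow> \<gamma> y \<in> U"
        using \<gamma>c[unfolded continuous_on_topological, rule_format, OF one U gU] by (elim exE conjE) (rule that)
      obtain h where h: "h > 0" "ball 1 h \<subseteq> N" using N(1,2) by (rule openE)
      \<comment> \<open>Strictly inside the unit interval, and close enough to 1 for
        \<open>\<gamma> s0\<close> to lie in \<open>U\<close>.\<close>
      define s0 where "s0 = 1 - min (h/2) (1/2)"
      have s0: "0 < s0" "s0 < 1" using h by (auto simp: s0_def)
      have "s0 \<in> ball 1 h" using h(1) by (auto simp: s0_def dist_real_def)
      then have "\<gamma> s0 \<in> U" using N(3) h(2) s0 by auto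
      define x1 where "x1 = coords c (\<gamma> s0)"
      have x1: "\<gamma> s0 \<in> chart_dom c" "x1 \<in> ball x0 \<rho>" using \<open>\<gamma> s0 \<in> U\<close> by (auto simp: U_def x1_def)
      \<comment> \<open>This speed carries the segment from \<open>x1\<close> at time
        \<open>s0\<close> to \<open>x0\<close> at time 1, so the modified curve keeps the time
        interval of \<open>\<gamma>\<close>.\<close>
      define w where "w = (1 / (1 - s0)) *\<^sub>R (x0 - x1)"
      define \<sigma> where "\<sigma> t = x1 + (t - s0) *\<^sub>R w" for t
      have \<sigma>1: "\<sigma> 1 = x0" using s0 by (simp add: \<sigma>_def w_def)
      have \<sigma>0: "\<sigma> s0 = x1" by (simp add: \<sigma>_def)
      have \<sigma>d: "(\<sigma> has_vector_derivative w) (at t)" for t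
      proof -
        have "((\<lambda>t. x1 + (t - s0) *\<^sub>R w) has_vector_derivative 0 + (1 *\<^sub>R w)) (at t)"
          by (intro has_vector_derivative_add has_vector_derivative_const bounded_linear.has_vector_derivative[OF bounded_linear_scaleR_left])
            (auto intro!: derivative_eq_intros)
        then show ?thesis by (simp add: \<sigma>_def[abs_def])
      qed
      have \<sigma>b: "\<sigma> t \<in> ball x0 \<rho>" if t: "t \<in> {s0..1}" for t
      proof -
        define \<theta> where "\<theta> = (t - s0) / (1 - s0)"
        have \<theta>: "0 \<le> \<theta>" "\<theta> \<le> 1" using t s0 by (auto simp: \<theta>_def divide_simps)
        have "\<sigma> t = (1 - \<theta>) *\<^sub>R x1 + \<theta> *\<^sub>R x0"
          by (simp add: \<sigma>_def w_def \<theta>_def algebra_simps)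
        then show ?thesis using convexD[OF convex_ball x1(2), of x0 "1 - \<theta>" \<theta>] \<theta> \<rho>(1) by simp
      qed
      have \<sigma>r: "\<sigma> t \<in> chart_range c" if "t \<in> {s0..1}" for t using \<sigma>b[OF that] br by blast
      define \<mu> where "\<mu> t = (if t \<le> s0 then \<gamma> t else param c (\<sigma> t))" for t
      have \<mu>0: "\<mu> 0 = q1" "\<mu> 1 = p" using s0 \<gamma>(2) x0(2) by (auto simp: \<mu>_def \<sigma>1)
      have psc: "continuous_on {s0..1} (\<lambda>t. param c (\<sigma> t))"
      proof (rule continuous_on_compose2[where g = "param c" and f = \<sigma>, OF continuous_on_param[OF c(1)]])
        show "continuous_on {s0..1} \<sigma>" unfolding \<sigma>_def by (intro continuous_intros)
        show "\<sigma> ` {s0..1} \<subseteq> chart_range c" using \<sigma>r by blast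
      qed
      have join: "\<gamma> s0 = param c (\<sigma> s0)" unfolding \<sigma>0 x1_def by (rule param_coords[OF c(1) x1(1), symmetric])
      have \<mu>c: "continuous_on {0..1} \<mu>" unfolding \<mu>_def
      proof (rule continuous_on_cases_le[where h = "\<lambda>t. t"])
        show "continuous_on {t \<in> {0..1}. t \<le> s0} \<gamma>" by (rule continuous_on_subset[OF \<gamma>c]) auto
        show "continuous_on {t \<in> {0..1}. s0 \<le> t} (\<lambda>t. param c (\<sigma> t))" by (rule continuous_on_subset[OF psc]) auto
      qed (auto simp: join)
      have pw: "(coords d \<circ> \<mu>) piecewise_C1_differentiable_on {a..b}"
        if d: "d \<in> A" and ab: "0 \<le> a" "a \<le> b" "b \<le> 1" and dom: "\<mu> ` {a..b} \<subseteq> chart_dom d" for d a b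
      proof -
        have left: "(coords d \<circ> \<gamma>) piecewise_C1_differentiable_on {a..m}" if "a \<le> m" "m \<le> b" "m \<le> s0" for m
        proof -
          have "\<gamma> ` {a..m} \<subseteq> chart_dom d"
          proof (rule image_subsetI)
            fix t assume "t \<in> {a..m}"
            then have "\<mu> t = \<gamma> t" "t \<in> {a..b}" using that by (auto simp: \<mu>_def)
            then show "\<gamma> t \<in> chart_dom d" using dom by (metis image_subset_iff)
          qed
          then show ?thesis using \<gamma>(1) d ab that unfolding piecewise_C1_curve_def by auto
        qed
        have right: "(\<lambda>t. coords d (param c (\<sigma> t))) piecewise_C1_differentiable_on {m..b}" if "a \<le> m" "m \<le> b" "s0 \<le> m" for m
        proof (rule chart_segment_C1[OF c(1) d _ _ \<sigma>d])
          fix t assume t: "t \<in> {m..b}"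
          then show "\<sigma> t \<in> chart_range c" using \<sigma>r that ab by auto
          have "\<mu> t = param c (\<sigma> t)" using t that join by (cases "t = s0") (auto simp: \<mu>_def)
          moreover have "t \<in> {a..b}" using t that by auto
          ultimately show "param c (\<sigma> t) \<in> chart_dom d" using dom by (metis image_subset_iff)
        qed
        \<comment> \<open>The break point may lie to the right of the interval, to the left, or in
          it; only in the last case are two pieces joined.\<close>
        consider "b < s0" | "s0 < a" | "a \<le> s0" "s0 \<le> b" by linarith
        then show ?thesis
        proof cases
          case 1
          show ?thesis
            by (rule piecewise_C1_differentiable_on_cong[OF left[OF ab(2) order_refl less_imp_le[OF 1]], of "{..<s0}"]) (use 1 in \<open>auto simp: \<mu>_def\<close>)
        next
          case 2
          show ?thesis
            by (rule piecewise_C1_differentiable_on_cong[OF right[OF order_refl ab(2) less_imp_le[OF 2]], of "{s0<..}"]) (use 2 in \<open>auto simp: \<mu>_def\<close>)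
        next
          case 3
          have "(\<lambda>t. if t \<le> s0 then (coords d \<circ> \<gamma>) t else coords d (param c (\<sigma> t))) piecewise_C1_differentiable_on {a..b}"
            by (rule piecewise_C1_differentiable_cases[OF left[OF 3 order_refl] right[OF 3 order_refl] 3]) (simp add: join)
          moreover have "(\<lambda>t. if t \<le> s0 then (coords d \<circ> \<gamma>) t else coords d (param c (\<sigma> t))) = coords d \<circ> \<mu>"
            by (auto simp: \<mu>_def)
          ultimately show ?thesis by simp
        qed
      qed
      have \<mu>pw: "piecewise_C1_curve A \<mu>" unfolding piecewise_C1_curve_def using \<mu>c pw by blast
      let ?F = "\<lambda>\<gamma> t. ennreal (sqrt (g (\<gamma> t) (velocity A {0..1} \<gamma> t) (velocity A {0..1} \<gamma> t)))"
      have F1: "?F \<mu> t = ?F \<gamma> t" if t: "t \<in> {0..<s0}" for t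
      proof -
        have "velocity A {0..1} \<mu> t = velocity A {0..1} \<gamma> t"
          by (rule velocity_local_cong[of "s0 - t"]) (use t s0 in \<open>auto simp: \<mu>_def dist_real_def\<close>)
        moreover have "\<mu> t = \<gamma> t" using t by (simp add: \<mu>_def)
        ultimately show ?thesis by simp
      qed
      have F2: "?F \<mu> t \<le> ennreal (B * norm w)" if t: "t \<in> {s0<..<1}" for t
      proof -
        have t': "t \<in> {s0..1}" "t \<in> {0..1}" using t s0 by auto
        have \<mu>t: "\<mu> t = param c (\<sigma> t)" using t by (simp add: \<mu>_def)
        have dc: "\<mu> t \<in> chart_dom c" "coords c (\<mu> t) = \<sigma> t"
          unfolding \<mu>t using param_in_dom[OF c(1) \<sigma>r[OF t'(1)]] coords_param[OF c(1) \<sigma>r[OF t'(1)]] by auto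
        have vel: "velocity A {0..1} \<mu> t = lift A c (\<mu> t) w"
        proof
          fix d
          show "velocity A {0..1} \<mu> t d = lift A c (\<mu> t) w d"
          proof (cases "d \<in> A \<and> \<mu> t \<in> chart_dom d")
            case True
            have "((\<lambda>s. coords d (param c (\<sigma> s))) has_vector_derivative transition_deriv c d (param c (\<sigma> t)) w) (at t)"
              by (rule chart_curve_has_vector_derivative[OF c(1) _ \<sigma>r[OF t'(1)] _ \<sigma>d]) (use True \<mu>t in auto)
            then have "((coords d \<circ> \<mu>) has_vector_derivative transition_deriv c d (\<mu> t) w) (at t)"
              unfolding \<mu>t by (rule has_vector_derivative_transform_within_open[of _ _ _ "{s0<..}"]) (use t in \<open>auto simp: \<mu>_def\<close>)
            then have "((coords d \<circ> \<mu>) has_vector_derivative transition_deriv c d (\<mu> t) w) (at t within {0..1})"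
              by (rule has_vector_derivative_at_within)
            from vector_derivative_within_closed_interval[OF _ t'(2) this] show ?thesis
              using True by (simp add: velocity_def lift_def)
          qed (auto simp: velocity_def lift_def)
        qed
        have T: "lift A c (\<mu> t) w \<in> tangent_space A (\<mu> t)" by (rule lift_in_tangent_space[OF c(1) dc(1)])
        have "g (\<mu> t) (velocity A {0..1} \<mu> t) (velocity A {0..1} \<mu> t) = energy c (\<sigma> t, w)"
          unfolding vel metric_coords[OF c(1) dc(1) T T] using c dc by (simp add: energy_def)
        also have "\<dots> \<le> (B * norm w)\<^sup>2" by (rule B(2)) (use \<sigma>b[OF t'(1)] bc in blast)
        finally have "sqrt (g (\<mu> t) (velocity A {0..1} \<mu> t) (velocity A {0..1} \<mu> t)) \<le> B * norm w"
          using B(1) by (intro real_le_lsqrt) auto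
        then show ?thesis by (rule ennreal_leI)
      qed
      have "riemannian_dist A g q1 p \<le> curve_length A g \<mu>"
        unfolding riemannian_dist_def by (rule INF_lower) (use \<mu>pw \<mu>0 in simp)
      also have "\<dots> \<le> curve_length A g \<gamma> + ennreal (B * norm w) * emeasure (lebesgue_on {0..1}) (space (lebesgue_on {0..1}) - {0..<s0})"
        unfolding curve_length_def
      proof (rule nn_integral_le_split)
        show "{0..<s0} \<in> sets (lebesgue_on {0..1})"
          using s0 by (auto simp: sets_restrict_space_iff)
        show "AE t in lebesgue_on {0..1}. ?F \<mu> t \<le> (if t \<in> {0..<s0} then ?F \<gamma> t else ennreal (B * norm w))"
          unfolding AE_lebesgue_on_iff
        \<comment> \<open>At \<open>s0\<close> the velocity of the broken curve is not controlled
          and at 1 it is one-sided; the two times form a null set.\<close>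
        proof (intro exI[of _ "{s0, 1}"] conjI ballI)
          fix t :: real assume t: "t \<in> {0..1} - {s0, 1}"
          show "?F \<mu> t \<le> (if t \<in> {0..<s0} then ?F \<gamma> t else ennreal (B * norm w))"
          proof (cases "t < s0")
            case True
            then show ?thesis using F1[of t] t by simp
          next
            case False
            then show ?thesis using F2[of t] t by simp
          qed
        qed (simp add: negligible_finite)
      qed
      also have "emeasure (lebesgue_on {0..1}) (space (lebesgue_on {0..1}) - {0..<s0}) = ennreal (1 - s0)"
      proof -
        have "space (lebesgue_on {0..1}) - {0..<s0} = {s0..1}" using s0 by auto
        moreover have "emeasure (lebesgue_on {0..1}) {s0..1} = emeasure lebesgue {s0..1}"
          by (rule emeasure_restrict_space) (use s0 in auto)
        ultimately show ?thesis using s0 by simp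
      qed
      also have "ennreal (B * norm w) * ennreal (1 - s0) = ennreal (B * norm (x0 - x1))"
        using B(1) s0 by (simp add: ennreal_mult[symmetric] w_def)
      also have "\<dots> \<le> ennreal e"
      proof (rule ennreal_leI)
        have "B * norm (x0 - x1) \<le> B * \<rho>" using x1(2) B(1) by (intro mult_left_mono) (auto simp: dist_norm)
        then show "B * norm (x0 - x1) \<le> e" using \<rho>(3) by simp
      qed
      finally show ?thesis by (simp add: add_left_mono)
    qed
    have "riemannian_dist A g q1 p - ennreal e \<le> riemannian_dist A g q1 p'"
      unfolding riemannian_dist_def[of A g q1 p']
    proof (rule INF_greatest)
      fix \<gamma> assume "\<gamma> \<in> {\<gamma>. piecewise_C1_curve A \<gamma> \<and> \<gamma> 0 = q1 \<and> \<gamma> 1 = p'}"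
      then show "riemannian_dist A g q1 p - ennreal e \<le> curve_length A g \<gamma>"
        using key[of \<gamma>] by (auto simp: ennreal_minus_le_iff add.commute)
    qed
    then show "riemannian_dist A g q1 p \<le> riemannian_dist A g q1 p' + ennreal e"
      by (auto simp: ennreal_minus_le_iff add.commute)
  qed
qed

text \<open>Lower semicontinuity in the form of open superlevel sets, from which both the inequality
  for lower limits and measurability along a curve are read off.\<close>

lemma open_dist_greater: "open {p. y < riemannian_dist A g q1 p}"
proof (subst open_subopen, rule ballI)
  fix p assume "p \<in> {p. y < riemannian_dist A g q1 p}"
  then have y: "y < riemannian_dist A g q1 p" by simp
  \<comment> \<open>The gap above \<open>y\<close> has positive size, also when the distance is
    infinite; otherwise the distance would be at most \<open>y + ennreal e\<close> for all positive
    \<open>e\<close>.\<close>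
  have "\<exists>e>0. y + ennreal e < riemannian_dist A g q1 p"
  proof (rule ccontr)
    assume ne: "\<not> ?thesis"
    have le: "riemannian_dist A g q1 p \<le> y + ennreal e" if e: "e > 0" for e
    proof (rule leI, rule notI)
      assume "y + ennreal e < riemannian_dist A g q1 p"
      with e ne show False by blast
    qed
    have "riemannian_dist A g q1 p \<le> y" by (rule ennreal_le_epsilon) (rule le)
    with y show False by simp
  qed
  then obtain e where e: "e > 0" "y + ennreal e < riemannian_dist A g q1 p" by blast
  obtain U where U: "open U" "p \<in> U" "\<And>p'. p' \<in> U \<Longrightarrow> riemannian_dist A g q1 p \<le> riemannian_dist A g q1 p' + ennreal e"
    by (rule riemannian_dist_near[OF e(1)]) (rule that)
  show "\<exists>T. open T \<and> p \<in> T \<and> T \<subseteq> {p. y < riemannian_dist A g q1 p}"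
  proof (intro exI[of _ U] conjI U(1,2) subsetI CollectI)
    fix p' assume "p' \<in> U"
    from less_le_trans[OF e(2) U(3)[OF this]] have less: "y + ennreal e < riemannian_dist A g q1 p' + ennreal e" .
    show "y < riemannian_dist A g q1 p'"
    proof (rule ccontr)
      assume "\<not> ?thesis"
      then have "riemannian_dist A g q1 p' + ennreal e \<le> y + ennreal e" by (intro add_right_mono) simp
      from leD[OF this] less show False by contradiction
    qed
  qed
qed

end

section \<open>Existence of an optimal control\<close>

lemma liminf_add_le_ennreal:
  fixes a b :: "nat \<Rightarrow> ennreal"
  shows "liminf a + liminf b \<le> liminf (\<lambda>k. a k + b k)"
proof -
  have inc: "incseq (\<lambda>n. INF m\<in>{n..}. h m)" for h :: "nat \<Rightarrow> ennreal"
    by (intro monoI INF_superset_mono) auto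
  have "liminf a + liminf b = (SUP n. (INF m\<in>{n..}. a m) + (INF m\<in>{n..}. b m))"
    unfolding liminf_SUP_INF by (rule ennreal_SUP_add[symmetric]) (rule inc)+
  also have "\<dots> \<le> (SUP n. INF m\<in>{n..}. a m + b m)"
  proof (rule SUP_mono)
    fix n :: nat
    have "(INF m\<in>{n..}. a m) + (INF m\<in>{n..}. b m) \<le> (INF m\<in>{n..}. a m + b m)"
      by (intro INF_greatest add_mono INF_lower)
    then show "\<exists>k\<in>UNIV. (INF m\<in>{n..}. a m) + (INF m\<in>{n..}. b m) \<le> (INF m\<in>{k..}. a m + b m)" by blast
  qed
  finally show ?thesis by (simp only: liminf_SUP_INF)
qed

lemma half_square_ennreal: "x\<^sup>2 / 2 = inverse 2 * (x * x)" for x :: ennreal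
  by (simp add: divide_ennreal_def power2_eq_square mult.commute)

text \<open>A continuous increasing map commutes with the lower limit. Multiplication of extended
  reals is discontinuous only at 0 times infinity, which squaring avoids.\<close>

lemma liminf_half_square_ennreal:
  fixes d :: "nat \<Rightarrow> ennreal"
  shows "liminf (\<lambda>k. (d k)\<^sup>2 / 2) = (liminf d)\<^sup>2 / 2"
proof -
  have c: "continuous_on UNIV (\<lambda>x::ennreal. inverse 2 * (x * x))"
    unfolding continuous_on_def
    by (intro ballI ennreal_tendsto_cmult tendsto_mult_ennreal tendsto_ident_at) auto
  have m: "mono (\<lambda>x::ennreal. inverse 2 * (x * x))"
    by (intro monoI mult_mono order_refl) auto
  show ?thesis
    unfolding half_square_ennreal
    by (rule Liminf_compose_continuous_mono[of "\<lambda>x::ennreal. inverse 2 * (x * x)", OF c m sequentially_bot])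
qed

text \<open>Minimum over the unit sphere, extended by homogeneity. It converts bounds on the control
  cost into energy bounds.\<close>

lemma positive_definite_lower_bound:
  fixes R :: "real ^ 'm ^ 'm::finite"
  assumes "\<And>x. x \<noteq> 0 \<Longrightarrow> x \<bullet> (R *v x) > 0"
  obtains \<kappa> where "\<kappa> > 0" "\<And>x. \<kappa> * (norm x)\<^sup>2 \<le> x \<bullet> (R *v x)"
proof -
  have c: "continuous_on (sphere 0 1) (\<lambda>x. x \<bullet> (R *v x))"
    by (intro continuous_on_inner continuous_on_id matrix_vector_mult_linear_continuous_on)
  have ne: "axis undefined 1 \<in> sphere (0 :: real ^ 'm) 1" by simp
  then have "sphere (0 :: real ^ 'm) 1 \<noteq> {}" by blast
  from continuous_attains_inf[OF compact_sphere this c]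
  obtain z where z: "z \<in> sphere (0 :: real ^ 'm) 1" "\<forall>x\<in>sphere 0 1. z \<bullet> (R *v z) \<le> x \<bullet> (R *v x)" by blast
  show thesis
  proof (rule that)
    have "z \<noteq> 0" using z(1) by auto
    then show "0 < z \<bullet> (R *v z)" by (rule assms)
    fix x :: "real ^ 'm"
    show "(z \<bullet> (R *v z)) * (norm x)\<^sup>2 \<le> x \<bullet> (R *v x)"
    proof (cases "x = 0")
      case False
      define y where "y = (1 / norm x) *\<^sub>R x"
      have y: "y \<in> sphere 0 1" using False by (simp add: y_def)
      have x: "x = norm x *\<^sub>R y" using False by (simp add: y_def)
      have "x \<bullet> (R *v x) = (norm x)\<^sup>2 * (y \<bullet> (R *v y))"
        by (subst (1 2) x) (simp add: scaleR_matrix_vector_assoc[symmetric] matrix_vector_mult_scaleR power2_eq_square)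
      moreover have "(norm x)\<^sup>2 * (z \<bullet> (R *v z)) \<le> (norm x)\<^sup>2 * (y \<bullet> (R *v y))"
        using z(2) y by (intro mult_left_mono) auto
      ultimately show ?thesis by (simp add: mult.commute)
    qed simp
  qed
qed

text \<open>The right side minus the left side is a quarter of the form at
  \<open>x - y\<close>.\<close>

lemma quadratic_form_midpoint:
  fixes R :: "real ^ 'm ^ 'm::finite"
  assumes "\<And>x. 0 \<le> x \<bullet> (R *v x)"
  shows "((1/2) *\<^sub>R (x + y)) \<bullet> (R *v ((1/2) *\<^sub>R (x + y))) \<le> x \<bullet> (R *v x) / 2 + y \<bullet> (R *v y) / 2"
  using assms[of "x - y"]
  by (simp add: matrix_vector_mult_scaleR matrix_vector_mult_diff_distrib matrix_vector_right_distrib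
      inner_add_left inner_add_right inner_diff_left inner_diff_right algebra_simps)

context riemannian
begin

lemma riemannian_dist_le_liminf:
  assumes "q \<longlonglongrightarrow> p"
  shows "riemannian_dist A g q1 p \<le> liminf (\<lambda>k. riemannian_dist A g q1 (q k))"
  unfolding le_Liminf_iff
proof (intro allI impI)
  fix y assume "y < riemannian_dist A g q1 p"
  then have "p \<in> {p. y < riemannian_dist A g q1 p}" by simp
  from topological_tendstoD[OF assms open_dist_greater this]
  show "\<forall>\<^sub>F k in sequentially. y < riemannian_dist A g q1 (q k)" by simp
qed

lemma riemannian_dist_measurable:
  fixes q :: "real \<Rightarrow> 'a"
  assumes "continuous_on {a..b} q"
  shows "(\<lambda>t. riemannian_dist A g q1 (q t)) \<in> borel_measurable (lebesgue_on {a..b})"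
proof (rule borel_measurableI_greater)
  fix y
  have "openin (top_of_set {a..b}) ({a..b} \<inter> q -` {p. y < riemannian_dist A g q1 p})"
    by (rule continuous_openin_preimage_gen[OF assms open_dist_greater])
  then obtain S where S: "open S" "{a..b} \<inter> q -` {p. y < riemannian_dist A g q1 p} = {a..b} \<inter> S"
    unfolding openin_open by blast
  have "{t \<in> space (lebesgue_on {a..b}). y < riemannian_dist A g q1 (q t)} = {a..b} \<inter> S"
    unfolding S(2)[symmetric] by (auto simp: space_restrict_space)
  then show "{t \<in> space (lebesgue_on {a..b}). y < riemannian_dist A g q1 (q t)} \<in> sets (lebesgue_on {a..b})"
    using S(1) by (simp add: sets_restrict_space_iff borel_open)
qed

end

context control_system
begin

lemma kinetic_continuous_on:
  assumes ic: "integral_curve u q V" and tan: "\<And>t. t \<in> {0..T} \<Longrightarrow> V t \<in> tangent_space A (q t)"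
  shows "continuous_on {0..T} (\<lambda>t. g (q t) (V t) (V t))"
  unfolding continuous_on_eq_continuous_within
proof
  fix t assume t: "t \<in> {0..T}"
  obtain c where c: "c \<in> A" "q t \<in> chart_dom c" using charts_cover by blast
  obtain a b where ab: "0 \<le> a" "a \<le> t" "t \<le> b" "b \<le> T" "a < b" "q ` {a..b} \<subseteq> chart_dom c"
    "at t within {a..b} = at t within {0..T}"
    by (rule chart_neighbourhood[OF integral_curveD(1)[OF ic] t open_chart_dom[OF c(1)] c(2)]) (rule that)
  have ab': "a \<le> b" using ab(5) by simp
  have rng: "(\<lambda>s. phase c (q s) (V s)) ` {a..b} \<subseteq> chart_range c \<times> UNIV"
    using ab(6) by (auto simp: phase_def chart_range_def)
  have "continuous_on {a..b} (\<lambda>s. energy c (phase c (q s) (V s)))"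
    by (rule continuous_on_compose2[OF continuous_on_energy[OF c(1)] phase_continuous[OF ic c(1) ab(1) ab' ab(4,6)] rng])
  moreover have "energy c (phase c (q s) (V s)) = g (q s) (V s) (V s)" if s: "s \<in> {a..b}" for s
  proof -
    have "V s \<in> tangent_space A (q s)" using tan s ab(1,4) by simp
    moreover have "q s \<in> chart_dom c" using ab(6) s by blast
    ultimately show ?thesis using metric_coords[OF c(1)] by (simp add: energy_def phase_def)
  qed
  ultimately have "continuous_on {a..b} (\<lambda>s. g (q s) (V s) (V s))" by (rule continuous_on_eq)
  then have "continuous (at t within {a..b}) (\<lambda>s. g (q s) (V s) (V s))"
    using ab(2,3) by (simp add: continuous_on_eq_continuous_within)
  then show "continuous (at t within {0..T}) (\<lambda>s. g (q s) (V s) (V s))" by (simp only: ab(7))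
qed

lemma kinetic_tendsto:
  assumes tc: "tconv q V p \<xi>" and \<xi>: "\<xi> \<in> tangent_space A p" and V: "\<And>k. V k \<in> tangent_space A (q k)"
  shows "(\<lambda>k. g (q k) (V k) (V k)) \<longlonglongrightarrow> g p \<xi> \<xi>"
proof -
  obtain c where c: "c \<in> A" "p \<in> chart_dom c" using charts_cover by blast
  have ev: "\<forall>\<^sub>F k in sequentially. q k \<in> chart_dom c"
    by (rule tconv_eventually_dom[OF tc open_chart_dom[OF c(1)] c(2)])
  have "phase c p \<xi> \<in> chart_range c \<times> UNIV" using c(2) by (simp add: phase_def chart_range_def)
  moreover have "\<forall>\<^sub>F k in sequentially. phase c (q k) (V k) \<in> chart_range c \<times> UNIV"
    using ev by eventually_elim (simp add: phase_def chart_range_def)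
  ultimately have "(\<lambda>k. energy c (phase c (q k) (V k))) \<longlonglongrightarrow> energy c (phase c p \<xi>)"
    by (rule continuous_on_tendsto_compose[OF continuous_on_energy[OF c(1)] tconv_phase[OF tc c]])
  then have "(\<lambda>k. energy c (phase c (q k) (V k))) \<longlonglongrightarrow> g p \<xi> \<xi>"
    using metric_coords[OF c \<xi> \<xi>] by (simp add: energy_def phase_def)
  then show ?thesis
  proof (rule Lim_transform_eventually)
    show "\<forall>\<^sub>F k in sequentially. energy c (phase c (q k) (V k)) = g (q k) (V k) (V k)"
      using ev by eventually_elim (simp add: energy_def phase_def metric_coords[OF c(1) _ V V])
  qed
qed

text \<open>The part of the integrand without the control. It passes to the limit by Fatou along the
  states, while the quadratic control cost needs convexity, so the two are kept apart.\<close>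

definition running_cost :: "'a \<Rightarrow> 'a \<Rightarrow> ('a, 'n) tvec \<Rightarrow> ennreal" where
  "running_cost q1 p \<xi> = ennreal (1 / 2 * g p \<xi> \<xi>) + (riemannian_dist A g q1 p)\<^sup>2 / 2"

lemma running_cost_measurable:
  assumes ic: "integral_curve u q V" and tan: "\<And>t. t \<in> {0..T} \<Longrightarrow> V t \<in> tangent_space A (q t)"
  shows "(\<lambda>t. running_cost q1 (q t) (V t)) \<in> borel_measurable (lebesgue_on {0..T})"
proof -
  have [measurable]: "(\<lambda>t. g (q t) (V t) (V t)) \<in> borel_measurable (lebesgue_on {0..T})"
    by (rule continuous_imp_measurable_on_sets_lebesgue[OF kinetic_continuous_on[OF ic tan]]) auto
  have [measurable]: "(\<lambda>t. riemannian_dist A g q1 (q t)) \<in> borel_measurable (lebesgue_on {0..T})"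
    by (rule riemannian_dist_measurable[OF integral_curveD(1)[OF ic]])
  show ?thesis unfolding running_cost_def half_square_ennreal by measurable
qed

lemma running_cost_le_liminf:
  assumes tc: "tconv q V p \<xi>" and \<xi>: "\<xi> \<in> tangent_space A p" and V: "\<And>k. V k \<in> tangent_space A (q k)"
  shows "running_cost q1 p \<xi> \<le> liminf (\<lambda>k. running_cost q1 (q k) (V k))"
proof -
  have "(\<lambda>k. ennreal (1 / 2 * g (q k) (V k) (V k))) \<longlonglongrightarrow> ennreal (1 / 2 * g p \<xi> \<xi>)"
    by (intro tendsto_ennrealI tendsto_mult tendsto_const kinetic_tendsto[OF assms])
  then have e: "liminf (\<lambda>k. ennreal (1 / 2 * g (q k) (V k) (V k))) = ennreal (1 / 2 * g p \<xi> \<xi>)"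
    by (rule lim_imp_Liminf[OF sequentially_bot])
  have "riemannian_dist A g q1 p \<le> liminf (\<lambda>k. riemannian_dist A g q1 (q k))"
    by (rule riemannian_dist_le_liminf) (use tc in \<open>simp add: tconv_def\<close>)
  then have "(riemannian_dist A g q1 p)\<^sup>2 / 2 \<le> liminf (\<lambda>k. (riemannian_dist A g q1 (q k))\<^sup>2 / 2)"
    unfolding liminf_half_square_ennreal unfolding half_square_ennreal by (intro mult_mono order_refl) auto
  then have "running_cost q1 p \<xi> \<le> liminf (\<lambda>k. ennreal (1 / 2 * g (q k) (V k) (V k))) + liminf (\<lambda>k. (riemannian_dist A g q1 (q k))\<^sup>2 / 2)"
    unfolding running_cost_def e by (rule add_left_mono)
  also have "\<dots> \<le> liminf (\<lambda>k. running_cost q1 (q k) (V k))"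
    unfolding running_cost_def by (rule liminf_add_le_ennreal)
  finally show ?thesis .
qed

text \<open>The chosen trajectory inside \<open>cost\<close> is replaced by the known one, and
  nonnegativity of the control and kinetic terms allows \<open>ennreal\<close> to be split over
  their sum.\<close>

lemma cost_eq:
  fixes u :: "real \<Rightarrow> real ^ 'm"
  assumes tr: "is_trajectory A g W f T q0 v0 u q" and u: "u square_integrable_on {0..T}"
    and tan: "\<And>t. t \<in> {0..T} \<Longrightarrow> velocity A {0..T} q t \<in> tangent_space A (q t)"
    and R: "\<And>x. 0 \<le> x \<bullet> (R *v x)"
  shows "cost A g W f T q0 v0 R q1 u = (\<integral>\<^sup>+ t. ennreal (u t \<bullet> (R *v u t)) \<partial>lebesgue_on {0..T}) +
           (\<integral>\<^sup>+ t. running_cost q1 (q t) (velocity A {0..T} q t) \<partial>lebesgue_on {0..T})"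
proof -
  let ?v = "velocity A {0..T} q"
  note ic = trajectory_imp_integral_curve[OF tr]
  have um: "u \<in> borel_measurable (lebesgue_on {0..T})" using u by (simp add: square_integrable_on_def)
  have "continuous_on UNIV (\<lambda>x. x \<bullet> (R *v x))"
    by (intro continuous_on_inner continuous_on_id matrix_vector_mult_linear_continuous_on)
  from measurable_compose[OF um borel_measurable_continuous_onI[OF this]]
  have qm: "(\<lambda>t. ennreal (u t \<bullet> (R *v u t))) \<in> borel_measurable (lebesgue_on {0..T})"
    by (rule measurable_compose[OF _ measurable_ennreal])
  have "cost A g W f T q0 v0 R q1 u =
     (\<integral>\<^sup>+ t. ennreal (u t \<bullet> (R *v u t)) + running_cost q1 (q t) (?v t) \<partial>lebesgue_on {0..T})"
    unfolding cost_def Let_def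
  proof (rule nn_integral_cong)
    fix t assume "t \<in> space (lebesgue_on {0..T})"
    then have t: "t \<in> {0..T}" by (simp add: space_restrict_space)
    have "0 \<le> 1 / 2 * g (q t) (?v t) (?v t)" using metric_nonneg[OF tan[OF t]] by simp
    from ennreal_plus[OF R this, of "u t"]
    show "ennreal (u t \<bullet> (R *v u t) + 1 / 2 * g (trajectory_of A g W f T q0 v0 u t)
          (velocity A {0..T} (trajectory_of A g W f T q0 v0 u) t) (velocity A {0..T} (trajectory_of A g W f T q0 v0 u) t)) +
        (riemannian_dist A g q1 (trajectory_of A g W f T q0 v0 u t))\<^sup>2 / 2 =
        ennreal (u t \<bullet> (R *v u t)) + running_cost q1 (q t) (?v t)"
      unfolding trajectory_of_eq[OF tr u t] running_cost_def by (simp only: add.assoc)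
  qed
  also have "\<dots> = (\<integral>\<^sup>+ t. ennreal (u t \<bullet> (R *v u t)) \<partial>lebesgue_on {0..T}) +
           (\<integral>\<^sup>+ t. running_cost q1 (q t) (?v t) \<partial>lebesgue_on {0..T})"
    by (rule nn_integral_add[OF qm running_cost_measurable[OF ic tan]])
  finally show ?thesis .
qed

lemma cost_attained_in_the_limit:
  fixes u :: "nat \<Rightarrow> real \<Rightarrow> real ^ 'm"
  assumes K: "compactin (tangent_bundle_topology A) K" "K \<subseteq> tangent_bundle A"
    and v0: "v0 \<in> tangent_space A q0"
    and \<Omega>: "closed \<Omega>" "convex \<Omega>"
    and R: "\<And>x. x \<noteq> 0 \<Longrightarrow> x \<bullet> (R *v x) > 0"
    and u: "\<And>k. u k \<in> admissible_controls A g W f T q0 v0 \<Omega> K"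
    and I: "0 \<le> I" and cost: "\<And>k. cost A g W f T q0 v0 R q1 (u k) \<le> ennreal I + ennreal (inverse (real (Suc k)))"
  obtains v where "v \<in> admissible_controls A g W f T q0 v0 \<Omega> K" "cost A g W f T q0 v0 R q1 v \<le> ennreal I"
proof -
  let ?M = "lebesgue_on {0..T}"
  have fm: "finite_measure ?M" by (rule finite_measure_lebesgue_on) auto
  have R0: "0 \<le> x \<bullet> (R *v x)" for x using R[of x] by (cases "x = 0") auto
  have uL: "u k \<in> L2_controls T \<Omega>" for k using u[of k] unfolding admissible_controls_def by blast
  have um: "u k \<in> borel_measurable ?M" and ui: "integrable ?M (\<lambda>t. (norm (u k t))\<^sup>2)"
    and u\<Omega>: "AE t in ?M. u k t \<in> \<Omega>" for k
    using uL[of k] unfolding L2_controls_def by blast+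
  have us: "u k square_integrable_on {0..T}" for k using um ui by (simp add: square_integrable_on_def)
  have "\<forall>k. \<exists>q. is_trajectory A g W f T q0 v0 (u k) q \<and> (\<forall>t\<in>{0..T}. (q t, velocity A {0..T} q t) \<in> K)"
    using u unfolding admissible_controls_def by blast
  from choice[OF this] obtain q where q: "\<forall>k. is_trajectory A g W f T q0 v0 (u k) (q k) \<and>
      (\<forall>t\<in>{0..T}. (q k t, velocity A {0..T} (q k) t) \<in> K)" by (elim exE) (rule that)
  define V where "V k = velocity A {0..T} (q k)" for k
  have tr: "is_trajectory A g W f T q0 v0 (u k) (q k)" for k using q by blast
  have qK: "(q k t, V k t) \<in> K" if "t \<in> {0..T}" for k t using q that unfolding V_def by blast
  have tan: "V k t \<in> tangent_space A (q k t)" if "t \<in> {0..T}" for k t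
    using subsetD[OF K(2) qK[OF that]] by (simp add: tangent_bundle_def)
  have ic: "integral_curve (u k) (q k) (V k)" for k
    unfolding V_def by (rule trajectory_imp_integral_curve[OF tr])
  have init: "q k 0 = q0" "V k 0 = v0" for k
    using tr[of k] unfolding is_trajectory_def Let_def V_def by blast+
  define a where "a k = (\<integral>\<^sup>+ t. ennreal (u k t \<bullet> (R *v u k t)) \<partial>?M)" for k
  define H where "H k = (\<integral>\<^sup>+ t. running_cost q1 (q k t) (V k t) \<partial>?M)" for k
  have aH: "a k + H k \<le> ennreal I + ennreal (inverse (real (Suc k)))" for k
  proof -
    have "cost A g W f T q0 v0 R q1 (u k) = a k + H k"
      unfolding a_def H_def V_def by (rule cost_eq[OF tr us _ R0]) (rule tan[unfolded V_def])
    with cost[of k] show ?thesis by simp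
  qed
  have aI: "a k \<le> ennreal (I + 1)" for k
  proof -
    have "a k \<le> a k + H k" by simp
    also note aH
    also have "ennreal I + ennreal (inverse (real (Suc k))) = ennreal (I + inverse (real (Suc k)))"
      by (rule ennreal_plus[symmetric]) (use I in simp_all)
    also have "\<dots> \<le> ennreal (I + 1)" by (intro ennreal_leI add_left_mono) (simp add: field_simps)
    finally show ?thesis .
  qed
  obtain \<kappa> where \<kappa>: "\<kappa> > 0" "\<And>x. \<kappa> * (norm x)\<^sup>2 \<le> x \<bullet> (R *v x)"
    by (rule positive_definite_lower_bound[OF R]) (assumption, rule that)
  \<comment> \<open>\<open>\<kappa>\<close> times the energy is at most the control cost, which
    stays below \<open>I + 1\<close> along the sequence.\<close>
  define E where "E = (I + 1) / \<kappa>"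
  have uE: "(\<integral>t. (norm (u k t))\<^sup>2 \<partial>?M) \<le> E" for k
  proof -
    have "ennreal (\<integral>t. \<kappa> * (norm (u k t))\<^sup>2 \<partial>?M) = (\<integral>\<^sup>+ t. ennreal (\<kappa> * (norm (u k t))\<^sup>2) \<partial>?M)"
      by (rule nn_integral_eq_integral[symmetric]) (use ui \<kappa>(1) in auto)
    also have "\<dots> \<le> a k" unfolding a_def by (intro nn_integral_mono ennreal_leI \<kappa>(2))
    also have "\<dots> \<le> ennreal (I + 1)" by (rule aI)
    finally have "(\<integral>t. \<kappa> * (norm (u k t))\<^sup>2 \<partial>?M) \<le> I + 1"
      using I by (subst (asm) ennreal_le_iff) auto
    then have "\<kappa> * (\<integral>t. (norm (u k t))\<^sup>2 \<partial>?M) \<le> I + 1" by simp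
    then show ?thesis using \<kappa>(1) by (simp add: E_def field_simps)
  qed
  obtain \<rho> Q X where \<rho>: "strict_mono \<rho>" and X: "\<And>t. t \<in> {0..T} \<Longrightarrow> X t \<in> tangent_space A (Q t)"
    and tc\<rho>: "\<And>t. t \<in> {0..T} \<Longrightarrow> tconv (\<lambda>k. q (\<rho> k) t) (\<lambda>k. V (\<rho> k) t) (Q t) (X t)"
    by (rule curves_compact[OF K ic us uE qK]) (assumption, rule that)
  \<comment> \<open>The two parts of the cost need not converge separately. A further subsequence
    makes the control costs converge, as the convexity inequality for \<open>v\<close> requires; the
    rest is handled by lower limits.\<close>
  define r where "r k = enn2real (a (\<rho> k))" for k
  have afin: "a k < top" for k by (rule le_less_trans[OF aI]) simp
  have ar: "a (\<rho> k) = ennreal (r k)" for k using afin[of "\<rho> k"] by (simp add: r_def)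
  have "r k \<in> {0..I + 1}" for k
  proof -
    have "ennreal (r k) \<le> ennreal (I + 1)" using aI[of "\<rho> k"] unfolding ar .
    then have "r k \<le> I + 1" using I by (subst (asm) ennreal_le_iff) auto
    then show ?thesis by (simp add: r_def)
  qed
  with compact_Icc[of 0 "I + 1", THEN compact_imp_seq_compact, unfolded seq_compact_def, rule_format, of r]
  obtain l \<sigma> where \<sigma>: "strict_mono \<sigma>" "(r \<circ> \<sigma>) \<longlonglongrightarrow> l" by blast
  define \<tau> where "\<tau> k = \<rho> (\<sigma> k)" for k
  have \<tau>: "strict_mono \<tau>" unfolding \<tau>_def using strict_mono_o[OF \<rho> \<sigma>(1)] by (simp add: o_def)
  have al: "(\<lambda>k. a (\<tau> k)) \<longlonglongrightarrow> ennreal l"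
    using tendsto_ennrealI[OF \<sigma>(2)] by (simp add: \<tau>_def ar o_def)
  have tc: "tconv (\<lambda>k. q (\<tau> k) t) (\<lambda>k. V (\<tau> k) t) (Q t) (X t)" if "t \<in> {0..T}" for t
    unfolding \<tau>_def by (rule tconv_subseq[OF tc\<rho>[OF that] \<sigma>(1)])
  obtain v where vm: "v \<in> borel_measurable ?M" and vi: "integrable ?M (\<lambda>t. (norm (v t))\<^sup>2)"
    and weak: "\<And>\<phi> B l. \<phi> \<in> borel_measurable ?M \<Longrightarrow> (\<And>t. norm (\<phi> t) \<le> B) \<Longrightarrow>
       (\<lambda>k. \<integral>t. u (\<tau> k) t \<bullet> \<phi> t \<partial>?M) \<longlonglongrightarrow> l \<Longrightarrow> (\<integral>t. v t \<bullet> \<phi> t \<partial>?M) = l"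
    and con: "\<And>\<Omega>. closed \<Omega> \<Longrightarrow> convex \<Omega> \<Longrightarrow> (\<And>k. AE t in ?M. u (\<tau> k) t \<in> \<Omega>) \<Longrightarrow> AE t in ?M. v t \<in> \<Omega>"
    and low: "\<And>Q j. continuous_on UNIV Q \<Longrightarrow> (\<And>x. 0 \<le> Q x) \<Longrightarrow>
       (\<And>x y. Q ((1/2) *\<^sub>R (x + y)) \<le> Q x / 2 + Q y / 2) \<Longrightarrow>
       (\<lambda>k. \<integral>\<^sup>+ t. ennreal (Q (u (\<tau> k) t)) \<partial>?M) \<longlonglongrightarrow> j \<Longrightarrow> (\<integral>\<^sup>+ t. ennreal (Q (v t)) \<partial>?M) \<le> j"
  proof (rule finite_measure.convex_combination_limit[OF fm, of "\<lambda>k. u (\<tau> k)" E, OF um ui uE], goal_cases)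
    case (1 v)
    show ?case by (rule that[of v]) (fact 1)+
  qed
  have vs: "v square_integrable_on {0..T}" using vm vi by (simp add: square_integrable_on_def)
  have icv: "integral_curve v Q X"
  proof (rule limit_integral_curve[of "\<lambda>k. u (\<tau> k)" "\<lambda>k. q (\<tau> k)" "\<lambda>k. V (\<tau> k)", OF ic us uE vs])
    show "\<forall>\<phi> B l. \<phi> \<in> borel_measurable ?M \<longrightarrow> (\<forall>t. norm (\<phi> t) \<le> B) \<longrightarrow>
       (\<lambda>k. \<integral>t. u (\<tau> k) t \<bullet> \<phi> t \<partial>?M) \<longlonglongrightarrow> l \<longrightarrow> (\<integral>t. v t \<bullet> \<phi> t \<partial>?M) = l"
    proof (intro allI impI)
      fix \<phi> B l assume "\<phi> \<in> borel_measurable ?M" and B: "\<forall>t. norm (\<phi> t) \<le> B"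
        and "(\<lambda>k. \<integral>t. u (\<tau> k) t \<bullet> \<phi> t \<partial>?M) \<longlonglongrightarrow> l"
      then show "(\<integral>t. v t \<bullet> \<phi> t \<partial>?M) = l" by (intro weak[OF _ spec[OF B]])
    qed
    show "\<forall>t\<in>{0..T}. tconv (\<lambda>k. q (\<tau> k) t) (\<lambda>k. V (\<tau> k) t) (Q t) (X t)" using tc by blast
  qed
  have out: "X t c = 0" if "t \<in> {0..T}" "c \<notin> A \<or> Q t \<notin> chart_dom c" for t c
    using X[OF that(1)] that(2) unfolding tangent_space_def by blast
  have z: "0 \<in> {0..T}" using T by simp
  have Q0: "Q 0 = q0"
  proof (rule LIMSEQ_unique)
    show "(\<lambda>k. q (\<tau> k) 0) \<longlonglongrightarrow> Q 0" using tc[OF z] by (simp add: tconv_def)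
    show "(\<lambda>k. q (\<tau> k) 0) \<longlonglongrightarrow> q0" by (simp add: init)
  qed
  \<comment> \<open>Vectors at the same point are equal as soon as they agree in one chart around
    it.\<close>
  have X0: "X 0 = v0"
  proof -
    obtain c where c: "c \<in> A" "q0 \<in> chart_dom c" using charts_cover by blast
    have "(\<lambda>k. V (\<tau> k) 0 c) \<longlonglongrightarrow> X 0 c" using tc[OF z] c unfolding tconv_def Q0 by blast
    then have "v0 c = X 0 c" by (simp add: init LIMSEQ_const_iff)
    then show ?thesis using X[OF z] v0 c unfolding Q0 by (intro tangent_space_eqI[of _ q0 _ c]) auto
  qed
  have trv: "is_trajectory A g W f T q0 v0 v Q"
    using integral_curve_imp_trajectory[OF icv vs out] unfolding Q0 X0 .
  have vel: "velocity A {0..T} Q t = X t" if "t \<in> {0..T}" for t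
    by (rule velocity_eq[OF icv that out[OF that]])
  have "AE t in ?M. v t \<in> \<Omega>" by (rule con[OF \<Omega> u\<Omega>])
  then have "v \<in> L2_controls T \<Omega>" using vm vi unfolding L2_controls_def by blast
  moreover have "(Q t, velocity A {0..T} Q t) \<in> K" if t: "t \<in> {0..T}" for t
    unfolding vel[OF t] by (rule tconv_in_compact[OF K _ tc[OF t] X[OF t]]) (rule qK[OF t])
  ultimately have adm: "v \<in> admissible_controls A g W f T q0 v0 \<Omega> K"
    using trv unfolding admissible_controls_def by blast
  have av: "(\<integral>\<^sup>+ t. ennreal (v t \<bullet> (R *v v t)) \<partial>?M) \<le> ennreal l"
  proof (rule low[of "\<lambda>x. x \<bullet> (R *v x)"])
    show "continuous_on UNIV (\<lambda>x. x \<bullet> (R *v x))"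
      by (intro continuous_on_inner continuous_on_id matrix_vector_mult_linear_continuous_on)
    show "(\<lambda>k. \<integral>\<^sup>+ t. ennreal (u (\<tau> k) t \<bullet> (R *v u (\<tau> k) t)) \<partial>?M) \<longlonglongrightarrow> ennreal l"
      using al by (simp only: a_def)
  qed (rule R0 quadratic_form_midpoint[OF R0])+
  have Hv: "(\<integral>\<^sup>+ t. running_cost q1 (Q t) (X t) \<partial>?M) \<le> liminf (\<lambda>k. H (\<tau> k))"
  proof -
    have "(\<integral>\<^sup>+ t. running_cost q1 (Q t) (X t) \<partial>?M)
      \<le> (\<integral>\<^sup>+ t. liminf (\<lambda>k. running_cost q1 (q (\<tau> k) t) (V (\<tau> k) t)) \<partial>?M)"
    proof (rule nn_integral_mono)
      fix t assume "t \<in> space ?M"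
      then have t: "t \<in> {0..T}" by (simp add: space_restrict_space)
      show "running_cost q1 (Q t) (X t) \<le> liminf (\<lambda>k. running_cost q1 (q (\<tau> k) t) (V (\<tau> k) t))"
        by (rule running_cost_le_liminf[OF tc[OF t] X[OF t] tan[OF t]])
    qed
    also have "\<dots> \<le> liminf (\<lambda>k. \<integral>\<^sup>+ t. running_cost q1 (q (\<tau> k) t) (V (\<tau> k) t) \<partial>?M)"
      by (rule nn_integral_liminf) (rule running_cost_measurable[OF ic tan])
    finally show ?thesis unfolding H_def .
  qed
  have "cost A g W f T q0 v0 R q1 v = (\<integral>\<^sup>+ t. ennreal (v t \<bullet> (R *v v t)) \<partial>?M) +
      (\<integral>\<^sup>+ t. running_cost q1 (Q t) (velocity A {0..T} Q t) \<partial>?M)"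
    by (rule cost_eq[OF trv vs _ R0]) (simp only: vel X)
  also have "(\<integral>\<^sup>+ t. running_cost q1 (Q t) (velocity A {0..T} Q t) \<partial>?M) = (\<integral>\<^sup>+ t. running_cost q1 (Q t) (X t) \<partial>?M)"
    by (rule nn_integral_cong) (simp add: space_restrict_space vel)
  \<comment> \<open>Since the control costs converge, their limit is also their lower limit;
    superadditivity of lower limits then recombines both parts into the total cost.\<close>
  also have "(\<integral>\<^sup>+ t. ennreal (v t \<bullet> (R *v v t)) \<partial>?M) + (\<integral>\<^sup>+ t. running_cost q1 (Q t) (X t) \<partial>?M)
      \<le> liminf (\<lambda>k. a (\<tau> k)) + liminf (\<lambda>k. H (\<tau> k))"
    unfolding lim_imp_Liminf[OF sequentially_bot al] by (rule add_mono[OF av Hv])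
  also have "\<dots> \<le> liminf (\<lambda>k. a (\<tau> k) + H (\<tau> k))" by (rule liminf_add_le_ennreal)
  also have "\<dots> \<le> liminf (\<lambda>k. ennreal I + ennreal (inverse (real (Suc (\<tau> k)))))"
    by (intro Liminf_mono always_eventually allI aH)
  also have "\<dots> = ennreal I"
  proof (rule lim_imp_Liminf[OF sequentially_bot])
    have "(\<lambda>k. inverse (real (Suc (\<tau> k)))) \<longlonglongrightarrow> 0"
      using LIMSEQ_subseq_LIMSEQ[OF LIMSEQ_inverse_real_of_nat \<tau>] by (simp add: o_def)
    from tendsto_add[OF tendsto_const tendsto_ennrealI[OF this]]
    show "(\<lambda>k. ennreal I + ennreal (inverse (real (Suc (\<tau> k))))) \<longlonglongrightarrow> ennreal I" by simp
  qed
  finally have "cost A g W f T q0 v0 R q1 v \<le> ennreal I" .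
  with adm show thesis by (rule that)
qed

end

theorem mainTheorem4:
  fixes A :: "('a::{t2_space, second_countable_topology}, 'n::finite) chart set"
    and g :: "'a \<Rightarrow> ('a, 'n) tvec \<Rightarrow> ('a, 'n) tvec \<Rightarrow> real"
    and W :: "'a \<Rightarrow> real"
    and f :: "'m::finite \<Rightarrow> 'a \<Rightarrow> ('a, 'n) tvec"
    and T :: real
    and q0 q1 :: 'a
    and v0 :: "('a, 'n) tvec"
    and \<Omega> :: "(real ^ 'm) set"
    and K :: "('a \<times> ('a, 'n) tvec) set"
    and R :: "real ^ 'm ^ 'm"
  assumes "smooth_atlas A"
    and "riemannian_metric A g"
    and "smooth_fun A W"
    and "\<And>j. smooth_vector_field A (f j)"
    and "T > 0"
    and "(q0, v0) \<in> tangent_bundle A"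
    and "K \<subseteq> tangent_bundle A"
    and "compactin (tangent_bundle_topology A) K"
    and "admissible_controls A g W f T q0 v0 \<Omega> K \<noteq> {}"
    and "closed \<Omega>"
    and "convex \<Omega>"
    and "transpose R = R"
    and "\<And>x. x \<noteq> 0 \<Longrightarrow> x \<bullet> (R *v x) > 0"
  shows "\<exists>u\<^sub>o \<in> admissible_controls A g W f T q0 v0 \<Omega> K.
           cost A g W f T q0 v0 R q1 u\<^sub>o =
           (INF u \<in> admissible_controls A g W f T q0 v0 \<Omega> K. cost A g W f T q0 v0 R q1 u)"
proof -
  interpret control_system A g W f T
    by unfold_locales (rule assms)+
  let ?U = "admissible_controls A g W f T q0 v0 \<Omega> K" and ?J = "cost A g W f T q0 v0 R q1"
  have v0: "v0 \<in> tangent_space A q0" using assms(6) by (simp add: tangent_bundle_def)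
  have "\<exists>v\<in>?U. ?J v \<le> (INF u\<in>?U. ?J u)"
  proof (cases "(INF u\<in>?U. ?J u)" rule: ennreal_cases)
    \<comment> \<open>An infinite infimum, as for \<open>q1\<close> and \<open>q0\<close> in
      different components, is attained by every admissible control.\<close>
    case top
    then show ?thesis using assms(9) by auto
  next
    case (real I)
    have "\<exists>u. u \<in> ?U \<and> ?J u \<le> ennreal I + ennreal (inverse (real (Suc k)))" for k
    proof -
      have "(INF u\<in>?U. ?J u) < ennreal I + ennreal (inverse (real (Suc k)))"
      proof -
        have "0 < inverse (real (Suc k))" by simp
        with real(1) have "ennreal I < ennreal (I + inverse (real (Suc k)))" by (intro ennreal_lessI) linarith+
        then show ?thesis using real by (subst ennreal_plus[symmetric]) simp_all
      qed
      then show ?thesis unfolding INF_less_iff by (auto intro: less_imp_le)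
    qed
    then obtain u where u: "\<forall>k. u k \<in> ?U \<and> ?J (u k) \<le> ennreal I + ennreal (inverse (real (Suc k)))"
      using choice[of "\<lambda>k u. u \<in> ?U \<and> ?J u \<le> ennreal I + ennreal (inverse (real (Suc k)))"] by blast
    obtain v where "v \<in> ?U" "?J v \<le> ennreal I"
      by (rule cost_attained_in_the_limit[OF assms(8,7) v0 assms(10,11,13) conjunct1[OF spec[OF u]] real(1) conjunct2[OF spec[OF u]]])
        (assumption, rule that)
    then show ?thesis using real(2) by auto
  qed
  then obtain v where v: "v \<in> ?U" "?J v \<le> (INF u\<in>?U. ?J u)" by blast
  moreover have "(INF u\<in>?U. ?J u) \<le> ?J v" by (rule INF_lower[OF v(1)])
  ultimately show ?thesis by (intro bexI[of _ v] antisym)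
qed

end
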